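(* Let $w$ be a modulus of continuity for which there exists a constant $0<\alpha<1$ such that $w^{1+\alpha}$ is a modulus of continuity and $$\int_0^1 w^\alpha(t)\,\frac{dt}{t}<\infty .$$ Let $\Theta=BS_\mu$ be an inner function, where $B$ denotes its Blaschke factor and $\mu$ is a positive finite singular Borel measure on $\partial\mathbb{D}$, and let $\mu=\mu_P+\mu_C$ be the decomposition of $\mu$ with respect to sets of finite $w$-entropy. Then: (Existence) $\mathcal{A}_w\cap K_\Theta=\{0\}$ if and only if $\Theta=S_{\mu_C}$ up to a unimodular constant factor. (Density) $\mathcal{A}_w\cap K_\Theta$ is dense in $K_\Theta$ if and only if $\Theta=BS_{\mu_P}$. Furthermore, the closure of $\mathcal{A}_w\cap K_\Theta$ in $K_\Theta$ equals $K_{\Theta_P}$, where $\Theta_P=BS_{\mu_P}$.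
   Context: $\mathbb{D}$ is the open unit disc, $\partial\mathbb{D}$ the unit circle, $m$ the normalized Lebesgue measure on $\partial\mathbb{D}$. "Singular" for measures means singular with respect to $m$. $H^2$ is the Hardy space on $\mathbb{D}$ and $H^\infty$ the algebra of bounded analytic functions in $\mathbb{D}$. A modulus of continuity is a continuous, non-decreasing, sub-additive function on $[0,1]$ vanishing at $0$ (not identically zero); it is extended by $w(t)=w(1)$ for $t>1$. $\mathcal{A}_w$ is the Banach space of bounded analytic functions $f$ in $\mathbb{D}$ with continuous extension to $\partial\mathbb{D}$ and finite norm $\|f\|_{\mathcal{A}_w}=\|f\|_{H^\infty}+\sup_{\xi\ne\zeta\in\partial\mathbb{D}}\frac{|f(\xi)-f(\zeta)|}{w(|\xi-\zeta|)}$. An inner function is a bounded analytic function in $\mathbb{D}$ with unimodular radial limits $m$-a.e.; it factors as $\Theta=BS_\mu$ with $B$ a Blaschke product (including a unimodular constant) and $S_\mu(z)=\exp\big(-\int_{\partial\mathbb{D}}\frac{\zeta+z}{\zeta-z}\,d\mu(\zeta)\big)$. The model space is $K_\Theta=H^2\ominus\Theta H^2$, with the $H^2$ norm. A closed set $E\subset\partial\mathbb{D}$ of Lebesgue measure zero has finite $w$-entropy if $\int_{\partial\mathbb{D}}\log w(\mathrm{dist}(\zeta,E))\,dm(\zeta)>-\infty$, where $\mathrm{dist}$ is the unit-normalized arc-length distance on $\partial\mathbb{D}$. Each positive finite singular Borel measure $\mu$ on $\partial\mathbb{D}$ decomposes uniquely as $\mu=\mu_P+\mu_C$ with $\mu_P,\mu_C\geq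 0$ where $\mu_P$ is concentrated on a countable union of sets of finite $w$-entropy and $\mu_C$ assigns measure zero to every set of finite $w$-entropy. *)

theory Defs
  imports "HOL-Complex_Analysis.Complex_Analysis"
begin

abbreviation unit_disc :: "complex set" where
  "unit_disc \<equiv> ball 0 1"

abbreviation unit_circle :: "complex set" where
  "unit_circle \<equiv> sphere 0 1"

definition circle_borel :: "complex measure" where
  "circle_borel = restrict_space borel unit_circle"

definition circle_measure :: "complex measure" where
  "circle_measure =
     distr (uniform_measure lborel {0..1::real}) circle_borel (\<lambda>t. cis (2 * pi * t))"

definition singular_on_circle :: "complex measure \<Rightarrow> bool" where
  "singular_on_circle \<mu> \<longleftrightarrow>
     (\<exists>N \<in> sets circle_borel. emeasure circle_measure N = 0 \<and> emeasure \<mu> (unit_circle - N) = 0)"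

text \<open>Only the values of \<open>w\<close> on the interval \<open>[0,1]\<close> matter, here and in what follows.\<close>

definition modulus_of_continuity :: "(real \<Rightarrow> real) \<Rightarrow> bool" where
  "modulus_of_continuity w \<longleftrightarrow>
     continuous_on {0..1} w \<and>
     mono_on {0..1} w \<and>
     (\<forall>s\<in>{0..1}. \<forall>t\<in>{0..1}. s + t \<le> 1 \<longrightarrow> w (s + t) \<le> w s + w t) \<and>
     w 0 = 0 \<and>
     (\<exists>t\<in>{0..1}. w t \<noteq> 0)"

definition modulus_ext :: "(real \<Rightarrow> real) \<Rightarrow> real \<Rightarrow> real" where
  "modulus_ext w t = w (min t 1)"

text \<open>
  Functions in the disc are represented by functions on the whole plane that vanish off the
  disc, so that equality of functions in the disc is equality in HOL.
\<close>

definition disc_holomorphic :: "(complex \<Rightarrow> complex) set" where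
  "disc_holomorphic = {f. f holomorphic_on unit_disc \<and> (\<forall>z. z \<notin> unit_disc \<longrightarrow> f z = 0)}"

definition boundary_value :: "(complex \<Rightarrow> complex) \<Rightarrow> complex \<Rightarrow> complex" where
  "boundary_value f \<xi> = Lim (at \<xi> within unit_disc) f"

definition A_norm :: "(real \<Rightarrow> real) \<Rightarrow> (complex \<Rightarrow> complex) \<Rightarrow> ennreal" where
  "A_norm w f =
     (SUP z\<in>unit_disc. ennreal (cmod (f z))) +
     (SUP (\<xi>, \<zeta>)\<in>{(\<xi>, \<zeta>). \<xi> \<in> unit_circle \<and> \<zeta> \<in> unit_circle \<and> \<xi> \<noteq> \<zeta>}.
        ennreal (cmod (boundary_value f \<xi> - boundary_value f \<zeta>) / modulus_ext w (cmod (\<xi> - \<zeta>))))"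

definition A_space :: "(real \<Rightarrow> real) \<Rightarrow> (complex \<Rightarrow> complex) set" where
  "A_space w =
     {f \<in> disc_holomorphic.
        (\<exists>g. continuous_on (cball 0 1) g \<and> (\<forall>z\<in>unit_disc. g z = f z)) \<and> A_norm w f < \<infinity>}"

definition H2_norm_sq :: "(complex \<Rightarrow> complex) \<Rightarrow> ennreal" where
  "H2_norm_sq f =
     (SUP r\<in>{0..<1::real}. \<integral>\<^sup>+ \<zeta>. ennreal ((cmod (f (of_real r * \<zeta>)))\<^sup>2) \<partial>circle_measure)"

definition H2_space :: "(complex \<Rightarrow> complex) set" where
  "H2_space = {f \<in> disc_holomorphic. H2_norm_sq f < \<infinity>}"

definition H2_norm :: "(complex \<Rightarrow> complex) \<Rightarrow> real" where
  "H2_norm f = sqrt (enn2real (H2_norm_sq f))"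

text \<open>
  For \<open>f\<close> and \<open>g\<close> in \<open>H\<^sup>2\<close> the limit exists and equals the integral over the circle of \<open>f\<close>
  times the conjugate of \<open>g\<close> (radial boundary values).
\<close>

definition H2_inner :: "(complex \<Rightarrow> complex) \<Rightarrow> (complex \<Rightarrow> complex) \<Rightarrow> complex" where
  "H2_inner f g =
     Lim (at_left (1::real))
       (\<lambda>r. \<integral> \<zeta>. f (of_real r * \<zeta>) * cnj (g (of_real r * \<zeta>)) \<partial>circle_measure)"

definition H2_dist :: "(complex \<Rightarrow> complex) \<Rightarrow> (complex \<Rightarrow> complex) \<Rightarrow> real" where
  "H2_dist f g = H2_norm (\<lambda>z. f z - g z)"

text \<open>Only the values in the disc of an inner function matter.\<close>

definition inner_function :: "(complex \<Rightarrow> complex) \<Rightarrow> bool" where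
  "inner_function \<Theta> \<longleftrightarrow>
     \<Theta> holomorphic_on unit_disc \<and>
     bounded (\<Theta> ` unit_disc) \<and>
     (AE \<zeta> in circle_measure.
        \<exists>l. cmod l = 1 \<and> ((\<lambda>r. \<Theta> (of_real r * \<zeta>)) \<longlongrightarrow> l) (at_left (1::real)))"

definition blaschke_factor :: "complex \<Rightarrow> complex \<Rightarrow> complex" where
  "blaschke_factor a z =
     (if a = 0 then z else of_real (cmod a) / a * ((a - z) / (1 - cnj a * z)))"

text \<open>
  The index set \<open>N\<close> may be empty, finite or infinite; zeros are repeated according to multiplicity.
\<close>

definition blaschke_product :: "(complex \<Rightarrow> complex) \<Rightarrow> bool" where
  "blaschke_product B \<longleftrightarrow>
     (\<exists>c N (a :: nat \<Rightarrow> complex).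
        cmod c = 1 \<and>
        (\<forall>n\<in>N. a n \<in> unit_disc) \<and>
        (\<lambda>n. 1 - cmod (a n)) summable_on N \<and>
        (\<forall>z\<in>unit_disc. B z = c * (\<Prod>n. if n \<in> N then blaschke_factor (a n) z else 1)))"

definition singular_inner :: "complex measure \<Rightarrow> complex \<Rightarrow> complex" where
  "singular_inner \<mu> z = exp (- (\<integral> \<zeta>. (\<zeta> + z) / (\<zeta> - z) \<partial>\<mu>))"

definition model_space :: "(complex \<Rightarrow> complex) \<Rightarrow> (complex \<Rightarrow> complex) set" where
  "model_space \<Theta> = {f \<in> H2_space. \<forall>g\<in>H2_space. H2_inner f (\<lambda>z. \<Theta> z * g z) = 0}"

definition model_topology :: "(complex \<Rightarrow> complex) \<Rightarrow> (complex \<Rightarrow> complex) topology" where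
  "model_topology \<Theta> = Metric_space.mtopology (model_space \<Theta>) H2_dist"

text \<open>Arc length, normalized so that the whole circle has length 1.\<close>

definition arc_dist :: "complex \<Rightarrow> complex \<Rightarrow> real" where
  "arc_dist \<zeta> \<xi> = \<bar>Arg (\<zeta> / \<xi>)\<bar> / (2 * pi)"

text \<open>
  The convention for the empty set (any value in \<open>(0,1]\<close> would do) makes the empty set a set of
  finite entropy.
\<close>

definition arc_infdist :: "complex \<Rightarrow> complex set \<Rightarrow> real" where
  "arc_infdist \<zeta> E = (if E = {} then 1 else (INF \<xi>\<in>E. arc_dist \<zeta> \<xi>))"

text \<open>
  The integrand is measurable and bounded above, so its integral exists in \<open>[-\<infinity>, \<infinity>)\<close> and is
  greater than \<open>-\<infinity>\<close> iff the integrand is integrable.  On the null set \<open>E\<close>, where the logarithm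
  is \<open>-\<infinity>\<close> in the usual convention and \<open>ln 0 = 0\<close> in HOL, its value plays no role.
\<close>

definition finite_entropy :: "(real \<Rightarrow> real) \<Rightarrow> complex set \<Rightarrow> bool" where
  "finite_entropy w E \<longleftrightarrow>
     closed E \<and> E \<subseteq> unit_circle \<and> emeasure circle_measure E = 0 \<and>
     integrable circle_measure (\<lambda>\<zeta>. ln (w (arc_infdist \<zeta> E)))"

definition entropy_decomposition ::
  "(real \<Rightarrow> real) \<Rightarrow> complex measure \<Rightarrow> complex measure \<Rightarrow> complex measure \<Rightarrow> bool" where
  "entropy_decomposition w \<mu> \<mu>P \<mu>C \<longleftrightarrow>
     sets \<mu>P = sets circle_borel \<and>
     sets \<mu>C = sets circle_borel \<and>
     (\<forall>A\<in>sets circle_borel. emeasure \<mu> A = emeasure \<mu>P A + emeasure \<mu>C A) \<and>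
     (\<exists>F. countable F \<and> (\<forall>E\<in>F. finite_entropy w E) \<and> emeasure \<mu>P (unit_circle - \<Union>F) = 0) \<and>
     (\<forall>E. finite_entropy w E \<longrightarrow> emeasure \<mu>C E = 0)"

lemma measurable_cis_circle [measurable]:
  "(\<lambda>t. cis (2 * pi * t)) \<in> lborel \<rightarrow>\<^sub>M circle_borel"
proof -
  have "continuous_on UNIV (\<lambda>t::real. cis (2 * pi * t))"
    by (intro continuous_intros)
  then show ?thesis
    unfolding circle_borel_def
    by (intro measurable_restrict_space2) (auto intro: borel_measurable_continuous_onI)
qed

lemma sets_circle_measure [measurable_cong]: "sets circle_measure = sets circle_borel"
  by (simp add: circle_measure_def)

lemma space_circle_measure [simp]: "space circle_measure = unit_circle"
  by (simp add: circle_measure_def circle_borel_def space_restrict_space)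

lemma measurable_on_circle:
  fixes f :: "complex \<Rightarrow> complex"
  assumes "f holomorphic_on unit_disc" "0 \<le> r" "r < (1::real)"
  shows "(\<lambda>\<zeta>. f (of_real r * \<zeta>)) \<in> borel_measurable circle_measure"
proof -
  have "continuous_on unit_circle (\<lambda>\<zeta>. f (of_real r * \<zeta>))"
    by (rule continuous_on_compose2[OF holomorphic_on_imp_continuous_on[OF assms(1)]])
      (use assms in \<open>auto intro!: continuous_intros simp: norm_mult\<close>)
  then have "(\<lambda>\<zeta>. f (of_real r * \<zeta>)) \<in> borel_measurable circle_borel"
    unfolding circle_borel_def by (rule borel_measurable_continuous_on_restrict)
  then show ?thesis
    by (simp add: measurable_cong_sets[OF sets_circle_measure refl])
qed

lemma H2_norm_sq_add_le:
  fixes u v :: "complex \<Rightarrow> complex"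
  assumes u: "u holomorphic_on unit_disc" and v: "v holomorphic_on unit_disc"
    and ab: "a > 0" "b > 0"
    and ua: "H2_norm_sq u \<le> ennreal (a\<^sup>2)" and vb: "H2_norm_sq v \<le> ennreal (b\<^sup>2)"
  shows "H2_norm_sq (\<lambda>z. u z + v z) \<le> ennreal ((a + b)\<^sup>2)"
  unfolding H2_norm_sq_def
proof (rule SUP_least)
  fix r :: real assume r: "r \<in> {0..<1}"
  have [measurable]: "(\<lambda>\<zeta>. u (of_real r * \<zeta>)) \<in> borel_measurable circle_measure"
      "(\<lambda>\<zeta>. v (of_real r * \<zeta>)) \<in> borel_measurable circle_measure"
    using r u v by (auto intro: measurable_on_circle)
  have pt: "(cmod (x + y))\<^sup>2 \<le> (1 + b / a) * (cmod x)\<^sup>2 + (1 + a / b) * (cmod y)\<^sup>2" for x y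
  proof -
    have "(cmod (x + y))\<^sup>2 \<le> (cmod x + cmod y)\<^sup>2"
      by (intro power_mono norm_triangle_ineq) auto
    also have "0 \<le> (b * cmod x - a * cmod y)\<^sup>2 / (a * b)"
      using ab by simp
    then have "2 * (cmod x * cmod y) \<le> b / a * (cmod x)\<^sup>2 + a / b * (cmod y)\<^sup>2"
      using ab by (simp add: field_simps power2_eq_square)
    then have "(cmod x + cmod y)\<^sup>2 \<le> (1 + b / a) * (cmod x)\<^sup>2 + (1 + a / b) * (cmod y)\<^sup>2"
      by (simp add: power2_sum algebra_simps)
    finally show ?thesis .
  qed
  let ?I = "\<lambda>f. \<integral>\<^sup>+ \<zeta>. ennreal ((cmod (f (of_real r * \<zeta>)))\<^sup>2) \<partial>circle_measure"
  have "?I (\<lambda>z. u z + v z) \<le>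
      (\<integral>\<^sup>+ \<zeta>. ennreal (1 + b / a) * ennreal ((cmod (u (of_real r * \<zeta>)))\<^sup>2)
        + ennreal (1 + a / b) * ennreal ((cmod (v (of_real r * \<zeta>)))\<^sup>2) \<partial>circle_measure)"
    using pt ab by (intro nn_integral_mono)
      (simp add: ennreal_mult[symmetric] ennreal_plus[symmetric] del: ennreal_plus)
  also have "\<dots> = ennreal (1 + b / a) * ?I u + ennreal (1 + a / b) * ?I v"
    by (simp add: nn_integral_add nn_integral_cmult)
  also have "\<dots> \<le> ennreal (1 + b / a) * ennreal (a\<^sup>2) + ennreal (1 + a / b) * ennreal (b\<^sup>2)"
  proof (intro add_mono mult_left_mono)
    show "?I u \<le> ennreal (a\<^sup>2)"
      using r by (intro order_trans[OF _ ua]) (auto simp: H2_norm_sq_def intro: SUP_upper)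
    show "?I v \<le> ennreal (b\<^sup>2)"
      using r by (intro order_trans[OF _ vb]) (auto simp: H2_norm_sq_def intro: SUP_upper)
  qed simp_all
  also have "\<dots> = ennreal ((1 + b / a) * a\<^sup>2 + (1 + a / b) * b\<^sup>2)"
    using ab by (simp add: ennreal_mult[symmetric] ennreal_plus[symmetric] del: ennreal_plus)
  also have "(1 + b / a) * a\<^sup>2 + (1 + a / b) * b\<^sup>2 = (a + b)\<^sup>2"
    using ab by (simp add: field_simps power2_eq_square)
  finally show "?I (\<lambda>z. u z + v z) \<le> ennreal ((a + b)\<^sup>2)" .
qed

lemma H2_norm_sq_le:
  assumes "H2_norm_sq u < \<infinity>" "H2_norm u \<le> a"
  shows "H2_norm_sq u \<le> ennreal (a\<^sup>2)"
proof -
  have "enn2real (H2_norm_sq u) \<le> a\<^sup>2"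
    using assms(2) unfolding H2_norm_def by (rule sqrt_le_D)
  then have "ennreal (enn2real (H2_norm_sq u)) \<le> ennreal (a\<^sup>2)"
    by (rule ennreal_leI)
  moreover have "ennreal (enn2real (H2_norm_sq u)) = H2_norm_sq u"
    using assms(1) by (intro ennreal_enn2real) simp
  ultimately show ?thesis by simp
qed

lemma H2_norm_le:
  assumes "H2_norm_sq u \<le> ennreal (a\<^sup>2)" "a \<ge> 0"
  shows "H2_norm u \<le> a"
proof -
  have "enn2real (H2_norm_sq u) \<le> a\<^sup>2"
    using assms by (simp add: enn2real_leI)
  then show ?thesis
    unfolding H2_norm_def using assms(2) by (intro real_le_lsqrt) auto
qed

lemma H2_norm_nonneg [simp]: "H2_norm u \<ge> 0"
  by (simp add: H2_norm_def)

lemma H2_norm_add: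
  assumes "u holomorphic_on unit_disc" "v holomorphic_on unit_disc"
    and "H2_norm_sq u < \<infinity>" "H2_norm_sq v < \<infinity>"
  shows "H2_norm_sq (\<lambda>z. u z + v z) < \<infinity>"
    and "H2_norm (\<lambda>z. u z + v z) \<le> H2_norm u + H2_norm v"
proof -
  have *: "H2_norm_sq (\<lambda>z. u z + v z) \<le> ennreal ((H2_norm u + e + (H2_norm v + e))\<^sup>2)"
    if "e > 0" for e
    using that assms
    by (intro H2_norm_sq_add_le H2_norm_sq_le) (auto intro: add_nonneg_pos)
  from *[of 1] show "H2_norm_sq (\<lambda>z. u z + v z) < \<infinity>"
    by (auto simp: ennreal_less_top intro: order.strict_trans1)
  show "H2_norm (\<lambda>z. u z + v z) \<le> H2_norm u + H2_norm v"
  proof (rule field_le_epsilon)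
    fix e :: real assume "e > 0"
    then show "H2_norm (\<lambda>z. u z + v z) \<le> H2_norm u + H2_norm v + e"
      using H2_norm_le[OF *[of "e / 2"]] by (simp add: algebra_simps)
  qed
qed

lemma H2_norm_sq_eq_0:
  assumes h: "h holomorphic_on unit_disc" and "H2_norm_sq h = 0" and z: "z \<in> unit_disc"
  shows "h z = 0"
proof -
  define r where "r = cmod z"
  have r: "0 \<le> r" "r < 1"
    using z by (auto simp: r_def)
  have [measurable]: "(\<lambda>\<zeta>. h (of_real r * \<zeta>)) \<in> borel_measurable circle_measure"
    using r h by (auto intro: measurable_on_circle)
  have "(\<integral>\<^sup>+ \<zeta>. ennreal ((cmod (h (of_real r * \<zeta>)))\<^sup>2) \<partial>circle_measure) \<le> H2_norm_sq h"
    unfolding H2_norm_sq_def using r by (intro SUP_upper) auto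
  then have "(\<integral>\<^sup>+ \<zeta>. ennreal ((cmod (h (of_real r * \<zeta>)))\<^sup>2) \<partial>circle_measure) = 0"
    using assms(2) by simp
  then have "AE \<zeta> in circle_measure. h (of_real r * \<zeta>) = 0"
    by (subst (asm) nn_integral_0_iff_AE) auto
  then have "AE t in uniform_measure lborel {0..1::real}. h (of_real r * cis (2 * pi * t)) = 0"
    unfolding circle_measure_def
    by (rule AE_distrD[rotated]) (simp add: uniform_measure_def)
  then have "AE t in lborel. t \<in> {0..1::real} \<longrightarrow> h (of_real r * cis (2 * pi * t)) = 0"
    by (simp add: AE_uniform_measure)
  then have ae: "AE t\<in>{0<..<1} in lebesgue. t \<in> {t::real. h (of_real r * cis (2 * pi * t)) = 0}"
    by (intro AE_completion) auto
  have "continuous_on UNIV (\<lambda>t::real. h (of_real r * cis (2 * pi * t)))"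
    by (rule continuous_on_compose2[OF holomorphic_on_imp_continuous_on[OF h]])
      (use r in \<open>auto intro!: continuous_intros simp: norm_mult\<close>)
  then have cl: "closed {t::real. h (of_real r * cis (2 * pi * t)) = 0}"
    by (intro closed_Collect_eq continuous_intros)
  have "{0<..<1} \<subseteq> {t::real. h (of_real r * cis (2 * pi * t)) = 0}"
    using mem_closed_if_AE_lebesgue_open[OF _ cl ae] by auto
  then have sub: "{0..1} \<subseteq> {t::real. h (of_real r * cis (2 * pi * t)) = 0}"
    using closure_minimal[OF _ cl] closure_greaterThanLessThan[of "0::real" 1] by (metis zero_less_one)
  have "z = of_real r * cis (2 * pi * (Arg2pi z / (2 * pi)))"
    using Arg2pi_eq[of z] by (simp add: r_def cis_conv_exp mult.commute)
  moreover have "Arg2pi z / (2 * pi) \<in> {0..1}"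
    using Arg2pi_ge_0[of z] Arg2pi_lt_2pi[of z] by simp
  ultimately show ?thesis
    using sub by (metis (mono_tags, lifting) mem_Collect_eq subsetD)
qed

lemma H2_norm_sq_uminus: "H2_norm_sq (\<lambda>z. - u z) = H2_norm_sq u"
  by (simp add: H2_norm_sq_def)

lemma H2_diff:
  assumes "f \<in> H2_space" "g \<in> H2_space"
  shows "(\<lambda>z. f z - g z) holomorphic_on unit_disc" "H2_norm_sq (\<lambda>z. f z - g z) < \<infinity>"
proof -
  show "(\<lambda>z. f z - g z) holomorphic_on unit_disc"
    using assms by (auto simp: H2_space_def disc_holomorphic_def intro: holomorphic_intros)
  show "H2_norm_sq (\<lambda>z. f z - g z) < \<infinity>"
    using assms H2_norm_add(1)[of f "\<lambda>z. - g z"]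
    by (auto simp: H2_space_def disc_holomorphic_def H2_norm_sq_uminus intro: holomorphic_intros)
qed

lemma Metric_space_H2: "Metric_space H2_space H2_dist"
proof
  fix f g :: "complex \<Rightarrow> complex"
  show "0 \<le> H2_dist f g"
    by (simp add: H2_dist_def)
  show "H2_dist f g = H2_dist g f"
    by (simp add: H2_dist_def H2_norm_def H2_norm_sq_def norm_minus_commute)
next
  fix f g assume fg: "f \<in> H2_space" "g \<in> H2_space"
  show "H2_dist f g = 0 \<longleftrightarrow> f = g"
  proof
    assume "H2_dist f g = 0"
    then have "H2_norm_sq (\<lambda>z. f z - g z) = 0"
      using H2_diff(2)[OF fg] by (auto simp: H2_dist_def H2_norm_def enn2real_eq_0_iff)
    then have "f z = g z" if "z \<in> unit_disc" for z
      using H2_norm_sq_eq_0[OF H2_diff(1)[OF fg]] that by auto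
    moreover have "f z = g z" if "z \<notin> unit_disc" for z
      using fg that by (auto simp: H2_space_def disc_holomorphic_def)
    ultimately show "f = g" by blast
  next
    assume "f = g"
    then show "H2_dist f g = 0"
      by (simp add: H2_dist_def H2_norm_def H2_norm_sq_def)
  qed
next
  fix f g h assume "f \<in> H2_space" "g \<in> H2_space" "h \<in> H2_space"
  then show "H2_dist f h \<le> H2_dist f g + H2_dist g h"
    using H2_norm_add(2)[of "\<lambda>z. f z - g z" "\<lambda>z. g z - h z"] H2_diff
    by (simp add: H2_dist_def)
qed

lemma Metric_space_model_space: "Metric_space (model_space \<Theta>) H2_dist"
  by (rule Metric_space.subspace[OF Metric_space_H2]) (auto simp: model_space_def)

lemma topspace_model_topology [simp]: "topspace (model_topology \<Theta>) = model_space \<Theta>"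
  by (simp add: model_topology_def Metric_space.topspace_mtopology[OF Metric_space_model_space])

end

theory Submission
  imports Defs
begin

text \<open>
  Let \<open>\<Theta>\<^sub>P\<close> be the product of \<open>B\<close> and the singular inner function of \<open>\<mu>P\<close>.  Everything follows from
  two facts about \<open>A\<^sub>w\<close>: its elements in \<open>K\<^sub>\<Theta>\<close> lie in the smaller model space of \<open>\<Theta>\<^sub>P\<close>, and they are
  dense there.

  For the first fact let \<open>\<nu>\<close> vanish on the sets of finite entropy.  Following Roberts, \<open>\<nu>\<close> is split
  into pieces \<open>\<nu>\<^sub>k\<close> that charge every arc of length \<open>1 / n\<^sub>k\<close> by at most a small multiple of
  \<open>ln (1 / w (1 / n\<^sub>k)) / n\<^sub>k\<close>, where \<open>w (1 / n\<^sub>k)\<close> decreases like iterated squares; the mass that is never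
  removed sits on a set of finite entropy, so there is none.  Replacing the singular inner function of
  \<open>\<nu>\<^sub>k\<close> by its quotient with its own dilate, which is close to 1 in a large disc, costs little in the
  pairing with an element of \<open>A\<^sub>w\<close>.  Summing the costs, orthogonality to the multiples of \<open>\<Phi> S\<^sub>\<nu>\<close>
  becomes orthogonality to the multiples of \<open>\<Phi>\<close>.

  For the second fact one may assume that \<open>B\<close> is finite and that \<open>\<mu>P\<close> lives on one set \<open>E\<close> of finite
  entropy.  The projection \<open>e\<close> of a monomial onto the model space is smooth on the circle off \<open>E\<close>, with
  a Lipschitz constant given by a potential.  Finite entropy yields outer functions \<open>F\<close> near 1 whose
  decay at \<open>E\<close> makes \<open>cnj F * e\<close> smooth with modulus \<open>w\<^sup>1\<^sup>+\<^sup>\<alpha>\<close>.  By the Dini condition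
  its Cauchy transform, which still is in the model space, belongs to \<open>A\<^sub>w\<close>, and it is close to \<open>e\<close>.
\<close>

section \<open>Integrals over the circle and power series\<close>

text \<open>The hypotheses on \<open>w\<close> meet in one estimate: the Cauchy transform of a
  function with modulus w^(\<alpha>+\<theta>) on the circle has modulus w^\<theta> in the disc, the
  Dini integral paying for the lost w^\<alpha>. It is used with \<theta> = 1 to land in
  \<open>A_space w\<close>, and with \<theta> = 1 - \<alpha> to compare an element of
  \<open>A_space w\<close> with its dilates. So only a power 1 - \<alpha> of \<open>w\<close> is
  available against the factors in the first fact, and the mass allowed on each arc is proportional
  to 1 - \<alpha>. Iterated squares serve two opposite purposes: the scales shrink fast enough for
  the bounds of all earlier factors to multiply up to a power of the current scale, and slowly
  enough for ln (1 / w) to grow by a bounded factor per step, which makes the set carrying the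
  remaining mass one of finite entropy. In the second fact the obstacle is that the potential is
  bounded only by the inverse square of the distance to \<open>E\<close>, which powers of
  \<open>w\<close> need not beat. Hence the potential itself is put into the exponent of the outer
  function, and y * exp (- y) \<le> 1 lets it cancel its own growth.\<close>

lemma compact_norm_bound:
  fixes f :: "'a::topological_space \<Rightarrow> 'b::real_normed_vector"
  assumes "compact K" "continuous_on K f"
  shows "\<exists>M. \<forall>x\<in>K. norm (f x) \<le> M"
  using compact_imp_bounded[OF compact_continuous_image[OF assms(2,1)]] unfolding bounded_iff by blast

section \<open>Borel functions on the circle and integration over \<open>{0..1}\<close>\<close>

lemma circle_measurable_cong: "measurable circle_measure = measurable circle_borel"
  using measurable_cong_sets[OF sets_circle_measure refl] by (auto simp: fun_eq_iff)

lemma emeasure_circle_space [simp]: "emeasure circle_measure unit_circle = 1"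
proof -
  have "emeasure circle_measure (space circle_borel)
      = emeasure (uniform_measure lborel {0..1::real})
          ((\<lambda>t. cis (2 * pi * t)) -` space circle_borel \<inter> space (uniform_measure lborel {0..1}))"
    unfolding circle_measure_def
    by (rule emeasure_distr) (use measurable_cis_circle in \<open>auto simp: uniform_measure_def\<close>)
  also have "(\<lambda>t. cis (2 * pi * t)) -` space circle_borel \<inter> space (uniform_measure lborel {0..1}) = UNIV"
    by (auto simp: circle_borel_def space_restrict_space)
  finally show ?thesis
    by (simp add: circle_borel_def space_restrict_space)
qed

interpretation circle: finite_measure circle_measure
  by standard simp

lemma measure_circle_space [simp]: "measure circle_measure unit_circle = 1"
  by (simp add: measure_def)

lemma circle_borel_measurable_continuous:
  "continuous_on unit_circle f \<Longrightarrow> f \<in> borel_measurable circle_borel"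
  for f :: "complex \<Rightarrow> 'b::topological_space"
  unfolding circle_borel_def by (rule borel_measurable_continuous_on_restrict)

lemma circle_measurable_continuous:
  "continuous_on unit_circle f \<Longrightarrow> f \<in> borel_measurable circle_measure"
  for f :: "complex \<Rightarrow> 'b::topological_space"
  by (simp add: circle_measurable_cong circle_borel_measurable_continuous)

lemma circle_borel_measurable_borel:
  "f \<in> measurable borel N \<Longrightarrow> f \<in> measurable circle_borel N"
  unfolding circle_borel_def by (rule measurable_restrict_space1)

lemma space_circle_borel [simp]: "space circle_borel = unit_circle"
  by (simp add: circle_borel_def space_restrict_space)

lemma circle_sets_measurable: "sets M = sets circle_borel \<Longrightarrow> measurable M N = measurable circle_borel N"
  by (rule measurable_cong_sets) simp_all

lemma circle_sets_space: "sets M = sets circle_borel \<Longrightarrow> space M = unit_circle"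
  using sets_eq_imp_space_eq[of M circle_borel] by simp

lemma circle_sets_id: "sets M = sets circle_borel \<Longrightarrow> (\<lambda>\<zeta>::complex. \<zeta>) \<in> borel_measurable M"
  by (subst circle_sets_measurable) (auto intro: circle_borel_measurable_borel)

lemma circle_borel_Collect:
  assumes "Measurable.pred borel P"
  shows "{\<zeta> \<in> unit_circle. P \<zeta>} \<in> sets circle_borel"
  using predE[OF circle_borel_measurable_borel[OF assms]] unfolding space_circle_borel .

lemma closed_circle_borel: "closed E \<Longrightarrow> E \<subseteq> unit_circle \<Longrightarrow> E \<in> sets circle_borel"
  by (auto simp: circle_borel_def sets_restrict_space intro!: image_eqI[where x = E])

lemma measurable_cis_uniform:
  "(\<lambda>t. cis (2 * pi * t)) \<in> uniform_measure lborel {0..1::real} \<rightarrow>\<^sub>M circle_borel"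
  by (simp add: measurable_cis_circle)

lemma nn_integral_circle:
  assumes "f \<in> borel_measurable circle_borel"
  shows "(\<integral>\<^sup>+ \<zeta>. f \<zeta> \<partial>circle_measure) = (\<integral>\<^sup>+ t\<in>{0..1}. f (cis (2 * pi * t)) \<partial>lborel)"
proof -
  have m: "(\<lambda>t. f (cis (2 * pi * t))) \<in> borel_measurable lborel"
    by (rule measurable_compose[OF measurable_cis_circle assms])
  have "(\<integral>\<^sup>+ \<zeta>. f \<zeta> \<partial>circle_measure)
      = (\<integral>\<^sup>+ t. f (cis (2 * pi * t)) \<partial>uniform_measure lborel {0..1})"
    unfolding circle_measure_def
    by (rule nn_integral_distr[OF measurable_cis_uniform])
       (simp add: assms measurable_cong_sets[OF sets_distr refl])
  then show ?thesis
    using m by (simp add: nn_integral_uniform_measure divide_ennreal_def)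
qed

lemma integral_circle:
  fixes f :: "complex \<Rightarrow> 'b::{banach, second_countable_topology}"
  assumes "f \<in> borel_measurable circle_borel"
  shows "(\<integral> \<zeta>. f \<zeta> \<partial>circle_measure)
    = (\<integral> t. indicator {0..1} t *\<^sub>R f (cis (2 * pi * t)) \<partial>lborel)"
proof -
  have m: "(\<lambda>t. f (cis (2 * pi * t))) \<in> borel_measurable lborel"
    by (rule measurable_compose[OF measurable_cis_circle assms])
  have "(\<integral> \<zeta>. f \<zeta> \<partial>circle_measure)
      = (\<integral> t. f (cis (2 * pi * t)) \<partial>uniform_measure lborel {0..1})"
    unfolding circle_measure_def by (rule integral_distr[OF measurable_cis_uniform assms])
  also have "\<dots> = (\<integral> t. f (cis (2 * pi * t)) \<partial>density lborel (\<lambda>t. ennreal (indicator {0..1} t)))"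
    by (simp add: uniform_measure_def divide_ennreal_def ennreal_indicator)
  also have "\<dots> = (\<integral> t. indicator {0..1} t *\<^sub>R f (cis (2 * pi * t)) \<partial>lborel)"
    by (rule integral_density[OF m]) auto
  finally show ?thesis .
qed

lemma circle_integrable_bounded:
  fixes f :: "complex \<Rightarrow> 'b::{banach, second_countable_topology}"
  assumes "f \<in> borel_measurable circle_borel" "\<And>\<zeta>. \<zeta> \<in> unit_circle \<Longrightarrow> norm (f \<zeta>) \<le> C"
  shows "integrable circle_measure f"
  by (rule circle.integrable_const_bound[where B = C])
     (use assms in \<open>auto simp: circle_measurable_cong\<close>)

lemma circle_integrable_continuous:
  fixes f :: "complex \<Rightarrow> complex"
  assumes "continuous_on unit_circle f"
  shows "integrable circle_measure f"
proof -
  obtain C where "\<And>x. x \<in> unit_circle \<Longrightarrow> norm (f x) \<le> C"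
    using compact_norm_bound[OF compact_sphere assms] by blast
  then show ?thesis
    by (intro circle_integrable_bounded circle_borel_measurable_continuous assms)
qed

lemma circle_integral_cis_int:
  assumes "k \<noteq> (0::int)"
  shows "(\<integral> t. indicator {0..1} t *\<^sub>R cis (2 * pi * of_int k * t) \<partial>lborel) = 0"
proof -
  let ?F = "\<lambda>t::real. cis (2 * pi * of_int k * t) / (2 * pi * of_int k * \<i>)"
  have "(\<integral> t. indicator {0..1} t *\<^sub>R cis (2 * pi * of_int k * t) \<partial>lborel) = ?F 1 - ?F 0"
  proof (rule integral_FTC_atLeastAtMost)
    fix t :: real
    have "((\<lambda>x. (\<lambda>z. exp (2 * pi * of_int k * \<i> * z) / (2 * pi * of_int k * \<i>)) (of_real x))
        has_vector_derivative exp (2 * pi * of_int k * \<i> * of_real t)) (at t within {0..1})"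
      using assms
      by (intro has_vector_derivative_real_field) (auto intro!: derivative_eq_intros simp: field_simps)
    then show "(?F has_vector_derivative cis (2 * pi * of_int k * t)) (at t within {0..1})"
      by (simp add: cis_conv_exp mult_ac)
  qed (auto intro!: continuous_intros)
  also have "\<dots> = 0"
    by (simp add: cis_multiple_2pi)
  finally show ?thesis .
qed

lemma circle_integral_powers:
  "(\<integral> \<zeta>. \<zeta> ^ k * cnj \<zeta> ^ n \<partial>circle_measure) = (if k = n then 1 else 0)"
proof (cases "k = n")
  case True
  have "(\<integral> \<zeta>. \<zeta> ^ k * cnj \<zeta> ^ n \<partial>circle_measure) = (\<integral> \<zeta>. (1::complex) \<partial>circle_measure)"
  proof (rule Bochner_Integration.integral_cong[OF refl])
    fix \<zeta> assume "\<zeta> \<in> space circle_measure"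
    then have "\<zeta> * cnj \<zeta> = 1" by (simp add: complex_norm_square[symmetric])
    then show "\<zeta> ^ k * cnj \<zeta> ^ n = 1"
      using True by (simp add: power_mult_distrib[symmetric])
  qed
  then show ?thesis using True measure_circle_space by simp
next
  case False
  have "(\<integral> \<zeta>. \<zeta> ^ k * cnj \<zeta> ^ n \<partial>circle_measure)
     = (\<integral> t. indicator {0..1} t *\<^sub>R (cis (2 * pi * t) ^ k * cnj (cis (2 * pi * t)) ^ n) \<partial>lborel)"
    by (rule integral_circle) (intro circle_borel_measurable_continuous continuous_intros)
  also have "\<dots> = (\<integral> t. indicator {0..1} t *\<^sub>R cis (2 * pi * of_int (int k - int n) * t) \<partial>lborel)"
    by (intro Bochner_Integration.integral_cong refl)
       (simp add: Complex.DeMoivre cis_cnj cis_mult algebra_simps)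
  also have "\<dots> = 0"
    using False by (intro circle_integral_cis_int) auto
  finally show ?thesis using False by simp
qed

section \<open>Taylor coefficients as Fourier coefficients of dilates\<close>

lemma continuous_on_dilate:
  assumes "f holomorphic_on unit_disc" "0 \<le> r" "r < (1::real)"
  shows "continuous_on unit_circle (\<lambda>\<zeta>. f (of_real r * \<zeta>))"
  by (rule continuous_on_compose2[OF holomorphic_on_imp_continuous_on[OF assms(1)]])
     (use assms in \<open>auto intro!: continuous_intros simp: norm_mult\<close>)

definition hcoeff :: "(complex \<Rightarrow> complex) \<Rightarrow> nat \<Rightarrow> complex" where
  "hcoeff f n = (deriv ^^ n) f 0 / fact n"

lemma hcoeff_sums:
  assumes "f holomorphic_on unit_disc" "z \<in> unit_disc"
  shows "(\<lambda>n. hcoeff f n * z ^ n) sums f z"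
  using holomorphic_power_series[OF assms] by (simp add: hcoeff_def)

text \<open>One exchange of sum and integral for three kinds of series: powers of \<zeta>, powers of
  \<open>cnj \<zeta>\<close>, and the Cauchy kernel, where \<open>c n\<close> is
  \<open>z ^ n\<close>. The factor \<open>h\<close> is merely bounded and Borel, so that it can be a
  boundary function.\<close>

lemma integral_power_series_circle:
  assumes s: "summable (\<lambda>n. cmod (c n))"
    and f: "\<And>\<zeta>. \<zeta> \<in> unit_circle \<Longrightarrow> (\<lambda>n. c n * e n \<zeta>) sums f \<zeta>"
    and e: "\<And>n. continuous_on unit_circle (e n)" "\<And>n \<zeta>. \<zeta> \<in> unit_circle \<Longrightarrow> cmod (e n \<zeta>) \<le> 1"
    and h: "h \<in> borel_measurable circle_borel" "\<And>\<zeta>. \<zeta> \<in> unit_circle \<Longrightarrow> cmod (h \<zeta>) \<le> C"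
  shows "(\<lambda>n. c n * (\<integral> \<zeta>. e n \<zeta> * h \<zeta> \<partial>circle_measure)) sums (\<integral> \<zeta>. f \<zeta> * h \<zeta> \<partial>circle_measure)"
proof -
  have em [measurable]: "e n \<in> borel_measurable circle_borel" for n
    by (rule circle_borel_measurable_continuous[OF e(1)])
  note [measurable] = h(1)
  have C: "0 \<le> C"
    using h(2)[of 1] norm_ge_zero[of "h 1"] by (simp del: norm_ge_zero)
  have b: "cmod (c n * e n \<zeta> * h \<zeta>) \<le> cmod (c n) * C" if "\<zeta> \<in> unit_circle" for n \<zeta>
    using mult_mono[OF e(2)[OF that, of n] h(2)[OF that]] C
    by (simp add: norm_mult mult.assoc mult_left_mono)
  have i: "integrable circle_measure (\<lambda>\<zeta>. c n * e n \<zeta> * h \<zeta>)" for n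
    by (rule circle_integrable_bounded[OF _ b]) auto
  have sC: "summable (\<lambda>n. cmod (c n) * C)"
    by (rule summable_mult2[OF s])
  have "(\<lambda>n. \<integral> \<zeta>. c n * e n \<zeta> * h \<zeta> \<partial>circle_measure) sums
      (\<integral> \<zeta>. (\<Sum>n. c n * e n \<zeta> * h \<zeta>) \<partial>circle_measure)"
  proof (rule sums_integral[OF i])
    show "AE \<zeta> in circle_measure. summable (\<lambda>n. cmod (c n * e n \<zeta> * h \<zeta>))"
      by (rule AE_I2, rule summable_comparison_test'[OF sC]) (use b in auto)
    show "summable (\<lambda>n. \<integral> \<zeta>. cmod (c n * e n \<zeta> * h \<zeta>) \<partial>circle_measure)"
    proof (rule summable_comparison_test'[OF sC])
      fix n :: nat
      have "(\<integral> \<zeta>. cmod (c n * e n \<zeta> * h \<zeta>) \<partial>circle_measure)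
          \<le> (\<integral> \<zeta>. cmod (c n) * C \<partial>circle_measure)"
        by (rule integral_mono[OF integrable_norm[OF i]]) (use b in auto)
      then show "norm (\<integral> \<zeta>. cmod (c n * e n \<zeta> * h \<zeta>) \<partial>circle_measure) \<le> cmod (c n) * C"
        using measure_circle_space by simp
    qed
  qed
  also have "(\<integral> \<zeta>. (\<Sum>n. c n * e n \<zeta> * h \<zeta>) \<partial>circle_measure) = (\<integral> \<zeta>. f \<zeta> * h \<zeta> \<partial>circle_measure)"
    by (intro Bochner_Integration.integral_cong refl sums_unique[symmetric] sums_mult2 f) auto
  finally show ?thesis
    by (simp add: mult.assoc)
qed

text \<open>Convergence at the larger radius \<open>(r + 1) / 2\<close> forces absolute convergence
  at \<open>r\<close>.\<close>

lemma power_series_abs_summable: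
  assumes "\<And>z. z \<in> unit_disc \<Longrightarrow> (\<lambda>n. a n * z ^ n) sums f z" "0 \<le> r" "r < (1::real)"
  shows "summable (\<lambda>n. cmod (a n * of_real r ^ n))"
proof -
  have "summable (\<lambda>n. a n * of_real ((r + 1) / 2) ^ n)"
    using assms(2,3) by (intro sums_summable[OF assms(1)]) (auto simp: norm_of_real simp del: of_real_divide of_real_add)
  then have "summable (\<lambda>n. norm (a n * of_real r ^ n))"
    by (rule powser_insidea) (use assms(2,3) in \<open>simp only: norm_of_real, auto\<close>)
  then show ?thesis .
qed

lemma integral_power_series_disc:
  assumes a: "\<And>z. z \<in> unit_disc \<Longrightarrow> (\<lambda>n. a n * z ^ n) sums f z" and r: "0 \<le> r" "r < (1::real)"
    and h: "h \<in> borel_measurable circle_borel" "\<And>\<zeta>. \<zeta> \<in> unit_circle \<Longrightarrow> cmod (h \<zeta>) \<le> C"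
  shows "(\<lambda>n. a n * of_real r ^ n * (\<integral> \<zeta>. \<zeta> ^ n * h \<zeta> \<partial>circle_measure)) sums
    (\<integral> \<zeta>. f (of_real r * \<zeta>) * h \<zeta> \<partial>circle_measure)"
proof (rule integral_power_series_circle[OF power_series_abs_summable[OF a r] _ _ _ h])
  fix \<zeta> :: complex assume "\<zeta> \<in> unit_circle"
  then have "of_real r * \<zeta> \<in> unit_disc"
    using r by (simp add: norm_mult)
  from a[OF this] show "(\<lambda>n. a n * of_real r ^ n * \<zeta> ^ n) sums f (of_real r * \<zeta>)"
    by (simp add: power_mult_distrib mult.assoc)
qed (auto intro!: continuous_intros simp: norm_power)

lemma integral_power_series_cnj_disc:
  assumes a: "\<And>z. z \<in> unit_disc \<Longrightarrow> (\<lambda>n. a n * z ^ n) sums f z" and r: "0 \<le> r" "r < (1::real)"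
    and h: "h \<in> borel_measurable circle_borel" "\<And>\<zeta>. \<zeta> \<in> unit_circle \<Longrightarrow> cmod (h \<zeta>) \<le> C"
  shows "(\<lambda>n. cnj (a n) * of_real r ^ n * (\<integral> \<zeta>. cnj \<zeta> ^ n * h \<zeta> \<partial>circle_measure)) sums
    (\<integral> \<zeta>. cnj (f (of_real r * \<zeta>)) * h \<zeta> \<partial>circle_measure)"
proof (rule integral_power_series_circle[OF _ _ _ _ h])
  show "summable (\<lambda>n. cmod (cnj (a n) * of_real r ^ n))"
    using power_series_abs_summable[OF a r] by (simp add: norm_mult)
  fix \<zeta> :: complex assume "\<zeta> \<in> unit_circle"
  then have "of_real r * \<zeta> \<in> unit_disc"
    using r by (simp add: norm_mult)
  from a[OF this] have "(\<lambda>n. cnj (a n * (of_real r * \<zeta>) ^ n)) sums cnj (f (of_real r * \<zeta>))"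
    by (subst sums_cnj)
  then show "(\<lambda>n. cnj (a n) * of_real r ^ n * cnj \<zeta> ^ n) sums cnj (f (of_real r * \<zeta>))"
    by (simp add: power_mult_distrib mult.assoc)
qed (auto intro!: continuous_intros simp: norm_power)

lemma power_series_coeff_integral:
  assumes a: "\<And>z. z \<in> unit_disc \<Longrightarrow> (\<lambda>n. a n * z ^ n) sums f z" and r: "0 \<le> r" "r < (1::real)"
  shows "(\<integral> \<zeta>. f (of_real r * \<zeta>) * cnj \<zeta> ^ n \<partial>circle_measure) = a n * of_real r ^ n"
proof -
  have "(\<lambda>k. a k * of_real r ^ k * (\<integral> \<zeta>. \<zeta> ^ k * cnj \<zeta> ^ n \<partial>circle_measure)) sums
      (\<integral> \<zeta>. f (of_real r * \<zeta>) * cnj \<zeta> ^ n \<partial>circle_measure)"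
    by (rule integral_power_series_disc[OF a r, where C = 1])
       (auto intro!: circle_borel_measurable_continuous continuous_intros simp: norm_power)
  then have "(\<lambda>k. if k = n then a k * of_real r ^ k else 0) sums
      (\<integral> \<zeta>. f (of_real r * \<zeta>) * cnj \<zeta> ^ n \<partial>circle_measure)"
    by (simp add: circle_integral_powers if_distrib cong: if_cong)
  then show ?thesis
    by (rule sums_unique2[OF _ sums_single])
qed

text \<open>Fourier coefficients on the circle of radius 1/2 determine the Taylor coefficients. From
  here on \<open>hcoeff\<close> is computed by exhibiting a series that converges in the
  disc.\<close>

lemma hcoeff_unique:
  assumes a: "\<And>z. z \<in> unit_disc \<Longrightarrow> (\<lambda>n. a n * z ^ n) sums f z"
  shows "hcoeff f = a"
proof
  fix n
  have hol: "f holomorphic_on unit_disc"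
    by (rule power_series_holomorphic) (use a in auto)
  have "hcoeff f n * of_real (1/2) ^ n = a n * of_real (1/2) ^ n"
    using power_series_coeff_integral[OF hcoeff_sums[OF hol], of "1/2" n]
      power_series_coeff_integral[OF a, of "1/2" n] by simp
  then show "hcoeff f n = a n" by simp
qed

text \<open>Only the dilate of \<open>g\<close> is expanded; integrating the dilate of
  \<open>f\<close> against conjugate powers yields its coefficients, and the two dilations combine
  into \<open>r\<^sup>2\<close>. This is later used to shift a dilation from one factor to the
  other.\<close>

lemma parseval_circle:
  assumes f: "f holomorphic_on unit_disc" and g: "g holomorphic_on unit_disc"
    and r: "0 \<le> r" "r < (1::real)"
  shows "(\<lambda>n. hcoeff f n * cnj (hcoeff g n) * of_real (r\<^sup>2) ^ n) sums
    (\<integral> \<zeta>. f (of_real r * \<zeta>) * cnj (g (of_real r * \<zeta>)) \<partial>circle_measure)"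
proof -
  note cont = continuous_on_dilate[OF f r]
  obtain C where C: "\<And>\<zeta>. \<zeta> \<in> unit_circle \<Longrightarrow> cmod (f (of_real r * \<zeta>)) \<le> C"
    using compact_norm_bound[OF compact_sphere cont] by blast
  have "(\<lambda>n. cnj (hcoeff g n) * of_real r ^ n * (\<integral> \<zeta>. cnj \<zeta> ^ n * f (of_real r * \<zeta>) \<partial>circle_measure)) sums
    (\<integral> \<zeta>. cnj (g (of_real r * \<zeta>)) * f (of_real r * \<zeta>) \<partial>circle_measure)"
    by (rule integral_power_series_cnj_disc[OF hcoeff_sums[OF g] r, where C = C])
       (use C circle_borel_measurable_continuous[OF cont] in auto)
  moreover have "(\<integral> \<zeta>. cnj \<zeta> ^ n * f (of_real r * \<zeta>) \<partial>circle_measure) = hcoeff f n * of_real r ^ n" for n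
    using power_series_coeff_integral[OF hcoeff_sums[OF f] r, of n] by (simp add: mult.commute)
  ultimately show ?thesis
    by (simp add: mult_ac power2_eq_square power_mult_distrib)
qed

section \<open>The Hardy space\<close>

lemma hcoeff_add:
  assumes "f holomorphic_on unit_disc" "g holomorphic_on unit_disc"
  shows "hcoeff (\<lambda>z. f z + g z) = (\<lambda>n. hcoeff f n + hcoeff g n)"
  by (rule hcoeff_unique) (use assms in \<open>auto simp: distrib_right intro!: sums_add hcoeff_sums\<close>)

lemma hcoeff_cmult:
  assumes "f holomorphic_on unit_disc"
  shows "hcoeff (\<lambda>z. c * f z) = (\<lambda>n. c * hcoeff f n)"
  by (rule hcoeff_unique) (use assms in \<open>auto simp: mult.assoc intro!: sums_mult hcoeff_sums\<close>)

lemma hcoeff_diff: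
  assumes "f holomorphic_on unit_disc" "g holomorphic_on unit_disc"
  shows "hcoeff (\<lambda>z. f z - g z) = (\<lambda>n. hcoeff f n - hcoeff g n)"
  by (rule hcoeff_unique) (use assms in \<open>auto simp: left_diff_distrib intro!: sums_diff hcoeff_sums\<close>)

lemma hcoeff_cong:
  assumes "f holomorphic_on unit_disc" "\<And>z. z \<in> unit_disc \<Longrightarrow> f z = g z"
  shows "hcoeff g = hcoeff f"
  by (rule hcoeff_unique) (use hcoeff_sums[OF assms(1)] assms(2) in auto)

lemma hcoeff_0 [simp]: "hcoeff f 0 = f 0"
  by (simp add: hcoeff_def)

lemma hcoeff_mult:
  assumes f: "f holomorphic_on unit_disc" and g: "g holomorphic_on unit_disc"
  shows "hcoeff (\<lambda>z. f z * g z) = (\<lambda>n. \<Sum>j\<le>n. hcoeff f j * hcoeff g (n - j))"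
proof (rule hcoeff_unique)
  fix z :: complex assume z: "z \<in> unit_disc"
  have abs: "summable (\<lambda>n. cmod (hcoeff h n * z ^ n))" if "h holomorphic_on unit_disc" for h
    using power_series_abs_summable[OF hcoeff_sums[OF that], of "cmod z"] z
    by (simp add: norm_mult norm_power)
  have "(\<lambda>n. \<Sum>j\<le>n. (hcoeff f j * z ^ j) * (hcoeff g (n - j) * z ^ (n - j))) sums
      ((\<Sum>n. hcoeff f n * z ^ n) * (\<Sum>n. hcoeff g n * z ^ n))"
    by (rule Cauchy_product_sums[OF abs[OF f] abs[OF g]])
  also have "(\<lambda>n. \<Sum>j\<le>n. (hcoeff f j * z ^ j) * (hcoeff g (n - j) * z ^ (n - j)))
      = (\<lambda>n. (\<Sum>j\<le>n. hcoeff f j * hcoeff g (n - j)) * z ^ n)"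
  proof
    fix n
    have "(hcoeff f j * z ^ j) * (hcoeff g (n - j) * z ^ (n - j)) = hcoeff f j * hcoeff g (n - j) * z ^ n"
      if "j \<in> {..n}" for j
    proof -
      have "z ^ n = z ^ j * z ^ (n - j)"
        using that by (simp add: power_add[symmetric])
      then show ?thesis by simp
    qed
    then show "(\<Sum>j\<le>n. (hcoeff f j * z ^ j) * (hcoeff g (n - j) * z ^ (n - j)))
        = (\<Sum>j\<le>n. hcoeff f j * hcoeff g (n - j)) * z ^ n"
      unfolding sum_distrib_right by (rule sum.cong[OF refl])
  qed
  finally show "(\<lambda>n. (\<Sum>j\<le>n. hcoeff f j * hcoeff g (n - j)) * z ^ n) sums (f z * g z)"
    using sums_unique[OF hcoeff_sums[OF f z]] sums_unique[OF hcoeff_sums[OF g z]] by simp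
qed

lemma hcoeff_power: "hcoeff (\<lambda>z. z ^ k) = (\<lambda>n. if n = k then 1 else 0)"
proof (rule hcoeff_unique)
  fix z :: complex
  have "(\<lambda>n. if n = k then z ^ n else 0) sums z ^ k"
    by (rule sums_single)
  then show "(\<lambda>n. (if n = k then 1 else 0) * z ^ n) sums z ^ k"
    by (simp add: if_distrib[of "\<lambda>x. x * _"] cong: if_cong)
qed

lemma hcoeff_poly:
  assumes "finite I"
  shows "hcoeff (\<lambda>z. \<Sum>k\<in>I. c k * z ^ k) = (\<lambda>n. if n \<in> I then c n else 0)"
proof (rule hcoeff_unique)
  fix z :: complex
  have "(\<lambda>n. if n \<in> I then c n * z ^ n else 0) sums (\<Sum>k\<in>I. c k * z ^ k)"
    by (rule sums_If_finite_set[OF assms])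
  then show "(\<lambda>n. (if n \<in> I then c n else 0) * z ^ n) sums (\<Sum>k\<in>I. c k * z ^ k)"
    by (simp add: if_distrib[of "\<lambda>x. x * _"] cong: if_cong)
qed

section \<open>The norm and the inner product in terms of Taylor coefficients\<close>

lemma nn_integral_norm_sq_circle:
  assumes f: "f holomorphic_on unit_disc" and r: "0 \<le> r" "r < (1::real)"
  shows "(\<integral>\<^sup>+ \<zeta>. ennreal ((cmod (f (of_real r * \<zeta>)))\<^sup>2) \<partial>circle_measure)
    = (\<Sum>n. ennreal ((cmod (hcoeff f n))\<^sup>2 * (r\<^sup>2) ^ n))"
proof -
  note cont = continuous_on_dilate[OF f r]
  have i: "integrable circle_measure (\<lambda>\<zeta>. f (of_real r * \<zeta>) * cnj (f (of_real r * \<zeta>)))"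
    by (intro circle_integrable_continuous continuous_intros cont)
  have eq: "f (of_real r * \<zeta>) * cnj (f (of_real r * \<zeta>)) = of_real ((cmod (f (of_real r * \<zeta>)))\<^sup>2)" for \<zeta>
    by (simp only: complex_norm_square)
  have ri: "integrable circle_measure (\<lambda>\<zeta>. (cmod (f (of_real r * \<zeta>)))\<^sup>2)"
    using integrable_Re[OF i] unfolding eq Re_complex_of_real .
  have s: "(\<lambda>n. (cmod (hcoeff f n))\<^sup>2 * (r\<^sup>2) ^ n) sums (\<integral> \<zeta>. (cmod (f (of_real r * \<zeta>)))\<^sup>2 \<partial>circle_measure)"
  proof -
    have "(\<lambda>n. of_real ((cmod (hcoeff f n))\<^sup>2 * (r\<^sup>2) ^ n) :: complex) sums
       (of_real (\<integral> \<zeta>. (cmod (f (of_real r * \<zeta>)))\<^sup>2 \<partial>circle_measure))"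
      using parseval_circle[OF f f r] unfolding eq complex_norm_square[symmetric]
      by (simp add: integral_complex_of_real[symmetric])
    then show ?thesis
      by (simp only: sums_of_real_iff)
  qed
  have "(\<integral>\<^sup>+ \<zeta>. ennreal ((cmod (f (of_real r * \<zeta>)))\<^sup>2) \<partial>circle_measure)
      = ennreal (\<integral> \<zeta>. (cmod (f (of_real r * \<zeta>)))\<^sup>2 \<partial>circle_measure)"
    by (rule nn_integral_eq_integral[OF ri]) simp
  also have "\<dots> = ennreal (\<Sum>n. (cmod (hcoeff f n))\<^sup>2 * (r\<^sup>2) ^ n)"
    using sums_unique[OF s] by simp
  also have "\<dots> = (\<Sum>n. ennreal ((cmod (hcoeff f n))\<^sup>2 * (r\<^sup>2) ^ n))"
    by (rule suminf_ennreal2[symmetric]) (use sums_summable[OF s] in auto)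
  finally show ?thesis .
qed

text \<open>Each circle mean is a series in \<open>r\<^sup>2\<close> with nonnegative terms,
  dominated by the series at 1; conversely every partial sum at 1 is a limit of partial sums below
  the circle means.\<close>

lemma H2_norm_sq_hcoeff:
  assumes f: "f holomorphic_on unit_disc"
  shows "H2_norm_sq f = (\<Sum>n. ennreal ((cmod (hcoeff f n))\<^sup>2))"
proof (rule antisym)
  show "H2_norm_sq f \<le> (\<Sum>n. ennreal ((cmod (hcoeff f n))\<^sup>2))"
    unfolding H2_norm_sq_def
  proof (rule SUP_least)
    fix r :: real assume "r \<in> {0..<1}"
    then have r: "0 \<le> r" "r < 1" by auto
    show "(\<integral>\<^sup>+ \<zeta>. ennreal ((cmod (f (of_real r * \<zeta>)))\<^sup>2) \<partial>circle_measure)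
       \<le> (\<Sum>n. ennreal ((cmod (hcoeff f n))\<^sup>2))"
      unfolding nn_integral_norm_sq_circle[OF f r]
      by (intro suminf_le ennreal_leI mult_left_le power_le_one) (use r in \<open>auto simp: power_le_one\<close>)
  qed
  show "(\<Sum>n. ennreal ((cmod (hcoeff f n))\<^sup>2)) \<le> H2_norm_sq f"
    unfolding suminf_eq_SUP
  proof (rule SUP_least)
    fix N :: nat
    have "((\<lambda>r::real. ennreal (\<Sum>n<N. (cmod (hcoeff f n))\<^sup>2 * (r\<^sup>2) ^ n)) \<longlongrightarrow>
        ennreal (\<Sum>n<N. (cmod (hcoeff f n))\<^sup>2 * (1\<^sup>2) ^ n)) (at_left 1)"
      by (intro tendsto_intros)
    moreover have "\<forall>\<^sub>F r in at_left (1::real). ennreal (\<Sum>n<N. (cmod (hcoeff f n))\<^sup>2 * (r\<^sup>2) ^ n) \<le> H2_norm_sq f"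
      using eventually_at_left_real[OF zero_less_one[where 'a=real]]
    proof eventually_elim
      case (elim r)
      then have r: "0 \<le> r" "r < 1" by auto
      have "ennreal (\<Sum>n<N. (cmod (hcoeff f n))\<^sup>2 * (r\<^sup>2) ^ n)
          = (\<Sum>n<N. ennreal ((cmod (hcoeff f n))\<^sup>2 * (r\<^sup>2) ^ n))"
        by (rule sum_ennreal[symmetric]) auto
      also have "\<dots> \<le> (\<Sum>n. ennreal ((cmod (hcoeff f n))\<^sup>2 * (r\<^sup>2) ^ n))"
        by (rule sum_le_suminf) auto
      also have "\<dots> \<le> H2_norm_sq f"
        unfolding nn_integral_norm_sq_circle[OF f r, symmetric] H2_norm_sq_def
        using r by (intro SUP_upper) auto
      finally show ?case .
    qed
    ultimately have "ennreal (\<Sum>n<N. (cmod (hcoeff f n))\<^sup>2 * (1\<^sup>2) ^ n) \<le> H2_norm_sq f"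
      by (rule tendsto_upperbound) simp
    then show "(\<Sum>n<N. ennreal ((cmod (hcoeff f n))\<^sup>2)) \<le> H2_norm_sq f"
      by (simp add: sum_ennreal)
  qed
qed

text \<open>\<open>H2_space\<close> without the condition that functions vanish off the disc, so
  that products, polynomials and exponentials can be used as they stand. The theory is developed on
  coefficients.\<close>

definition hardy :: "(complex \<Rightarrow> complex) \<Rightarrow> bool" where
  "hardy f \<longleftrightarrow> f holomorphic_on unit_disc \<and> summable (\<lambda>n. (cmod (hcoeff f n))\<^sup>2)"

lemma hardy_holomorphic: "hardy f \<Longrightarrow> f holomorphic_on unit_disc"
  by (simp add: hardy_def)

lemma ennreal_less_infinity: "x < \<infinity> \<longleftrightarrow> x \<noteq> \<infinity>" for x :: ennreal
  by (cases x) auto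

lemma hardy_iff: "hardy f \<longleftrightarrow> f holomorphic_on unit_disc \<and> H2_norm_sq f < \<infinity>"
proof (cases "f holomorphic_on unit_disc")
  case True
  have "summable (\<lambda>n. (cmod (hcoeff f n))\<^sup>2) \<longleftrightarrow> (\<Sum>n. ennreal ((cmod (hcoeff f n))\<^sup>2)) \<noteq> \<infinity>"
  proof
    assume "summable (\<lambda>n. (cmod (hcoeff f n))\<^sup>2)"
    then show "(\<Sum>n. ennreal ((cmod (hcoeff f n))\<^sup>2)) \<noteq> \<infinity>"
      unfolding infinity_ennreal_def by (rule ennreal_suminf_neq_top) (rule zero_le_power2)
  next
    assume "(\<Sum>n. ennreal ((cmod (hcoeff f n))\<^sup>2)) \<noteq> \<infinity>"
    then show "summable (\<lambda>n. (cmod (hcoeff f n))\<^sup>2)"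
      unfolding infinity_ennreal_def by (rule summable_suminf_not_top[rotated]) (rule zero_le_power2)
  qed
  then show ?thesis
    using True unfolding hardy_def H2_norm_sq_hcoeff[OF True] ennreal_less_infinity
    by blast
qed (simp add: hardy_def)

lemma H2_space_iff: "f \<in> H2_space \<longleftrightarrow> hardy f \<and> (\<forall>z. z \<notin> unit_disc \<longrightarrow> f z = 0)"
  by (auto simp: H2_space_def disc_holomorphic_def hardy_iff)

lemma H2_norm_power2:
  assumes "hardy f"
  shows "(H2_norm f)\<^sup>2 = (\<Sum>n. (cmod (hcoeff f n))\<^sup>2)"
proof -
  have "H2_norm_sq f = ennreal (\<Sum>n. (cmod (hcoeff f n))\<^sup>2)"
    using assms by (simp add: H2_norm_sq_hcoeff hardy_def suminf_ennreal2)
  then show ?thesis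
    by (simp add: H2_norm_def suminf_nonneg assms[unfolded hardy_def])
qed

lemma summable_mult_squares:
  fixes a b :: "nat \<Rightarrow> complex"
  assumes "summable (\<lambda>n. (cmod (a n))\<^sup>2)" "summable (\<lambda>n. (cmod (b n))\<^sup>2)"
  shows "summable (\<lambda>n. cmod (a n * cnj (b n)))"
proof (rule summable_comparison_test')
  show "summable (\<lambda>n. (cmod (a n))\<^sup>2 + (cmod (b n))\<^sup>2)"
    by (intro summable_add assms)
  fix n
  have "0 \<le> (cmod (a n) - cmod (b n))\<^sup>2" by simp
  then have "2 * (cmod (a n) * cmod (b n)) \<le> (cmod (a n))\<^sup>2 + (cmod (b n))\<^sup>2"
    unfolding power2_diff by simp
  moreover have "0 \<le> cmod (a n) * cmod (b n)" by simp
  ultimately have "cmod (a n) * cmod (b n) \<le> (cmod (a n))\<^sup>2 + (cmod (b n))\<^sup>2"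
    by linarith
  then show "norm (cmod (a n * cnj (b n))) \<le> (cmod (a n))\<^sup>2 + (cmod (b n))\<^sup>2"
    by (simp add: norm_mult)
qed

text \<open>By Parseval the integral is a series in \<open>r\<^sup>2\<close> with absolutely
  summable coefficients. It converges uniformly on \<open>{0..1}\<close>, hence is continuous up to
  \<open>r = 1\<close>.\<close>

lemma H2_inner_tendsto:
  assumes f: "hardy f" and g: "hardy g"
  shows "((\<lambda>r. \<integral> \<zeta>. f (of_real r * \<zeta>) * cnj (g (of_real r * \<zeta>)) \<partial>circle_measure)
     \<longlongrightarrow> (\<Sum>n. hcoeff f n * cnj (hcoeff g n))) (at_left (1::real))"
proof -
  let ?c = "\<lambda>n. hcoeff f n * cnj (hcoeff g n)"
  have s: "summable (\<lambda>n. cmod (?c n))"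
    using f g by (intro summable_mult_squares) (auto simp: hardy_def)
  have "uniform_limit {0..1} (\<lambda>N r. \<Sum>n<N. ?c n * of_real (r\<^sup>2) ^ n)
      (\<lambda>r::real. \<Sum>n. ?c n * of_real (r\<^sup>2) ^ n) sequentially"
    by (rule Weierstrass_m_test[OF _ s])
       (auto simp: norm_mult norm_power intro!: mult_left_le power_le_one)
  then have "continuous_on {0..1} (\<lambda>r::real. \<Sum>n. ?c n * of_real (r\<^sup>2) ^ n)"
    by (rule uniform_limit_theorem[rotated]) (auto intro!: always_eventually continuous_intros)
  then have "((\<lambda>r::real. \<Sum>n. ?c n * of_real (r\<^sup>2) ^ n) \<longlongrightarrow> (\<Sum>n. ?c n * of_real (1\<^sup>2) ^ n)) (at 1 within {0..1})"
    unfolding continuous_on by (rule bspec) simp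
  then have "((\<lambda>r::real. \<Sum>n. ?c n * of_real (r\<^sup>2) ^ n) \<longlongrightarrow> (\<Sum>n. ?c n)) (at_left 1)"
    by (simp add: at_within_Icc_at_left)
  moreover have "\<forall>\<^sub>F r in at_left (1::real). (\<Sum>n. ?c n * of_real (r\<^sup>2) ^ n)
      = (\<integral> \<zeta>. f (of_real r * \<zeta>) * cnj (g (of_real r * \<zeta>)) \<partial>circle_measure)"
    using eventually_at_left_real[OF zero_less_one[where 'a=real]]
    by eventually_elim
      (use f g in \<open>auto simp: hardy_def simp del: of_real_power intro!: sums_unique[symmetric] parseval_circle\<close>)
  ultimately show ?thesis
    by (rule Lim_transform_eventually)
qed

lemma H2_inner_hcoeff:
  assumes "hardy f" "hardy g"
  shows "H2_inner f g = (\<Sum>n. hcoeff f n * cnj (hcoeff g n))"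
  unfolding H2_inner_def by (intro tendsto_Lim H2_inner_tendsto assms) simp

lemma H2_inner_sums:
  assumes "hardy f" "hardy g"
  shows "(\<lambda>n. hcoeff f n * cnj (hcoeff g n)) sums H2_inner f g"
  unfolding H2_inner_hcoeff[OF assms]
  by (intro summable_sums summable_norm_cancel[OF summable_mult_squares])
     (use assms in \<open>auto simp: hardy_def\<close>)

lemma H2_inner_sequence:
  assumes "hardy f" "hardy g" and "\<And>n. r n < 1" "r \<longlonglongrightarrow> (1::real)"
  shows "(\<lambda>n. \<integral> \<zeta>. f (of_real (r n) * \<zeta>) * cnj (g (of_real (r n) * \<zeta>)) \<partial>circle_measure)
     \<longlonglongrightarrow> H2_inner f g"
proof -
  have "filterlim r (at_left 1) sequentially"
    unfolding filterlim_at
    using assms(3,4) by (auto simp: less_imp_neq intro!: always_eventually)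
  from filterlim_compose[OF H2_inner_tendsto[OF assms(1,2)] this] show ?thesis
    by (simp add: H2_inner_hcoeff assms)
qed

lemma hardy_cong:
  assumes "hardy f" "\<And>z. z \<in> unit_disc \<Longrightarrow> f z = g z"
  shows "hardy g"
  using assms hcoeff_cong[of f g] holomorphic_cong[of unit_disc unit_disc f g] by (auto simp: hardy_def)

lemma H2_norm_sq_cong:
  assumes "\<And>z. z \<in> unit_disc \<Longrightarrow> f z = g z"
  shows "H2_norm_sq f = H2_norm_sq g"
  unfolding H2_norm_sq_def
  by (intro SUP_cong nn_integral_cong refl) (simp add: assms norm_mult)

lemma H2_norm_cong:
  assumes "\<And>z. z \<in> unit_disc \<Longrightarrow> f z = g z"
  shows "H2_norm f = H2_norm g"
  using H2_norm_sq_cong[of f g] assms by (simp add: H2_norm_def)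

text \<open>The limit predicates agree for every candidate value, so the values of
  \<open>Lim\<close> agree even where no limit exists.\<close>

lemma H2_inner_cong:
  assumes "\<And>z. z \<in> unit_disc \<Longrightarrow> f z = f' z" "\<And>z. z \<in> unit_disc \<Longrightarrow> g z = g' z"
  shows "H2_inner f g = H2_inner f' g'"
proof -
  have "((\<lambda>r. \<integral> \<zeta>. f (of_real r * \<zeta>) * cnj (g (of_real r * \<zeta>)) \<partial>circle_measure) \<longlongrightarrow> l) (at_left (1::real))
     \<longleftrightarrow> ((\<lambda>r. \<integral> \<zeta>. f' (of_real r * \<zeta>) * cnj (g' (of_real r * \<zeta>)) \<partial>circle_measure) \<longlongrightarrow> l) (at_left (1::real))" for l
  proof (rule tendsto_cong)
    show "\<forall>\<^sub>F r in at_left (1::real). (\<integral> \<zeta>. f (of_real r * \<zeta>) * cnj (g (of_real r * \<zeta>)) \<partial>circle_measure)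
       = (\<integral> \<zeta>. f' (of_real r * \<zeta>) * cnj (g' (of_real r * \<zeta>)) \<partial>circle_measure)"
      using eventually_at_left_real[OF zero_less_one[where 'a=real]]
      by eventually_elim (auto intro!: Bochner_Integration.integral_cong simp: assms norm_mult)
  qed
  then show ?thesis
    unfolding H2_inner_def Topological_Spaces.Lim_def by simp
qed

lemma hardy_add: "hardy f \<Longrightarrow> hardy g \<Longrightarrow> hardy (\<lambda>z. f z + g z)"
  using H2_norm_add(1)[of f g] by (auto simp: hardy_iff intro: holomorphic_intros)

lemma hardy_cmult: "hardy f \<Longrightarrow> hardy (\<lambda>z. c * f z)"
  by (auto simp: hardy_def hcoeff_cmult norm_mult power_mult_distrib intro!: holomorphic_intros summable_mult)

lemma hardy_uminus: "hardy f \<Longrightarrow> hardy (\<lambda>z. - f z)"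
  using hardy_cmult[of f "-1"] by simp

lemma hardy_diff: "hardy f \<Longrightarrow> hardy g \<Longrightarrow> hardy (\<lambda>z. f z - g z)"
  using hardy_add[of f "\<lambda>z. - g z"] by (simp add: hardy_uminus)

lemma hardy_sum: "(\<And>i. i \<in> I \<Longrightarrow> hardy (f i)) \<Longrightarrow> hardy (\<lambda>z. \<Sum>i\<in>I. f i z)"
proof (induction I rule: infinite_finite_induct)
  case (insert x F)
  then show ?case using hardy_add[of "f x" "\<lambda>z. \<Sum>i\<in>F. f i z"] by simp
qed (auto simp: hardy_def hcoeff_def)

lemma hardy_bounded_mult:
  assumes b: "b holomorphic_on unit_disc" "\<And>z. z \<in> unit_disc \<Longrightarrow> cmod (b z) \<le> C" and f: "hardy f"
  shows "hardy (\<lambda>z. b z * f z)" "H2_norm (\<lambda>z. b z * f z) \<le> C * H2_norm f"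
proof -
  have C: "0 \<le> C" using b(2)[of 0] norm_ge_zero[of "b 0"] by (simp del: norm_ge_zero)
  have *: "H2_norm_sq (\<lambda>z. b z * f z) \<le> ennreal ((C * H2_norm f)\<^sup>2)"
    unfolding H2_norm_sq_def
  proof (rule SUP_least)
    fix r :: real assume r: "r \<in> {0..<1}"
    have m: "(\<lambda>\<zeta>. f (of_real r * \<zeta>)) \<in> borel_measurable circle_measure"
      using r f by (auto intro: measurable_on_circle simp: hardy_def)
    have "(\<integral>\<^sup>+ \<zeta>. ennreal ((cmod (b (of_real r * \<zeta>) * f (of_real r * \<zeta>)))\<^sup>2) \<partial>circle_measure)
       \<le> (\<integral>\<^sup>+ \<zeta>. ennreal (C\<^sup>2) * ennreal ((cmod (f (of_real r * \<zeta>)))\<^sup>2) \<partial>circle_measure)"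
    proof (rule nn_integral_mono)
      fix \<zeta> assume "\<zeta> \<in> space circle_measure"
      then have "cmod (b (of_real r * \<zeta>)) \<le> C"
        using r by (intro b(2)) (auto simp: norm_mult)
      then have "(cmod (b (of_real r * \<zeta>) * f (of_real r * \<zeta>)))\<^sup>2 \<le> C\<^sup>2 * (cmod (f (of_real r * \<zeta>)))\<^sup>2"
        by (simp add: norm_mult power_mult_distrib mult_right_mono power_mono)
      then show "ennreal ((cmod (b (of_real r * \<zeta>) * f (of_real r * \<zeta>)))\<^sup>2)
          \<le> ennreal (C\<^sup>2) * ennreal ((cmod (f (of_real r * \<zeta>)))\<^sup>2)"
        by (simp add: ennreal_mult[symmetric] ennreal_leI)
    qed
    also have "\<dots> = ennreal (C\<^sup>2) * (\<integral>\<^sup>+ \<zeta>. ennreal ((cmod (f (of_real r * \<zeta>)))\<^sup>2) \<partial>circle_measure)"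
      using m by (intro nn_integral_cmult) auto
    also have "\<dots> \<le> ennreal (C\<^sup>2) * H2_norm_sq f"
      using r unfolding H2_norm_sq_def by (intro mult_left_mono SUP_upper) auto
    also have "\<dots> \<le> ennreal (C\<^sup>2) * ennreal ((H2_norm f)\<^sup>2)"
      using f by (intro mult_left_mono H2_norm_sq_le) (auto simp: hardy_iff)
    also have "\<dots> = ennreal ((C * H2_norm f)\<^sup>2)"
      by (simp add: ennreal_mult[symmetric] power_mult_distrib)
    finally show "(\<integral>\<^sup>+ \<zeta>. ennreal ((cmod (b (of_real r * \<zeta>) * f (of_real r * \<zeta>)))\<^sup>2) \<partial>circle_measure)
      \<le> ennreal ((C * H2_norm f)\<^sup>2)" .
  qed
  show "hardy (\<lambda>z. b z * f z)"
    unfolding hardy_iff using b f order.strict_trans1[OF * ennreal_less_top]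
    by (auto simp: hardy_holomorphic intro!: holomorphic_intros)
  show "H2_norm (\<lambda>z. b z * f z) \<le> C * H2_norm f"
    by (rule H2_norm_le[OF *]) (simp add: C)
qed

lemma hardy_power: "hardy (\<lambda>z. z ^ k)"
proof -
  have "(\<lambda>n. (cmod (hcoeff (\<lambda>z. z ^ k) n))\<^sup>2) = (\<lambda>n. if n = k then 1 else 0)"
    by (auto simp: hcoeff_power)
  then show ?thesis
    using sums_summable[OF sums_single[of k "\<lambda>_. 1::real"]]
    by (auto simp: hardy_def intro!: holomorphic_intros)
qed

lemma hardy_const: "hardy (\<lambda>z. c)"
  using hardy_cmult[OF hardy_power[of 0], of c] by simp

lemma hardy_poly: "hardy (\<lambda>z. \<Sum>k\<in>I. c k * z ^ k)"
  by (intro hardy_sum hardy_cmult hardy_power)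

lemma H2_norm_const: "H2_norm (\<lambda>z. c) = cmod c"
proof -
  have "hcoeff (\<lambda>z. c) = (\<lambda>n. if n = 0 then c else 0)"
    using hcoeff_poly[of "{0}" "\<lambda>_. c"] by simp
  then have "(\<lambda>n. (cmod (hcoeff (\<lambda>z. c) n))\<^sup>2) = (\<lambda>n. if n = 0 then (cmod c)\<^sup>2 else 0)"
    by auto
  then have "(H2_norm (\<lambda>z. c))\<^sup>2 = (cmod c)\<^sup>2"
    using H2_norm_power2[OF hardy_const[of c]] sums_unique[OF sums_single[of 0 "\<lambda>_. (cmod c)\<^sup>2"]] by simp
  then show ?thesis
    by (simp add: power2_eq_iff_nonneg)
qed

lemma hardy_bounded:
  assumes "b holomorphic_on unit_disc" "\<And>z. z \<in> unit_disc \<Longrightarrow> cmod (b z) \<le> C"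
  shows "hardy b" "H2_norm b \<le> C"
  using hardy_bounded_mult[OF assms hardy_const[of 1]] by (simp_all add: H2_norm_const)

lemma H2_inner_add_left:
  assumes "hardy f" "hardy g" "hardy h"
  shows "H2_inner (\<lambda>z. f z + g z) h = H2_inner f h + H2_inner g h"
proof -
  have "(\<lambda>n. hcoeff (\<lambda>z. f z + g z) n * cnj (hcoeff h n)) sums (H2_inner f h + H2_inner g h)"
    using sums_add[OF H2_inner_sums[OF assms(1,3)] H2_inner_sums[OF assms(2,3)]]
    by (simp add: hcoeff_add hardy_holomorphic assms distrib_right)
  then show ?thesis
    using H2_inner_sums[OF hardy_add[OF assms(1,2)] assms(3)] sums_unique2 by blast
qed

lemma H2_inner_cmult_left:
  assumes "hardy f" "hardy h"
  shows "H2_inner (\<lambda>z. c * f z) h = c * H2_inner f h"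
proof -
  have "(\<lambda>n. hcoeff (\<lambda>z. c * f z) n * cnj (hcoeff h n)) sums (c * H2_inner f h)"
    using sums_mult[OF H2_inner_sums[OF assms], of c]
    by (simp add: hcoeff_cmult hardy_holomorphic assms mult.assoc)
  then show ?thesis
    using H2_inner_sums[OF hardy_cmult[OF assms(1)] assms(2)] sums_unique2 by blast
qed

lemma H2_inner_cnj:
  assumes "hardy f" "hardy g"
  shows "H2_inner g f = cnj (H2_inner f g)"
proof -
  have "(\<lambda>n. cnj (hcoeff f n * cnj (hcoeff g n))) sums cnj (H2_inner f g)"
    unfolding sums_cnj by (rule H2_inner_sums[OF assms])
  then have "(\<lambda>n. hcoeff g n * cnj (hcoeff f n)) sums cnj (H2_inner f g)"
    by (simp add: mult.commute)
  then show ?thesis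
    using H2_inner_sums[OF assms(2,1)] sums_unique2 by blast
qed

lemma H2_inner_diff_left:
  assumes "hardy f" "hardy g" "hardy h"
  shows "H2_inner (\<lambda>z. f z - g z) h = H2_inner f h - H2_inner g h"
  using H2_inner_add_left[OF assms(1) hardy_cmult[OF assms(2), of "-1"] assms(3)]
    H2_inner_cmult_left[OF assms(2,3), of "-1"] by simp

lemma H2_inner_add_right:
  assumes "hardy f" "hardy g" "hardy h"
  shows "H2_inner h (\<lambda>z. f z + g z) = H2_inner h f + H2_inner h g"
  using H2_inner_add_left[OF assms] H2_inner_cnj assms hardy_add by (metis complex_cnj_add)

lemma H2_inner_cmult_right:
  assumes "hardy f" "hardy h"
  shows "H2_inner h (\<lambda>z. c * f z) = cnj c * H2_inner h f"
  using H2_inner_cmult_left[OF assms] H2_inner_cnj assms hardy_cmult by (metis complex_cnj_mult)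

lemma H2_inner_diff_right:
  assumes "hardy f" "hardy g" "hardy h"
  shows "H2_inner h (\<lambda>z. f z - g z) = H2_inner h f - H2_inner h g"
  using H2_inner_diff_left[OF assms] H2_inner_cnj assms hardy_diff by (metis complex_cnj_diff)

lemma H2_inner_self:
  assumes "hardy f"
  shows "H2_inner f f = of_real ((H2_norm f)\<^sup>2)"
proof -
  have "(\<lambda>n. (cmod (hcoeff f n))\<^sup>2) sums (H2_norm f)\<^sup>2"
    using assms by (simp add: H2_norm_power2 hardy_def summable_sums)
  then have "(\<lambda>n. of_real ((cmod (hcoeff f n))\<^sup>2) :: complex) sums of_real ((H2_norm f)\<^sup>2)"
    by (rule sums_of_real)
  then have "(\<lambda>n. hcoeff f n * cnj (hcoeff f n)) sums of_real ((H2_norm f)\<^sup>2)"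
    unfolding complex_norm_square .
  then show ?thesis
    using H2_inner_sums[OF assms assms] sums_unique2 by blast
qed

lemma H2_Cauchy_Schwarz:
  assumes "hardy f" "hardy g"
  shows "cmod (H2_inner f g) \<le> H2_norm f * H2_norm g"
proof -
  have L2: "L2_set (\<lambda>n. cmod (hcoeff h n)) {..<N} \<le> H2_norm h" if "hardy h" for h N
  proof -
    have "(\<Sum>n<N. (cmod (hcoeff h n))\<^sup>2) \<le> (H2_norm h)\<^sup>2"
      unfolding H2_norm_power2[OF that] using that by (intro sum_le_suminf) (auto simp: hardy_def)
    then show ?thesis
      unfolding L2_set_def by (intro real_le_lsqrt) (auto intro: sum_nonneg)
  qed
  have "cmod (\<Sum>n<N. hcoeff f n * cnj (hcoeff g n)) \<le> H2_norm f * H2_norm g" for N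
  proof -
    have "cmod (\<Sum>n<N. hcoeff f n * cnj (hcoeff g n)) \<le> (\<Sum>n<N. \<bar>cmod (hcoeff f n)\<bar> * \<bar>cmod (hcoeff g n)\<bar>)"
      by (rule order_trans[OF norm_sum]) (simp add: norm_mult)
    also have "\<dots> \<le> L2_set (\<lambda>n. cmod (hcoeff f n)) {..<N} * L2_set (\<lambda>n. cmod (hcoeff g n)) {..<N}"
      by (rule L2_set_mult_ineq)
    also have "\<dots> \<le> H2_norm f * H2_norm g"
      by (intro mult_mono L2 assms) auto
    finally show ?thesis .
  qed
  then show ?thesis
    using tendsto_norm[OF H2_inner_sums[OF assms, unfolded sums_def]]
    by (intro LIMSEQ_le_const2) auto
qed

lemma H2_norm_cmult: "hardy f \<Longrightarrow> H2_norm (\<lambda>z. c * f z) = cmod c * H2_norm f"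
proof -
  assume f: "hardy f"
  have "(H2_norm (\<lambda>z. c * f z))\<^sup>2 = (cmod c * H2_norm f)\<^sup>2"
    unfolding power_mult_distrib H2_norm_power2[OF f] H2_norm_power2[OF hardy_cmult[OF f]]
      hcoeff_cmult[OF hardy_holomorphic[OF f]] norm_mult
    by (rule suminf_mult) (use f in \<open>simp add: hardy_def\<close>)
  then show ?thesis
    by (simp add: power2_eq_iff_nonneg)
qed

lemma H2_norm_triangle: "hardy f \<Longrightarrow> hardy g \<Longrightarrow> H2_norm (\<lambda>z. f z + g z) \<le> H2_norm f + H2_norm g"
  by (rule H2_norm_add(2)) (auto simp: hardy_iff)

lemma H2_norm_diff_sq:
  assumes "hardy f" "hardy g"
  shows "(H2_norm (\<lambda>z. f z - g z))\<^sup>2 = (H2_norm f)\<^sup>2 - 2 * Re (H2_inner f g) + (H2_norm g)\<^sup>2"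
proof -
  have "of_real ((H2_norm (\<lambda>z. f z - g z))\<^sup>2) = H2_inner f f - H2_inner f g - (H2_inner g f - H2_inner g g)"
    using assms by (simp add: H2_inner_self[symmetric] hardy_diff H2_inner_diff_left H2_inner_diff_right del: of_real_power)
  then have "(H2_norm (\<lambda>z. f z - g z))\<^sup>2 = Re (H2_inner f f - H2_inner f g - (H2_inner g f - H2_inner g g))"
    by (metis Re_complex_of_real)
  then show ?thesis
    using H2_inner_cnj[OF assms] by (simp add: H2_inner_self assms del: of_real_power)
qed

lemma H2_norm_0_imp:
  assumes "hardy f" "H2_norm f = 0" "z \<in> unit_disc"
  shows "f z = 0"
  using H2_norm_sq_eq_0[of f z] assms
  by (auto simp: hardy_iff H2_norm_def enn2real_eq_0_iff)

lemma hcoeff_le_H2_norm: "hardy f \<Longrightarrow> cmod (hcoeff f n) \<le> H2_norm f"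
proof -
  assume f: "hardy f"
  have "(\<Sum>k\<in>{n}. (cmod (hcoeff f k))\<^sup>2) \<le> (H2_norm f)\<^sup>2"
    unfolding H2_norm_power2[OF f] using f by (intro sum_le_suminf) (auto simp: hardy_def)
  then show ?thesis
    by (simp add: power2_le_iff_abs_le)
qed

section \<open>Approximation by Taylor polynomials\<close>

definition taylor_poly :: "(complex \<Rightarrow> complex) \<Rightarrow> nat \<Rightarrow> complex \<Rightarrow> complex" where
  "taylor_poly f N z = (\<Sum>k<N. hcoeff f k * z ^ k)"

lemma hardy_taylor_poly: "hardy (taylor_poly f N)"
  unfolding taylor_poly_def by (rule hardy_poly)

lemma taylor_poly_tendsto:
  assumes f: "hardy f"
  shows "(\<lambda>N. H2_norm (\<lambda>z. f z - taylor_poly f N z)) \<longlonglongrightarrow> 0"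
proof -
  let ?a = "\<lambda>n. (cmod (hcoeff f n))\<^sup>2"
  have s: "summable ?a" using f by (simp add: hardy_def)
  have "(H2_norm (\<lambda>z. f z - taylor_poly f N z))\<^sup>2 = (\<Sum>n. ?a (n + N))" for N
  proof -
    have h: "hcoeff (\<lambda>z. f z - taylor_poly f N z) n = (if n < N then 0 else hcoeff f n)" for n
      using f hardy_taylor_poly[of f N] unfolding taylor_poly_def
      by (subst hcoeff_diff) (auto simp: hardy_holomorphic hcoeff_poly)
    have "(H2_norm (\<lambda>z. f z - taylor_poly f N z))\<^sup>2 = (\<Sum>n. if n < N then 0 else ?a n)"
      unfolding H2_norm_power2[OF hardy_diff[OF f hardy_taylor_poly]] h
      by (intro arg_cong[of _ _ suminf]) auto
    also have "\<dots> = (\<Sum>n. if n + N < N then 0 else ?a (n + N)) + (\<Sum>n<N. if n < N then 0 else ?a n)"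
      by (rule suminf_split_initial_segment)
        (rule summable_comparison_test'[OF s], auto)
    also have "\<dots> = (\<Sum>n. ?a (n + N))" by simp
    finally show ?thesis .
  qed
  moreover have "(\<lambda>N. \<Sum>n. ?a (n + N)) \<longlonglongrightarrow> 0"
    by (rule suminf_exist_split2[OF s])
  ultimately have "(\<lambda>N. (H2_norm (\<lambda>z. f z - taylor_poly f N z))\<^sup>2) \<longlonglongrightarrow> 0"
    by simp
  then have "(\<lambda>N. sqrt ((H2_norm (\<lambda>z. f z - taylor_poly f N z))\<^sup>2)) \<longlonglongrightarrow> sqrt 0"
    by (rule tendsto_real_sqrt)
  then show ?thesis by simp
qed

text \<open>The Taylor polynomials of \<open>g\<close> converge in norm, and multiplication by the
  bounded \<phi> and the pairing with \<open>f\<close> are continuous.\<close>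

lemma H2_inner_orth_closed:
  assumes f: "hardy f" and g: "hardy g" and phi: "\<phi> holomorphic_on unit_disc" "\<And>z. z \<in> unit_disc \<Longrightarrow> cmod (\<phi> z) \<le> C"
    and orth: "\<And>N. H2_inner f (\<lambda>z. \<phi> z * taylor_poly g N z) = 0"
  shows "H2_inner f (\<lambda>z. \<phi> z * g z) = 0"
proof -
  have "cmod (H2_inner f (\<lambda>z. \<phi> z * g z)) \<le> H2_norm f * (C * H2_norm (\<lambda>z. g z - taylor_poly g N z))" for N
  proof -
    note b = hardy_bounded_mult[OF phi]
    have "H2_inner f (\<lambda>z. \<phi> z * g z) = H2_inner f (\<lambda>z. \<phi> z * g z - \<phi> z * taylor_poly g N z)"
      using orth[of N] by (subst H2_inner_diff_right) (auto intro!: b f g hardy_taylor_poly)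
    also have "(\<lambda>z. \<phi> z * g z - \<phi> z * taylor_poly g N z) = (\<lambda>z. \<phi> z * (g z - taylor_poly g N z))"
      by (simp add: algebra_simps)
    also have "cmod (H2_inner f \<dots>) \<le> H2_norm f * H2_norm (\<lambda>z. \<phi> z * (g z - taylor_poly g N z))"
      by (intro H2_Cauchy_Schwarz f b hardy_diff g hardy_taylor_poly)
    also have "\<dots> \<le> H2_norm f * (C * H2_norm (\<lambda>z. g z - taylor_poly g N z))"
      by (intro mult_left_mono b hardy_diff g hardy_taylor_poly) auto
    finally show ?thesis .
  qed
  moreover have "(\<lambda>N. H2_norm f * (C * H2_norm (\<lambda>z. g z - taylor_poly g N z))) \<longlonglongrightarrow> H2_norm f * (C * 0)"
    by (intro tendsto_intros taylor_poly_tendsto g)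
  ultimately have "cmod (H2_inner f (\<lambda>z. \<phi> z * g z)) \<le> H2_norm f * (C * 0)"
    by (intro LIMSEQ_le_const) auto
  then show ?thesis by simp
qed

section \<open>Model spaces and Toeplitz operators\<close>

definition contractive :: "(complex \<Rightarrow> complex) \<Rightarrow> bool" where
  "contractive \<phi> \<longleftrightarrow> \<phi> holomorphic_on unit_disc \<and> (\<forall>z\<in>unit_disc. cmod (\<phi> z) \<le> 1)"

lemma contractiveI:
  "\<phi> holomorphic_on unit_disc \<Longrightarrow> (\<And>z. z \<in> unit_disc \<Longrightarrow> cmod (\<phi> z) \<le> 1) \<Longrightarrow> contractive \<phi>"
  by (simp add: contractive_def)

lemma contractiveD:
  assumes "contractive \<phi>"
  shows "\<phi> holomorphic_on unit_disc" "\<And>z. z \<in> unit_disc \<Longrightarrow> cmod (\<phi> z) \<le> 1"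
  using assms by (auto simp: contractive_def)

lemma contractive_mult: "contractive \<phi> \<Longrightarrow> contractive \<psi> \<Longrightarrow> contractive (\<lambda>z. \<phi> z * \<psi> z)"
  by (auto simp: contractive_def norm_mult intro!: holomorphic_intros mult_le_one)

lemma contractive_hardy_mult:
  assumes "contractive \<phi>" "hardy h"
  shows "hardy (\<lambda>z. \<phi> z * h z)" "H2_norm (\<lambda>z. \<phi> z * h z) \<le> H2_norm h"
  using hardy_bounded_mult[OF contractiveD[OF assms(1)] assms(2)] by simp_all

lemma contractive_hardy: "contractive \<phi> \<Longrightarrow> hardy \<phi>"
  using hardy_bounded contractiveD by metis

lemma contractive_cong:
  assumes "contractive \<phi>" "\<And>z. z \<in> unit_disc \<Longrightarrow> \<phi> z = \<psi> z"
  shows "contractive \<psi>"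
  using assms holomorphic_cong[of unit_disc unit_disc \<phi> \<psi>] by (auto simp: contractive_def)

text \<open>Expresses that a function is inner by its action on the Hardy space. In this form the
  property passes to divisors, as \<open>isometric_divisor\<close> shows.\<close>

definition isometric :: "(complex \<Rightarrow> complex) \<Rightarrow> bool" where
  "isometric \<phi> \<longleftrightarrow> contractive \<phi> \<and> (\<forall>h. hardy h \<longrightarrow> H2_norm (\<lambda>z. \<phi> z * h z) = H2_norm h)"

lemma isometric_contractive: "isometric \<phi> \<Longrightarrow> contractive \<phi>"
  by (simp add: isometric_def)

text \<open>Polarization: norms of differences determine the real part of the inner product, and
  replacing \<open>f\<close> by \<open>\<i> * f\<close> gives the imaginary part.\<close>

lemma isometric_inner:
  assumes "isometric \<phi>" "hardy f" "hardy g"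
  shows "H2_inner (\<lambda>z. \<phi> z * f z) (\<lambda>z. \<phi> z * g z) = H2_inner f g"
proof -
  have c: "contractive \<phi>" by (rule isometric_contractive[OF assms(1)])
  have n: "H2_norm (\<lambda>z. \<phi> z * h z) = H2_norm h" if "hardy h" for h
    using assms(1) that by (simp add: isometric_def)
  have re: "Re (H2_inner (\<lambda>z. \<phi> z * f z) (\<lambda>z. \<phi> z * g z)) = Re (H2_inner f g)" if f: "hardy f" for f
  proof -
    have "(H2_norm (\<lambda>z. \<phi> z * f z - \<phi> z * g z))\<^sup>2 = (H2_norm (\<lambda>z. f z - g z))\<^sup>2"
      using n[OF hardy_diff[OF f assms(3)]] by (simp add: right_diff_distrib)
    then show ?thesis
      using f assms(3) by (simp add: H2_norm_diff_sq contractive_hardy_mult[OF c] n)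
  qed
  have "H2_inner (\<lambda>z. \<phi> z * (\<i> * f z)) (\<lambda>z. \<phi> z * g z) = \<i> * H2_inner (\<lambda>z. \<phi> z * f z) (\<lambda>z. \<phi> z * g z)"
    using H2_inner_cmult_left[OF contractive_hardy_mult(1)[OF c assms(2)] contractive_hardy_mult(1)[OF c assms(3)], of \<i>]
    by (simp add: mult_ac)
  with re[OF hardy_cmult[OF assms(2), of \<i>]]
  have "Im (H2_inner (\<lambda>z. \<phi> z * f z) (\<lambda>z. \<phi> z * g z)) = Im (H2_inner f g)"
    by (simp add: H2_inner_cmult_left assms)
  with re[OF assms(2)] show ?thesis
    by (simp add: complex_eq_iff)
qed

text \<open>The norm of \<open>h\<close>, which is that of \<theta> h = \<psi> \<phi> h, is at most
  that of \<phi> h, which is at most that of \<open>h\<close>; so equality holds throughout.\<close>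

lemma isometric_divisor:
  assumes "isometric \<theta>" "contractive \<phi>" "contractive \<psi>"
    and "\<And>z. z \<in> unit_disc \<Longrightarrow> \<theta> z = \<phi> z * \<psi> z"
  shows "isometric \<phi>"
  unfolding isometric_def
proof (intro conjI allI impI antisym)
  fix h assume h: "hardy h"
  note hm = contractive_hardy_mult[OF assms(2) h]
  show "H2_norm (\<lambda>z. \<phi> z * h z) \<le> H2_norm h" by (rule hm)
  have "H2_norm h = H2_norm (\<lambda>z. \<theta> z * h z)"
    using assms(1) h by (simp add: isometric_def)
  also have "\<dots> = H2_norm (\<lambda>z. \<psi> z * (\<phi> z * h z))"
    by (rule H2_norm_cong) (simp add: assms(4))
  also have "\<dots> \<le> H2_norm (\<lambda>z. \<phi> z * h z)"
    by (rule contractive_hardy_mult[OF assms(3) hm(1)])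
  finally show "H2_norm h \<le> H2_norm (\<lambda>z. \<phi> z * h z)" .
qed (rule assms(2))

text \<open>One fixed sequence of radii, through which radial limits are fed to dominated
  convergence and to measurability of limits.\<close>

definition rseq :: "nat \<Rightarrow> real" where
  "rseq n = 1 - inverse (real (Suc n))"

lemma rseq: "0 \<le> rseq n" "rseq n < 1" "rseq \<longlonglongrightarrow> 1" "\<bar>rseq n\<bar> < 1"
proof -
  show "0 \<le> rseq n" "rseq n < 1" by (auto simp: rseq_def inverse_le_1_iff)
  then show "\<bar>rseq n\<bar> < 1" by simp
  have "(\<lambda>n. 1 - inverse (real (Suc n))) \<longlonglongrightarrow> 1 - 0"
    by (intro tendsto_diff tendsto_const LIMSEQ_inverse_real_of_nat)
  then show "rseq \<longlonglongrightarrow> 1" by (simp add: rseq_def[abs_def])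
qed

lemma rseq_at_left: "filterlim rseq (at_left 1) sequentially"
  unfolding filterlim_at using rseq by (auto simp: less_imp_neq intro!: always_eventually)

lemma circle_radial_DCT:
  fixes f :: "complex \<Rightarrow> complex"
  assumes f: "continuous_on unit_disc f" "\<And>z. z \<in> unit_disc \<Longrightarrow> cmod (f z) \<le> C"
    and F: "F \<in> borel_measurable circle_borel"
    and lim: "AE \<zeta> in circle_measure. ((\<lambda>r. f (of_real r * \<zeta>)) \<longlongrightarrow> F \<zeta>) (at_left (1::real))"
    and U: "U \<in> borel_measurable circle_borel" "\<And>\<zeta>. \<zeta> \<in> unit_circle \<Longrightarrow> cmod (U \<zeta>) \<le> K"
    and r: "filterlim r (at_left 1) sequentially" "\<And>n. 0 \<le> r n" "\<And>n. r n < 1"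
  shows "(\<lambda>n. \<integral> \<zeta>. f (of_real (r n) * \<zeta>) * U \<zeta> \<partial>circle_measure) \<longlonglongrightarrow> (\<integral> \<zeta>. F \<zeta> * U \<zeta> \<partial>circle_measure)"
proof -
  note [measurable] = F U(1)
  have [measurable]: "(\<lambda>\<zeta>. f (of_real (r n) * \<zeta>)) \<in> borel_measurable circle_borel" for n
    by (intro circle_borel_measurable_continuous continuous_on_compose2[OF f(1)] continuous_intros)
       (use r in \<open>auto simp: norm_mult\<close>)
  have C: "0 \<le> C" using f(2)[of 0] norm_ge_zero[of "f 0"] by (simp del: norm_ge_zero)
  show ?thesis
  proof (rule integral_dominated_convergence[where w = "\<lambda>_. C * K"])
    show "AE \<zeta> in circle_measure. (\<lambda>n. f (of_real (r n) * \<zeta>) * U \<zeta>) \<longlonglongrightarrow> F \<zeta> * U \<zeta>"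
      using lim
    proof eventually_elim
      case (elim \<zeta>)
      from filterlim_compose[OF this r(1)] show ?case
        by (intro tendsto_mult tendsto_const)
    qed
    fix n
    show "AE \<zeta> in circle_measure. norm (f (of_real (r n) * \<zeta>) * U \<zeta>) \<le> C * K"
    proof (rule AE_I2)
      fix \<zeta> assume z: "\<zeta> \<in> space circle_measure"
      then have "of_real (r n) * \<zeta> \<in> unit_disc" using r by (simp add: norm_mult)
      then show "norm (f (of_real (r n) * \<zeta>) * U \<zeta>) \<le> C * K"
        using z C by (auto simp: norm_mult intro!: mult_mono f(2) U(2))
    qed
  qed (auto simp: circle_measurable_cong)
qed

lemma radial_limit_cball:
  fixes p :: "complex \<Rightarrow> complex"
  assumes "continuous_on (cball 0 1) p" "\<zeta> \<in> unit_circle"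
  shows "((\<lambda>r. p (of_real r * \<zeta>)) \<longlongrightarrow> p \<zeta>) (at_left (1::real))"
proof -
  have "((\<lambda>r::real. of_real r * \<zeta>) \<longlongrightarrow> of_real 1 * \<zeta>) (at_left 1)"
    by (intro tendsto_intros)
  then have lim: "((\<lambda>r::real. of_real r * \<zeta>) \<longlongrightarrow> \<zeta>) (at_left 1)" by simp
  show ?thesis
  proof (rule continuous_on_tendsto_compose[OF assms(1) lim])
    show "\<zeta> \<in> cball 0 1" using assms(2) by simp
    show "\<forall>\<^sub>F r in at_left (1::real). of_real r * \<zeta> \<in> cball 0 1"
      by (rule eventually_mono[OF eventually_at_left_real[OF zero_less_one]]) (use assms(2) in \<open>auto simp: norm_mult\<close>)
  qed
qed

section \<open>Model spaces and the projections of monomials\<close>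

lemma model_space_hardy: "f \<in> model_space \<Theta> \<Longrightarrow> hardy f"
  by (simp add: model_space_def H2_space_iff)

definition disc_cut :: "(complex \<Rightarrow> complex) \<Rightarrow> complex \<Rightarrow> complex" where
  "disc_cut f z = (if z \<in> unit_disc then f z else 0)"

lemma disc_cut_eq [simp]: "z \<in> unit_disc \<Longrightarrow> disc_cut f z = f z"
  by (simp add: disc_cut_def)

lemma disc_cut_H2_space: "hardy f \<Longrightarrow> disc_cut f \<in> H2_space"
  by (auto simp: H2_space_iff disc_cut_def intro: hardy_cong)

text \<open>The products of \<Theta> with polynomials are dense in \<Theta> H^2, because polynomials
  are dense and \<Theta> is contractive.\<close>

lemma model_space_iff:
  assumes c: "contractive \<Theta>"
  shows "f \<in> model_space \<Theta> \<longleftrightarrow> f \<in> H2_space \<and> (\<forall>k. H2_inner f (\<lambda>z. \<Theta> z * z ^ k) = 0)"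
proof (intro iffI conjI allI)
  fix k assume f: "f \<in> model_space \<Theta>"
  then show "f \<in> H2_space" by (simp add: model_space_def)
  have "H2_inner f (\<lambda>z. \<Theta> z * disc_cut (\<lambda>z. z ^ k) z) = 0"
    using f disc_cut_H2_space[OF hardy_power] by (auto simp: model_space_def)
  then show "H2_inner f (\<lambda>z. \<Theta> z * z ^ k) = 0"
    by (subst (asm) H2_inner_cong[where f' = f and g' = "\<lambda>z. \<Theta> z * z ^ k"]) auto
next
  assume "f \<in> H2_space \<and> (\<forall>k. H2_inner f (\<lambda>z. \<Theta> z * z ^ k) = 0)"
  then have f: "f \<in> H2_space" "hardy f" and orth: "\<And>k. H2_inner f (\<lambda>z. \<Theta> z * z ^ k) = 0"
    by (auto simp: H2_space_iff)
  note hm = contractive_hardy_mult[OF c]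
  have "H2_inner f (\<lambda>z. \<Theta> z * taylor_poly g N z) = 0" for g N
  proof (induction N)
    case 0
    then show ?case
      using H2_inner_cmult_right[OF hardy_const[of 0] f(2), of 0] by (simp add: taylor_poly_def)
  next
    case (Suc N)
    have "H2_inner f (\<lambda>z. \<Theta> z * taylor_poly g N z + hcoeff g N * (\<Theta> z * z ^ N)) = 0"
      using Suc orth[of N]
      by (simp add: H2_inner_add_right H2_inner_cmult_right f hm hardy_cmult hardy_power hardy_taylor_poly)
    then show ?case by (simp add: taylor_poly_def algebra_simps)
  qed
  then have "H2_inner f (\<lambda>z. \<Theta> z * g z) = 0" if "hardy g" for g
    by (intro H2_inner_orth_closed[OF f(2) that contractiveD[OF c]])
  then show "f \<in> model_space \<Theta>"
    using f by (auto simp: model_space_def H2_space_iff)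
qed

lemma model_space_orth:
  assumes "contractive \<Theta>" "f \<in> model_space \<Theta>" "hardy g"
  shows "H2_inner f (\<lambda>z. \<Theta> z * g z) = 0"
proof -
  have "H2_inner f (\<lambda>z. \<Theta> z * disc_cut g z) = 0"
    using assms disc_cut_H2_space by (auto simp: model_space_def)
  then show ?thesis
    by (subst (asm) H2_inner_cong[where f' = f and g' = "\<lambda>z. \<Theta> z * g z"]) auto
qed

lemma model_space_cong:
  assumes "\<And>z. z \<in> unit_disc \<Longrightarrow> \<Theta> z = \<Theta>' z"
  shows "model_space \<Theta> = model_space \<Theta>'"
proof -
  have "H2_inner f (\<lambda>z. \<Theta> z * g z) = H2_inner f (\<lambda>z. \<Theta>' z * g z)" for f g
    by (rule H2_inner_cong) (auto simp: assms)
  then show ?thesis by (simp add: model_space_def)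
qed

lemma model_space_divisor:
  assumes "contractive \<phi>" "contractive \<psi>" "\<And>z. z \<in> unit_disc \<Longrightarrow> \<Theta> z = \<phi> z * \<psi> z"
  shows "model_space \<phi> \<subseteq> model_space \<Theta>"
proof
  fix f assume f: "f \<in> model_space \<phi>"
  have "H2_inner f (\<lambda>z. \<Theta> z * g z) = 0" if "g \<in> H2_space" for g
  proof -
    have "H2_inner f (\<lambda>z. \<phi> z * (\<psi> z * g z)) = 0"
      using that by (intro model_space_orth assms f contractive_hardy_mult) (auto simp: H2_space_iff)
    then show ?thesis
      by (subst H2_inner_cong[where f' = f and g' = "\<lambda>z. \<phi> z * (\<psi> z * g z)"]) (auto simp: assms)
  qed
  then show "f \<in> model_space \<Theta>"
    using f by (simp add: model_space_def)
qed

text \<open>The analytic part of \<open>cnj \<Theta> * z ^ n\<close> on the circle, that is, the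
  adjoint of multiplication by \<Theta> applied to \<open>z ^ n\<close>. It is a polynomial of
  degree at most \<open>n\<close>.\<close>

definition proj_poly :: "(complex \<Rightarrow> complex) \<Rightarrow> nat \<Rightarrow> complex \<Rightarrow> complex" where
  "proj_poly \<Theta> n z = (\<Sum>j\<le>n. cnj (hcoeff \<Theta> (n - j)) * z ^ j)"

text \<open>The orthogonal projection of the monomial \<open>z ^ n\<close> onto the model space.\<close>

definition model_gen :: "(complex \<Rightarrow> complex) \<Rightarrow> nat \<Rightarrow> complex \<Rightarrow> complex" where
  "model_gen \<Theta> n z = z ^ n - \<Theta> z * proj_poly \<Theta> n z"

lemma hardy_proj_poly: "hardy (proj_poly \<Theta> n)"
  unfolding proj_poly_def[abs_def] by (rule hardy_poly)

lemma hardy_model_gen: "contractive \<Theta> \<Longrightarrow> hardy (model_gen \<Theta> n)"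
  unfolding model_gen_def[abs_def]
  by (intro hardy_diff hardy_power contractive_hardy_mult hardy_proj_poly)

lemma H2_inner_power_left:
  assumes "hardy g"
  shows "H2_inner (\<lambda>z. z ^ n) g = cnj (hcoeff g n)"
proof -
  have "(\<lambda>k. if k = n then cnj (hcoeff g k) else 0) sums H2_inner (\<lambda>z. z ^ n) g"
    using H2_inner_sums[OF hardy_power assms, of n]
    by (simp add: hcoeff_power if_distrib[of "\<lambda>x. x * _"] cong: if_cong)
  then show ?thesis
    using sums_unique2[OF _ sums_single[of n "\<lambda>k. cnj (hcoeff g k)"]] by metis
qed

text \<open>Pairing \<open>z ^ n\<close> with \<Theta> g picks the conjugate of the n-th coefficient
  of a Cauchy product. This is the pairing of \<open>proj_poly \<Theta> n\<close> with
  \<open>g\<close>, and multiplying both by the isometric \<Theta> does not change it.\<close>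

lemma model_gen_orth:
  assumes "isometric \<Theta>" "hardy g"
  shows "H2_inner (model_gen \<Theta> n) (\<lambda>z. \<Theta> z * g z) = 0"
proof -
  note c = isometric_contractive[OF assms(1)]
  note hm = contractive_hardy_mult[OF c]
  have "H2_inner (\<lambda>z. z ^ n) (\<lambda>z. \<Theta> z * g z) = cnj (\<Sum>j\<le>n. hcoeff \<Theta> j * hcoeff g (n - j))"
    using assms c by (simp add: H2_inner_power_left hm hcoeff_mult contractiveD hardy_holomorphic)
  also have "(\<Sum>j\<le>n. hcoeff \<Theta> j * hcoeff g (n - j)) = (\<Sum>j\<le>n. hcoeff \<Theta> (n - j) * hcoeff g j)"
    by (rule sum.reindex_bij_witness[of _ "\<lambda>j. n - j" "\<lambda>j. n - j"]) auto
  also have "cnj \<dots> = (\<Sum>j\<le>n. cnj (hcoeff \<Theta> (n - j)) * cnj (hcoeff g j))"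
    by simp
  also have "\<dots> = H2_inner (proj_poly \<Theta> n) g"
  proof -
    have "(\<lambda>j. if j \<in> {..n} then cnj (hcoeff \<Theta> (n - j)) * cnj (hcoeff g j) else 0) sums H2_inner (proj_poly \<Theta> n) g"
      using H2_inner_sums[OF hardy_proj_poly assms(2), of \<Theta> n]
      by (simp add: proj_poly_def[abs_def] hcoeff_poly if_distrib[of "\<lambda>x. x * _"] cong: if_cong)
    from sums_unique2[OF sums_If_finite_set this] show ?thesis by simp
  qed
  also have "\<dots> = H2_inner (\<lambda>z. \<Theta> z * proj_poly \<Theta> n z) (\<lambda>z. \<Theta> z * g z)"
    by (rule isometric_inner[symmetric, OF assms(1) hardy_proj_poly assms(2)])
  finally show ?thesis
    unfolding model_gen_def[abs_def]
    by (simp add: H2_inner_diff_left hardy_power hm hardy_proj_poly assms)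
qed

text \<open>With \<open>x\<close> the error on the left and \<open>q\<close> the same combination of
  the \<open>proj_poly\<close>, the Taylor remainder is x - \<Theta> q. Since \<open>x\<close> is
  orthogonal to \<Theta> q, Pythagoras gives the bound. Hence the generators span a dense subspace
  of the model space.\<close>

lemma model_gen_approx:
  assumes iso: "isometric \<Theta>" and f: "f \<in> model_space \<Theta>"
  shows "H2_norm (\<lambda>z. f z - (\<Sum>k<N. hcoeff f k * model_gen \<Theta> k z)) \<le> H2_norm (\<lambda>z. f z - taylor_poly f N z)"
proof -
  note c = isometric_contractive[OF iso]
  note hm = contractive_hardy_mult[OF c]
  define q where "q z = (\<Sum>k<N. hcoeff f k * proj_poly \<Theta> k z)" for z
  define x where "x z = f z - (\<Sum>k<N. hcoeff f k * model_gen \<Theta> k z)" for z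
  have hf: "hardy f" by (rule model_space_hardy[OF f])
  have hq: "hardy q"
    unfolding q_def[abs_def] by (intro hardy_sum hardy_cmult hardy_proj_poly)
  have hs: "hardy (\<lambda>z. \<Sum>k<N. hcoeff f k * model_gen \<Theta> k z)"
    by (intro hardy_sum hardy_cmult hardy_model_gen c)
  have hx: "hardy x"
    unfolding x_def[abs_def] by (intro hardy_diff hf hs)
  have s0: "H2_inner (\<lambda>z. \<Sum>k<N. hcoeff f k * model_gen \<Theta> k z) (\<lambda>z. \<Theta> z * q z) = 0"
  proof (induction N)
    case 0
    then show ?case
      using H2_inner_cmult_left[OF hardy_const[of 0] hm(1)[OF hq], of 0] by simp
  next
    case (Suc N)
    have "H2_inner (\<lambda>z. (\<Sum>k<N. hcoeff f k * model_gen \<Theta> k z) + hcoeff f N * model_gen \<Theta> N z) (\<lambda>z. \<Theta> z * q z)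
        = H2_inner (\<lambda>z. \<Sum>k<N. hcoeff f k * model_gen \<Theta> k z) (\<lambda>z. \<Theta> z * q z)
        + hcoeff f N * H2_inner (model_gen \<Theta> N) (\<lambda>z. \<Theta> z * q z)"
      by (simp add: H2_inner_add_left H2_inner_cmult_left hardy_sum hardy_cmult hardy_model_gen c hm hq)
    then show ?case
      using Suc model_gen_orth[OF iso hq] by simp
  qed
  have "H2_inner x (\<lambda>z. \<Theta> z * q z) = 0"
    unfolding x_def[abs_def]
    using s0 model_space_orth[OF c f hq] by (simp add: H2_inner_diff_left hf hs hm hq)
  then have "(H2_norm (\<lambda>z. x z - \<Theta> z * q z))\<^sup>2 = (H2_norm x)\<^sup>2 + (H2_norm (\<lambda>z. \<Theta> z * q z))\<^sup>2"
    by (simp add: H2_norm_diff_sq hx hm hq)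
  moreover have "x z - \<Theta> z * q z = f z - taylor_poly f N z" for z
    unfolding x_def q_def taylor_poly_def model_gen_def
    by (simp add: algebra_simps sum_subtractf sum_distrib_left)
  ultimately have "(H2_norm x)\<^sup>2 \<le> (H2_norm (\<lambda>z. f z - taylor_poly f N z))\<^sup>2"
    by simp
  then show ?thesis
    unfolding x_def[abs_def] by (rule power2_le_imp_le) simp
qed

section \<open>Cauchy transforms and bounded functions with radial limits\<close>

definition cauchy_transform :: "(complex \<Rightarrow> complex) \<Rightarrow> complex \<Rightarrow> complex" where
  "cauchy_transform U z = (\<integral> \<zeta>. U \<zeta> / (1 - z * cnj \<zeta>) \<partial>circle_measure)"

definition bounded_borel :: "(complex \<Rightarrow> complex) \<Rightarrow> real \<Rightarrow> bool" where
  "bounded_borel U C \<longleftrightarrow> U \<in> borel_measurable circle_borel \<and> (\<forall>\<zeta>\<in>unit_circle. cmod (U \<zeta>) \<le> C)"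

lemma bounded_borelD:
  assumes "bounded_borel U C"
  shows "U \<in> borel_measurable circle_borel" "\<And>\<zeta>. \<zeta> \<in> unit_circle \<Longrightarrow> cmod (U \<zeta>) \<le> C" "0 \<le> C"
  using assms order_trans[OF norm_ge_zero, of "U 1" C] by (auto simp: bounded_borel_def)

lemma bounded_borel_integrable: "bounded_borel U C \<Longrightarrow> integrable circle_measure U"
  using circle_integrable_bounded bounded_borelD by metis

text \<open>Geometric expansion of the kernel. The transform keeps the Fourier coefficients of
  \<open>U\<close> with nonnegative index, so it is the Riesz projection of
  \<open>U\<close>.\<close>

lemma cauchy_transform_sums:
  assumes U: "bounded_borel U C" and z: "z \<in> unit_disc"
  shows "(\<lambda>n. (\<integral> \<zeta>. cnj \<zeta> ^ n * U \<zeta> \<partial>circle_measure) * z ^ n) sums cauchy_transform U z"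
proof -
  have "(\<lambda>n. z ^ n * (\<integral> \<zeta>. cnj \<zeta> ^ n * U \<zeta> \<partial>circle_measure)) sums
      (\<integral> \<zeta>. (1 / (1 - z * cnj \<zeta>)) * U \<zeta> \<partial>circle_measure)"
  proof (rule integral_power_series_circle[OF _ _ _ _ bounded_borelD(1,2)[OF U]])
    show "summable (\<lambda>n. cmod (z ^ n))"
      using z by (simp add: norm_power summable_geometric)
    fix \<zeta> :: complex assume "\<zeta> \<in> unit_circle"
    then have "norm (z * cnj \<zeta>) < 1" using z by (simp add: norm_mult)
    from geometric_sums[OF this] show "(\<lambda>n. z ^ n * cnj \<zeta> ^ n) sums (1 / (1 - z * cnj \<zeta>))"
      by (simp add: power_mult_distrib)
  qed (auto intro!: continuous_intros simp: norm_power)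
  then show ?thesis
    by (simp add: cauchy_transform_def mult.commute)
qed

lemma cauchy_transform_holomorphic:
  "bounded_borel U C \<Longrightarrow> cauchy_transform U holomorphic_on unit_disc"
  by (rule power_series_holomorphic) (auto intro: cauchy_transform_sums)

lemma hcoeff_cauchy_transform:
  "bounded_borel U C \<Longrightarrow> hcoeff (cauchy_transform U) = (\<lambda>n. \<integral> \<zeta>. cnj \<zeta> ^ n * U \<zeta> \<partial>circle_measure)"
  by (rule hcoeff_unique) (rule cauchy_transform_sums)

lemma bounded_borel_mult: "bounded_borel U C \<Longrightarrow> bounded_borel V K \<Longrightarrow> bounded_borel (\<lambda>\<zeta>. U \<zeta> * V \<zeta>) (C * K)"
  by (auto simp: bounded_borel_def norm_mult intro!: mult_mono order_trans[OF norm_ge_zero] borel_measurable_times)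

lemma bounded_borel_cnj: "bounded_borel U C \<Longrightarrow> bounded_borel (\<lambda>\<zeta>. cnj (U \<zeta>)) C"
  by (auto simp: bounded_borel_def intro!: borel_measurable_continuous_on[OF _ _, of cnj] continuous_intros)

lemma bounded_borel_continuous:
  "continuous_on unit_circle U \<Longrightarrow> (\<And>\<zeta>. \<zeta> \<in> unit_circle \<Longrightarrow> cmod (U \<zeta>) \<le> C) \<Longrightarrow> bounded_borel U C"
  by (auto simp: bounded_borel_def intro: circle_borel_measurable_continuous)

lemma bounded_borel_diff: "bounded_borel U C \<Longrightarrow> bounded_borel V K \<Longrightarrow> bounded_borel (\<lambda>\<zeta>. U \<zeta> - V \<zeta>) (C + K)"
  by (auto simp: bounded_borel_def intro!: borel_measurable_diff order_trans[OF norm_triangle_ineq4] add_mono)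

text \<open>Bessel's inequality: the square of \<open>U\<close> minus a partial Fourier sum has
  nonnegative integral, and expanding it leaves the integral of |U|^2 minus the sum of the |a
  n|^2.\<close>

lemma cauchy_transform_bessel:
  assumes U: "bounded_borel U C"
  shows "hardy (cauchy_transform U)"
    "(H2_norm (cauchy_transform U))\<^sup>2 \<le> (\<integral> \<zeta>. (cmod (U \<zeta>))\<^sup>2 \<partial>circle_measure)"
proof -
  define a where "a = hcoeff (cauchy_transform U)"
  have a: "a n = (\<integral> \<zeta>. cnj \<zeta> ^ n * U \<zeta> \<partial>circle_measure)" for n
    by (simp add: a_def hcoeff_cauchy_transform[OF U])
  note [measurable] = bounded_borelD(1)[OF U]
  have UU: "integrable circle_measure (\<lambda>\<zeta>. U \<zeta> * cnj (U \<zeta>))"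
    by (rule bounded_borel_integrable[OF bounded_borel_mult[OF U bounded_borel_cnj[OF U]]])
  have pw: "bounded_borel (\<lambda>\<zeta>. \<zeta> ^ n) 1" "bounded_borel (\<lambda>\<zeta>. cnj \<zeta> ^ n) 1" for n
    by (auto intro!: bounded_borel_continuous continuous_intros simp: norm_power)
  have I1: "integrable circle_measure (\<lambda>\<zeta>. cnj \<zeta> ^ n * U \<zeta>)" for n
    by (rule bounded_borel_integrable[OF bounded_borel_mult[OF pw(2) U]])
  have I2: "integrable circle_measure (\<lambda>\<zeta>. \<zeta> ^ n * cnj (U \<zeta>))" for n
    by (rule bounded_borel_integrable[OF bounded_borel_mult[OF pw(1) bounded_borel_cnj[OF U]]])
  have I3: "integrable circle_measure (\<lambda>\<zeta>. \<zeta> ^ n * cnj \<zeta> ^ k)" for n k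
    by (rule bounded_borel_integrable[OF bounded_borel_mult[OF pw]])
  have bound: "(\<Sum>n<N. (cmod (a n))\<^sup>2) \<le> (\<integral> \<zeta>. (cmod (U \<zeta>))\<^sup>2 \<partial>circle_measure)" for N
  proof -
    define P where "P \<zeta> = (\<Sum>n<N. a n * \<zeta> ^ n)" for \<zeta>
    have eq: "(\<lambda>\<zeta>. (U \<zeta> - P \<zeta>) * cnj (U \<zeta> - P \<zeta>)) = (\<lambda>\<zeta>. U \<zeta> * cnj (U \<zeta>)
        - (\<Sum>n<N. cnj (a n) * (cnj \<zeta> ^ n * U \<zeta>)) - (\<Sum>n<N. a n * (\<zeta> ^ n * cnj (U \<zeta>)))
        + (\<Sum>n<N. \<Sum>k<N. a n * cnj (a k) * (\<zeta> ^ n * cnj \<zeta> ^ k)))"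
      unfolding P_def
      by (simp add: fun_eq_iff algebra_simps sum_distrib_left cnj_sum sum_product) (intro allI sum.swap)
    have cU: "(\<integral> \<zeta>. \<zeta> ^ n * cnj (U \<zeta>) \<partial>circle_measure) = cnj (a n)" for n
    proof -
      have "(\<integral> \<zeta>. cnj (cnj \<zeta> ^ n * U \<zeta>) \<partial>circle_measure) = cnj (a n)"
        unfolding a by (rule Bochner_Integration.integral_cnj)
      then show ?thesis by simp
    qed
    have s3: "(\<Sum>n<N. \<Sum>k<N. a n * cnj (a k) * (if n = k then 1 else 0)) = (\<Sum>n<N. a n * cnj (a n))"
      by (intro sum.cong refl) (simp add: if_distrib cong: if_cong)
    have "(\<integral> \<zeta>. (U \<zeta> - P \<zeta>) * cnj (U \<zeta> - P \<zeta>) \<partial>circle_measure)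
        = (\<integral> \<zeta>. U \<zeta> * cnj (U \<zeta>) \<partial>circle_measure) - (\<Sum>n<N. cnj (a n) * a n)
          - (\<Sum>n<N. a n * cnj (a n)) + (\<Sum>n<N. \<Sum>k<N. a n * cnj (a k) * (if n = k then 1 else 0))"
      unfolding eq a[symmetric] cU[symmetric] circle_integral_powers[symmetric]
      by (simp add: Bochner_Integration.integral_add Bochner_Integration.integral_diff UU I1 I2 I3
          Bochner_Integration.integral_sum a[symmetric])
    also have "\<dots> = (\<integral> \<zeta>. U \<zeta> * cnj (U \<zeta>) \<partial>circle_measure) - (\<Sum>n<N. a n * cnj (a n))"
      unfolding s3 by (simp add: mult.commute)
    finally have "(\<integral> \<zeta>. of_real ((cmod (U \<zeta> - P \<zeta>))\<^sup>2) \<partial>circle_measure)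
        = (\<integral> \<zeta>. of_real ((cmod (U \<zeta>))\<^sup>2) \<partial>circle_measure) - (\<Sum>n<N. complex_of_real ((cmod (a n))\<^sup>2))"
      unfolding complex_norm_square .
    then have "(\<integral> \<zeta>. (cmod (U \<zeta> - P \<zeta>))\<^sup>2 \<partial>circle_measure)
        = (\<integral> \<zeta>. (cmod (U \<zeta>))\<^sup>2 \<partial>circle_measure) - (\<Sum>n<N. (cmod (a n))\<^sup>2)"
      unfolding integral_complex_of_real of_real_sum[symmetric] of_real_diff[symmetric] of_real_eq_iff .
    moreover have "0 \<le> (\<integral> \<zeta>. (cmod (U \<zeta> - P \<zeta>))\<^sup>2 \<partial>circle_measure)"
      by (rule Bochner_Integration.integral_nonneg) simp
    ultimately show ?thesis by simp
  qed
  have s: "summable (\<lambda>n. (cmod (a n))\<^sup>2)"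
    by (rule summableI_nonneg_bounded[OF _ bound]) simp
  then show h: "hardy (cauchy_transform U)"
    by (simp add: hardy_def cauchy_transform_holomorphic[OF U] a_def)
  show "(H2_norm (cauchy_transform U))\<^sup>2 \<le> (\<integral> \<zeta>. (cmod (U \<zeta>))\<^sup>2 \<partial>circle_measure)"
    unfolding H2_norm_power2[OF h] a_def[symmetric]
    by (rule suminf_le_const[OF s bound])
qed

text \<open>The boundary function is part of the data, Borel and bounded by the same constant at
  every point of the circle; only the radial convergence is almost everywhere.\<close>

definition radial_boundary :: "(complex \<Rightarrow> complex) \<Rightarrow> (complex \<Rightarrow> complex) \<Rightarrow> real \<Rightarrow> bool" where
  "radial_boundary f F C \<longleftrightarrow> f holomorphic_on unit_disc \<and> (\<forall>z\<in>unit_disc. cmod (f z) \<le> C) \<and>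
     bounded_borel F C \<and>
     (AE \<zeta> in circle_measure. ((\<lambda>r. f (of_real r * \<zeta>)) \<longlongrightarrow> F \<zeta>) (at_left (1::real)))"

lemma radial_boundaryD:
  assumes "radial_boundary f F C"
  shows "f holomorphic_on unit_disc" "\<And>z. z \<in> unit_disc \<Longrightarrow> cmod (f z) \<le> C" "bounded_borel F C"
    "AE \<zeta> in circle_measure. ((\<lambda>r. f (of_real r * \<zeta>)) \<longlongrightarrow> F \<zeta>) (at_left (1::real))"
    "hardy f"
  using assms hardy_bounded(1)[of f C] by (auto simp: radial_boundary_def)

lemma radial_boundary_mult:
  assumes "radial_boundary f F C" "radial_boundary g G K"
  shows "radial_boundary (\<lambda>z. f z * g z) (\<lambda>z. F z * G z) (C * K)"
  unfolding radial_boundary_def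
proof (intro conjI ballI)
  show "AE \<zeta> in circle_measure. ((\<lambda>r. f (of_real r * \<zeta>) * g (of_real r * \<zeta>)) \<longlongrightarrow> F \<zeta> * G \<zeta>) (at_left (1::real))"
    using radial_boundaryD(4)[OF assms(1)] radial_boundaryD(4)[OF assms(2)]
    by eventually_elim (rule tendsto_mult)
  show "cmod (f z * g z) \<le> C * K" if "z \<in> unit_disc" for z
    unfolding norm_mult using that radial_boundaryD(2)[OF assms(1) that] radial_boundaryD(2)[OF assms(2) that]
    by (intro mult_mono) (auto intro: order_trans[OF norm_ge_zero])
qed (use radial_boundaryD[OF assms(1)] radial_boundaryD[OF assms(2)] in \<open>auto intro!: holomorphic_intros bounded_borel_mult\<close>)

lemma radial_boundary_cball:
  assumes "p holomorphic_on unit_disc" "continuous_on (cball 0 1) p" "\<And>z. z \<in> cball 0 1 \<Longrightarrow> cmod (p z) \<le> C"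
  shows "radial_boundary p p C"
  unfolding radial_boundary_def
  using assms by (auto intro!: bounded_borel_continuous AE_I2 radial_limit_cball intro: continuous_on_subset)

lemma radial_boundary_cong:
  assumes "radial_boundary f F C" "\<And>z. z \<in> unit_disc \<Longrightarrow> f z = g z"
  shows "radial_boundary g F C"
  unfolding radial_boundary_def
proof (intro conjI ballI)
  note f = radial_boundaryD[OF assms(1)]
  show "g holomorphic_on unit_disc" using holomorphic_transform[OF f(1) assms(2)] .
  show "cmod (g z) \<le> C" if "z \<in> unit_disc" for z using f(2)[OF that] assms(2)[OF that] by simp
  show "bounded_borel F C" by (rule f)
  show "AE \<zeta> in circle_measure. ((\<lambda>r. g (of_real r * \<zeta>)) \<longlongrightarrow> F \<zeta>) (at_left (1::real))"
    using f(4) AE_space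
  proof eventually_elim
    case (elim \<zeta>)
    have "\<forall>\<^sub>F r in at_left (1::real). g (of_real r * \<zeta>) = f (of_real r * \<zeta>)"
      by (rule eventually_mono[OF eventually_at_left_real[OF zero_less_one]])
         (use elim(2) assms(2) in \<open>auto simp: norm_mult\<close>)
    then show ?case using elim(1) tendsto_cong by force
  qed
qed

lemma radial_boundary_diff:
  assumes "radial_boundary f F C" "radial_boundary g G K"
  shows "radial_boundary (\<lambda>z. f z - g z) (\<lambda>z. F z - G z) (C + K)"
  unfolding radial_boundary_def
proof (intro conjI ballI)
  show "AE \<zeta> in circle_measure. ((\<lambda>r. f (of_real r * \<zeta>) - g (of_real r * \<zeta>)) \<longlongrightarrow> F \<zeta> - G \<zeta>) (at_left (1::real))"
    using radial_boundaryD(4)[OF assms(1)] radial_boundaryD(4)[OF assms(2)]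
    by eventually_elim (rule tendsto_diff)
  show "cmod (f z - g z) \<le> C + K" if "z \<in> unit_disc" for z
    using radial_boundaryD(2)[OF assms(1) that] radial_boundaryD(2)[OF assms(2) that]
    by (intro order_trans[OF norm_triangle_ineq4] add_mono)
qed (use radial_boundaryD[OF assms(1)] radial_boundaryD[OF assms(2)] in \<open>auto intro!: holomorphic_intros bounded_borel_diff\<close>)

text \<open>Dominated convergence along the dilates. Consequently a bounded function is the Cauchy
  transform of its boundary function.\<close>

lemma hcoeff_radial_boundary:
  assumes "radial_boundary f F C"
  shows "hcoeff f k = (\<integral> \<zeta>. F \<zeta> * cnj \<zeta> ^ k \<partial>circle_measure)"
proof -
  note D = radial_boundaryD[OF assms]
  have "(\<lambda>n. \<integral> \<zeta>. f (of_real (rseq n) * \<zeta>) * cnj \<zeta> ^ k \<partial>circle_measure)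
      \<longlonglongrightarrow> (\<integral> \<zeta>. F \<zeta> * cnj \<zeta> ^ k \<partial>circle_measure)"
    by (rule circle_radial_DCT[OF holomorphic_on_imp_continuous_on[OF D(1)] D(2) bounded_borelD(1)[OF D(3)] D(4), where K = 1])
       (use rseq rseq_at_left in \<open>auto intro!: circle_borel_measurable_continuous continuous_intros simp: norm_power\<close>)
  moreover have "(\<integral> \<zeta>. f (of_real (rseq n) * \<zeta>) * cnj \<zeta> ^ k \<partial>circle_measure) = hcoeff f k * of_real (rseq n) ^ k" for n
    by (rule power_series_coeff_integral[OF hcoeff_sums[OF D(1)] rseq(1,2)])
  moreover have "(\<lambda>n. hcoeff f k * of_real (rseq n) ^ k) \<longlonglongrightarrow> hcoeff f k * of_real 1 ^ k"
    by (intro tendsto_intros rseq)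
  ultimately show ?thesis
    using LIMSEQ_unique by fastforce
qed

lemma radial_boundary_cauchy:
  assumes "radial_boundary f F C" "z \<in> unit_disc"
  shows "f z = cauchy_transform F z"
proof -
  note D = radial_boundaryD[OF assms(1)]
  have "(\<lambda>n. hcoeff f n * z ^ n) sums cauchy_transform F z"
    using cauchy_transform_sums[OF D(3) assms(2)]
    by (simp add: hcoeff_radial_boundary[OF assms(1)] mult.commute)
  then show ?thesis
    using hcoeff_sums[OF D(1) assms(2)] sums_unique2 by blast
qed

text \<open>By Parseval, dilating both factors by \<open>r\<close> has the same effect as dilating
  \<open>h\<close> alone by \<open>r\<^sup>2\<close>. The function \<open>U\<close> stays fixed on
  the circle, and the radial limits of \<open>h\<close> give the result.\<close>

lemma H2_inner_cauchy_transform: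
  assumes U: "bounded_borel U K" and h: "radial_boundary h H C"
  shows "H2_inner (cauchy_transform U) h = (\<integral> \<zeta>. cnj (H \<zeta>) * U \<zeta> \<partial>circle_measure)"
proof -
  note D = radial_boundaryD[OF h]
  note B = cauchy_transform_bessel[OF U]
  have lim: "filterlim (\<lambda>n. (rseq n)\<^sup>2) (at_left 1) sequentially"
  proof -
    have "(\<lambda>n. (rseq n)\<^sup>2) \<longlonglongrightarrow> 1\<^sup>2" by (intro tendsto_intros rseq)
    moreover have "(rseq n)\<^sup>2 < 1" for n using rseq(1,2,4)[of n] by (simp add: abs_square_less_1)
    ultimately show ?thesis
      unfolding filterlim_at by (auto simp: less_imp_neq intro!: always_eventually)
  qed
  have "(\<lambda>n. \<integral> \<zeta>. (\<lambda>z. cnj (h z)) (of_real ((rseq n)\<^sup>2) * \<zeta>) * U \<zeta> \<partial>circle_measure)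
      \<longlonglongrightarrow> (\<integral> \<zeta>. cnj (H \<zeta>) * U \<zeta> \<partial>circle_measure)"
  proof (rule circle_radial_DCT[OF _ _ _ _ bounded_borelD(1,2)[OF U] lim, where C = C])
    show "continuous_on unit_disc (\<lambda>z. cnj (h z))"
      by (intro continuous_intros holomorphic_on_imp_continuous_on D)
    show "(\<lambda>\<zeta>. cnj (H \<zeta>)) \<in> borel_measurable circle_borel"
      by (rule bounded_borelD[OF bounded_borel_cnj[OF D(3)]])
    show "AE \<zeta> in circle_measure. ((\<lambda>r. cnj (h (of_real r * \<zeta>))) \<longlongrightarrow> cnj (H \<zeta>)) (at_left (1::real))"
      using D(4) by eventually_elim (rule tendsto_cnj)
    show "(rseq n)\<^sup>2 < 1" for n using rseq(1,2,4)[of n] by (simp add: abs_square_less_1)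
  qed (use D in auto)
  moreover have "(\<integral> \<zeta>. (\<lambda>z. cnj (h z)) (of_real ((rseq n)\<^sup>2) * \<zeta>) * U \<zeta> \<partial>circle_measure)
     = (\<integral> \<zeta>. cauchy_transform U (of_real (rseq n) * \<zeta>) * cnj (h (of_real (rseq n) * \<zeta>)) \<partial>circle_measure)" for n
  proof -
    have r2: "0 \<le> (rseq n)\<^sup>2" "(rseq n)\<^sup>2 < 1" using rseq(1,2,4)[of n] by (simp_all add: abs_square_less_1)
    have "(\<lambda>k. cnj (hcoeff h k) * of_real ((rseq n)\<^sup>2) ^ k * (\<integral> \<zeta>. cnj \<zeta> ^ k * U \<zeta> \<partial>circle_measure)) sums
      (\<integral> \<zeta>. cnj (h (of_real ((rseq n)\<^sup>2) * \<zeta>)) * U \<zeta> \<partial>circle_measure)"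
      by (rule integral_power_series_cnj_disc[OF hcoeff_sums[OF D(1)] r2 bounded_borelD(1,2)[OF U]])
    moreover have "(\<lambda>k. (\<integral> \<zeta>. cnj \<zeta> ^ k * U \<zeta> \<partial>circle_measure) * cnj (hcoeff h k) * of_real ((rseq n)\<^sup>2) ^ k) sums
      (\<integral> \<zeta>. cauchy_transform U (of_real (rseq n) * \<zeta>) * cnj (h (of_real (rseq n) * \<zeta>)) \<partial>circle_measure)"
      using parseval_circle[OF cauchy_transform_holomorphic[OF U] D(1) rseq(1,2)]
      unfolding hcoeff_cauchy_transform[OF U] .
    ultimately show ?thesis
      by (simp add: mult_ac sums_unique2)
  qed
  ultimately show ?thesis
    using H2_inner_sequence[OF B(1) D(5) rseq(2,3)] LIMSEQ_unique by simp
qed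

lemma H2_norm_radial_boundary:
  assumes "radial_boundary f F C"
  shows "of_real ((H2_norm f)\<^sup>2) = (\<integral> \<zeta>. cnj (F \<zeta>) * F \<zeta> \<partial>circle_measure)"
proof -
  note D = radial_boundaryD[OF assms]
  have "H2_inner f f = H2_inner (cauchy_transform F) f"
    by (rule H2_inner_cong) (simp_all add: radial_boundary_cauchy[OF assms])
  then show ?thesis
    by (simp add: H2_inner_self[OF D(5)] H2_inner_cauchy_transform[OF D(3) assms])
qed

text \<open>Boundary values of modulus one make multiplication by \<Theta> preserve the norms of
  polynomials; density of polynomials and contractivity extend this to all of the Hardy
  space.\<close>

lemma inner_function_isometric:
  assumes inner: "inner_function \<Theta>" and c: "contractive \<Theta>"
  shows "isometric \<Theta>"
proof -
  note hm = contractive_hardy_mult[OF c]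
  define L where "L \<zeta> = lim (\<lambda>n. \<Theta> (of_real (rseq n) * \<zeta>))" for \<zeta>
  \<comment> \<open>Where the sequence of dilates has no limit, \<open>L\<close> has an unspecified
    value; cutting it off makes the boundary function bounded everywhere.\<close>
  define T where "T \<zeta> = (if cmod (L \<zeta>) \<le> 1 then L \<zeta> else 0)" for \<zeta>
  have [measurable]: "L \<in> borel_measurable circle_borel"
    unfolding L_def[abs_def] using measurable_on_circle[OF contractiveD(1)[OF c] rseq(1,2)]
    by (intro borel_measurable_lim_metric) (simp add: circle_measurable_cong)
  have T: "bounded_borel T 1" unfolding bounded_borel_def T_def[abs_def] by auto
  have lim: "AE \<zeta> in circle_measure. cmod (T \<zeta>) = 1 \<and> ((\<lambda>r. \<Theta> (of_real r * \<zeta>)) \<longlongrightarrow> T \<zeta>) (at_left (1::real))"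
    using inner[unfolded inner_function_def, THEN conjunct2, THEN conjunct2]
  proof eventually_elim
    case (elim \<zeta>)
    then obtain l where l: "cmod l = 1" "((\<lambda>r. \<Theta> (of_real r * \<zeta>)) \<longlongrightarrow> l) (at_left (1::real))" by blast
    have "L \<zeta> = l" unfolding L_def by (rule limI[OF filterlim_compose[OF l(2) rseq_at_left]])
    then show ?case using l by (simp add: T_def)
  qed
  then have rT: "radial_boundary \<Theta> T 1"
    unfolding radial_boundary_def using T contractiveD[OF c] by auto
  have poly: "H2_norm (\<lambda>z. \<Theta> z * taylor_poly h N z) = H2_norm (taylor_poly h N)" for h N
  proof -
    let ?p = "taylor_poly h N"
    have cont: "continuous_on (cball 0 1) ?p"
      unfolding taylor_poly_def[abs_def] by (intro continuous_intros)
    obtain M where M: "\<And>z. z \<in> cball 0 1 \<Longrightarrow> cmod (?p z) \<le> M"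
      using compact_norm_bound[OF compact_cball cont] by blast
    have p: "radial_boundary ?p ?p M"
      by (rule radial_boundary_cball[OF hardy_holomorphic[OF hardy_taylor_poly] cont M])
    note r = radial_boundary_mult[OF rT p]
    have "(\<integral> \<zeta>. cnj (T \<zeta> * ?p \<zeta>) * (T \<zeta> * ?p \<zeta>) \<partial>circle_measure) = (\<integral> \<zeta>. cnj (?p \<zeta>) * ?p \<zeta> \<partial>circle_measure)"
    proof (rule integral_cong_AE)
      show "AE \<zeta> in circle_measure. cnj (T \<zeta> * ?p \<zeta>) * (T \<zeta> * ?p \<zeta>) = cnj (?p \<zeta>) * ?p \<zeta>"
        using lim
      proof eventually_elim
        case (elim \<zeta>)
        have "cnj (T \<zeta> * ?p \<zeta>) * (T \<zeta> * ?p \<zeta>) = (T \<zeta> * cnj (T \<zeta>)) * (cnj (?p \<zeta>) * ?p \<zeta>)" by simp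
        also have "T \<zeta> * cnj (T \<zeta>) = 1" using elim by (simp add: complex_norm_square[symmetric])
        finally show ?case by simp
      qed
    qed (unfold circle_measurable_cong,
        rule bounded_borelD(1)[OF bounded_borel_mult[OF bounded_borel_cnj]], rule radial_boundaryD(3)[OF r],
        rule radial_boundaryD(3)[OF r], rule bounded_borelD(1)[OF bounded_borel_mult[OF bounded_borel_cnj]],
        (rule radial_boundaryD(3)[OF p])+)
    then have "(H2_norm (\<lambda>z. \<Theta> z * ?p z))\<^sup>2 = (H2_norm ?p)\<^sup>2"
      unfolding H2_norm_radial_boundary[OF r, symmetric] H2_norm_radial_boundary[OF p, symmetric] of_real_eq_iff .
    then show ?thesis
      by (simp add: power2_eq_iff_nonneg)
  qed
  show ?thesis
    unfolding isometric_def
  proof (intro conjI c allI impI antisym)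
    fix h assume h: "hardy h"
    show "H2_norm (\<lambda>z. \<Theta> z * h z) \<le> H2_norm h" by (rule hm[OF h])
    have "H2_norm h \<le> H2_norm (\<lambda>z. \<Theta> z * h z) + 2 * H2_norm (\<lambda>z. h z - taylor_poly h N z)" for N
    proof -
      let ?p = "taylor_poly h N" and ?d = "\<lambda>z. h z - taylor_poly h N z"
      have hd: "hardy ?d" by (intro hardy_diff h hardy_taylor_poly)
      have "H2_norm h = H2_norm (\<lambda>z. ?p z + ?d z)" by simp
      also have "\<dots> \<le> H2_norm ?p + H2_norm ?d"
        by (intro H2_norm_triangle hardy_taylor_poly hd)
      also have "H2_norm ?p = H2_norm (\<lambda>z. \<Theta> z * h z + (-1) * (\<Theta> z * ?d z))"
        by (simp add: poly[symmetric] algebra_simps)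
      also have "\<dots> \<le> H2_norm (\<lambda>z. \<Theta> z * h z) + H2_norm (\<lambda>z. (-1) * (\<Theta> z * ?d z))"
        by (intro H2_norm_triangle hardy_cmult hm h hd)
      also have "H2_norm (\<lambda>z. (-1) * (\<Theta> z * ?d z)) \<le> H2_norm ?d"
        unfolding H2_norm_cmult[OF hm(1)[OF hd]] using hm(2)[OF hd] by simp
      finally show ?thesis by simp
    qed
    moreover have "(\<lambda>N. H2_norm (\<lambda>z. \<Theta> z * h z) + 2 * H2_norm (\<lambda>z. h z - taylor_poly h N z))
        \<longlonglongrightarrow> H2_norm (\<lambda>z. \<Theta> z * h z) + 2 * 0"
      by (intro tendsto_intros taylor_poly_tendsto h)
    ultimately have "H2_norm h \<le> H2_norm (\<lambda>z. \<Theta> z * h z) + 2 * 0"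
      by (intro LIMSEQ_le_const) auto
    then show "H2_norm h \<le> H2_norm (\<lambda>z. \<Theta> z * h z)" by simp
  qed
qed

text \<open>Model spaces are invariant under Toeplitz operators with co-analytic symbols.\<close>

lemma toeplitz_model_space:
  assumes T: "radial_boundary \<Theta> T 1" and F: "radial_boundary F F' 1" and e: "radial_boundary e e' C"
    and orth: "\<And>g. hardy g \<Longrightarrow> H2_inner e (\<lambda>z. \<Theta> z * g z) = 0"
  shows "disc_cut (cauchy_transform (\<lambda>\<zeta>. cnj (F' \<zeta>) * e' \<zeta>)) \<in> model_space \<Theta>"
proof -
  note U = bounded_borel_mult[OF bounded_borel_cnj[OF radial_boundaryD(3)[OF F]] radial_boundaryD(3)[OF e]]
  let ?g = "cauchy_transform (\<lambda>\<zeta>. cnj (F' \<zeta>) * e' \<zeta>)"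
  have c: "contractive \<Theta>" using radial_boundaryD[OF T] by (auto simp: contractive_def)
  have pk: "radial_boundary (\<lambda>z. z ^ k) (\<lambda>z. z ^ k) 1" for k
    by (rule radial_boundary_cball) (auto intro!: holomorphic_intros continuous_intros simp: norm_power power_le_one)
  have "H2_inner ?g (\<lambda>z. \<Theta> z * z ^ k) = 0" for k
  proof -
    have "H2_inner ?g (\<lambda>z. \<Theta> z * z ^ k) = (\<integral> \<zeta>. cnj (T \<zeta> * \<zeta> ^ k) * (cnj (F' \<zeta>) * e' \<zeta>) \<partial>circle_measure)"
      by (rule H2_inner_cauchy_transform[OF U radial_boundary_mult[OF T pk]])
    \<comment> \<open>The co-analytic symbol moves to the other side of the pairing as the analytic
      factor \<open>F\<close>, and a multiple of \<Theta> remains a multiple of \<Theta>.\<close>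
    also have "\<dots> = (\<integral> \<zeta>. cnj (F' \<zeta> * (T \<zeta> * \<zeta> ^ k)) * e' \<zeta> \<partial>circle_measure)"
      by (simp add: mult_ac)
    also have "\<dots> = H2_inner (cauchy_transform e') (\<lambda>z. F z * (\<Theta> z * z ^ k))"
      by (rule H2_inner_cauchy_transform[symmetric, OF radial_boundaryD(3)[OF e]
            radial_boundary_mult[OF F radial_boundary_mult[OF T pk]]])
    also have "\<dots> = H2_inner e (\<lambda>z. \<Theta> z * (F z * z ^ k))"
      by (rule H2_inner_cong) (auto simp: radial_boundary_cauchy[OF e] mult_ac)
    also have "\<dots> = 0"
      by (intro orth radial_boundaryD(5)[OF radial_boundary_mult[OF F pk]])
    finally show ?thesis .
  qed
  moreover have "H2_inner (disc_cut ?g) (\<lambda>z. \<Theta> z * z ^ k) = H2_inner ?g (\<lambda>z. \<Theta> z * z ^ k)" for k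
    by (rule H2_inner_cong) auto
  ultimately show ?thesis
    unfolding model_space_iff[OF c]
    using disc_cut_H2_space[OF cauchy_transform_bessel(1)[OF U]] by simp
qed

lemma cauchy_transform_const: "z \<in> unit_disc \<Longrightarrow> (\<integral> \<zeta>. c / (1 - z * cnj \<zeta>) \<partial>circle_measure) = c"
proof -
  assume z: "z \<in> unit_disc"
  have "radial_boundary (\<lambda>_. c) (\<lambda>_. c) (cmod c)"
    by (rule radial_boundary_cball) auto
  from radial_boundary_cauchy[OF this z] show ?thesis
    by (simp add: cauchy_transform_def)
qed

lemma norm_one_minus_cnj: "\<zeta> \<in> unit_circle \<Longrightarrow> cmod (1 - z * cnj \<zeta>) = cmod (\<zeta> - z)"
proof -
  assume z: "\<zeta> \<in> unit_circle"
  then have "\<zeta> * cnj \<zeta> = 1" by (simp add: complex_norm_square[symmetric])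
  then have "1 - z * cnj \<zeta> = (\<zeta> - z) * cnj \<zeta>" by (simp add: algebra_simps)
  then show ?thesis using z by (simp add: norm_mult)
qed

lemma cauchy_kernel_integrable:
  assumes U: "bounded_borel U C" and z: "z \<in> unit_disc"
  shows "integrable circle_measure (\<lambda>\<zeta>. U \<zeta> / (1 - z * cnj \<zeta>))"
proof -
  have far: "1 - cmod z \<le> cmod (1 - z * cnj \<zeta>)" if "\<zeta> \<in> unit_circle" for \<zeta>
    using norm_triangle_ineq2[of \<zeta> z] that by (simp add: norm_one_minus_cnj)
  have "continuous_on unit_circle (\<lambda>\<zeta>. 1 / (1 - z * cnj \<zeta>))"
    by (intro continuous_intros ballI) (use far z in force)
  moreover have "cmod (1 / (1 - z * cnj \<zeta>)) \<le> 1 / (1 - cmod z)" if "\<zeta> \<in> unit_circle" for \<zeta>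
    unfolding norm_divide using far[OF that] z by (intro frac_le) auto
  ultimately have b: "bounded_borel (\<lambda>\<zeta>. 1 / (1 - z * cnj \<zeta>)) (1 / (1 - cmod z))"
    by (rule bounded_borel_continuous)
  show ?thesis using bounded_borel_integrable[OF bounded_borel_mult[OF U b]] by simp
qed

text \<open>Bessel's inequality bounds the square of the norm by the integral of |e'|^2 |1 - F'|^2.
  As |F'| \<le> 1, the second factor is at most 2 - 2 Re F', whose mean is given by the value of
  \<open>F\<close> at 0.\<close>

lemma toeplitz_close:
  assumes F: "radial_boundary F F' 1" and e: "radial_boundary e e' C"
  shows "H2_norm (\<lambda>z. e z - cauchy_transform (\<lambda>\<zeta>. cnj (F' \<zeta>) * e' \<zeta>) z) \<le> C * sqrt (2 - 2 * Re (F 0))"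
proof -
  note DF = radial_boundaryD[OF F] and De = radial_boundaryD[OF e]
  note U = bounded_borel_mult[OF bounded_borel_cnj[OF DF(3)] De(3)]
  note V = bounded_borel_diff[OF De(3) U]
  have C: "0 \<le> C" by (rule bounded_borelD(3)[OF De(3)])
  have "H2_norm (\<lambda>z. e z - cauchy_transform (\<lambda>\<zeta>. cnj (F' \<zeta>) * e' \<zeta>) z)
      = H2_norm (cauchy_transform (\<lambda>\<zeta>. e' \<zeta> - cnj (F' \<zeta>) * e' \<zeta>))"
  proof (rule H2_norm_cong)
    fix z :: complex assume z: "z \<in> unit_disc"
    show "e z - cauchy_transform (\<lambda>\<zeta>. cnj (F' \<zeta>) * e' \<zeta>) z = cauchy_transform (\<lambda>\<zeta>. e' \<zeta> - cnj (F' \<zeta>) * e' \<zeta>) z"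
      unfolding radial_boundary_cauchy[OF e z]
      using cauchy_kernel_integrable[OF De(3) z] cauchy_kernel_integrable[OF U z]
      by (simp add: cauchy_transform_def diff_divide_distrib)
  qed
  also have "\<dots> \<le> C * sqrt (2 - 2 * Re (F 0))"
  proof -
    have iF: "integrable circle_measure F'" by (rule bounded_borel_integrable[OF DF(3)])
    have F0: "F 0 = (\<integral> \<zeta>. F' \<zeta> \<partial>circle_measure)"
      using hcoeff_radial_boundary[OF F, of 0] by simp
    have "(H2_norm (cauchy_transform (\<lambda>\<zeta>. e' \<zeta> - cnj (F' \<zeta>) * e' \<zeta>)))\<^sup>2
        \<le> (\<integral> \<zeta>. (cmod (e' \<zeta> - cnj (F' \<zeta>) * e' \<zeta>))\<^sup>2 \<partial>circle_measure)"
      by (rule cauchy_transform_bessel(2)[OF V])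
    also have "\<dots> \<le> (\<integral> \<zeta>. C\<^sup>2 * (2 - 2 * Re (F' \<zeta>)) \<partial>circle_measure)"
    proof (rule integral_mono)
      show "integrable circle_measure (\<lambda>\<zeta>. (cmod (e' \<zeta> - cnj (F' \<zeta>) * e' \<zeta>))\<^sup>2)"
      proof (rule circle_integrable_bounded)
        show "(\<lambda>\<zeta>. (cmod (e' \<zeta> - cnj (F' \<zeta>) * e' \<zeta>))\<^sup>2) \<in> borel_measurable circle_borel"
          using bounded_borelD(1)[OF V] by measurable
        show "norm ((cmod (e' \<zeta> - cnj (F' \<zeta>) * e' \<zeta>))\<^sup>2) \<le> (C + 1 * C)\<^sup>2" if "\<zeta> \<in> unit_circle" for \<zeta>
          using power_mono[OF bounded_borelD(2)[OF V that], of 2] by simp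
      qed
      show "integrable circle_measure (\<lambda>\<zeta>. C\<^sup>2 * (2 - 2 * Re (F' \<zeta>)))"
        using iF by auto
      fix \<zeta> assume z: "\<zeta> \<in> space circle_measure"
      then have z: "\<zeta> \<in> unit_circle" by simp
      have "e' \<zeta> - cnj (F' \<zeta>) * e' \<zeta> = e' \<zeta> * cnj (1 - F' \<zeta>)"
        by (simp add: algebra_simps)
      then have "(cmod (e' \<zeta> - cnj (F' \<zeta>) * e' \<zeta>))\<^sup>2 = (cmod (e' \<zeta>))\<^sup>2 * (cmod (1 - F' \<zeta>))\<^sup>2"
        by (simp only: norm_mult complex_mod_cnj power_mult_distrib)
      also have "\<dots> \<le> C\<^sup>2 * (2 - 2 * Re (F' \<zeta>))"
      proof (rule mult_mono)
        show "(cmod (e' \<zeta>))\<^sup>2 \<le> C\<^sup>2"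
          using bounded_borelD(2)[OF De(3) z] by (intro power_mono) auto
        have "(cmod (F' \<zeta>))\<^sup>2 \<le> 1"
          using bounded_borelD(2)[OF DF(3) z] by (simp add: power_le_one)
        then show "(cmod (1 - F' \<zeta>))\<^sup>2 \<le> 2 - 2 * Re (F' \<zeta>)"
          unfolding cmod_power2 by (simp add: power2_eq_square algebra_simps)
      qed auto
      finally show "(cmod (e' \<zeta> - cnj (F' \<zeta>) * e' \<zeta>))\<^sup>2 \<le> C\<^sup>2 * (2 - 2 * Re (F' \<zeta>))" .
    qed
    also have "\<dots> = C\<^sup>2 * (2 - 2 * Re (F 0))"
      using iF F0 by simp
    finally have "(H2_norm (cauchy_transform (\<lambda>\<zeta>. e' \<zeta> - cnj (F' \<zeta>) * e' \<zeta>)))\<^sup>2 \<le> C\<^sup>2 * (2 - 2 * Re (F 0))" .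
    then have "H2_norm (cauchy_transform (\<lambda>\<zeta>. e' \<zeta> - cnj (F' \<zeta>) * e' \<zeta>)) \<le> sqrt (C\<^sup>2 * (2 - 2 * Re (F 0)))"
      by (rule real_le_rsqrt)
    then show ?thesis
      using C by (simp add: real_sqrt_mult)
  qed
  finally show ?thesis .
qed

section \<open>Moduli of continuity\<close>

locale modulus =
  fixes w :: "real \<Rightarrow> real"
  assumes modulus: "modulus_of_continuity w"
begin

abbreviation W :: "real \<Rightarrow> real" where "W \<equiv> modulus_ext w"

lemma W_eq: "t \<le> 1 \<Longrightarrow> W t = w t"
  by (simp add: modulus_ext_def)

lemma W_0 [simp]: "W 0 = 0"
  using modulus by (simp add: modulus_ext_def modulus_of_continuity_def)

lemma W_mono: "0 \<le> s \<Longrightarrow> s \<le> t \<Longrightarrow> W s \<le> W t"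
  using modulus unfolding modulus_ext_def modulus_of_continuity_def
  by (intro mono_onD[where f = w]) auto

lemma W_nonneg: "0 \<le> t \<Longrightarrow> 0 \<le> W t"
  using W_mono[of 0 t] by simp

lemma W_le: "0 \<le> t \<Longrightarrow> W t \<le> w 1"
  using modulus unfolding modulus_ext_def modulus_of_continuity_def
  by (intro mono_onD[where f = w]) auto

lemma W_add: assumes "0 \<le> s" "0 \<le> t" shows "W (s + t) \<le> W s + W t"
proof -
  have sub: "w (a + b) \<le> w a + w b" if "0 \<le> a" "0 \<le> b" "a + b \<le> 1" for a b
    using modulus that unfolding modulus_of_continuity_def by auto
  consider "s + t \<le> 1" | "1 \<le> s" | "1 \<le> t" | "s < 1" "t < 1" "1 < s + t" by linarith
  then show ?thesis
  proof cases
    case 1 then show ?thesis using sub[of s t] assms by (simp add: W_eq)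
  next
    case 2
    then have "W (s + t) = W s" using assms by (simp add: modulus_ext_def)
    then show ?thesis using W_nonneg[of t] assms by simp
  next
    case 3
    then have "W (s + t) = W t" using assms by (simp add: modulus_ext_def)
    then show ?thesis using W_nonneg[of s] assms by simp
  next
    case 4
    have "W (s + t) = w (s + (1 - s))" using 4 by (simp add: modulus_ext_def)
    also have "\<dots> \<le> w s + w (1 - s)" using 4 assms by (intro sub) auto
    also have "\<dots> \<le> W s + W t"
      using W_mono[of "1 - s" t] 4 assms by (simp add: W_eq)
    finally show ?thesis .
  qed
qed

lemma W_mult_nat: "0 \<le> t \<Longrightarrow> W (real n * t) \<le> real n * W t"
proof (induction n)
  case (Suc n)
  then show ?case
    using W_add[of "real n * t" t] by (simp add: algebra_simps)
qed simp

text \<open>The substitute for concavity: cover \<open>d\<close> by the smallest number of steps of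
  length \<open>t\<close>, and use subadditivity and monotonicity.\<close>

lemma W_scale: assumes "0 < t" "0 \<le> d" shows "W d \<le> (1 + d / t) * W t"
proof -
  define n where "n = nat \<lceil>d / t\<rceil>"
  have n: "d / t \<le> real n" "real n \<le> 1 + d / t"
    using assms by (auto simp: n_def) linarith+
  have "W d \<le> W (real n * t)"
    using n assms by (intro W_mono) (auto simp: field_simps)
  also have "\<dots> \<le> real n * W t" using assms by (intro W_mult_nat) auto
  also have "\<dots> \<le> (1 + d / t) * W t"
    using n W_nonneg[of t] assms by (intro mult_right_mono) auto
  finally show ?thesis .
qed

text \<open>A zero at a positive point would spread to the whole interval by \<open>W_scale\<close>,
  but a modulus is not identically zero.\<close>

lemma W_pos: assumes "0 < t" shows "0 < W t"
proof (rule ccontr)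
  assume "\<not> 0 < W t"
  then have "W t = 0" using W_nonneg[of t] assms by simp
  then have le: "W d \<le> 0" if "0 \<le> d" for d
    using W_scale[OF assms that] by simp
  have "W d = 0" if "0 \<le> d" for d
    using le[OF that] W_nonneg[OF that] by (rule antisym)
  then have "w d = 0" if "d \<in> {0..1}" for d
    using that W_eq[of d] by simp
  then show False
    using modulus by (auto simp: modulus_of_continuity_def)
qed

lemma w_1_pos: "0 < w 1"
  using W_pos[of 1] by (simp add: W_eq)

lemma W_le_twice: assumes "0 \<le> s" "s \<le> t" "t \<le> real n * s" shows "W t \<le> real n * W s"
  using W_mult_nat[OF assms(1), of n] W_mono[of t "real n * s"] assms by linarith

lemma W_double:
  assumes "0 < s" "0 \<le> t" "t \<le> 2 * s"
  shows "W t \<le> 2 * W s"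
proof -
  have "W t \<le> W (s + s)" using assms by (intro W_mono) auto
  also have "\<dots> \<le> W s + W s" using assms by (intro W_add) auto
  finally show ?thesis by simp
qed

lemma W_continuous: "continuous_on {0..} W"
proof -
  have "continuous_on {0..1} w" using modulus by (simp add: modulus_of_continuity_def)
  then show ?thesis
    unfolding modulus_ext_def[abs_def]
    by (rule continuous_on_compose2) (auto intro!: continuous_intros)
qed

lemma W_continuous_comp:
  "continuous_on A g \<Longrightarrow> (\<And>x. x \<in> A \<Longrightarrow> 0 \<le> g x) \<Longrightarrow> continuous_on A (\<lambda>x. W (g x))"
  by (rule continuous_on_compose2[OF W_continuous]) auto

lemma W_ratio: assumes "0 < d" "d \<le> t" shows "W t / t \<le> 2 * (W d / d)"
proof -
  have "W t \<le> (1 + t / d) * W d" using assms by (intro W_scale) auto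
  also have "\<dots> \<le> (2 * t / d) * W d"
    using assms W_nonneg[of d] by (intro mult_right_mono) (auto simp: field_simps)
  finally show ?thesis using assms by (simp add: field_simps)
qed

lemma W_small: assumes "0 < e" obtains d where "0 < d" "d \<le> 1" "\<And>t. 0 \<le> t \<Longrightarrow> t \<le> d \<Longrightarrow> W t < e"
proof -
  have "0 \<in> {0..(1::real)}" by simp
  then obtain d where d: "0 < d" "\<And>t. t \<in> {0..} \<Longrightarrow> dist t 0 < d \<Longrightarrow> dist (W t) (W 0) < e"
    using W_continuous assms unfolding continuous_on_iff by (metis atLeast_iff order_refl)
  show ?thesis
  proof (rule that[of "min (d / 2) 1"])
    show "W t < e" if "0 \<le> t" "t \<le> min (d / 2) 1" for t
      using d(2)[of t] d(1) that W_nonneg[of t] by (auto simp: dist_real_def)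
  qed (use d in auto)
qed

end

section \<open>Chords, arcs and measures of arcs\<close>

lemma sin_lower: assumes "0 \<le> y" "y \<le> 2" shows "y / 3 \<le> sin (y::real)"
proof -
  have "\<bar>sin y - (\<Sum>m<3. sin_coeff m * y ^ m)\<bar> \<le> inverse (fact 3) * \<bar>y\<bar> ^ 3"
    by (rule Maclaurin_sin_bound)
  moreover have "(\<Sum>m<3. sin_coeff m * y ^ m) = y"
    by (simp add: eval_nat_numeral sin_coeff_def)
  ultimately have "\<bar>sin y - y\<bar> \<le> y ^ 3 / 6"
    using assms by (simp add: fact_numeral field_simps)
  \<comment> \<open>As y^2 \<le> 4, the cubic remainder y^3 / 6 is at most 2 y / 3, which leaves y /
    3.\<close>
  moreover have "y ^ 3 \<le> y * 4"
    unfolding power3_eq_cube mult.assoc using assms by (intro mult_left_mono) (auto intro: order_trans[OF mult_mono])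
  ultimately show ?thesis by linarith
qed

lemma cis_chord: "cmod (cis (2 * pi * t) - cis (2 * pi * s)) = 2 * \<bar>sin (pi * (t - s))\<bar>"
proof -
  have "cis (2 * pi * t) - cis (2 * pi * s) = cis (2 * pi * s) * (cis (2 * pi * (t - s)) - 1)"
    by (simp add: cis_mult right_diff_distrib algebra_simps)
  then have "cmod (cis (2 * pi * t) - cis (2 * pi * s)) = cmod (exp (\<i> * of_real (2 * pi * (t - s))) - 1)"
    by (simp add: norm_mult cis_conv_exp)
  also have "\<dots> = 2 * \<bar>sin (2 * pi * (t - s) / 2)\<bar>"
    by (rule dist_exp_i_1)
  finally show ?thesis by (simp add: mult.assoc)
qed

text \<open>The constant 8 here and the constant 2 in \<open>cis_chord_ge\<close> come from 3 < pi <
  4. Every later comparison of chords with arcs goes back to this pair.\<close>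

lemma cis_chord_le: "cmod (cis (2 * pi * t) - cis (2 * pi * s)) \<le> 8 * \<bar>t - s\<bar>"
proof -
  have "\<bar>sin (pi * (t - s))\<bar> \<le> \<bar>pi * (t - s)\<bar>" by (rule abs_sin_x_le_abs_x)
  also have "\<dots> \<le> 4 * \<bar>t - s\<bar>"
    using pi_less_4 by (simp add: abs_mult mult_right_mono)
  finally show ?thesis by (simp add: cis_chord)
qed

lemma cis_chord_ge:
  assumes "\<bar>t - s\<bar> \<le> 1 / 2"
  shows "2 * \<bar>t - s\<bar> \<le> cmod (cis (2 * pi * t) - cis (2 * pi * s))"
proof -
  have "\<bar>sin (pi * (t - s))\<bar> = sin (pi * \<bar>t - s\<bar>)"
  proof -
    have "0 \<le> sin (pi * \<bar>t - s\<bar>)"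
      using assms by (intro sin_ge_zero) (auto simp: mult_left_le)
    moreover have "pi * (t - s) = pi * \<bar>t - s\<bar> \<or> pi * (t - s) = - (pi * \<bar>t - s\<bar>)"
      by (cases "s \<le> t") (auto simp: algebra_simps)
    ultimately show ?thesis by (metis abs_of_nonneg abs_minus_cancel sin_minus)
  qed
  moreover have "pi * \<bar>t - s\<bar> / 3 \<le> sin (pi * \<bar>t - s\<bar>)"
  proof (rule sin_lower)
    have "pi * \<bar>t - s\<bar> \<le> 4 * (1 / 2)"
      using assms pi_less_4 by (intro mult_mono) auto
    then show "pi * \<bar>t - s\<bar> \<le> 2" by simp
  qed simp
  moreover have "3 * \<bar>t - s\<bar> \<le> pi * \<bar>t - s\<bar>"
    using pi_gt3 by (intro mult_right_mono) auto
  ultimately show ?thesis unfolding cis_chord by linarith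
qed

lemma cis_2pi_shift: "cis (2 * pi * (s + of_int k)) = cis (2 * pi * s)"
proof -
  have "cis (2 * pi * (s + of_int k)) = cis (2 * pi * s) * cis (2 * pi * of_int k)"
    unfolding cis_mult by (simp add: algebra_simps)
  then show ?thesis by (simp add: cis_multiple_2pi)
qed

lemma circle_param:
  assumes "\<zeta> \<in> unit_circle"
  obtains s where "0 \<le> s" "s < 1" "\<zeta> = cis (2 * pi * s)"
proof -
  have "\<zeta> = cis (2 * pi * (Arg2pi \<zeta> / (2 * pi)))"
    using Arg2pi_eq[of \<zeta>] assms by (simp add: cis_conv_exp mult.commute)
  moreover have "0 \<le> Arg2pi \<zeta> / (2 * pi)" "Arg2pi \<zeta> / (2 * pi) < 1"
    using Arg2pi_ge_0[of \<zeta>] Arg2pi_lt_2pi[of \<zeta>] by simp_all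
  ultimately show ?thesis using that by blast
qed

lemma periodic_reduce:
  assumes "t \<in> {0..1}" "s \<in> {0..(1::real)}"
  obtains k :: int where "k \<in> {-1, 0, 1}" "\<bar>t - (s + of_int k)\<bar> \<le> 1 / 2"
proof -
  consider "t - s < - (1/2)" | "\<bar>t - s\<bar> \<le> 1/2" | "t - s > 1/2" by linarith
  then show ?thesis
  proof cases
    case 1 then show ?thesis using assms by (intro that[of "-1"]) auto
  next
    case 2 then show ?thesis by (intro that[of 0]) auto
  next
    case 3 then show ?thesis using assms by (intro that[of 1]) auto
  qed
qed

text \<open>If \<open>s\<close> is the parameter of \<open>p\<close>, each parameter in
  \<open>{0..1}\<close> is within 1/2 of \<open>s - 1\<close>, \<open>s\<close> or
  \<open>s + 1\<close>. Bounding by the sum over the three translates gives the factor 3.\<close>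

lemma nn_integral_circle_le:
  fixes g :: "complex \<Rightarrow> ennreal" and h :: "real \<Rightarrow> ennreal"
  assumes p: "p \<in> unit_circle" and g: "g \<in> borel_measurable circle_borel" and h: "h \<in> borel_measurable borel"
    and le: "\<And>\<zeta> x. \<zeta> \<in> unit_circle \<Longrightarrow> \<bar>x\<bar> \<le> 1 / 2 \<Longrightarrow> 2 * \<bar>x\<bar> \<le> cmod (\<zeta> - p) \<Longrightarrow> cmod (\<zeta> - p) \<le> 8 * \<bar>x\<bar> \<Longrightarrow> g \<zeta> \<le> h x"
  shows "(\<integral>\<^sup>+ \<zeta>. g \<zeta> \<partial>circle_measure) \<le> 3 * (\<integral>\<^sup>+ x. h x \<partial>lborel)"
proof -
  obtain s where s: "0 \<le> s" "s < 1" "p = cis (2 * pi * s)" using circle_param[OF p] by blast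
  have "(\<integral>\<^sup>+ \<zeta>. g \<zeta> \<partial>circle_measure) = (\<integral>\<^sup>+ t. g (cis (2 * pi * t)) * indicator {0..1} t \<partial>lborel)"
    by (rule nn_integral_circle[OF g])
  also have "\<dots> \<le> (\<integral>\<^sup>+ t. h (t - (s - 1)) + (h (t - s) + h (t - (s + 1))) \<partial>lborel)"
  proof (rule nn_integral_mono)
    fix t :: real
    show "g (cis (2 * pi * t)) * indicator {0..1} t \<le> h (t - (s - 1)) + (h (t - s) + h (t - (s + 1)))"
    proof (cases "t \<in> {0..1}")
      case True
      obtain k :: int where k: "k \<in> {-1, 0, 1}" "\<bar>t - (s + of_int k)\<bar> \<le> 1 / 2"
        using periodic_reduce[OF True, of s] s by auto
      have "g (cis (2 * pi * t)) \<le> h (t - (s + of_int k))"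
        using k cis_chord_ge[OF k(2)] cis_chord_le[of t "s + of_int k"]
        by (intro le) (auto simp: s(3) cis_2pi_shift)
      also have "\<dots> \<le> h (t - (s - 1)) + (h (t - s) + h (t - (s + 1)))"
        using k(1) by (auto simp: add_increasing add_increasing2)
      finally show ?thesis using True by simp
    qed simp
  qed
  also have "\<dots> = (\<integral>\<^sup>+ t. h (t - (s - 1)) \<partial>lborel) + ((\<integral>\<^sup>+ t. h (t - s) \<partial>lborel) + (\<integral>\<^sup>+ t. h (t - (s + 1)) \<partial>lborel))"
    using h by (simp add: nn_integral_add)
  also have "\<dots> = 3 * (\<integral>\<^sup>+ x. h x \<partial>lborel)"
  proof -
    have "(\<integral>\<^sup>+ t. h (t - c) \<partial>lborel) = (\<integral>\<^sup>+ x. h x \<partial>lborel)" for c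
      using nn_integral_real_affine[of "\<lambda>x. h x" 1 "- c"] h by simp
    moreover have "(3::ennreal) * x = x + (x + x)" for x
    proof -
      have "(3::ennreal) = 1 + (1 + 1)" by simp
      then show ?thesis by (simp only: distrib_right mult_1_left)
    qed
    ultimately show ?thesis by (simp only:)
  qed
  finally show ?thesis .
qed

lemma circle_measure_ball_le:
  assumes "p \<in> unit_circle" "0 \<le> r"
  shows "emeasure circle_measure {\<zeta> \<in> unit_circle. cmod (\<zeta> - p) \<le> r} \<le> ennreal (3 * r)"
proof -
  have m: "{\<zeta> \<in> unit_circle. cmod (\<zeta> - p) \<le> r} \<in> sets circle_borel"
    by (rule circle_borel_Collect) measurable
  have "emeasure circle_measure {\<zeta> \<in> unit_circle. cmod (\<zeta> - p) \<le> r}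
      = (\<integral>\<^sup>+ \<zeta>. indicator {\<zeta> \<in> unit_circle. cmod (\<zeta> - p) \<le> r} \<zeta> \<partial>circle_measure)"
    using m by (simp add: sets_circle_measure)
  also have "\<dots> \<le> 3 * (\<integral>\<^sup>+ x. indicator {- (r / 2)..r / 2} x \<partial>lborel)"
  proof (rule nn_integral_circle_le[OF assms(1)])
    show "indicator {\<zeta> \<in> unit_circle. cmod (\<zeta> - p) \<le> r} \<in> borel_measurable circle_borel"
      using m by (rule borel_measurable_indicator)
  qed (auto simp: indicator_def)
  also have "\<dots> = ennreal (3 * r)"
    using assms by (simp add: ennreal_mult)
  finally show ?thesis .
qed

text \<open>A one-sided arc of parameter length r / 8 lies in the ball, because chords are at most 8
  times the parameter distance; it is taken on the side that stays in \<open>{0..1}\<close>.\<close>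

lemma circle_measure_ball_ge:
  assumes "p \<in> unit_circle" "0 < r" "r \<le> 1"
  shows "ennreal (r / 8) \<le> emeasure circle_measure {\<zeta> \<in> unit_circle. cmod (\<zeta> - p) < r}"
proof -
  obtain s where s: "0 \<le> s" "s < 1" "p = cis (2 * pi * s)" using circle_param[OF assms(1)] by blast
  let ?A = "{\<zeta> \<in> unit_circle. cmod (\<zeta> - p) < r}"
  have m: "?A \<in> sets circle_borel"
    by (rule circle_borel_Collect) measurable
  obtain a where a: "0 \<le> a" "a + r / 8 \<le> 1" "\<And>t. t \<in> {a<..<a + r / 8} \<Longrightarrow> \<bar>t - s\<bar> < r / 8"
  proof (cases "s \<le> 1 / 2")
    case True then show ?thesis using s assms by (intro that[of s]) auto
  next
    case False then show ?thesis using s assms by (intro that[of "s - r / 8"]) auto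
  qed
  have "ennreal (r / 8) = (\<integral>\<^sup>+ t. indicator {a<..<a + r / 8} t \<partial>lborel)"
    using assms by simp
  also have "\<dots> \<le> (\<integral>\<^sup>+ t. indicator ?A (cis (2 * pi * t)) * indicator {0..1} t \<partial>lborel)"
  proof (rule nn_integral_mono)
    fix t :: real
    show "indicator {a<..<a + r / 8} t \<le> (indicator ?A (cis (2 * pi * t)) * indicator {0..1} t :: ennreal)"
      using a(1,2) a(3)[of t] cis_chord_le[of t s] by (auto simp: indicator_def s(3))
  qed
  also have "\<dots> = (\<integral>\<^sup>+ \<zeta>. indicator ?A \<zeta> \<partial>circle_measure)"
    using m by (intro nn_integral_circle[symmetric]) auto
  also have "\<dots> = emeasure circle_measure ?A"
    using m by (simp add: sets_circle_measure)
  finally show ?thesis .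
qed

lemma norm_triangle_three: "cmod (x - y) \<le> cmod (x - x') + cmod (x' - y') + cmod (y - y')"
  by norm

section \<open>The Dini condition and Cauchy transforms of smooth functions\<close>

locale dini_modulus = modulus +
  fixes \<alpha> :: real
  assumes alpha: "0 < \<alpha>" "\<alpha> < 1"
    and dini: "(\<integral>\<^sup>+ t\<in>{0<..1}. ennreal (w t powr \<alpha> / t) \<partial>lborel) < \<infinity>"
begin

lemma W_powr_scale:
  assumes "0 < t" "0 \<le> d" "d \<le> c * t" "1 \<le> c" "0 \<le> \<theta>" "\<theta> \<le> 1"
  shows "W d powr \<theta> \<le> (1 + c) * W t powr \<theta>"
proof -
  have "W d \<le> (1 + d / t) * W t" using assms by (intro W_scale) auto
  also have "\<dots> \<le> (1 + c) * W t"
    using assms W_nonneg[of t] by (intro mult_right_mono) (auto simp: field_simps)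
  finally have "W d powr \<theta> \<le> ((1 + c) * W t) powr \<theta>"
    using assms W_nonneg by (intro powr_mono2) auto
  also have "\<dots> = (1 + c) powr \<theta> * W t powr \<theta>"
    using assms W_nonneg[of t] by (simp add: powr_mult)
  also have "\<dots> \<le> (1 + c) powr 1 * W t powr \<theta>"
    using assms by (intro mult_right_mono powr_mono) auto
  finally show ?thesis using assms by simp
qed

text \<open>The Dini integrand transplanted to the circle with \<open>p\<close> as origin. Its
  integral is bounded uniformly in \<open>p\<close>, and in this form the Dini condition enters all
  that follows. At \<open>p\<close> itself the value is 0 by division by zero.\<close>

definition kernel :: "complex \<Rightarrow> complex \<Rightarrow> real" where
  "kernel p \<zeta> = W (cmod (\<zeta> - p)) powr \<alpha> / cmod (\<zeta> - p)"

lemma kernel_measurable [measurable]: "kernel p \<in> borel_measurable borel"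
proof -
  have [measurable]: "(\<lambda>\<zeta>::complex. W (cmod (\<zeta> - p))) \<in> borel_measurable borel"
    by (intro borel_measurable_continuous_onI W_continuous_comp continuous_intros) auto
  show ?thesis unfolding kernel_def[abs_def] by measurable
qed

lemma kernel_nonneg: "0 \<le> kernel p \<zeta>"
  by (simp add: kernel_def)

text \<open>30 = 3 * (5 + 5): the three translates in \<open>nn_integral_circle_le\<close>, the two
  sides of \<open>p\<close>, and 5 as an upper bound for (1 + 8) / 2 from the chord
  constants.\<close>

definition kernel_mass :: real where
  "kernel_mass = enn2real (30 * (\<integral>\<^sup>+ t\<in>{0<..1}. ennreal (w t powr \<alpha> / t) \<partial>lborel))"

lemma kernel_mass_nonneg: "0 \<le> kernel_mass"
  by (simp add: kernel_mass_def)

lemma kernel_integral: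
  assumes "p \<in> unit_circle"
  shows "(\<integral>\<^sup>+ \<zeta>. ennreal (kernel p \<zeta>) \<partial>circle_measure) \<le> ennreal kernel_mass"
proof -
  define h where "h x = ennreal (W \<bar>x\<bar> powr \<alpha> / x) * indicator {0<..1} x" for x :: real
  have [measurable]: "(\<lambda>x::real. W \<bar>x\<bar>) \<in> borel_measurable borel"
    by (intro borel_measurable_continuous_onI W_continuous_comp continuous_intros) auto
  have hm [measurable]: "h \<in> borel_measurable borel"
    unfolding h_def[abs_def] by measurable
  have hJ: "(\<integral>\<^sup>+ x. h x \<partial>lborel) = (\<integral>\<^sup>+ t\<in>{0<..1}. ennreal (w t powr \<alpha> / t) \<partial>lborel)"
    by (intro nn_integral_cong) (auto simp: h_def W_eq indicator_def)
  have hJ': "(\<integral>\<^sup>+ x. h (- x) \<partial>lborel) = (\<integral>\<^sup>+ x. h x \<partial>lborel)"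
    using nn_integral_real_affine[of "\<lambda>x. h x" "-1" 0] by simp
  have "(\<integral>\<^sup>+ \<zeta>. ennreal (kernel p \<zeta>) \<partial>circle_measure) \<le> 3 * (\<integral>\<^sup>+ x. 5 * h x + 5 * h (- x) \<partial>lborel)"
  proof (rule nn_integral_circle_le[OF assms])
    show "(\<lambda>\<zeta>. ennreal (kernel p \<zeta>)) \<in> borel_measurable circle_borel"
      by (rule circle_borel_measurable_borel) measurable
    fix \<zeta> :: complex and x :: real
    assume x: "\<bar>x\<bar> \<le> 1 / 2" "2 * \<bar>x\<bar> \<le> cmod (\<zeta> - p)" "cmod (\<zeta> - p) \<le> 8 * \<bar>x\<bar>"
    show "ennreal (kernel p \<zeta>) \<le> 5 * h x + 5 * h (- x)"
    proof (cases "x = 0")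
      case True then show ?thesis using x by (simp add: kernel_def)
    next
      case False
      have "W (cmod (\<zeta> - p)) powr \<alpha> \<le> (1 + 8) * W \<bar>x\<bar> powr \<alpha>"
        using x False alpha by (intro W_powr_scale) auto
      then have "kernel p \<zeta> \<le> ((1 + 8) * W \<bar>x\<bar> powr \<alpha>) / (2 * \<bar>x\<bar>)"
        unfolding kernel_def using x False by (intro frac_le) auto
      also have "\<dots> \<le> 5 * (W \<bar>x\<bar> powr \<alpha> / \<bar>x\<bar>)"
        using False by (simp add: field_simps)
      finally have "ennreal (kernel p \<zeta>) \<le> 5 * ennreal (W \<bar>x\<bar> powr \<alpha> / \<bar>x\<bar>)"
        by (metis ennreal_leI ennreal_mult'' ennreal_numeral zero_le_numeral ennreal_mult' mult.commute divide_nonneg_nonneg abs_ge_zero powr_ge_zero)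
      also have "\<dots> \<le> 5 * h x + 5 * h (- x)"
        using x False by (cases "x > 0") (auto simp: h_def)
      finally show ?thesis .
    qed
  qed measurable
  also have "\<dots> = 30 * (\<integral>\<^sup>+ x. h x \<partial>lborel)"
  proof -
    have "(\<integral>\<^sup>+ x. 5 * h x + 5 * h (- x) \<partial>lborel) = 5 * (\<integral>\<^sup>+ x. h x \<partial>lborel) + 5 * (\<integral>\<^sup>+ x. h x \<partial>lborel)"
      using hJ' by (simp add: nn_integral_add nn_integral_cmult)
    then show ?thesis
      by (simp add: distrib_right[symmetric] mult.assoc[symmetric])
  qed
  also have "\<dots> = ennreal kernel_mass"
    unfolding kernel_mass_def hJ using dini
    by (intro ennreal_enn2real[symmetric]) (simp add: ennreal_mult_less_top)
  finally show ?thesis .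
qed

lemma kernel_integrable:
  assumes "p \<in> unit_circle"
  shows "integrable circle_measure (kernel p)" "(\<integral> \<zeta>. kernel p \<zeta> \<partial>circle_measure) \<le> kernel_mass"
proof -
  have m: "kernel p \<in> borel_measurable circle_measure"
    unfolding circle_measurable_cong by (rule circle_borel_measurable_borel) measurable
  show i: "integrable circle_measure (kernel p)"
    using kernel_integral[OF assms] m kernel_nonneg
    by (intro integrableI_nonneg) (auto simp: top_unique intro: order.strict_trans1 ennreal_less_top)
  have "ennreal (\<integral> \<zeta>. kernel p \<zeta> \<partial>circle_measure) \<le> ennreal kernel_mass"
    using kernel_integral[OF assms] nn_integral_eq_integral[OF i] kernel_nonneg by simp
  then show "(\<integral> \<zeta>. kernel p \<zeta> \<partial>circle_measure) \<le> kernel_mass"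
    using kernel_mass_nonneg by simp
qed

text \<open>Trades the modulus at \<open>d\<close> for the modulus at \<open>h\<close>. The factor h
  / (h + d) will be the extra decay of a difference of Cauchy kernels at distances beyond
  \<open>h\<close>.\<close>

lemma W_powr_shift:
  assumes "0 < h" "0 \<le> d" "0 \<le> \<theta>" "\<theta> \<le> 1"
  shows "W d powr \<theta> * (h / (h + d)) \<le> W h powr \<theta>"
proof -
  have "W d powr \<theta> \<le> ((1 + d / h) * W h) powr \<theta>"
    using assms W_nonneg by (intro powr_mono2 W_scale) auto
  also have "\<dots> = (1 + d / h) powr \<theta> * W h powr \<theta>"
    using assms W_nonneg[of h] by (simp add: powr_mult)
  also have "\<dots> \<le> (1 + d / h) powr 1 * W h powr \<theta>"
    using assms by (intro mult_right_mono powr_mono) auto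
  finally have "W d powr \<theta> * (h / (h + d)) \<le> (1 + d / h) * W h powr \<theta> * (h / (h + d))"
    using assms by (intro mult_right_mono) auto
  also have "\<dots> = ((1 + d / h) * (h / (h + d))) * W h powr \<theta>" by simp
  also have "(1 + d / h) * (h / (h + d)) = ((h + d) / h) * (h / (h + d))"
    using assms by (simp add: add_divide_distrib)
  also have "\<dots> = 1" using assms by simp
  finally show ?thesis by simp
qed

text \<open>Constants are reproduced, so the value of \<open>U\<close> at \<open>p\<close> can be
  subtracted from \<open>U\<close>. With d the distance of \<zeta> from \<open>p\<close>,
  \<open>geom\<close> bounds the difference of the kernels by K h / (d (h + d)). The modulus then
  splits: W(d)^\<alpha> / d is the integrable Dini kernel, and W(d)^\<theta> h / (h + d) is at most
  W(h)^\<theta>.\<close>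

lemma cauchy_transform_diff_le:
  assumes U: "bounded_borel U C" and L: "0 \<le> L"
    and smooth: "\<And>\<zeta> \<eta>. \<zeta> \<in> unit_circle \<Longrightarrow> \<eta> \<in> unit_circle \<Longrightarrow> cmod (U \<zeta> - U \<eta>) \<le> L * W (cmod (\<zeta> - \<eta>)) powr (\<alpha> + \<theta>)"
    and th: "0 \<le> \<theta>" "\<theta> \<le> 1" and h: "0 < h" and K: "0 \<le> K"
    and a: "a \<in> unit_disc" and b: "b \<in> unit_disc" and p: "p \<in> unit_circle"
    and geom: "\<And>\<zeta>. \<zeta> \<in> unit_circle \<Longrightarrow>
        cmod (a - b) * (cmod (\<zeta> - p) * (h + cmod (\<zeta> - p))) \<le> K * h * (cmod (\<zeta> - a) * cmod (\<zeta> - b))"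
  shows "cmod (cauchy_transform U a - cauchy_transform U b) \<le> K * L * kernel_mass * W h powr \<theta>"
proof -
  let ?V = "\<lambda>\<zeta>. U \<zeta> - U p"
  have V: "bounded_borel ?V (C + C)"
    by (rule bounded_borel_diff[OF U]) (use bounded_borelD[OF U] p in \<open>auto simp: bounded_borel_def\<close>)
  have eq: "cauchy_transform U z = (\<integral> \<zeta>. ?V \<zeta> / (1 - z * cnj \<zeta>) \<partial>circle_measure) + U p" if z: "z \<in> unit_disc" for z
  proof -
    have c: "bounded_borel (\<lambda>_. U p) C"
      using bounded_borelD[OF U] p by (auto simp: bounded_borel_def)
    have "(\<integral> \<zeta>. ?V \<zeta> / (1 - z * cnj \<zeta>) \<partial>circle_measure) = cauchy_transform U z - (\<integral> \<zeta>. U p / (1 - z * cnj \<zeta>) \<partial>circle_measure)"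
      unfolding cauchy_transform_def diff_divide_distrib
      by (intro Bochner_Integration.integral_diff cauchy_kernel_integrable[OF U z] cauchy_kernel_integrable[OF c z])
    then show ?thesis using cauchy_transform_const[OF z] by simp
  qed
  have "cauchy_transform U a - cauchy_transform U b
      = (\<integral> \<zeta>. ?V \<zeta> / (1 - a * cnj \<zeta>) - ?V \<zeta> / (1 - b * cnj \<zeta>) \<partial>circle_measure)"
    unfolding eq[OF a] eq[OF b]
    by (subst Bochner_Integration.integral_diff) (auto intro!: cauchy_kernel_integrable[OF V] a b simp del: mem_ball)
  also have "cmod \<dots> \<le> (\<integral> \<zeta>. K * L * W h powr \<theta> * kernel p \<zeta> \<partial>circle_measure)"
  proof (rule Bochner_Integration.integral_norm_bound_integral)
    show "integrable circle_measure (\<lambda>\<zeta>. ?V \<zeta> / (1 - a * cnj \<zeta>) - ?V \<zeta> / (1 - b * cnj \<zeta>))"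
      by (intro Bochner_Integration.integrable_diff cauchy_kernel_integrable[OF V] a b)
    show "integrable circle_measure (\<lambda>\<zeta>. K * L * W h powr \<theta> * kernel p \<zeta>)"
      by (intro integrable_mult_right kernel_integrable p)
    fix \<zeta> assume "\<zeta> \<in> space circle_measure"
    then have z: "\<zeta> \<in> unit_circle" by simp
    define d where "d = cmod (\<zeta> - p)"
    have pos: "0 < cmod (\<zeta> - a)" "0 < cmod (\<zeta> - b)"
      using z a b by auto
    have nz: "1 - a * cnj \<zeta> \<noteq> 0" "1 - b * cnj \<zeta> \<noteq> 0"
      using pos norm_one_minus_cnj[OF z, of a] norm_one_minus_cnj[OF z, of b] by auto
    have "?V \<zeta> / (1 - a * cnj \<zeta>) - ?V \<zeta> / (1 - b * cnj \<zeta>)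
        = ?V \<zeta> * ((a - b) * cnj \<zeta>) / ((1 - a * cnj \<zeta>) * (1 - b * cnj \<zeta>))"
      using nz by (simp add: field_simps)
    then have eqn: "cmod (?V \<zeta> / (1 - a * cnj \<zeta>) - ?V \<zeta> / (1 - b * cnj \<zeta>))
        = cmod (?V \<zeta>) * (cmod (a - b) / (cmod (\<zeta> - a) * cmod (\<zeta> - b)))"
      using z by (simp add: norm_mult norm_divide norm_one_minus_cnj)
    show "cmod (?V \<zeta> / (1 - a * cnj \<zeta>) - ?V \<zeta> / (1 - b * cnj \<zeta>)) \<le> K * L * W h powr \<theta> * kernel p \<zeta>"
    proof (cases "d = 0")
      case True
      then have "\<zeta> = p" by (simp add: d_def)
      then show ?thesis by (simp add: kernel_def)
    next
      case False
      then have d: "0 < d" by (simp add: d_def)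
      have "cmod (a - b) / (cmod (\<zeta> - a) * cmod (\<zeta> - b)) \<le> K * h / (d * (h + d))"
        using geom[OF z] pos d h by (simp add: divide_simps d_def[symmetric] mult_ac)
      then have "cmod (?V \<zeta>) * (cmod (a - b) / (cmod (\<zeta> - a) * cmod (\<zeta> - b)))
          \<le> (L * W d powr (\<alpha> + \<theta>)) * (K * h / (d * (h + d)))"
        using smooth[OF z p] L pos by (intro mult_mono) (auto simp: d_def)
      also have "\<dots> = K * L * (W d powr \<alpha> / d) * (W d powr \<theta> * (h / (h + d)))"
        using d h by (simp add: powr_add field_simps)
      also have "\<dots> \<le> K * L * (W d powr \<alpha> / d) * W h powr \<theta>"
        using W_powr_shift[OF h, of d \<theta>] d th K L by (intro mult_left_mono) auto
      also have "\<dots> = K * L * W h powr \<theta> * kernel p \<zeta>"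
        by (simp add: kernel_def d_def)
      finally show ?thesis unfolding eqn .
    qed
  qed
  also have "\<dots> \<le> K * L * W h powr \<theta> * kernel_mass"
    using kernel_integrable[OF p] K L by (simp add: mult_left_mono)
  finally show ?thesis by (simp add: mult_ac)
qed

text \<open>Both points lie on the radius ending at \<open>p\<close>, so the distance from \<zeta>
  to \<open>p\<close> is at most twice the distance to either of them, and the second point has
  distance at least \<open>h\<close> from the circle. Hence 6 = 2 * 3.\<close>

lemma cauchy_transform_dilate:
  assumes U: "bounded_borel U C" and L: "0 \<le> L"
    and smooth: "\<And>\<zeta> \<eta>. \<zeta> \<in> unit_circle \<Longrightarrow> \<eta> \<in> unit_circle \<Longrightarrow> cmod (U \<zeta> - U \<eta>) \<le> L * W (cmod (\<zeta> - \<eta>)) powr (\<alpha> + \<theta>)"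
    and th: "0 \<le> \<theta>" "\<theta> \<le> 1" and h: "0 < h" "h \<le> 1" and z: "z \<in> unit_disc"
  shows "cmod (cauchy_transform U z - cauchy_transform U (of_real (1 - h) * z)) \<le> 6 * L * kernel_mass * W h powr \<theta>"
proof -
  define p where "p = (if z = 0 then 1 else sgn z)"
  have p: "p \<in> unit_circle" by (auto simp: p_def norm_sgn)
  define b where "b = of_real (1 - h) * z"
  have bz: "cmod b = (1 - h) * cmod z" using h unfolding b_def norm_mult norm_of_real by simp
  have b: "b \<in> unit_disc"
    using z h mult_le_one[of "1 - h" "cmod z"] by (simp add: bz) (smt (verit) mult_less_cancel_right1 mult_nonneg_nonneg norm_ge_zero)
  have zp: "z = of_real (cmod z) * p"
    by (auto simp: p_def sgn_eq)
  have dist: "cmod (of_real c * p - p) = 1 - c" if "c \<le> 1" for c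
  proof -
    have "of_real c * p - p = of_real (c - 1) * p" by (simp add: algebra_simps)
    then show ?thesis using p that by (simp only: norm_mult norm_of_real) auto
  qed
  have zpd: "cmod (z - p) = 1 - cmod z"
    using dist[of "cmod z"] z zp by simp
  have bpd: "cmod (b - p) = 1 - cmod b"
  proof -
    have "b = of_real (cmod b) * p"
      unfolding bz by (subst b_def, subst zp) (simp add: mult_ac)
    then show ?thesis using dist[of "cmod b"] b by simp
  qed
  show ?thesis
    unfolding b_def[symmetric]
  proof (rule cauchy_transform_diff_le[OF U L smooth th h(1) _ z b p])
    fix \<zeta> :: complex assume c: "\<zeta> \<in> unit_circle"
    have 1: "cmod (\<zeta> - p) \<le> 2 * cmod (\<zeta> - z)"
      using norm_triangle_ineq[of "\<zeta> - z" "z - p"] norm_triangle_ineq2[of \<zeta> z] c zpd by simp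
    have 2: "cmod (\<zeta> - p) \<le> 2 * cmod (\<zeta> - b)"
      using norm_triangle_ineq[of "\<zeta> - b" "b - p"] norm_triangle_ineq2[of \<zeta> b] c bpd by simp
    have 3: "h \<le> cmod (\<zeta> - b)"
    proof -
      have "(1 - h) * cmod z \<le> 1 - h" using h z by (intro mult_left_le) auto
      then show ?thesis using norm_triangle_ineq2[of \<zeta> b] c bz by simp
    qed
    have 4: "cmod (z - b) \<le> h"
    proof -
      have "z - b = of_real h * z" by (simp add: b_def algebra_simps)
      then show ?thesis using z h by (simp add: norm_mult mult_left_le)
    qed
    have "cmod (z - b) * (cmod (\<zeta> - p) * (h + cmod (\<zeta> - p))) \<le> h * ((2 * cmod (\<zeta> - z)) * (3 * cmod (\<zeta> - b)))"
      using 1 2 3 4 h by (intro mult_mono) auto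
    then show "cmod (z - b) * (cmod (\<zeta> - p) * (h + cmod (\<zeta> - p))) \<le> 6 * h * (cmod (\<zeta> - z) * cmod (\<zeta> - b))"
      by (simp add: mult_ac)
  qed auto
qed

text \<open>Both points have distance at least \<open>h\<close> from the circle and at most
  \<open>h\<close> from each other, so their distances to \<zeta> agree up to the factor 2. With
  \<open>p\<close> on the radius through \<open>a\<close> this gives 12 = 2 * 6.\<close>

lemma cauchy_transform_near:
  assumes U: "bounded_borel U C" and L: "0 \<le> L"
    and smooth: "\<And>\<zeta> \<eta>. \<zeta> \<in> unit_circle \<Longrightarrow> \<eta> \<in> unit_circle \<Longrightarrow> cmod (U \<zeta> - U \<eta>) \<le> L * W (cmod (\<zeta> - \<eta>)) powr (\<alpha> + \<theta>)"
    and th: "0 \<le> \<theta>" "\<theta> \<le> 1" and h: "0 < h" and a: "cmod a \<le> 1 - h" and b: "cmod b \<le> 1 - h" and ab: "cmod (a - b) \<le> h"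
  shows "cmod (cauchy_transform U a - cauchy_transform U b) \<le> 12 * L * kernel_mass * W h powr \<theta>"
proof -
  define p where "p = (if a = 0 then 1 else sgn a)"
  have p: "p \<in> unit_circle" by (auto simp: p_def norm_sgn)
  have ap: "a = of_real (cmod a) * p"
    by (auto simp: p_def sgn_eq)
  have apd: "cmod (a - p) = 1 - cmod a"
  proof -
    have "a - p = of_real (cmod a - 1) * p" using ap by (simp add: algebra_simps)
    then show ?thesis using p a h by (simp only: norm_mult norm_of_real) auto
  qed
  show ?thesis
  proof (rule cauchy_transform_diff_le[OF U L smooth th h _ _ _ p])
    fix \<zeta> :: complex assume c: "\<zeta> \<in> unit_circle"
    have 1: "cmod (\<zeta> - p) \<le> 2 * cmod (\<zeta> - a)"
      using norm_triangle_ineq[of "\<zeta> - a" "a - p"] norm_triangle_ineq2[of \<zeta> a] c apd by simp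
    have 2: "h \<le> cmod (\<zeta> - b)" "h \<le> cmod (\<zeta> - a)"
      using norm_triangle_ineq2[of \<zeta> b] norm_triangle_ineq2[of \<zeta> a] c a b by simp_all
    have 3: "cmod (\<zeta> - a) \<le> 2 * cmod (\<zeta> - b)"
      using norm_triangle_ineq[of "\<zeta> - b" "b - a"] ab 2 by (simp add: norm_minus_commute)
    have "cmod (a - b) * (cmod (\<zeta> - p) * (h + cmod (\<zeta> - p))) \<le> h * ((2 * cmod (\<zeta> - a)) * (6 * cmod (\<zeta> - b)))"
      using 1 2 3 h ab by (intro mult_mono) auto
    then show "cmod (a - b) * (cmod (\<zeta> - p) * (h + cmod (\<zeta> - p))) \<le> 12 * h * (cmod (\<zeta> - a) * cmod (\<zeta> - b))"
      by (simp add: mult_ac)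
  qed (use a b h in auto)
qed

text \<open>Both points are pulled inwards by the factor 1 - h, where \<open>h\<close> is their
  distance, and compared there: 24 = 6 + 12 + 6. If \<open>h\<close> exceeds 1, both are compared
  with the origin.\<close>

lemma cauchy_transform_smooth:
  assumes U: "bounded_borel U C" and L: "0 \<le> L"
    and smooth: "\<And>\<zeta> \<eta>. \<zeta> \<in> unit_circle \<Longrightarrow> \<eta> \<in> unit_circle \<Longrightarrow> cmod (U \<zeta> - U \<eta>) \<le> L * W (cmod (\<zeta> - \<eta>)) powr (1 + \<alpha>)"
    and z: "z \<in> unit_disc" "z' \<in> unit_disc"
  shows "cmod (cauchy_transform U z - cauchy_transform U z') \<le> 24 * L * kernel_mass * W (cmod (z - z'))"
proof -
  have sm: "cmod (U \<zeta> - U \<eta>) \<le> L * W (cmod (\<zeta> - \<eta>)) powr (\<alpha> + 1)" if "\<zeta> \<in> unit_circle" "\<eta> \<in> unit_circle" for \<zeta> \<eta>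
    using smooth[OF that] by (simp add: add.commute)
  define h where "h = cmod (z - z')"
  note dil = cauchy_transform_dilate[OF U L sm _ _ _ _ z(1), simplified] cauchy_transform_dilate[OF U L sm _ _ _ _ z(2), simplified]
  note km = mult_nonneg_nonneg[OF L kernel_mass_nonneg]
  consider "h = 0" | "0 < h" "h \<le> 1" | "1 < h" using norm_ge_zero[of "z - z'"] unfolding h_def by linarith
  then show ?thesis
  proof cases
    case 1 then show ?thesis by (simp add: h_def)
  next
    case 2
    have c: "cmod (of_real (1 - h) * x) \<le> 1 - h" if "x \<in> unit_disc" for x :: complex
      using that 2 unfolding norm_mult norm_of_real by (simp add: mult_left_le)
    have "cmod (of_real (1 - h) * z - of_real (1 - h) * z') \<le> h"
    proof -
      have "cmod (of_real (1 - h) * z - of_real (1 - h) * z') = (1 - h) * h"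
        using 2 unfolding right_diff_distrib[symmetric] norm_mult norm_of_real h_def[symmetric] by simp
      then show ?thesis using 2 by (simp add: mult_left_le_one_le)
    qed
    from cauchy_transform_near[OF U L sm _ _ 2(1) c[OF z(1)] c[OF z(2)] this]
    have "cmod (cauchy_transform U (of_real (1 - h) * z) - cauchy_transform U (of_real (1 - h) * z')) \<le> 12 * L * kernel_mass * W h"
      using W_nonneg[of h] 2 by simp
    moreover have "cmod (cauchy_transform U z - cauchy_transform U (of_real (1 - h) * z)) \<le> 6 * L * kernel_mass * W h"
       "cmod (cauchy_transform U z' - cauchy_transform U (of_real (1 - h) * z')) \<le> 6 * L * kernel_mass * W h"
      using dil(1)[of h] dil(2)[of h] 2 W_nonneg[of h] by simp_all
    ultimately show ?thesis
      using norm_triangle_three[of "cauchy_transform U z" "cauchy_transform U z'" "cauchy_transform U (of_real (1 - h) * z)" "cauchy_transform U (of_real (1 - h) * z')"]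
      unfolding h_def[symmetric] by linarith
  next
    case 3
    have "cmod (cauchy_transform U z - cauchy_transform U 0) \<le> 6 * L * kernel_mass * W 1"
       "cmod (cauchy_transform U z' - cauchy_transform U 0) \<le> 6 * L * kernel_mass * W 1"
      using dil(1)[of 1] dil(2)[of 1] W_nonneg[of 1] by simp_all
    moreover have "W h = W 1" using 3 by (simp add: modulus_ext_def)
    moreover have "0 \<le> L * kernel_mass * W 1" using km W_nonneg[of 1] by simp
    ultimately show ?thesis
      using norm_triangle_three[of "cauchy_transform U z" "cauchy_transform U z'" "cauchy_transform U 0" "cauchy_transform U 0"]
      unfolding h_def[symmetric] by simp
  qed
qed

end

section \<open>Membership in the space of smooth functions\<close>

context modulus
begin

lemma boundary_value_ext:
  assumes g: "continuous_on (cball 0 1) g" "\<And>z. z \<in> unit_disc \<Longrightarrow> g z = f z" and xi: "\<xi> \<in> unit_circle"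
  shows "boundary_value f \<xi> = g \<xi>"
proof -
  have "(g \<longlongrightarrow> g \<xi>) (at \<xi> within cball 0 1)"
    using g(1) xi by (auto simp: continuous_on)
  then have "(g \<longlongrightarrow> g \<xi>) (at \<xi> within unit_disc)"
    by (rule tendsto_within_subset) auto
  then have "(f \<longlongrightarrow> g \<xi>) (at \<xi> within unit_disc)"
    by (rule tendsto_cong[THEN iffD1, rotated]) (use g(2) in \<open>auto simp: eventually_at_filter\<close>)
  moreover have "at \<xi> within unit_disc \<noteq> bot"
    using xi by (simp add: trivial_limit_within islimpt_ball)
  ultimately show ?thesis
    unfolding boundary_value_def by (intro tendsto_Lim)
qed

text \<open>Replaces the extended-valued norm by a bound for one continuous extension. Positivity of
  \<open>W\<close> keeps the quotients away from division by zero.\<close>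

lemma A_space_iff:
  "f \<in> A_space w \<longleftrightarrow> f \<in> disc_holomorphic \<and> (\<exists>g L. continuous_on (cball 0 1) g \<and> (\<forall>z\<in>unit_disc. g z = f z) \<and>
     (\<forall>\<xi>\<in>unit_circle. \<forall>\<zeta>\<in>unit_circle. cmod (g \<xi> - g \<zeta>) \<le> L * W (cmod (\<xi> - \<zeta>))))"
  (is "_ \<longleftrightarrow> _ \<and> ?R")
proof safe
  assume f: "f \<in> A_space w"
  then show "f \<in> disc_holomorphic" by (simp add: A_space_def)
  from f obtain g where g: "continuous_on (cball 0 1) g" "\<And>z. z \<in> unit_disc \<Longrightarrow> g z = f z"
    by (auto simp: A_space_def)
  let ?P = "{(\<xi>, \<zeta>). \<xi> \<in> unit_circle \<and> \<zeta> \<in> unit_circle \<and> \<xi> \<noteq> \<zeta>}"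
  let ?S = "SUP (\<xi>, \<zeta>)\<in>?P. ennreal (cmod (boundary_value f \<xi> - boundary_value f \<zeta>) / W (cmod (\<xi> - \<zeta>)))"
  have S: "?S < top"
    using f unfolding A_space_def A_norm_def by (auto simp: ennreal_add_less_top)
  have "cmod (g \<xi> - g \<zeta>) \<le> enn2real ?S * W (cmod (\<xi> - \<zeta>))" if "\<xi> \<in> unit_circle" "\<zeta> \<in> unit_circle" for \<xi> \<zeta>
  proof (cases "\<xi> = \<zeta>")
    case False
    have p: "0 < W (cmod (\<xi> - \<zeta>))" using False by (intro W_pos) simp
    have bv: "boundary_value f x = g x" if "x \<in> unit_circle" for x
      using boundary_value_ext[OF g that] by simp
    have "ennreal (cmod (g \<xi> - g \<zeta>) / W (cmod (\<xi> - \<zeta>))) \<le> ?S"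
      using that False bv[OF that(1)] bv[OF that(2)] by (intro SUP_upper2[of "(\<xi>, \<zeta>)"]) auto
    also have "?S = ennreal (enn2real ?S)" using S by simp
    finally have "cmod (g \<xi> - g \<zeta>) / W (cmod (\<xi> - \<zeta>)) \<le> enn2real ?S"
      by (subst (asm) ennreal_le_iff) simp_all
    then show ?thesis using p by (simp add: field_simps)
  qed simp
  then show ?R using g by blast
next
  fix g L
  assume f: "f \<in> disc_holomorphic" and g: "continuous_on (cball 0 1) g" "\<forall>z\<in>unit_disc. g z = f z"
    and L: "\<forall>\<xi>\<in>unit_circle. \<forall>\<zeta>\<in>unit_circle. cmod (g \<xi> - g \<zeta>) \<le> L * W (cmod (\<xi> - \<zeta>))"
  obtain M where M: "\<And>z. z \<in> cball 0 1 \<Longrightarrow> cmod (g z) \<le> M"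
    using compact_norm_bound[OF compact_cball g(1)] by blast
  have "(SUP z\<in>unit_disc. ennreal (cmod (f z))) \<le> ennreal M"
  proof (rule SUP_least)
    fix z :: complex assume "z \<in> unit_disc"
    then show "ennreal (cmod (f z)) \<le> ennreal M" using g(2) M[of z] by (intro ennreal_leI) auto
  qed
  moreover have "(SUP (\<xi>, \<zeta>)\<in>{(\<xi>, \<zeta>). \<xi> \<in> unit_circle \<and> \<zeta> \<in> unit_circle \<and> \<xi> \<noteq> \<zeta>}.
        ennreal (cmod (boundary_value f \<xi> - boundary_value f \<zeta>) / modulus_ext w (cmod (\<xi> - \<zeta>)))) \<le> ennreal L"
  proof (rule SUP_least, safe)
    fix \<xi> \<zeta> :: complex assume z: "\<xi> \<in> unit_circle" "\<zeta> \<in> unit_circle" "\<xi> \<noteq> \<zeta>"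
    have p: "0 < W (cmod (\<xi> - \<zeta>))" using z by (intro W_pos) simp
    have "cmod (boundary_value f \<xi> - boundary_value f \<zeta>) / modulus_ext w (cmod (\<xi> - \<zeta>)) \<le> L"
    proof -
      have bv: "boundary_value f x = g x" if "x \<in> unit_circle" for x
        using boundary_value_ext[OF g(1) _ that] g(2) by simp
      show ?thesis
        using L z p bv[OF z(1)] bv[OF z(2)] by (simp add: pos_divide_le_eq)
    qed
    then show "ennreal (cmod (boundary_value f \<xi> - boundary_value f \<zeta>) / modulus_ext w (cmod (\<xi> - \<zeta>))) \<le> ennreal L"
      by (rule ennreal_leI)
  qed
  ultimately have "A_norm w f \<le> ennreal M + ennreal L"
    unfolding A_norm_def by (rule add_mono)
  then have "A_norm w f < \<infinity>"
    by (rule order.strict_trans1) simp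
  then show "f \<in> A_space w"
    using f g by (auto simp: A_space_def)
qed

lemma A_space_lincomb:
  assumes "f \<in> A_space w" "g \<in> A_space w"
  shows "(\<lambda>z. f z + c * g z) \<in> A_space w"
proof -
  obtain F L where F: "continuous_on (cball 0 1) F" "\<forall>z\<in>unit_disc. F z = f z"
     "\<forall>\<xi>\<in>unit_circle. \<forall>\<zeta>\<in>unit_circle. cmod (F \<xi> - F \<zeta>) \<le> L * W (cmod (\<xi> - \<zeta>))"
    using assms(1) unfolding A_space_iff by blast
  obtain G K where G: "continuous_on (cball 0 1) G" "\<forall>z\<in>unit_disc. G z = g z"
     "\<forall>\<xi>\<in>unit_circle. \<forall>\<zeta>\<in>unit_circle. cmod (G \<xi> - G \<zeta>) \<le> K * W (cmod (\<xi> - \<zeta>))"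
    using assms(2) unfolding A_space_iff by blast
  have "cmod ((F \<xi> + c * G \<xi>) - (F \<zeta> + c * G \<zeta>)) \<le> (L + cmod c * K) * W (cmod (\<xi> - \<zeta>))"
    if "\<xi> \<in> unit_circle" "\<zeta> \<in> unit_circle" for \<xi> \<zeta>
  proof -
    have "(F \<xi> + c * G \<xi>) - (F \<zeta> + c * G \<zeta>) = (F \<xi> - F \<zeta>) + c * (G \<xi> - G \<zeta>)"
      by (simp add: algebra_simps)
    also have "cmod \<dots> \<le> cmod (F \<xi> - F \<zeta>) + cmod c * cmod (G \<xi> - G \<zeta>)"
      by (rule order_trans[OF norm_triangle_ineq]) (simp add: norm_mult)
    also have "\<dots> \<le> L * W (cmod (\<xi> - \<zeta>)) + cmod c * (K * W (cmod (\<xi> - \<zeta>)))"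
      using F(3) G(3) that by (intro add_mono mult_left_mono) auto
    finally show ?thesis by (simp add: algebra_simps)
  qed
  moreover have "continuous_on (cball 0 1) (\<lambda>z. F z + c * G z)"
    by (intro continuous_intros F G)
  moreover have "(\<lambda>z. f z + c * g z) \<in> disc_holomorphic"
    using assms by (auto simp: A_space_def disc_holomorphic_def intro!: holomorphic_intros)
  ultimately show ?thesis
    unfolding A_space_iff using F(2) G(2)
    by (intro conjI exI[of _ "\<lambda>z. F z + c * G z"] exI[of _ "L + cmod c * K"]) auto
qed

text \<open>Since \<open>W\<close> is small near 0, the bound gives uniform continuity and hence a
  continuous extension. It passes to the circle along dilates, which do not increase
  distances.\<close>

lemma A_space_smoothI:
  assumes f: "f \<in> disc_holomorphic" and C: "\<And>z z'. z \<in> unit_disc \<Longrightarrow> z' \<in> unit_disc \<Longrightarrow> cmod (f z - f z') \<le> C * W (cmod (z - z'))"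
    and "0 \<le> C"
  shows "f \<in> A_space w"
proof -
  have uc: "uniformly_continuous_on unit_disc f"
    unfolding uniformly_continuous_on_def
  proof (intro allI impI)
    fix e :: real assume e: "0 < e"
    have "0 < e / (C + 1)" using e assms(3) by simp
    from W_small[OF this] obtain d where d: "0 < d" "\<And>t. 0 \<le> t \<Longrightarrow> t \<le> d \<Longrightarrow> W t < e / (C + 1)" by metis
    have "dist (f x') (f x) < e" if "x \<in> unit_disc" "x' \<in> unit_disc" "dist x' x < d" for x x'
    proof -
      have "dist (f x') (f x) \<le> C * W (cmod (x' - x))"
        using C[OF that(2,1)] by (simp add: dist_norm)
      also have "\<dots> \<le> (C + 1) * W (cmod (x' - x))"
        using W_nonneg by (intro mult_right_mono) auto
      also have "\<dots> < (C + 1) * (e / (C + 1))"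
        using d(2)[of "cmod (x' - x)"] that assms(3) by (intro mult_strict_left_mono) (auto simp: dist_norm)
      also have "\<dots> = e" using assms(3) by simp
      finally show ?thesis .
    qed
    then show "\<exists>d>0. \<forall>x\<in>unit_disc. \<forall>x'\<in>unit_disc. dist x' x < d \<longrightarrow> dist (f x') (f x) < e"
      using d(1) by blast
  qed
  obtain g where g: "uniformly_continuous_on (closure unit_disc) g" "\<And>x. x \<in> unit_disc \<Longrightarrow> f x = g x"
    using uniformly_continuous_on_extension_on_closure[OF uc] by metis
  have cg: "continuous_on (cball 0 1) g"
    using uniformly_continuous_imp_continuous[OF g(1)] by simp
  have "cmod (g \<xi> - g \<zeta>) \<le> C * W (cmod (\<xi> - \<zeta>))" if z: "\<xi> \<in> unit_circle" "\<zeta> \<in> unit_circle" for \<xi> \<zeta>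
  proof -
    have lim: "(\<lambda>n. of_real (rseq n) * x) \<longlonglongrightarrow> x" for x :: complex
      using tendsto_mult[OF tendsto_of_real[OF rseq(3)] tendsto_const[of x]] by simp
    have glim: "(\<lambda>n. g (of_real (rseq n) * x)) \<longlonglongrightarrow> g x" if "x \<in> unit_circle" for x
      using cg that lim[of x] unfolding continuous_on_sequentially
      using rseq(1,2) by (auto simp: norm_mult comp_def less_imp_le)
    have "(\<lambda>n. cmod (g (of_real (rseq n) * \<xi>) - g (of_real (rseq n) * \<zeta>))) \<longlonglongrightarrow> cmod (g \<xi> - g \<zeta>)"
      by (intro tendsto_intros glim z)
    moreover have "cmod (g (of_real (rseq n) * \<xi>) - g (of_real (rseq n) * \<zeta>)) \<le> C * W (cmod (\<xi> - \<zeta>))" for n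
    proof -
      have in_disc: "of_real (rseq n) * x \<in> unit_disc" if "x \<in> unit_circle" for x :: complex
        using that rseq(1,2)[of n] by (simp add: norm_mult)
      have "cmod (of_real (rseq n) * \<xi> - of_real (rseq n) * \<zeta>) \<le> cmod (\<xi> - \<zeta>)"
        using rseq(1,2)[of n] unfolding right_diff_distrib[symmetric] norm_mult norm_of_real
        by (simp add: mult_left_le_one_le)
      then have "C * W (cmod (of_real (rseq n) * \<xi> - of_real (rseq n) * \<zeta>)) \<le> C * W (cmod (\<xi> - \<zeta>))"
        using assms(3) by (intro mult_left_mono W_mono) auto
      then show ?thesis
        using C[OF in_disc[OF z(1)] in_disc[OF z(2)]] g(2)[OF in_disc[OF z(1)]] g(2)[OF in_disc[OF z(2)]] by simp
    qed
    ultimately show ?thesis by (intro LIMSEQ_le_const2) auto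
  qed
  then show ?thesis
    unfolding A_space_iff using f cg g(2) by (intro conjI exI[of _ g] exI[of _ C]) auto
qed

end

section \<open>Sets of finite entropy and the decomposition of Roberts\<close>

lemma arc_dist_arcsin:
  assumes "\<zeta> \<in> unit_circle" "\<xi> \<in> unit_circle"
  shows "arc_dist \<zeta> \<xi> = arcsin (cmod (\<zeta> - \<xi>) / 2) / pi"
proof -
  define \<phi> where "\<phi> = Arg (\<zeta> / \<xi>)"
  have nz: "\<xi> \<noteq> 0" "\<zeta> / \<xi> \<noteq> 0" using assms by auto
  have n: "cmod (\<zeta> / \<xi>) = 1" using assms by (simp add: norm_divide)
  have phi: "- pi < \<phi>" "\<phi> \<le> pi" unfolding \<phi>_def by (simp_all add: mpi_less_Arg Arg_le_pi)
  have e: "\<zeta> / \<xi> = exp (\<i> * of_real \<phi>)"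
    using Arg_eq[OF nz(2)] n by (simp add: \<phi>_def)
  have "\<zeta> - \<xi> = (\<zeta> / \<xi> - 1) * \<xi>" using nz by (simp add: field_simps)
  then have "cmod (\<zeta> - \<xi>) = cmod (exp (\<i> * of_real \<phi>) - 1)"
    using assms by (simp add: norm_mult e)
  also have "\<dots> = 2 * \<bar>sin (\<phi> / 2)\<bar>" by (rule dist_exp_i_1)
  also have "\<bar>sin (\<phi> / 2)\<bar> = sin (\<bar>\<phi>\<bar> / 2)"
  proof -
    have "0 \<le> sin (\<bar>\<phi>\<bar> / 2)" using phi by (intro sin_ge_zero) auto
    moreover have "\<phi> / 2 = \<bar>\<phi>\<bar> / 2 \<or> \<phi> / 2 = - (\<bar>\<phi>\<bar> / 2)" by (cases "0 \<le> \<phi>") auto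
    ultimately show ?thesis by (metis abs_of_nonneg abs_minus_cancel sin_minus)
  qed
  finally have "arcsin (cmod (\<zeta> - \<xi>) / 2) = \<bar>\<phi>\<bar> / 2"
    using phi by (simp add: arcsin_sin)
  then have "arcsin (cmod (\<zeta> - \<xi>) / 2) / pi = \<bar>\<phi>\<bar> / 2 / pi" by (rule arg_cong)
  then show ?thesis unfolding arc_dist_def \<phi>_def[symmetric] by simp
qed

lemma infdist_attained:
  assumes "closed E" "E \<noteq> {}"
  obtains \<xi> where "\<xi> \<in> E" "infdist \<zeta> E = cmod (\<zeta> - \<xi>)"
proof -
  obtain \<xi> where x: "\<xi> \<in> E" "\<And>y. y \<in> E \<Longrightarrow> dist \<zeta> \<xi> \<le> dist \<zeta> y"
    using distance_attains_inf[OF assms, of \<zeta>] by blast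
  have "infdist \<zeta> E = dist \<zeta> \<xi>"
    unfolding infdist_def using x assms(2) by (auto intro!: cInf_eq_minimum)
  then show ?thesis using that x by (simp add: dist_norm)
qed

text \<open>The arc distance is an increasing function of the chord, so the point of
  \<open>E\<close> that is nearest in one distance is nearest in the other.\<close>

lemma arc_infdist_arcsin:
  assumes E: "closed E" "E \<noteq> {}" "E \<subseteq> unit_circle" and z: "\<zeta> \<in> unit_circle"
  shows "arc_infdist \<zeta> E = arcsin (infdist \<zeta> E / 2) / pi"
proof -
  obtain \<xi> where x: "\<xi> \<in> E" "infdist \<zeta> E = cmod (\<zeta> - \<xi>)"
    using infdist_attained[OF E(1,2)] by blast
  have xc: "\<xi> \<in> unit_circle" using x E by auto
  have "(INF \<xi>\<in>E. arc_dist \<zeta> \<xi>) = arc_dist \<zeta> \<xi>"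
  proof (rule cInf_eq_minimum)
    show "arc_dist \<zeta> \<xi> \<in> arc_dist \<zeta> ` E" using x by blast
    fix d assume "d \<in> arc_dist \<zeta> ` E"
    then obtain \<eta> where h: "\<eta> \<in> E" "d = arc_dist \<zeta> \<eta>" by blast
    have hc: "\<eta> \<in> unit_circle" using h E by auto
    have "cmod (\<zeta> - \<xi>) \<le> cmod (\<zeta> - \<eta>)"
      using infdist_le[OF h(1), of \<zeta>] x by (simp add: dist_norm)
    moreover have "cmod (\<zeta> - \<eta>) \<le> 2"
      using norm_triangle_ineq4[of \<zeta> \<eta>] z hc by simp
    ultimately have "arcsin (cmod (\<zeta> - \<xi>) / 2) \<le> arcsin (cmod (\<zeta> - \<eta>) / 2)"
      by (intro arcsin_le_arcsin) (auto intro: order_trans[OF _ norm_ge_zero])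
    then show "arc_dist \<zeta> \<xi> \<le> d"
      unfolding h(2) arc_dist_arcsin[OF z xc] arc_dist_arcsin[OF z hc] by (simp add: divide_right_mono)
  qed
  then show ?thesis
    unfolding arc_infdist_def x(2) arc_dist_arcsin[OF z xc, symmetric] using E by simp
qed

lemma infdist_circle_le: "E \<noteq> {} \<Longrightarrow> E \<subseteq> unit_circle \<Longrightarrow> \<zeta> \<in> unit_circle \<Longrightarrow> infdist \<zeta> E \<le> 2"
proof -
  assume "E \<noteq> {}" "E \<subseteq> unit_circle" and z: "\<zeta> \<in> unit_circle"
  then obtain \<xi> where x: "\<xi> \<in> E" "\<xi> \<in> unit_circle" by blast
  have "infdist \<zeta> E \<le> cmod (\<zeta> - \<xi>)" using infdist_le[OF x(1), of \<zeta>] by (simp add: dist_norm)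
  then show ?thesis using norm_triangle_ineq4[of \<zeta> \<xi>] x z by simp
qed

lemma arc_infdist_bounds:
  assumes E: "closed E" "E \<noteq> {}" "E \<subseteq> unit_circle" and z: "\<zeta> \<in> unit_circle"
  shows "2 * arc_infdist \<zeta> E \<le> infdist \<zeta> E" "infdist \<zeta> E \<le> 8 * arc_infdist \<zeta> E"
    "0 \<le> arc_infdist \<zeta> E" "arc_infdist \<zeta> E \<le> 1 / 2"
proof -
  define y where "y = arcsin (infdist \<zeta> E / 2)"
  have i: "0 \<le> infdist \<zeta> E / 2" "infdist \<zeta> E / 2 \<le> 1"
    using infdist_circle_le[OF E(2,3) z] by (auto simp: infdist_nonneg)
  have y: "0 \<le> y" "y \<le> pi / 2" "sin y = infdist \<zeta> E / 2"
    using i arcsin_bounded[of "infdist \<zeta> E / 2"] arcsin_le_arcsin[of 0 "infdist \<zeta> E / 2"] by (auto simp: y_def)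
  have a: "arc_infdist \<zeta> E = y / pi" by (simp add: arc_infdist_arcsin[OF E z] y_def)
  show "0 \<le> arc_infdist \<zeta> E" using a y by simp
  show "arc_infdist \<zeta> E \<le> 1 / 2" using y unfolding a by (simp add: pos_divide_le_eq)
  have "y / 3 \<le> sin y" using y pi_less_4 by (intro sin_lower) auto
  moreover have "3 * (y / pi) \<le> y"
    using y pi_gt3 mult_right_mono[of 3 pi y] by (simp add: divide_le_eq mult.commute)
  ultimately show "2 * arc_infdist \<zeta> E \<le> infdist \<zeta> E" using a y by linarith
  have "y \<le> 4 * (y / pi)" using y pi_less_4 mult_right_mono[of pi 4 y] by (simp add: pos_le_divide_eq mult.commute)
  moreover have "sin y \<le> y" using y by (intro sin_x_le_x) auto
  ultimately show "infdist \<zeta> E \<le> 8 * arc_infdist \<zeta> E" using a y by linarith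
qed

lemma arc_infdist_continuous:
  assumes E: "closed E" "E \<subseteq> unit_circle"
  shows "continuous_on unit_circle (\<lambda>\<zeta>. arc_infdist \<zeta> E)"
proof (cases "E = {}")
  case True
  then show ?thesis by (simp add: arc_infdist_def)
next
  case False
  have "continuous_on unit_circle (\<lambda>\<zeta>. arcsin (infdist \<zeta> E / 2) / pi)"
    using infdist_circle_le[OF False E(2)]
    by (intro continuous_intros) (auto intro: order_trans[OF _ infdist_nonneg])
  then show ?thesis
    by (rule continuous_on_eq) (simp add: arc_infdist_arcsin[OF E(1) False E(2)])
qed

lemma infdist_0_iff: "closed E \<Longrightarrow> E \<noteq> {} \<Longrightarrow> infdist \<zeta> E = 0 \<longleftrightarrow> \<zeta> \<in> E"
  by (simp add: in_closed_iff_infdist_zero)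

text \<open>The case distinction is for measurability: \<open>Arg2pi\<close> is continuous off the positive half-line.\<close>

definition turn :: "complex \<Rightarrow> real" where
  "turn \<zeta> = (if \<zeta> \<in> \<real>\<^sub>\<ge>\<^sub>0 then 0 else Arg2pi \<zeta> / (2 * pi))"

lemma turn_measurable [measurable]: "turn \<in> borel_measurable borel"
  unfolding turn_def[abs_def]
proof (rule borel_measurable_continuous_on_if)
  show "(\<real>\<^sub>\<ge>\<^sub>0 :: complex set) \<in> sets borel" by simp
  show "continuous_on (- \<real>\<^sub>\<ge>\<^sub>0) (\<lambda>\<zeta>. Arg2pi \<zeta> / (2 * pi))"
    by (intro continuous_intros) (auto intro!: continuous_at_imp_continuous_on continuous_at_Arg2pi)
qed (rule continuous_on_const)

lemma turn_range: "0 \<le> turn \<zeta>" "turn \<zeta> < 1"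
  using Arg2pi_ge_0[of \<zeta>] Arg2pi_lt_2pi[of \<zeta>] by (auto simp: turn_def)

lemma turn_eq: assumes "\<zeta> \<in> unit_circle" shows "\<zeta> = cis (2 * pi * turn \<zeta>)"
proof (cases "\<zeta> \<in> \<real>\<^sub>\<ge>\<^sub>0")
  case True
  then obtain x where "\<zeta> = of_real x" "0 \<le> x" by (auto elim: nonneg_Reals_cases)
  then show ?thesis using assms True by (auto simp: turn_def)
next
  case False
  then show ?thesis using Arg2pi_eq[of \<zeta>] assms by (simp add: turn_def cis_conv_exp mult.commute)
qed

lemma turn_cis: assumes "0 < t" "t < 1" shows "turn (cis (2 * pi * t)) = t"
proof -
  have *: "of_real 1 * exp (\<i> * of_real (2 * pi * t)) = cis (2 * pi * t)"
    by (simp add: cis_conv_exp)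
  have "Arg2pi (cis (2 * pi * t)) = 2 * pi * t"
    by (rule Arg2pi_unique[OF *]) (use assms in auto)
  moreover have "cis (2 * pi * t) \<notin> \<real>\<^sub>\<ge>\<^sub>0"
    using calculation assms Arg2pi_eq_0[of "cis (2 * pi * t)"]
    by (auto simp: complex_nonneg_Reals_iff complex_is_Real_iff)
  ultimately show ?thesis by (simp add: turn_def)
qed

section \<open>Division of the circle into cells\<close>

definition cell :: "nat \<Rightarrow> complex \<Rightarrow> nat" where
  "cell n \<zeta> = nat \<lfloor>real n * turn \<zeta>\<rfloor>"

lemma cell_measurable [measurable]: "cell n \<in> measurable borel (count_space UNIV)"
  unfolding cell_def[abs_def] by measurable

lemma cell_lt: "0 < n \<Longrightarrow> cell n \<zeta> < n"
proof -
  assume n: "0 < n"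
  have "real n * turn \<zeta> < real n * 1"
    using turn_range[of \<zeta>] n by (intro mult_strict_left_mono) auto
  then have "\<lfloor>real n * turn \<zeta>\<rfloor> < int n" by (simp add: floor_less_iff)
  then show ?thesis using n by (simp add: cell_def nat_less_iff)
qed

lemma mult_abs_diff: "0 \<le> c \<Longrightarrow> c * \<bar>a - b\<bar> = \<bar>c * a - c * (b::real)\<bar>"
  by (simp add: right_diff_distrib[symmetric] abs_mult)

lemma cell_center:
  assumes n: "0 < n" and z: "\<zeta> \<in> unit_circle"
  shows "cmod (\<zeta> - cis (2 * pi * (real (cell n \<zeta>) / real n))) \<le> 8 / real n"
proof -
  have c: "real (cell n \<zeta>) \<le> real n * turn \<zeta>" "real n * turn \<zeta> < real (cell n \<zeta>) + 1"
    using turn_range[of \<zeta>] by (auto simp: cell_def)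
  have "\<bar>turn \<zeta> - real (cell n \<zeta>) / real n\<bar> \<le> 1 / real n"
  proof -
    have "real n * \<bar>turn \<zeta> - real (cell n \<zeta>) / real n\<bar> = \<bar>real n * turn \<zeta> - real (cell n \<zeta>)\<bar>"
      using n mult_abs_diff[of "real n" "turn \<zeta>" "real (cell n \<zeta>) / real n"] by simp
    then show ?thesis using c n by (simp add: pos_le_divide_eq mult.commute)
  qed
  moreover have "cmod (cis (2 * pi * turn \<zeta>) - cis (2 * pi * (real (cell n \<zeta>) / real n))) \<le> 8 * \<bar>turn \<zeta> - real (cell n \<zeta>) / real n\<bar>"
    by (rule cis_chord_le)
  ultimately show ?thesis using turn_eq[OF z] by simp
qed

lemma cell_diameter:
  assumes n: "0 < n" and z: "\<zeta> \<in> unit_circle" "\<xi> \<in> unit_circle" and c: "cell n \<zeta> = cell n \<xi>"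
  shows "cmod (\<zeta> - \<xi>) \<le> 8 / real n"
proof -
  have 1: "real (cell n x) \<le> real n * turn x" "real n * turn x < real (cell n x) + 1" for x
    using turn_range[of x] by (auto simp: cell_def)
  have "\<bar>real n * turn \<zeta> - real n * turn \<xi>\<bar> \<le> 1"
    using 1[of \<zeta>] 1[of \<xi>] c by linarith
  moreover have "real n * \<bar>turn \<zeta> - turn \<xi>\<bar> = \<bar>real n * turn \<zeta> - real n * turn \<xi>\<bar>"
    by (rule mult_abs_diff) simp
  ultimately have "\<bar>turn \<zeta> - turn \<xi>\<bar> \<le> 1 / real n"
    using n by (simp add: pos_le_divide_eq mult.commute)
  then show ?thesis
    using cis_chord_le[of "turn \<zeta>" "turn \<xi>"] turn_eq[OF z(1)] turn_eq[OF z(2)] by simp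
qed

lemma cell_sets: "{\<zeta> \<in> unit_circle. cell n \<zeta> = j} \<in> sets circle_borel"
  by (rule circle_borel_Collect) measurable

lemma cell_measure:
  assumes n: "0 < n" and j: "j < n"
  shows "1 / real n \<le> measure circle_measure {\<zeta> \<in> unit_circle. cell n \<zeta> = j}"
proof -
  let ?A = "{\<zeta> \<in> unit_circle. cell n \<zeta> = j}"
  have "ennreal (1 / real n) = (\<integral>\<^sup>+ t. indicator {real j / real n<..<(real j + 1) / real n} t \<partial>lborel)"
    using n by (simp add: divide_right_mono diff_divide_distrib[symmetric])
  also have "\<dots> \<le> (\<integral>\<^sup>+ t. indicator ?A (cis (2 * pi * t)) * indicator {0..1} t \<partial>lborel)"
  proof (rule nn_integral_mono)
    fix t :: real
    have "cell n (cis (2 * pi * t)) = j" "0 < t" "t < 1" if t: "t \<in> {real j / real n<..<(real j + 1) / real n}"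
    proof -
      have "real j < real n * t" "real n * t < real j + 1" using t n by (auto simp: field_simps)
      moreover show "0 < t" using t j n by (auto intro: order.strict_trans1[of 0 "real j / real n"])
      moreover have "(real j + 1) / real n \<le> 1" using j n by (simp add: field_simps)
      then show "t < 1" using t by auto
      ultimately show "cell n (cis (2 * pi * t)) = j"
        using turn_cis[of t] by (simp add: cell_def) linarith
    qed
    then show "indicator {real j / real n<..<(real j + 1) / real n} t \<le> (indicator ?A (cis (2 * pi * t)) * indicator {0..1} t :: ennreal)"
      by (auto simp: indicator_def less_imp_le)
  qed
  also have "\<dots> = (\<integral>\<^sup>+ \<zeta>. indicator ?A \<zeta> \<partial>circle_measure)"
    by (intro nn_integral_circle[symmetric] borel_measurable_indicator cell_sets)
  also have "\<dots> = emeasure circle_measure ?A"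
    by (rule nn_integral_indicator) (simp only: sets_circle_measure cell_sets)
  also have "\<dots> = ennreal (measure circle_measure ?A)"
    by (rule circle.emeasure_eq_measure)
  finally show ?thesis by (simp add: measure_nonneg)
qed

section \<open>The decomposition of a measure along a sequence of scales\<close>

locale roberts = modulus w for w :: "real \<Rightarrow> real" +
  fixes \<nu> :: "complex measure" and n :: "nat \<Rightarrow> nat" and c :: real
  assumes nu: "finite_measure \<nu>" "sets \<nu> = sets circle_borel"
    and null: "\<And>E. finite_entropy w E \<Longrightarrow> emeasure \<nu> E = 0"
    and n_pos: "\<And>k. 0 < n k" and c_pos: "0 < c"
    and W_half: "\<And>k. W (1 / real (n k)) \<le> exp (- 1)"
    and W_step: "\<And>k. (W (1 / real (n k)))\<^sup>2 / 2 \<le> W (1 / real (n (Suc k)))"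
    and W_lim: "(\<lambda>k. W (1 / real (n k))) \<longlonglongrightarrow> 0"
begin

abbreviation "x k \<equiv> W (1 / real (n k))"

text \<open>At distance 1 / n from the circle the Poisson kernel is of order n. A measure with at
  most this mass on each cell therefore has a Poisson integral of order c ln (1 / x k)
  there.\<close>

definition cap :: "nat \<Rightarrow> real" where
  "cap k = c / real (n k) * ln (1 / x k)"

definition cell_mass :: "(complex \<Rightarrow> real) \<Rightarrow> nat \<Rightarrow> nat \<Rightarrow> real" where
  "cell_mass d k j = (\<integral> \<zeta>. d \<zeta> * of_bool (cell (n k) \<zeta> = j) \<partial>\<nu>)"

text \<open>The fraction of the density \<open>d\<close> on cell \<open>j\<close> that goes into the
  piece of step \<open>k\<close>; it is below 1 just when the mass of the cell exceeds
  \<open>cap k\<close>.\<close>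

definition keep :: "(complex \<Rightarrow> real) \<Rightarrow> nat \<Rightarrow> nat \<Rightarrow> real" where
  "keep d k j = (if cell_mass d k j \<le> cap k then 1 else cap k / cell_mass d k j)"

text \<open>\<open>rest k\<close> is the density of the mass not yet removed before step \<open>k\<close>; step \<open>k\<close> removes from
  each cell of length \<open>1 / n k\<close> as much mass as \<open>cap k\<close> allows.\<close>

primrec rest :: "nat \<Rightarrow> complex \<Rightarrow> real" where
  "rest 0 = (\<lambda>\<zeta>. 1)"
| "rest (Suc k) = (\<lambda>\<zeta>. rest k \<zeta> * (1 - keep (rest k) k (cell (n k) \<zeta>)))"

definition piece :: "nat \<Rightarrow> complex \<Rightarrow> real" where
  "piece k \<zeta> = rest k \<zeta> * keep (rest k) k (cell (n k) \<zeta>)"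

definition heavy :: "nat \<Rightarrow> nat set" where
  "heavy k = {j. j < n k \<and> cap k < cell_mass (rest k) k j}"

lemma measurable_nu: "measurable \<nu> N = measurable circle_borel N"
  by (rule circle_sets_measurable[OF nu(2)])

lemma space_nu [simp]: "space \<nu> = unit_circle"
  by (rule circle_sets_space[OF nu(2)])

sublocale nu: finite_measure \<nu> by (rule nu)

lemma x_pos: "0 < x k"
  using n_pos[of k] by (intro W_pos) simp

lemma ln_x: "1 \<le> ln (1 / x k)"
proof -
  have "ln (x k) \<le> -1"
    using ln_mono[OF W_half x_pos, of k] by simp
  then show ?thesis using x_pos[of k] by (simp add: ln_div)
qed

lemma cap_pos: "0 < cap k"
  unfolding cap_def using c_pos n_pos[of k] ln_x[of k] by (intro mult_pos_pos) auto

lemma keep_range: "0 \<le> keep d k j" "keep d k j \<le> 1"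
  using cap_pos[of k] by (auto simp: keep_def divide_le_eq_1)

lemma rest_range: "0 \<le> rest k \<zeta> \<and> rest k \<zeta> \<le> 1"
proof (induction k)
  case (Suc k)
  then show ?case
    using keep_range[of "rest k" k "cell (n k) \<zeta>"] by (auto intro!: mult_le_one)
qed simp

lemma rest_measurable [measurable]: "rest k \<in> borel_measurable borel"
  by (induction k) (simp_all, measurable)

lemma piece_measurable [measurable]: "piece k \<in> borel_measurable borel"
  unfolding piece_def[abs_def] by measurable

lemma piece_eq: "piece k \<zeta> = rest k \<zeta> - rest (Suc k) \<zeta>"
  by (simp add: piece_def algebra_simps)

lemma piece_range: "0 \<le> piece k \<zeta>" "piece k \<zeta> \<le> 1"
  unfolding piece_def using rest_range[of k \<zeta>] keep_range[of "rest k" k "cell (n k) \<zeta>"]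
  by (auto intro!: mult_le_one)

lemma sum_piece: "(\<Sum>k<N. piece k \<zeta>) + rest N \<zeta> = 1"
  by (induction N) (auto simp: piece_eq simp del: rest.simps(2))

lemma integrable_nu:
  fixes f :: "complex \<Rightarrow> real"
  assumes "f \<in> borel_measurable borel" "\<And>\<zeta>. \<bar>f \<zeta>\<bar> \<le> C"
  shows "integrable \<nu> f"
  by (rule nu.integrable_const_bound[where B = C])
     (use assms in \<open>auto simp: measurable_nu intro: circle_borel_measurable_borel\<close>)

lemma integrable_cell: "integrable \<nu> (\<lambda>\<zeta>. rest k \<zeta> * of_bool (cell (n k) \<zeta> = j))"
  "integrable \<nu> (\<lambda>\<zeta>. piece k \<zeta> * of_bool (cell (n k) \<zeta> = j))"
  "integrable \<nu> (piece k)" "integrable \<nu> (rest k)"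
  by (rule integrable_nu[where C = 1]; use rest_range[of k] piece_range[of k] in \<open>auto\<close>)+

lemma piece_cell_mass: "cell_mass (piece k) k j = keep (rest k) k j * cell_mass (rest k) k j"
proof -
  have "cell_mass (piece k) k j = (\<integral> \<zeta>. keep (rest k) k j * (rest k \<zeta> * of_bool (cell (n k) \<zeta> = j)) \<partial>\<nu>)"
    unfolding cell_mass_def piece_def by (intro Bochner_Integration.integral_cong) auto
  then show ?thesis by (simp add: cell_mass_def)
qed

lemma piece_cell_mass_le: "cell_mass (piece k) k j \<le> cap k"
  unfolding piece_cell_mass using cap_pos[of k] by (auto simp: keep_def)

lemma piece_cell_mass_heavy: "j \<in> heavy k \<Longrightarrow> cell_mass (piece k) k j = cap k"
  unfolding piece_cell_mass using cap_pos[of k] by (auto simp: keep_def heavy_def)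

lemma finite_heavy: "finite (heavy k)"
  by (simp add: heavy_def)

text \<open>A heavy cell contributes exactly \<open>cap k\<close> to the mass of the piece of step
  \<open>k\<close>, and the pieces add up to at most \<nu>.\<close>

lemma heavy_sum: "(\<Sum>k<N. real (card (heavy k)) * cap k) \<le> measure \<nu> unit_circle"
proof -
  have 1: "real (card (heavy k)) * cap k \<le> (\<integral> \<zeta>. piece k \<zeta> \<partial>\<nu>)" for k
  proof -
    have "real (card (heavy k)) * cap k = (\<Sum>j\<in>heavy k. cell_mass (piece k) k j)"
      by (simp add: piece_cell_mass_heavy)
    also have "\<dots> = (\<integral> \<zeta>. (\<Sum>j\<in>heavy k. piece k \<zeta> * of_bool (cell (n k) \<zeta> = j)) \<partial>\<nu>)"
      unfolding cell_mass_def by (rule Bochner_Integration.integral_sum[symmetric]) (rule integrable_cell)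
    also have "\<dots> \<le> (\<integral> \<zeta>. piece k \<zeta> \<partial>\<nu>)"
    proof (rule integral_mono)
      show "integrable \<nu> (\<lambda>\<zeta>. \<Sum>j\<in>heavy k. piece k \<zeta> * of_bool (cell (n k) \<zeta> = j))"
        by (intro Bochner_Integration.integrable_sum integrable_cell)
      fix \<zeta>
      have "(\<Sum>j\<in>heavy k. piece k \<zeta> * of_bool (cell (n k) \<zeta> = j)) = (\<Sum>j\<in>heavy k. if j = cell (n k) \<zeta> then piece k \<zeta> else 0)"
        by (intro sum.cong) auto
      also have "\<dots> \<le> piece k \<zeta>"
        using piece_range[of k \<zeta>] by (simp add: finite_heavy)
      finally show "(\<Sum>j\<in>heavy k. piece k \<zeta> * of_bool (cell (n k) \<zeta> = j)) \<le> piece k \<zeta>" .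
    qed (rule integrable_cell)
    finally show ?thesis .
  qed
  have "(\<Sum>k<N. real (card (heavy k)) * cap k) \<le> (\<Sum>k<N. \<integral> \<zeta>. piece k \<zeta> \<partial>\<nu>)"
    by (intro sum_mono 1)
  also have "\<dots> = (\<integral> \<zeta>. (\<Sum>k<N. piece k \<zeta>) \<partial>\<nu>)"
    by (rule Bochner_Integration.integral_sum[symmetric]) (rule integrable_cell)
  also have "\<dots> \<le> (\<integral> \<zeta>. 1 \<partial>\<nu>)"
  proof (rule integral_mono)
    show "integrable \<nu> (\<lambda>\<zeta>. \<Sum>k<N. piece k \<zeta>)"
      by (intro Bochner_Integration.integrable_sum integrable_cell)
    show "(\<Sum>k<N. piece k \<zeta>) \<le> 1" for \<zeta>
      using sum_piece[of \<zeta> N] rest_range[of N \<zeta>] by linarith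
  qed simp
  finally show ?thesis by simp
qed

lemma heavy_summable: "summable (\<lambda>k. real (card (heavy k)) * cap k)"
  by (rule summableI_nonneg_bounded[OF _ heavy_sum]) (intro mult_nonneg_nonneg less_imp_le[OF cap_pos], simp)

definition center :: "nat \<Rightarrow> nat \<Rightarrow> complex" where
  "center k j = cis (2 * pi * (real j / real (n k)))"

lemma center_circle: "center k j \<in> unit_circle"
  by (simp add: center_def)

text \<open>Closed arcs instead of cells make \<open>core\<close> closed. The radius 8 / n covers a
  whole cell around its initial point, and 16 / n covers in addition all points at arc distance less
  than 1 / n.\<close>

definition nbhd :: "nat \<Rightarrow> real \<Rightarrow> complex set" where
  "nbhd k r = (\<Union>j\<in>heavy k. {\<zeta> \<in> unit_circle. cmod (\<zeta> - center k j) \<le> r / real (n k)})"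

definition core :: "complex set" where
  "core = (\<Inter>k. nbhd k 8)"

lemma closed_nbhd: "closed (nbhd k r)"
proof -
  have "closed {\<zeta> \<in> unit_circle. cmod (\<zeta> - center k j) \<le> r / real (n k)}" for j
  proof -
    have "{\<zeta> \<in> unit_circle. cmod (\<zeta> - center k j) \<le> r / real (n k)} = unit_circle \<inter> cball (center k j) (r / real (n k))"
      by (auto simp: dist_norm norm_minus_commute)
    then show ?thesis by (simp add: closed_Int)
  qed
  then show ?thesis unfolding nbhd_def by (intro closed_UN finite_heavy) auto
qed

lemma nbhd_subset: "nbhd k r \<subseteq> unit_circle"
  by (auto simp: nbhd_def)

lemma nbhd_measure:
  assumes "0 \<le> r"
  shows "emeasure circle_measure (nbhd k r) \<le> ennreal (3 * r * (real (card (heavy k)) / real (n k)))"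
proof -
  have "emeasure circle_measure (nbhd k r)
     \<le> (\<Sum>j\<in>heavy k. emeasure circle_measure {\<zeta> \<in> unit_circle. cmod (\<zeta> - center k j) \<le> r / real (n k)})"
    unfolding nbhd_def
  proof (rule emeasure_subadditive_finite[OF finite_heavy])
    show "(\<lambda>j. {\<zeta> \<in> unit_circle. cmod (\<zeta> - center k j) \<le> r / real (n k)}) ` heavy k \<subseteq> sets circle_measure"
      unfolding sets_circle_measure by (intro image_subsetI circle_borel_Collect) measurable
  qed
  also have "\<dots> \<le> (\<Sum>j\<in>heavy k. ennreal (3 * (r / real (n k))))"
    by (intro sum_mono circle_measure_ball_le center_circle) (use assms in auto)
  also have "\<dots> = ennreal (3 * r * (real (card (heavy k)) / real (n k)))"
    using assms by (simp add: ennreal_of_nat_eq_real_of_nat ennreal_mult[symmetric] mult_ac)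
  finally show ?thesis .
qed

lemma closed_core: "closed core"
  unfolding core_def by (intro closed_INT) (auto intro: closed_nbhd)

lemma core_subset: "core \<subseteq> nbhd k 8" "core \<subseteq> unit_circle"
  using nbhd_subset[of 0 8] by (auto simp: core_def)

text \<open>As ln (1 / x k) \<ge> 1, the number of heavy cells divided by \<open>n k\<close> is at
  most 1 / c times a term of the convergent series \<open>heavy_summable\<close>, and so tends to
  0.\<close>

lemma core_null: "emeasure circle_measure core = 0"
proof -
  have bound: "emeasure circle_measure core \<le> ennreal (24 / c * (real (card (heavy k)) * cap k))" for k
  proof -
    have "emeasure circle_measure core \<le> emeasure circle_measure (nbhd k 8)"
      using closed_circle_borel[OF closed_nbhd nbhd_subset] core_subset
      by (intro emeasure_mono) (auto simp: sets_circle_measure)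
    also have "\<dots> \<le> ennreal (3 * 8 * (real (card (heavy k)) / real (n k)))"
      by (rule nbhd_measure) simp
    also have "\<dots> \<le> ennreal (24 / c * (real (card (heavy k)) * cap k))"
    proof (rule ennreal_leI)
      have "real (card (heavy k)) / real (n k) * 1 \<le> real (card (heavy k)) / real (n k) * ln (1 / x k)"
        by (intro mult_left_mono ln_x) auto
      then show "3 * 8 * (real (card (heavy k)) / real (n k)) \<le> 24 / c * (real (card (heavy k)) * cap k)"
        using c_pos by (simp add: cap_def field_simps)
    qed
    finally show ?thesis .
  qed
  have "(\<lambda>k. 24 / c * (real (card (heavy k)) * cap k)) \<longlonglongrightarrow> 24 / c * 0"
    by (intro tendsto_intros summable_LIMSEQ_zero heavy_summable)
  then have "(\<lambda>k. ennreal (24 / c * (real (card (heavy k)) * cap k))) \<longlonglongrightarrow> ennreal 0"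
    by (intro tendsto_ennrealI) simp
  then have "emeasure circle_measure core \<le> ennreal 0"
    by (rule LIMSEQ_le_const) (use bound in auto)
  then show ?thesis by simp
qed

text \<open>A point whose distance from the core is between two consecutive scales lies in the
  neighbourhood \<open>nbhd p 16\<close> for the larger one, and there ln (1 / w) is at most 3 ln (1
  / x p) up to a constant. The integral is thus bounded by the sum of these values times the
  measures of the neighbourhoods, which is a multiple of \<open>heavy_summable\<close>; 144 = 3 *
  48.\<close>

lemma core_entropy: "finite_entropy w core"
proof (cases "core = {}")
  case True
  then show ?thesis by (simp add: finite_entropy_def arc_infdist_def)
next
  case False
  note arc = arc_infdist_bounds[OF closed_core False core_subset(2)]
  let ?d = "\<lambda>\<zeta>. arc_infdist \<zeta> core"
  define C0 where "C0 = \<bar>ln (w 1)\<bar> + \<bar>ln (x 0)\<bar>"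
  have dpos: "0 < ?d \<zeta>" if "\<zeta> \<in> unit_circle - core" for \<zeta>
    using arc(2)[of \<zeta>] arc(3)[of \<zeta>] that infdist_0_iff[OF closed_core False, of \<zeta>] infdist_nonneg[of \<zeta> core] by force
  have nb: "\<zeta> \<in> nbhd k 16" if z: "\<zeta> \<in> unit_circle" and d: "?d \<zeta> < 1 / real (n k)" for k \<zeta>
  proof -
    obtain \<xi> where x: "\<xi> \<in> core" "infdist \<zeta> core = cmod (\<zeta> - \<xi>)"
      using infdist_attained[OF closed_core False] by blast
    obtain j where j: "j \<in> heavy k" "cmod (\<xi> - center k j) \<le> 8 / real (n k)"
      using x(1) core_subset(1)[of k] by (auto simp: nbhd_def)
    have "cmod (\<zeta> - \<xi>) \<le> 8 / real (n k)"
      using arc(2)[OF z] x(2) d by simp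
    then have "cmod (\<zeta> - center k j) \<le> 16 / real (n k)"
      using j(2) norm_triangle_ineq[of "\<zeta> - \<xi>" "\<xi> - center k j"] by simp
    then show ?thesis using z j by (auto simp: nbhd_def)
  qed
  have pt: "ennreal \<bar>ln (w (?d \<zeta>))\<bar> \<le> ennreal C0 + (\<Sum>k. ennreal (3 * ln (1 / x k)) * indicator (nbhd k 16) \<zeta>)"
    if z: "\<zeta> \<in> unit_circle - core" for \<zeta>
  proof -
    have zc: "\<zeta> \<in> unit_circle" using z by simp
    note d = dpos[OF z]
    have d1: "?d \<zeta> \<le> 1" using arc(4)[OF zc] by simp
    have Wd: "w (?d \<zeta>) = W (?d \<zeta>)" using d1 by (simp add: W_eq)
    have up: "ln (w (?d \<zeta>)) \<le> ln (w 1)"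
      using W_le[of "?d \<zeta>"] W_pos[OF d] d by (simp add: Wd)
    show ?thesis
    proof (cases "1 / real (n 0) \<le> ?d \<zeta>")
      case True
      have "x 0 \<le> W (?d \<zeta>)" using True by (intro W_mono) auto
      then have "ln (x 0) \<le> ln (w (?d \<zeta>))" using x_pos[of 0] by (simp add: Wd)
      then have "\<bar>ln (w (?d \<zeta>))\<bar> \<le> C0" using up by (simp add: C0_def)
      then have "ennreal \<bar>ln (w (?d \<zeta>))\<bar> \<le> ennreal C0" by (rule ennreal_leI)
      then show ?thesis by (rule order_trans) simp
    next
      case False
      have "\<forall>\<^sub>F k in sequentially. x k < W (?d \<zeta>)"
        using order_tendstoD(2)[OF W_lim W_pos[OF d]] .
      then obtain k where k: "x k < W (?d \<zeta>)" by (auto simp: eventually_sequentially)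
      have "1 / real (n k) \<le> ?d \<zeta>"
        using k W_mono[of "?d \<zeta>" "1 / real (n k)"] d by linarith
      \<comment> \<open>The first scale that is at most the distance. It exists because x k tends to
        0, and the distance is still below the preceding scale \<open>p\<close>.\<close>
      define m where "m = (LEAST k. 1 / real (n k) \<le> ?d \<zeta>)"
      have m: "1 / real (n m) \<le> ?d \<zeta>" unfolding m_def by (rule LeastI) fact
      have "m \<noteq> 0" using m False by (metis)
      then obtain p where p: "m = Suc p" by (cases m) auto
      have pd: "?d \<zeta> < 1 / real (n p)"
        using not_less_Least[of p "\<lambda>k. 1 / real (n k) \<le> ?d \<zeta>"] p by (simp add: m_def)
      \<comment> \<open>The next scale has modulus at least x p^2 / 2 by \<open>W_step\<close>.
        Since x p \<le> 1/2, a cube lies below this, hence the factor 3 in front of the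
        logarithm.\<close>
      have "x p ^ 3 \<le> x p ^ 2 / 2"
      proof -
        have "x p \<le> 1 / 2"
        proof -
          have "2 \<le> exp (1::real)" using exp_ge_add_one_self[of "1::real"] by simp
          then have "exp (- (1::real)) \<le> 1 / 2" by (simp add: exp_minus inverse_eq_divide field_simps)
          then show ?thesis using W_half[of p] by linarith
        qed
        then show ?thesis using x_pos[of p] mult_left_mono[of "x p" "1/2" "x p * x p"] by (simp add: power3_eq_cube power2_eq_square)
      qed
      also have "\<dots> \<le> x m" using W_step[of p] p by simp
      also have "\<dots> \<le> W (?d \<zeta>)" using m by (intro W_mono) auto
      finally have "ln (x p ^ 3) \<le> ln (w (?d \<zeta>))"
        unfolding Wd using x_pos[of p] by (intro ln_mono) auto
      then have "3 * ln (x p) \<le> ln (w (?d \<zeta>))" using x_pos[of p] by (simp add: ln_realpow)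
      then have "\<bar>ln (w (?d \<zeta>))\<bar> \<le> C0 + 3 * ln (1 / x p)"
        using up x_pos[of p] ln_x[of p] by (simp add: C0_def ln_div)
      then have "ennreal \<bar>ln (w (?d \<zeta>))\<bar> \<le> ennreal C0 + ennreal (3 * ln (1 / x p))"
      proof -
        have "0 \<le> C0" "0 \<le> 3 * ln (1 / x p)" using ln_x[of p] by (auto simp: C0_def)
        from ennreal_plus[OF this] show ?thesis
          using ennreal_leI[OF \<open>\<bar>ln (w (?d \<zeta>))\<bar> \<le> C0 + 3 * ln (1 / x p)\<close>] by simp
      qed
      also have "ennreal (3 * ln (1 / x p)) = ennreal (3 * ln (1 / x p)) * indicator (nbhd p 16) \<zeta>"
        using nb[OF zc pd] by simp
      also have "\<dots> \<le> (\<Sum>k. ennreal (3 * ln (1 / x k)) * indicator (nbhd k 16) \<zeta>)"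
      proof -
        define F where "F k = ennreal (3 * ln (1 / x k)) * indicator (nbhd k 16) \<zeta>" for k
        have "F p \<le> (\<Sum>k. F k)" using sum_le_suminf[of F "{p}"] by simp
        then show ?thesis by (simp only: F_def)
      qed
      finally show ?thesis by (simp add: add_left_mono)
    qed
  qed
  have lnm: "(\<lambda>\<zeta>. ln (w (?d \<zeta>))) \<in> borel_measurable circle_measure"
  proof -
    have "continuous_on unit_circle (\<lambda>\<zeta>. W (?d \<zeta>))"
      using arc(3) by (intro W_continuous_comp arc_infdist_continuous closed_core core_subset)
    then have "(\<lambda>\<zeta>. ln (W (?d \<zeta>))) \<in> borel_measurable circle_measure"
      by (intro borel_measurable_ln circle_measurable_continuous)
    then show ?thesis
      by (rule measurable_cong[THEN iffD1, rotated]) (use arc(4) in \<open>force simp: W_eq\<close>)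
  qed
  have nm: "nbhd k 16 \<in> sets circle_measure" for k
    unfolding sets_circle_measure by (rule closed_circle_borel[OF closed_nbhd nbhd_subset])
  have "AE \<zeta> in circle_measure. \<zeta> \<notin> core"
    using core_null closed_circle_borel[OF closed_core core_subset(2)]
    by (intro AE_not_in) (auto simp: null_sets_def sets_circle_measure)
  then have "AE \<zeta> in circle_measure. ennreal (norm (ln (w (?d \<zeta>))))
      \<le> ennreal C0 + (\<Sum>k. ennreal (3 * ln (1 / x k)) * indicator (nbhd k 16) \<zeta>)"
    using AE_space
  proof eventually_elim
    case (elim \<zeta>)
    then show ?case using pt[of \<zeta>] by simp
  qed
  then have "(\<integral>\<^sup>+ \<zeta>. ennreal (norm (ln (w (?d \<zeta>)))) \<partial>circle_measure)
      \<le> (\<integral>\<^sup>+ \<zeta>. ennreal C0 + (\<Sum>k. ennreal (3 * ln (1 / x k)) * indicator (nbhd k 16) \<zeta>) \<partial>circle_measure)"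
    by (rule nn_integral_mono_AE)
  also have "\<dots> = ennreal C0 + (\<Sum>k. ennreal (3 * ln (1 / x k)) * emeasure circle_measure (nbhd k 16))"
    using nm by (subst nn_integral_add) (auto simp: nn_integral_suminf nn_integral_cmult_indicator)
  also have "\<dots> \<le> ennreal C0 + (\<Sum>k. ennreal (144 / c * (real (card (heavy k)) * cap k)))"
  proof (intro add_left_mono suminf_le)
    fix k
    have "ennreal (3 * ln (1 / x k)) * emeasure circle_measure (nbhd k 16)
        \<le> ennreal (3 * ln (1 / x k)) * ennreal (3 * 16 * (real (card (heavy k)) / real (n k)))"
      by (intro mult_left_mono nbhd_measure) auto
    also have "\<dots> = ennreal (144 / c * (real (card (heavy k)) * cap k))"
      using ln_x[of k] c_pos by (subst ennreal_mult[symmetric]) (auto simp: cap_def field_simps)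
    finally show "ennreal (3 * ln (1 / x k)) * emeasure circle_measure (nbhd k 16)
      \<le> ennreal (144 / c * (real (card (heavy k)) * cap k))" .
  qed auto
  also have "\<dots> < \<infinity>"
  proof -
    have "summable (\<lambda>k. 144 / c * (real (card (heavy k)) * cap k))"
      by (intro summable_mult heavy_summable)
    then have "(\<Sum>k. ennreal (144 / c * (real (card (heavy k)) * cap k))) \<noteq> top"
      by (rule ennreal_suminf_neq_top)
         (intro mult_nonneg_nonneg divide_nonneg_pos less_imp_le[OF cap_pos] c_pos; simp)
    then show ?thesis
      unfolding infinity_ennreal_def less_top by (intro ennreal_add_less_top[THEN iffD2] conjI ennreal_less_top)
  qed
  finally have "integrable circle_measure (\<lambda>\<zeta>. ln (w (?d \<zeta>)))"
    using lnm by (intro integrableI_bounded) auto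
  then show ?thesis
    using closed_core core_subset core_null by (simp add: finite_entropy_def)
qed

lemma rest_antimono: "rest (k + l) \<zeta> \<le> rest k \<zeta>"
proof (induction l)
  case (Suc l)
  then show ?case using piece_eq[of "k + l" \<zeta>] piece_range[of "k + l" \<zeta>] by (simp del: rest.simps)
qed simp

text \<open>Outside the core the cell of \<zeta> fails to be heavy at some step, and that step
  removes everything left at \<zeta>.\<close>

lemma rest_eventually_0:
  assumes "\<zeta> \<in> unit_circle" "\<zeta> \<notin> core"
  shows "(\<lambda>k. rest k \<zeta>) \<longlonglongrightarrow> 0"
proof -
  obtain k where k: "\<zeta> \<notin> nbhd k 8" using assms by (auto simp: core_def)
  have "cell (n k) \<zeta> \<notin> heavy k"
    using cell_center[OF n_pos assms(1), of k] k assms(1) by (auto simp: nbhd_def center_def)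
  then have "keep (rest k) k (cell (n k) \<zeta>) = 1"
    using cell_lt[OF n_pos, of k \<zeta>] by (auto simp: heavy_def keep_def)
  then have "rest (Suc k) \<zeta> = 0" by simp
  then have "rest (Suc k + l) \<zeta> = 0" for l
    using rest_antimono[of "Suc k" l \<zeta>] rest_range[of "Suc k + l" \<zeta>] by linarith
  then have "\<forall>\<^sub>F l in sequentially. rest l \<zeta> = 0"
    unfolding eventually_sequentially by (metis le_add_diff_inverse)
  then show ?thesis by (rule tendsto_eventually)
qed

text \<open>Here the hypothesis on \<nu> enters: the core is a set of finite entropy, so it has no
  mass, and off the core the remainders tend to 0.\<close>

lemma rest_tendsto_0: "(\<lambda>k. \<integral> \<zeta>. rest k \<zeta> \<partial>\<nu>) \<longlonglongrightarrow> 0"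
proof -
  have "AE \<zeta> in \<nu>. \<zeta> \<notin> core"
    using null[OF core_entropy] closed_circle_borel[OF closed_core core_subset(2)] nu(2)
    by (intro AE_not_in) (auto simp: null_sets_def)
  then have ae: "AE \<zeta> in \<nu>. (\<lambda>k. rest k \<zeta>) \<longlonglongrightarrow> 0"
    using AE_space by eventually_elim (rule rest_eventually_0, auto)
  have "(\<lambda>k. \<integral> \<zeta>. rest k \<zeta> \<partial>\<nu>) \<longlonglongrightarrow> (\<integral> \<zeta>. 0 \<partial>\<nu>)"
    by (rule integral_dominated_convergence[where w = "\<lambda>_. 1"])
       (use ae rest_range borel_measurable_integrable[OF integrable_cell(4)] in auto)
  then show ?thesis by simp
qed

text \<open>On each cell \<open>P\<close> is at most \<open>H\<close> times its mean over the cell,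
  a cell has measure at least 1 / n, and the piece has mass at most \<open>cap k\<close> on it.
  Summation over the cells uses only the total integral of \<open>P\<close>.\<close>

lemma piece_sum_mass:
  assumes P: "P \<in> borel_measurable borel" "\<And>\<zeta>. \<zeta> \<in> unit_circle \<Longrightarrow> 0 \<le> P \<zeta>" "\<And>\<zeta>. \<zeta> \<in> unit_circle \<Longrightarrow> P \<zeta> \<le> B"
    and harnack: "\<And>\<zeta> \<xi>. \<zeta> \<in> unit_circle \<Longrightarrow> \<xi> \<in> unit_circle \<Longrightarrow> cmod (\<zeta> - \<xi>) \<le> 8 / real (n k) \<Longrightarrow> P \<zeta> \<le> H * P \<xi>"
    and H: "0 \<le> H" and one: "(\<integral> \<zeta>. P \<zeta> \<partial>circle_measure) \<le> 1"
  shows "(\<integral> \<zeta>. piece k \<zeta> * P \<zeta> \<partial>\<nu>) \<le> H * real (n k) * cap k"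
proof -
  let ?n = "n k"
  define g where "g j = (\<integral> \<xi>. P \<xi> * of_bool (cell ?n \<xi> = j) \<partial>circle_measure)" for j
  note [measurable] = P(1)
  have iPc: "integrable circle_measure (\<lambda>\<xi>. P \<xi> * of_bool (cell ?n \<xi> = j))" for j
    using P by (intro circle_integrable_bounded[where C = B] circle_borel_measurable_borel) (auto intro: order_trans)
  have g0: "0 \<le> g j" for j
    unfolding g_def by (rule Bochner_Integration.integral_nonneg) (use P in auto)
  have gsum: "(\<Sum>j<?n. g j) \<le> 1"
  proof -
    have "(\<Sum>j<?n. g j) = (\<integral> \<xi>. (\<Sum>j<?n. P \<xi> * of_bool (cell ?n \<xi> = j)) \<partial>circle_measure)"
      unfolding g_def by (rule Bochner_Integration.integral_sum[symmetric]) (rule iPc)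
    also have "\<dots> = (\<integral> \<xi>. P \<xi> \<partial>circle_measure)"
    proof (rule Bochner_Integration.integral_cong[OF refl])
      fix \<xi>
      have "(\<Sum>j<?n. P \<xi> * of_bool (cell ?n \<xi> = j)) = (\<Sum>j<?n. if j = cell ?n \<xi> then P \<xi> else 0)"
        by (intro sum.cong) auto
      then show "(\<Sum>j<?n. P \<xi> * of_bool (cell ?n \<xi> = j)) = P \<xi>"
        using cell_lt[OF n_pos, of k \<xi>] by simp
    qed
    finally show ?thesis using one by simp
  qed
  have Pg: "P \<zeta> \<le> H * real ?n * g (cell ?n \<zeta>)" if z: "\<zeta> \<in> unit_circle" for \<zeta>
  proof -
    let ?A = "{\<xi> \<in> unit_circle. cell ?n \<xi> = cell ?n \<zeta>}"
    have A: "?A \<in> sets circle_measure" using cell_sets by (simp add: sets_circle_measure)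
    have "P \<zeta> * (1 / real ?n) \<le> P \<zeta> * measure circle_measure ?A"
      using z P by (intro mult_left_mono cell_measure n_pos cell_lt) auto
    also have "\<dots> = (\<integral> \<xi>. P \<zeta> * indicator ?A \<xi> \<partial>circle_measure)"
      using sets.Int_space_eq2[OF A] by simp
    also have "\<dots> \<le> (\<integral> \<xi>. H * (P \<xi> * of_bool (cell ?n \<xi> = cell ?n \<zeta>)) \<partial>circle_measure)"
    proof (rule integral_mono)
      show "integrable circle_measure (\<lambda>\<xi>. P \<zeta> * indicator ?A \<xi>)"
        using A by (intro integrable_mult_right integrable_real_indicator) (auto simp: circle.emeasure_eq_measure)
      show "P \<zeta> * indicator ?A \<xi> \<le> H * (P \<xi> * of_bool (cell ?n \<xi> = cell ?n \<zeta>))" if "\<xi> \<in> space circle_measure" for \<xi>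
        using harnack[OF z, of \<xi>] cell_diameter[OF n_pos z, of \<xi> k] that by (auto simp: indicator_def)
    qed (intro integrable_mult_right iPc)
    also have "\<dots> = H * g (cell ?n \<zeta>)" by (simp add: g_def)
    finally show ?thesis using n_pos[of k] by (simp add: field_simps)
  qed
  have "(\<integral> \<zeta>. piece k \<zeta> * P \<zeta> \<partial>\<nu>) \<le> (\<integral> \<zeta>. (\<Sum>j<?n. H * real ?n * g j * (piece k \<zeta> * of_bool (cell ?n \<zeta> = j))) \<partial>\<nu>)"
  proof (rule integral_mono)
    show "integrable \<nu> (\<lambda>\<zeta>. piece k \<zeta> * P \<zeta>)"
      by (rule nu.integrable_const_bound[where B = B])
         (use P piece_range[of k] in \<open>auto simp: measurable_nu abs_mult intro!: circle_borel_measurable_borel AE_I2 order_trans[OF mult_left_le_one_le]\<close>)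
    show "integrable \<nu> (\<lambda>\<zeta>. \<Sum>j<?n. H * real ?n * g j * (piece k \<zeta> * of_bool (cell ?n \<zeta> = j)))"
      by (intro Bochner_Integration.integrable_sum integrable_mult_right integrable_cell)
    fix \<zeta> assume "\<zeta> \<in> space \<nu>"
    then have z: "\<zeta> \<in> unit_circle" by simp
    have "(\<Sum>j<?n. H * real ?n * g j * (piece k \<zeta> * of_bool (cell ?n \<zeta> = j))) = (\<Sum>j<?n. if j = cell ?n \<zeta> then H * real ?n * g j * piece k \<zeta> else 0)"
      by (intro sum.cong) auto
    also have "\<dots> = piece k \<zeta> * (H * real ?n * g (cell ?n \<zeta>))"
      using cell_lt[OF n_pos, of k \<zeta>] by simp
    finally show "piece k \<zeta> * P \<zeta> \<le> (\<Sum>j<?n. H * real ?n * g j * (piece k \<zeta> * of_bool (cell ?n \<zeta> = j)))"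
      using Pg[OF z] piece_range[of k \<zeta>] by (simp add: mult_left_mono)
  qed
  also have "\<dots> = (\<Sum>j<?n. H * real ?n * g j * cell_mass (piece k) k j)"
    by (subst Bochner_Integration.integral_sum) (auto intro!: integrable_mult_right integrable_cell simp: cell_mass_def)
  also have "\<dots> \<le> (\<Sum>j<?n. H * real ?n * g j * cap k)"
    using H g0 by (intro sum_mono mult_left_mono piece_cell_mass_le) auto
  also have "\<dots> = H * real ?n * cap k * (\<Sum>j<?n. g j)"
    by (simp add: sum_distrib_left sum_distrib_right mult_ac)
  also have "\<dots> \<le> H * real ?n * cap k * 1"
    using H gsum cap_pos[of k] by (intro mult_left_mono) auto
  finally show ?thesis by simp
qed

end

section \<open>Herglotz integrals\<close>

text \<open>Poles and density are separate parameters. The identity as \<open>\<xi>\<close> gives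
  the singular inner functions of parts of a measure; poles moved off the circle give the outer
  functions.\<close>

definition herglotz :: "'a measure \<Rightarrow> ('a \<Rightarrow> complex) \<Rightarrow> ('a \<Rightarrow> real) \<Rightarrow> complex \<Rightarrow> complex" where
  "herglotz M \<xi> d z = (\<integral> x. of_real (d x) * ((\<xi> x + z) / (\<xi> x - z)) \<partial>M)"

lemma singular_inner_herglotz: "singular_inner \<mu> z = exp (- herglotz \<mu> (\<lambda>\<zeta>. \<zeta>) (\<lambda>_. 1) z)"
  by (simp add: singular_inner_def herglotz_def)

lemma Re_herglotz_kernel: "Re ((\<xi> + z) / (\<xi> - z)) = ((cmod \<xi>)\<^sup>2 - (cmod z)\<^sup>2) / (cmod (\<xi> - z))\<^sup>2"
  unfolding Re_divide cmod_power2 by (simp add: power2_eq_square algebra_simps)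

lemma Re_of_real_mult: "Re (of_real a * z) = a * Re z"
  by simp

lemma exp_diff_le:
  assumes "Re a \<le> c" "Re b \<le> c"
  shows "cmod (exp a - exp b) \<le> exp c * cmod (a - b)"
proof (rule field_differentiable_bound[where S = "{z. Re z \<le> c}" and f = exp and f' = exp])
  show "convex {z. Re z \<le> c}" by (rule convex_halfspace_Re_le)
qed (use assms in \<open>auto intro!: derivative_eq_intros\<close>)

lemma harnack_frac: "0 \<le> N \<Longrightarrow> 0 < a \<Longrightarrow> 0 < b \<Longrightarrow> b \<le> c * a \<Longrightarrow> N / a \<le> c * (N / (b::real))"
  using mult_left_mono[of b "c * a" N] by (simp add: divide_simps mult_ac)

lemma herglotz_kernel_diff:
  fixes \<xi> z z' :: complex
  assumes "\<xi> \<noteq> z" "\<xi> \<noteq> z'"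
  shows "(\<xi> + z) / (\<xi> - z) - (\<xi> + z') / (\<xi> - z') = 2 * \<xi> * (z - z') / ((\<xi> - z) * (\<xi> - z'))"
  using assms by (simp add: field_simps)

locale herglotz_data =
  fixes M :: "'a measure" and \<xi> :: "'a \<Rightarrow> complex" and d :: "'a \<Rightarrow> real"
  assumes xi_meas [measurable]: "\<xi> \<in> borel_measurable M"
    and xi_ge: "\<And>x. x \<in> space M \<Longrightarrow> 1 \<le> cmod (\<xi> x)"
    and d_int: "integrable M d"
    and d_nonneg: "\<And>x. x \<in> space M \<Longrightarrow> 0 \<le> d x"
begin

abbreviation kern :: "complex \<Rightarrow> 'a \<Rightarrow> complex" where
  "kern z x \<equiv> of_real (d x) * ((\<xi> x + z) / (\<xi> x - z))"

lemma d_meas [measurable]: "d \<in> borel_measurable M"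
  using d_int by (rule borel_measurable_integrable)

lemma kernel_bound:
  assumes "x \<in> space M" "z \<in> unit_disc"
  shows "cmod ((\<xi> x + z) / (\<xi> x - z)) \<le> 2 / (1 - cmod z)"
proof -
  define s t where "s = cmod (\<xi> x)" "t = cmod z"
  have st: "1 \<le> s" "0 \<le> t" "t < 1" using assms xi_ge by (auto simp: s_t_def)
  have "cmod ((\<xi> x + z) / (\<xi> x - z)) \<le> (s + t) / (s - t)"
    unfolding norm_divide s_t_def using st norm_triangle_ineq[of "\<xi> x" z] norm_triangle_ineq2[of "\<xi> x" z]
    by (intro frac_le) (auto simp: s_t_def)
  also have "\<dots> \<le> 2 / (1 - t)"
  proof -
    have "t * 1 \<le> t * s" using st by (intro mult_left_mono) auto
    moreover have "0 \<le> (1 - t) * (1 - t)" using st by simp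
    ultimately have "(s + t) * (1 - t) \<le> 2 * (s - t)"
      using st by (simp add: algebra_simps)
    then show ?thesis using st by (simp add: divide_simps)
  qed
  finally show ?thesis by (simp add: s_t_def)
qed

lemma integrable_kernel:
  assumes "z \<in> unit_disc"
  shows "integrable M (kern z)"
proof (rule Bochner_Integration.integrable_bound)
  show "integrable M (\<lambda>x. d x * (2 / (1 - cmod z)))" by (intro integrable_mult_left d_int)
  show "AE x in M. norm (kern z x) \<le> norm (d x * (2 / (1 - cmod z)))"
  proof (rule AE_I2)
    fix x assume x: "x \<in> space M"
    have "d x * cmod ((\<xi> x + z) / (\<xi> x - z)) \<le> d x * (2 / (1 - cmod z))"
      by (intro mult_left_mono kernel_bound x assms d_nonneg)
    moreover have "0 \<le> d x * (2 / (1 - cmod z))" using d_nonneg[OF x] assms by simp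
    ultimately show "norm (kern z x) \<le> norm (d x * (2 / (1 - cmod z)))"
      using d_nonneg[OF x] by (simp only: norm_mult norm_of_real real_norm_def abs_of_nonneg)
  qed
qed measurable

text \<open>The kernel is 1 + 2 * (sum of (z / \<xi>)^n over n \<ge> 1), dominated by a geometric
  series because |\<xi>| \<ge> 1; integrating term by term gives a power series.\<close>

lemma herglotz_holomorphic: "herglotz M \<xi> d holomorphic_on unit_disc"
proof -
  define t where "t z n x = of_real (d x) * ((if n = 0 then 1 else 2) * (z / \<xi> x) ^ n)" for z n x
  have bound: "cmod (t z n x) \<le> 2 * d x * cmod z ^ n" if x: "x \<in> space M" for z n x
  proof -
    have "cmod (z / \<xi> x) \<le> cmod z"
      using xi_ge[OF x] divide_left_mono[of 1 "cmod (\<xi> x)" "cmod z"] by (cases "\<xi> x = 0") (auto simp: norm_divide)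
    then have "cmod ((if n = 0 then 1 else 2) * (z / \<xi> x) ^ n) \<le> 2 * cmod z ^ n"
      unfolding norm_mult norm_power by (intro mult_mono power_mono) auto
    from mult_left_mono[OF this d_nonneg[OF x]] show ?thesis
      using d_nonneg[OF x] by (simp only: t_def norm_mult[of "of_real _"] norm_of_real abs_of_nonneg)
  qed
  have int: "integrable M (t z n)" for z n
  proof (rule Bochner_Integration.integrable_bound[of M "\<lambda>x. 2 * d x * cmod z ^ n"])
    show "AE x in M. norm (t z n x) \<le> norm (2 * d x * cmod z ^ n)"
      using order_trans[OF bound abs_ge_self] by (auto intro!: AE_I2)
  qed (use d_int in \<open>auto simp: t_def[abs_def]\<close>)
  have "(\<lambda>n. (\<integral> x. t 1 n x \<partial>M) * (z - 0) ^ n) sums herglotz M \<xi> d z" if z: "z \<in> unit_disc" for z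
  proof -
    have pt: "(\<lambda>n. t z n x) sums kern z x" if x: "x \<in> space M" for x
    proof -
      have nz: "\<xi> x \<noteq> 0" "\<xi> x \<noteq> z" and "cmod (z / \<xi> x) < 1"
        using xi_ge[OF x] z by (auto simp: norm_divide divide_less_eq)
      then have "(\<lambda>n. 2 * (z / \<xi> x) ^ n - (if n = 0 then 1 else 0)) sums (2 * (1 / (1 - z / \<xi> x)) - 1)"
        by (intro sums_diff sums_mult geometric_sums sums_single)
      moreover have "2 * (1 / (1 - z / \<xi> x)) - 1 = (\<xi> x + z) / (\<xi> x - z)" using nz by (simp add: field_simps)
      moreover have "2 * (z / \<xi> x) ^ n - (if n = 0 then 1 else 0) = (if n = 0 then 1 else 2) * (z / \<xi> x) ^ n" for n by simp
      ultimately show ?thesis unfolding t_def by (intro sums_mult) simp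
    qed
    have sg: "summable (\<lambda>n. cmod z ^ n)" using z by (simp add: summable_geometric)
    have "(\<lambda>n. \<integral> x. t z n x \<partial>M) sums (\<integral> x. (\<Sum>n. t z n x) \<partial>M)"
    proof (rule sums_integral[OF int])
      show "AE x in M. summable (\<lambda>n. norm (t z n x))"
        by (intro AE_I2 summable_comparison_test'[OF summable_mult[OF sg]]) (use bound in auto)
      show "summable (\<lambda>n. \<integral> x. norm (t z n x) \<partial>M)"
      proof (rule summable_comparison_test'[OF summable_mult[OF sg, of "\<integral> x. 2 * d x \<partial>M"]])
        fix n
        have "(\<integral> x. norm (t z n x) \<partial>M) \<le> (\<integral> x. 2 * d x * cmod z ^ n \<partial>M)"
          using d_int by (intro integral_mono integrable_norm int bound) auto
        then show "norm (\<integral> x. norm (t z n x) \<partial>M) \<le> (\<integral> x. 2 * d x \<partial>M) * cmod z ^ n" by simp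
      qed
    qed
    moreover have "t z n x = t 1 n x * z ^ n" for n x by (simp add: t_def power_divide)
    moreover have "(\<integral> x. (\<Sum>n. t z n x) \<partial>M) = herglotz M \<xi> d z"
      unfolding herglotz_def by (intro Bochner_Integration.integral_cong refl sums_unique[symmetric] pt)
    ultimately show ?thesis by simp
  qed
  then show ?thesis by (intro power_series_holomorphic) auto
qed

lemma herglotz_0: "herglotz M \<xi> d 0 = of_real (\<integral> x. d x \<partial>M)"
proof -
  have "herglotz M \<xi> d 0 = (\<integral> x. of_real (d x) \<partial>M)"
    unfolding herglotz_def
  proof (rule Bochner_Integration.integral_cong[OF refl])
    fix x assume "x \<in> space M"
    then have "\<xi> x \<noteq> 0" using xi_ge[of x] by auto
    then show "of_real (d x) * ((\<xi> x + 0) / (\<xi> x - 0)) = complex_of_real (d x)" by simp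
  qed
  then show ?thesis by simp
qed

lemma Re_herglotz:
  assumes "integrable M (kern z)"
  shows "Re (herglotz M \<xi> d z) = (\<integral> x. d x * (((cmod (\<xi> x))\<^sup>2 - (cmod z)\<^sup>2) / (cmod (\<xi> x - z))\<^sup>2) \<partial>M)"
    "integrable M (\<lambda>x. d x * (((cmod (\<xi> x))\<^sup>2 - (cmod z)\<^sup>2) / (cmod (\<xi> x - z))\<^sup>2))"
proof -
  have eq: "Re (kern z x) = d x * (((cmod (\<xi> x))\<^sup>2 - (cmod z)\<^sup>2) / (cmod (\<xi> x - z))\<^sup>2)" for x
    unfolding Re_herglotz_kernel[symmetric] by (rule Re_of_real_mult)
  show "Re (herglotz M \<xi> d z) = (\<integral> x. d x * (((cmod (\<xi> x))\<^sup>2 - (cmod z)\<^sup>2) / (cmod (\<xi> x - z))\<^sup>2) \<partial>M)"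
    unfolding herglotz_def eq[symmetric] using integral_Re[OF assms] by simp
  show "integrable M (\<lambda>x. d x * (((cmod (\<xi> x))\<^sup>2 - (cmod z)\<^sup>2) / (cmod (\<xi> x - z))\<^sup>2))"
    unfolding eq[symmetric] by (rule integrable_Re[OF assms])
qed

text \<open>Integrability of the kernel as the hypothesis, with |z| \<le> 1, covers also the points
  of the circle that keep a distance from the poles.\<close>

lemma Re_herglotz_nonneg:
  assumes "integrable M (kern z)" "cmod z \<le> 1"
  shows "0 \<le> Re (herglotz M \<xi> d z)"
  unfolding Re_herglotz(1)[OF assms(1)]
proof (rule Bochner_Integration.integral_nonneg)
  fix x assume "x \<in> space M"
  then show "0 \<le> d x * (((cmod (\<xi> x))\<^sup>2 - (cmod z)\<^sup>2) / (cmod (\<xi> x - z))\<^sup>2)"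
    using assms(2) d_nonneg[of x] xi_ge[of x]
    by (intro mult_nonneg_nonneg divide_nonneg_nonneg) (auto intro!: power_mono)
qed

lemma exp_herglotz_contractive: "contractive (\<lambda>z. exp (- herglotz M \<xi> d z))"
proof (rule contractiveI)
  show "(\<lambda>z. exp (- herglotz M \<xi> d z)) holomorphic_on unit_disc"
    by (intro holomorphic_intros herglotz_holomorphic)
  show "cmod (exp (- herglotz M \<xi> d z)) \<le> 1" if "z \<in> unit_disc" for z
    using Re_herglotz_nonneg[OF integrable_kernel[OF that]] that by simp
qed

lemma herglotz_diff_le:
  assumes z: "integrable M (kern z)"
    and z': "integrable M (kern z')"
    and ne: "AE x in M. \<xi> x \<noteq> z \<and> \<xi> x \<noteq> z'"
    and g: "integrable M g" "AE x in M. d x * (2 * cmod (\<xi> x) * cmod (z - z') / (cmod (\<xi> x - z) * cmod (\<xi> x - z'))) \<le> g x"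
  shows "cmod (herglotz M \<xi> d z - herglotz M \<xi> d z') \<le> (\<integral> x. g x \<partial>M)"
proof -
  have "cmod (herglotz M \<xi> d z - herglotz M \<xi> d z') = cmod (\<integral> x. kern z x - kern z' x \<partial>M)"
    unfolding herglotz_def by (rule arg_cong[OF Bochner_Integration.integral_diff[symmetric, OF z z']])
  also have "\<dots> \<le> (\<integral> x. norm (kern z x - kern z' x) \<partial>M)"
    by (rule integral_norm_bound)
  also have "\<dots> \<le> (\<integral> x. g x \<partial>M)"
  proof (rule integral_mono_AE)
    show "integrable M (\<lambda>x. norm (kern z x - kern z' x))"
      by (rule integrable_norm) (rule Bochner_Integration.integrable_diff[OF z z'])
    show "integrable M g" by (rule g(1))
    show "AE x in M. norm (kern z x - kern z' x) \<le> g x"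
      using ne g(2) AE_space
    proof eventually_elim
      case (elim x)
      have e: "kern z x - kern z' x
          = of_real (d x) * (2 * \<xi> x * (z - z') / ((\<xi> x - z) * (\<xi> x - z')))"
        unfolding right_diff_distrib[symmetric] using elim(1)
        by (intro arg_cong2[of _ _ _ _ "(*)"] refl herglotz_kernel_diff) auto
      have "norm (of_real (d x) * (2 * \<xi> x * (z - z') / ((\<xi> x - z) * (\<xi> x - z'))))
          = d x * (2 * cmod (\<xi> x) * cmod (z - z') / (cmod (\<xi> x - z) * cmod (\<xi> x - z')))"
        unfolding norm_mult norm_divide norm_of_real abs_of_nonneg[OF d_nonneg[OF elim(3)]] by simp
      then show ?case
        unfolding e using elim(2) by (simp only:)
    qed
  qed
  finally show ?thesis .
qed

end

text \<open>Expanding the square leaves 1 - 2 Re (R 0) plus the square of the norm of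
  \<open>R\<close>, which is at most 1. So a contraction with value near 1 at the origin is near 1
  in norm; this controls the mass not yet removed as well as the exhaustion of \<Theta> by
  divisors.\<close>

lemma contractive_one_minus:
  assumes "contractive R"
  shows "H2_norm (\<lambda>z. 1 - R z) \<le> sqrt (2 - 2 * Re (R 0))"
proof -
  have h1: "hardy (\<lambda>z. 1)" by (rule hardy_const)
  have hR: "hardy R" by (rule contractive_hardy[OF assms])
  have "H2_inner (\<lambda>z. 1) R = cnj (R 0)"
    using H2_inner_power_left[OF hR, of 0] by simp
  then have "(H2_norm (\<lambda>z. 1 - R z))\<^sup>2 = 1 - 2 * Re (R 0) + (H2_norm R)\<^sup>2"
    using H2_norm_diff_sq[OF h1 hR] by (simp add: H2_norm_const)
  moreover have "(H2_norm R)\<^sup>2 \<le> 1"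
    using hardy_bounded(2)[OF contractiveD[OF assms]] by (simp add: power_le_one)
  ultimately show ?thesis by (intro real_le_rsqrt) simp
qed

section \<open>Measures without mass on the sets of finite entropy\<close>

context dini_modulus
begin

text \<open>If \<open>f\<close> is smooth on the circle, a bounded \<open>G\<close> that is small except near the circle is nearly
  orthogonal to \<open>f\<close>.\<close>

definition paired :: "(complex \<Rightarrow> complex) \<Rightarrow> real \<Rightarrow> bool" where
  "paired f C \<longleftrightarrow> (\<forall>G X \<delta> \<kappa>. G holomorphic_on unit_disc \<longrightarrow> (\<forall>z\<in>unit_disc. cmod (G z) \<le> X) \<longrightarrow>
     0 < \<kappa> \<longrightarrow> \<kappa> \<le> 1 \<longrightarrow> (\<forall>z. cmod z \<le> 1 - \<kappa> \<longrightarrow> cmod (G z) \<le> \<delta>) \<longrightarrow>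
     cmod (H2_inner f G) \<le> C * (\<delta> + X * W \<kappa> powr (1 - \<alpha>)))"

text \<open>\<open>f\<close> is replaced by its dilate \<open>f2\<close>. As the Cauchy transform of
  its own boundary values, \<open>f\<close> differs from the dilate by a multiple of W(\<kappa>)^(1
  - \<alpha>), and the pairing of \<open>f2\<close> with \<open>G\<close> sees \<open>G\<close> only
  on the circle of radius 1 - \<kappa>, where it is at most \<delta>.\<close>

lemma A_space_pairing:
  assumes f: "f \<in> A_space w"
  obtains C where "0 \<le> C" "hardy f" "paired f C"
proof -
  obtain g L where g: "continuous_on (cball 0 1) g" "\<And>z. z \<in> unit_disc \<Longrightarrow> g z = f z"
    and L: "\<And>\<xi> \<zeta>. \<xi> \<in> unit_circle \<Longrightarrow> \<zeta> \<in> unit_circle \<Longrightarrow> cmod (g \<xi> - g \<zeta>) \<le> L * W (cmod (\<xi> - \<zeta>))"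
    using f unfolding A_space_iff by blast
  have fh: "f holomorphic_on unit_disc" using f by (simp add: A_space_def disc_holomorphic_def)
  obtain M where M: "\<And>z. z \<in> cball 0 1 \<Longrightarrow> cmod (g z) \<le> M"
    using compact_norm_bound[OF compact_cball g(1)] by blast
  have M0: "0 \<le> M" using M[of 0] norm_ge_zero[of "g 0"] by (simp del: norm_ge_zero)
  have fM: "cmod (f z) \<le> M" if "z \<in> unit_disc" for z using M[of z] g(2)[OF that] that by simp
  have rb: "radial_boundary f g M"
    by (rule radial_boundary_cong[OF radial_boundary_cball[OF _ g(1) M] g(2)])
       (use holomorphic_transform[OF fh] g(2) in auto)
  note gb = radial_boundaryD(3)[OF rb]
  have fC: "f z = cauchy_transform g z" if "z \<in> unit_disc" for z
    by (rule radial_boundary_cauchy[OF rb that])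
  define L' where "L' = max L 0"
  have smooth: "cmod (g \<xi> - g \<zeta>) \<le> L' * W (cmod (\<xi> - \<zeta>)) powr (\<alpha> + (1 - \<alpha>))" if "\<xi> \<in> unit_circle" "\<zeta> \<in> unit_circle" for \<xi> \<zeta>
  proof -
    have "L * W (cmod (\<xi> - \<zeta>)) \<le> L' * W (cmod (\<xi> - \<zeta>))"
      by (intro mult_right_mono W_nonneg) (auto simp: L'_def)
    then show ?thesis using L[OF that] W_nonneg[of "cmod (\<xi> - \<zeta>)"] by simp
  qed
  have hf: "hardy f" by (rule radial_boundaryD(5)[OF rb])
  define K where "K = 12 * L' * kernel_mass"
  have K0: "0 \<le> K" using kernel_mass_nonneg by (simp add: K_def L'_def)
  have main: "cmod (H2_inner f G) \<le> (M + K) * (\<delta> + X * W \<kappa> powr (1 - \<alpha>))"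
    if G: "G holomorphic_on unit_disc" "\<And>z. z \<in> unit_disc \<Longrightarrow> cmod (G z) \<le> X"
      and k: "0 < \<kappa>" "\<kappa> \<le> 1" and d: "\<And>z. cmod z \<le> 1 - \<kappa> \<Longrightarrow> cmod (G z) \<le> \<delta>" for G X \<delta> \<kappa>
  proof -
    define r where "r = 1 - \<kappa>"
    have r: "0 \<le> r" "r < 1" using k by (auto simp: r_def)
    \<comment> \<open>The dilation is by the square of \<open>r\<close>, because Parseval turns the
      pairing of \<open>f2\<close> with \<open>G\<close> into a mean of \<open>f * cnj G\<close>
      over the circle of radius \<open>r\<close>. Since h = 2 \<kappa> - \<kappa>^2, it lies between
      \<kappa> and 2 \<kappa>.\<close>
    define h where "h = 1 - r\<^sup>2"
    have hh: "0 < h" "h \<le> 1" "h \<le> 2 * \<kappa>" "\<kappa> \<le> h"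
    proof -
      have "h = 2 * \<kappa> - \<kappa> * \<kappa>" by (simp add: h_def r_def power2_eq_square algebra_simps)
      moreover have "0 \<le> \<kappa> * \<kappa>" "\<kappa> * \<kappa> \<le> \<kappa> * 1" using k by (auto intro: mult_left_mono)
      ultimately show "h \<le> 2 * \<kappa>" "\<kappa> \<le> h" by auto
      then show "0 < h" "h \<le> 1" using k by (auto simp: h_def)
    qed
    define f2 where "f2 z = f (of_real (r\<^sup>2) * z)" for z
    have in_disc: "of_real (r\<^sup>2) * z \<in> unit_disc" if "z \<in> unit_disc" for z :: complex
    proof -
      have "r\<^sup>2 * cmod z \<le> 1 * cmod z" using r by (intro mult_right_mono power_le_one) auto
      then show ?thesis using that by (simp add: norm_mult norm_power)
    qed
    have f2h: "f2 holomorphic_on unit_disc"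
    proof -
      have "(\<lambda>z. of_real (r\<^sup>2) * z) holomorphic_on unit_disc" by (intro holomorphic_intros)
      moreover have "(\<lambda>z. of_real (r\<^sup>2) * z) ` unit_disc \<subseteq> unit_disc" using in_disc by blast
      ultimately have "f \<circ> (\<lambda>z. of_real (r\<^sup>2) * z) holomorphic_on unit_disc"
        using fh holomorphic_on_compose_gen by blast
      then show ?thesis by (simp only: comp_def f2_def[abs_def])
    qed
    have hf2: "hardy f2"
      by (rule hardy_bounded(1)[OF f2h, of M]) (use fM in_disc in \<open>auto simp: f2_def\<close>)
    have hG: "hardy G" by (rule hardy_bounded(1)[OF G])
    have X0: "0 \<le> X" using G(2)[of 0] norm_ge_zero[of "G 0"] by (simp del: norm_ge_zero)
    have d0: "0 \<le> \<delta>" using d[of 0] norm_ge_zero[of "G 0"] k by (simp del: norm_ge_zero)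
    have 1: "cmod (H2_inner (\<lambda>z. f z - f2 z) G) \<le> (K * W \<kappa> powr (1 - \<alpha>)) * X"
    proof -
      have b: "cmod (f z - f2 z) \<le> K * W \<kappa> powr (1 - \<alpha>)" if z: "z \<in> unit_disc" for z
      proof -
        have "cmod (cauchy_transform g z - cauchy_transform g (of_real (1 - h) * z)) \<le> 6 * L' * kernel_mass * W h powr (1 - \<alpha>)"
          by (rule cauchy_transform_dilate[OF gb _ smooth _ _ hh(1,2) z]) (use alpha in \<open>auto simp: L'_def\<close>)
        also have "W h powr (1 - \<alpha>) \<le> (2 * W \<kappa>) powr (1 - \<alpha>)"
          using W_double[of \<kappa> h] hh k alpha W_nonneg[of h] by (intro powr_mono2) auto
        also have "\<dots> = 2 powr (1 - \<alpha>) * W \<kappa> powr (1 - \<alpha>)"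
          using W_nonneg[of \<kappa>] k by (simp add: powr_mult)
        also have "\<dots> \<le> 2 powr 1 * W \<kappa> powr (1 - \<alpha>)"
          using alpha by (intro mult_right_mono powr_mono) auto
        finally have "cmod (cauchy_transform g z - cauchy_transform g (of_real (1 - h) * z)) \<le> K * W \<kappa> powr (1 - \<alpha>)"
          using kernel_mass_nonneg by (simp add: K_def L'_def mult_left_mono mult.assoc)
        then show ?thesis
          using fC[OF z] fC[OF in_disc[OF z]] by (simp add: f2_def h_def)
      qed
      have "cmod (H2_inner (\<lambda>z. f z - f2 z) G) \<le> H2_norm (\<lambda>z. f z - f2 z) * H2_norm G"
        by (intro H2_Cauchy_Schwarz hardy_diff hf hf2 hG)
      also have "\<dots> \<le> (K * W \<kappa> powr (1 - \<alpha>)) * X"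
        by (intro mult_mono hardy_bounded(2)[OF holomorphic_on_diff[OF fh f2h] b] hardy_bounded(2)[OF G])
           (use K0 in auto)
      finally show ?thesis .
    qed
    have 2: "cmod (H2_inner f2 G) \<le> M * \<delta>"
    proof -
      have hc: "hcoeff f2 = (\<lambda>n. hcoeff f n * of_real (r\<^sup>2) ^ n)"
      proof (rule hcoeff_unique)
        fix z :: complex assume "z \<in> unit_disc"
        from hcoeff_sums[OF fh in_disc[OF this]]
        show "(\<lambda>n. hcoeff f n * of_real (r\<^sup>2) ^ n * z ^ n) sums f2 z"
          by (simp only: f2_def power_mult_distrib mult.assoc)
      qed
      have "(\<lambda>n. hcoeff f2 n * cnj (hcoeff G n)) sums (\<integral> \<zeta>. f (of_real r * \<zeta>) * cnj (G (of_real r * \<zeta>)) \<partial>circle_measure)"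
        using parseval_circle[OF fh G(1) r] by (simp add: hc mult_ac)
      then have eq: "H2_inner f2 G = (\<integral> \<zeta>. f (of_real r * \<zeta>) * cnj (G (of_real r * \<zeta>)) \<partial>circle_measure)"
        by (rule sums_unique2[OF H2_inner_sums[OF hf2 hG]])
      have "cmod (\<integral> \<zeta>. f (of_real r * \<zeta>) * cnj (G (of_real r * \<zeta>)) \<partial>circle_measure) \<le> (\<integral> \<zeta>. M * \<delta> \<partial>circle_measure)"
      proof (rule Bochner_Integration.integral_norm_bound_integral)
        show "integrable circle_measure (\<lambda>\<zeta>. f (of_real r * \<zeta>) * cnj (G (of_real r * \<zeta>)))"
          by (intro circle_integrable_continuous continuous_intros continuous_on_dilate fh G r)
        fix \<zeta> assume "\<zeta> \<in> space circle_measure"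
        then have z: "cmod (of_real r * \<zeta>) = r" using r by (simp add: norm_mult)
        show "norm (f (of_real r * \<zeta>) * cnj (G (of_real r * \<zeta>))) \<le> M * \<delta>"
          unfolding norm_mult[of "f _"] complex_mod_cnj
          by (intro mult_mono fM d M0) (use z r in \<open>auto simp: r_def\<close>)
      qed simp
      then show ?thesis using eq by simp
    qed
    have "H2_inner f G = H2_inner (\<lambda>z. f z - f2 z) G + H2_inner f2 G"
      by (simp add: H2_inner_diff_left hf hf2 hG)
    then have "cmod (H2_inner f G) \<le> (K * W \<kappa> powr (1 - \<alpha>)) * X + M * \<delta>"
      using norm_triangle_ineq[of "H2_inner (\<lambda>z. f z - f2 z) G" "H2_inner f2 G"] 1 2 by simp
    also have "\<dots> \<le> (M + K) * (\<delta> + X * W \<kappa> powr (1 - \<alpha>))"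
      using M0 K0 d0 X0 by (simp add: algebra_simps)
    finally show ?thesis .
  qed
  show ?thesis
    by (rule that[of "M + K"]) (use M0 K0 hf main in \<open>auto simp: paired_def\<close>)
qed

end

section \<open>A sequence of scales that decreases like iterated squares\<close>

context modulus
begin

text \<open>Take the least \<open>n\<close> with W(1 / n) \<le> y. It is at least 2 because y < w 1,
  and passing from n - 1 to n at most halves \<open>W\<close>.\<close>

lemma scale_step:
  assumes "0 < y" "y < w 1"
  obtains n :: nat where "0 < n" "W (1 / real n) \<le> y" "y / 2 \<le> W (1 / real n)"
proof -
  let ?P = "\<lambda>n::nat. 0 < n \<and> W (1 / real n) \<le> y"
  obtain d where d: "0 < d" "\<And>t. 0 \<le> t \<Longrightarrow> t \<le> d \<Longrightarrow> W t < y" using W_small[OF assms(1)] by metis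
  obtain m :: nat where "0 < m" "inverse (real m) < d" using ex_inverse_of_nat_less[OF d(1)] by blast
  then have ex: "?P m" using d(2)[of "1 / real m"] by (simp add: inverse_eq_divide less_imp_le)
  define n where "n = (LEAST n. ?P n)"
  have n: "?P n" unfolding n_def by (rule LeastI[of ?P, OF ex])
  have "n \<noteq> 1" using n assms(2) by (auto simp: W_eq)
  then have n2: "2 \<le> n" using n by linarith
  have "\<not> ?P (n - 1)" unfolding n_def by (rule not_less_Least) (use n2 in \<open>simp add: n_def[symmetric]\<close>)
  then have "y < W (1 / real (n - 1))" using n2 by auto
  also have "\<dots> \<le> real 2 * W (1 / real n)"
    by (rule W_le_twice) (use n2 in \<open>auto simp: field_simps of_nat_diff\<close>)
  finally show ?thesis using that[of n] n by simp
qed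

lemma scales:
  assumes "0 < e" "e \<le> 1" "e < w 1"
  obtains n :: "nat \<Rightarrow> nat" where "\<And>k. 0 < n k" "W (1 / real (n 0)) \<le> e"
    "\<And>k. W (1 / real (n (Suc k))) \<le> (W (1 / real (n k)))\<^sup>2"
    "\<And>k. (W (1 / real (n k)))\<^sup>2 / 2 \<le> W (1 / real (n (Suc k)))"
proof -
  have "\<exists>n. \<forall>k. (0 < n k \<and> W (1 / real (n k)) \<le> e) \<and>
     (W (1 / real (n (Suc k))) \<le> (W (1 / real (n k)))\<^sup>2 \<and> (W (1 / real (n k)))\<^sup>2 / 2 \<le> W (1 / real (n (Suc k))))"
  proof (rule dependent_nat_choice)
    show "\<exists>x::nat. 0 < x \<and> W (1 / real x) \<le> e"
      using scale_step[OF assms(1,3)] by metis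
    fix x and m :: nat assume x: "0 < x \<and> W (1 / real x) \<le> e"
    have p: "0 < W (1 / real x)" using x by (intro W_pos) auto
    have "(W (1 / real x))\<^sup>2 \<le> e * 1"
      unfolding power2_eq_square using x p assms by (intro mult_mono) auto
    then have le: "(W (1 / real x))\<^sup>2 \<le> e" by simp
    have lt: "(W (1 / real x))\<^sup>2 < w 1" using le assms(3) by linarith
    obtain m' :: nat where m': "0 < m'" "W (1 / real m') \<le> (W (1 / real x))\<^sup>2" "(W (1 / real x))\<^sup>2 / 2 \<le> W (1 / real m')"
      by (rule scale_step[OF zero_less_power[OF p] lt])
    show "\<exists>y. (0 < y \<and> W (1 / real y) \<le> e) \<and> W (1 / real y) \<le> (W (1 / real x))\<^sup>2 \<and> (W (1 / real x))\<^sup>2 / 2 \<le> W (1 / real y)"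
      using m' le by (intro exI[of _ m'] conjI) linarith+
  qed
  then show ?thesis using that by blast
qed

end

text \<open>The conditions in \<open>small\<close> serve, in this order, for
  \<open>kap k \<le> 1\<close>, for an exponent of modulus at most 1 in \<open>F_near_1\<close>, and
  for a geometric series of ratio at most 1/2 in \<open>x_powr_sum\<close>.\<close>

locale roberts_dini = roberts w \<nu> n c + dini_modulus w \<alpha>
  for w :: "real \<Rightarrow> real" and \<nu> n c \<alpha> +
  assumes W_sq: "\<And>k. W (1 / real (n (Suc k))) \<le> (W (1 / real (n k)))\<^sup>2"
    and c_eq: "c = (1 - \<alpha>) / 648"
    and small: "2 * sqrt (W (1 / real (n 0))) \<le> w 1" "4 * W (1 / real (n 0)) powr ((1 - \<alpha>) / 4) \<le> 1"
      "2 * W (1 / real (n 0)) powr ((1 - \<alpha>) / 8) \<le> 1"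
begin

text \<open>\<open>81\<close> is the Harnack constant of the Poisson kernel on a cell, and \<open>648 = 8 * 81\<close>.\<close>

definition gam :: real where "gam = (1 - \<alpha>) / 8"

lemma gam: "0 < gam" "gam \<le> 1 / 8" "81 * c = gam" "1 - \<alpha> = 8 * gam"
  using alpha by (auto simp: gam_def c_eq)

lemma x_le_1: "x k \<le> 1"
  using W_half[of k] by (rule order_trans) simp

lemma x_antimono: "x k \<le> x 0"
proof (induction k)
  case (Suc k)
  have "x (Suc k) \<le> x k * x k" using W_sq[of k] by (simp add: power2_eq_square)
  also have "\<dots> \<le> x k * 1" using x_le_1[of k] x_pos[of k] by (intro mult_left_mono) auto
  finally show ?case using Suc by simp
qed simp

lemma x_geometric: "x k \<le> x 0 ^ Suc k"
proof (induction k)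
  case (Suc k)
  have "x (Suc k) \<le> x k * x k" using W_sq[of k] by (simp add: power2_eq_square)
  also have "\<dots> \<le> x 0 ^ Suc k * x 0"
    using Suc x_antimono[of k] x_pos[of k] x_pos[of 0] by (intro mult_mono) auto
  finally show ?case by (simp add: mult_ac)
qed simp

text \<open>Squaring at each step keeps x k below the product of all its predecessors. Hence bounds
  x j^(-gam) for the earlier factors multiply to at most x k^(-gam).\<close>

lemma x_prod: "x k \<le> (\<Prod>j<k. x j)"
proof (induction k)
  case 0 then show ?case using x_le_1[of 0] by simp
next
  case (Suc k)
  have "x (Suc k) \<le> x k * x k" using W_sq[of k] by (simp add: power2_eq_square)
  also have "\<dots> \<le> (\<Prod>j<k. x j) * x k" using Suc x_pos[of k] by (intro mult_right_mono) auto
  finally show ?case by simp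
qed

definition rho :: "nat \<Rightarrow> real" where "rho k = 1 - 1 / real (n k)"

lemma rho: "0 \<le> rho k" "rho k < 1"
  using n_pos[of k] by (auto simp: rho_def)

abbreviation "h k \<equiv> herglotz \<nu> (\<lambda>\<zeta>. \<zeta>) (piece k)"
abbreviation "hrest k \<equiv> herglotz \<nu> (\<lambda>\<zeta>. \<zeta>) (rest k)"

lemma id_meas [measurable]: "(\<lambda>\<zeta>::complex. \<zeta>) \<in> borel_measurable \<nu>"
  unfolding measurable_nu by (rule circle_borel_measurable_borel) simp

sublocale hp: herglotz_data \<nu> "\<lambda>\<zeta>. \<zeta>" "piece k" for k
  by standard (use integrable_cell piece_range in auto)

sublocale hr: herglotz_data \<nu> "\<lambda>\<zeta>. \<zeta>" "rest k" for k
  by standard (use integrable_cell rest_range in auto)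

sublocale h1: herglotz_data \<nu> "\<lambda>\<zeta>. \<zeta>" "\<lambda>_. 1"
  by standard auto

lemma herglotz_split:
  assumes "z \<in> unit_disc"
  shows "herglotz \<nu> (\<lambda>\<zeta>. \<zeta>) (\<lambda>_. 1) z = (\<Sum>k<N. h k z) + hrest N z"
proof (induction N)
  case 0
  then show ?case by simp
next
  case (Suc N)
  have "hrest N z = h N z + hrest (Suc N) z"
  proof -
    have "hrest N z = (\<integral> \<zeta>. of_real (piece N \<zeta>) * ((\<zeta> + z) / (\<zeta> - z)) + of_real (rest (Suc N) \<zeta>) * ((\<zeta> + z) / (\<zeta> - z)) \<partial>\<nu>)"
      unfolding herglotz_def piece_eq of_real_diff left_diff_distrib by (simp del: rest.simps)
    then show ?thesis
      unfolding herglotz_def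
      by (simp only: Bochner_Integration.integral_add[OF hp.integrable_kernel[OF assms] hr.integrable_kernel[OF assms]])
  qed
  then show ?case using Suc by simp
qed

text \<open>Points of one cell differ by at most 8 / n, while \<zeta> has distance at least 1 / n
  from \<open>z\<close>; so distances to \<open>z\<close> vary over a cell by a factor of at most 9,
  and the Poisson kernel by 81. The choice of \<open>c\<close> turns 81 n \<open>cap k\<close> into
  the right-hand side.\<close>

lemma poisson_piece:
  assumes z: "cmod z \<le> rho k"
  shows "Re (h k z) \<le> gam * ln (1 / x k)"
proof -
  have zd: "z \<in> unit_disc" using z rho(2)[of k] by simp
  let ?P = "\<lambda>\<zeta>. (1 - (cmod z)\<^sup>2) / (cmod (\<zeta> - z))\<^sup>2"
  have t: "1 / real (n k) \<le> 1 - cmod z" using z by (simp add: rho_def)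
  have far: "1 - cmod z \<le> cmod (\<zeta> - z)" "0 < cmod (\<zeta> - z)" if "\<zeta> \<in> unit_circle" for \<zeta>
    using norm_triangle_ineq2[of \<zeta> z] that zd by auto
  have nn: "0 \<le> 1 - (cmod z)\<^sup>2" using zd by (simp add: power_le_one)
  have "Re (h k z) = (\<integral> \<zeta>. piece k \<zeta> * (((cmod \<zeta>)\<^sup>2 - (cmod z)\<^sup>2) / (cmod (\<zeta> - z))\<^sup>2) \<partial>\<nu>)"
    by (rule hp.Re_herglotz(1)[OF hp.integrable_kernel[OF zd]])
  also have "\<dots> = (\<integral> \<zeta>. piece k \<zeta> * ?P \<zeta> \<partial>\<nu>)"
    by (intro Bochner_Integration.integral_cong refl) auto
  also have "\<dots> \<le> 81 * real (n k) * cap k"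
  proof (rule piece_sum_mass[where B = "1 / (1 - cmod z)\<^sup>2"])
    show "?P \<in> borel_measurable borel" by measurable
    fix \<zeta> assume c: "\<zeta> \<in> unit_circle"
    show "0 \<le> ?P \<zeta>" using nn by simp
    show "?P \<zeta> \<le> 1 / (1 - cmod z)\<^sup>2"
      using far[OF c] zd nn by (intro frac_le power_mono) auto
    fix \<xi> assume c': "\<xi> \<in> unit_circle" and near: "cmod (\<zeta> - \<xi>) \<le> 8 / real (n k)"
    have "cmod (\<xi> - z) \<le> cmod (\<zeta> - \<xi>) + cmod (\<zeta> - z)"
      using norm_triangle_ineq[of "\<xi> - \<zeta>" "\<zeta> - z"] by (simp add: norm_minus_commute)
    also have "\<dots> \<le> 9 * cmod (\<zeta> - z)" using near t far[OF c] by simp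
    finally have "(cmod (\<xi> - z))\<^sup>2 \<le> (9 * cmod (\<zeta> - z))\<^sup>2" by (intro power_mono) auto
    then have "(cmod (\<xi> - z))\<^sup>2 \<le> 81 * (cmod (\<zeta> - z))\<^sup>2" by (simp add: power_mult_distrib)
    then show "?P \<zeta> \<le> 81 * ?P \<xi>"
      using far[OF c] far[OF c'] nn by (intro harnack_frac) auto
  next
    have b: "bounded_borel (\<lambda>_. 1) 1" by (rule bounded_borel_continuous) auto
    note i = cauchy_kernel_integrable[OF b zd]
    \<comment> \<open>The Poisson kernel is 2 Re (\<zeta> / (\<zeta> - z)) - 1; its mean is 1
      because the Cauchy kernel reproduces constants.\<close>
    have eq: "?P \<zeta> = 2 * Re (1 / (1 - z * cnj \<zeta>)) - 1" if c: "\<zeta> \<in> unit_circle" for \<zeta>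
    proof -
      have z1: "\<zeta> * cnj \<zeta> = 1" using c by (simp add: complex_norm_square[symmetric])
      have nz: "\<zeta> - z \<noteq> 0" using far[OF c] by auto
      have e: "1 - z * cnj \<zeta> = (\<zeta> - z) * cnj \<zeta>" using z1 by (simp add: algebra_simps)
      have "cnj \<zeta> \<noteq> 0" using z1 by auto
      then have "(\<zeta> * cnj \<zeta>) / ((\<zeta> - z) * cnj \<zeta>) = \<zeta> / (\<zeta> - z)" by simp
      then have "1 / (1 - z * cnj \<zeta>) = \<zeta> / (\<zeta> - z)"
        by (simp only: z1 e)
      moreover have h: "(\<zeta> + z) / (\<zeta> - z) = 2 * (\<zeta> / (\<zeta> - z)) - 1"
        using nz by (simp add: field_simps)
      have two: "Re (2 * u - 1) = 2 * Re u - 1" for u by simp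
      ultimately show ?thesis
        using Re_herglotz_kernel[of \<zeta> z] c unfolding h two by simp
    qed
    have "(\<integral> \<zeta>. ?P \<zeta> \<partial>circle_measure) = (\<integral> \<zeta>. 2 * Re (1 / (1 - z * cnj \<zeta>)) - 1 \<partial>circle_measure)"
      by (intro Bochner_Integration.integral_cong refl eq) simp
    also have "\<dots> = 2 * Re (\<integral> \<zeta>. 1 / (1 - z * cnj \<zeta>) \<partial>circle_measure) - 1"
      using i by simp
    also have "\<dots> = 1" using cauchy_transform_const[OF zd, of 1] by simp
    finally show "(\<integral> \<zeta>. ?P \<zeta> \<partial>circle_measure) \<le> 1" by simp
  qed simp
  also have "\<dots> = gam * ln (1 / x k)"
    using n_pos[of k] gam(3) by (simp add: cap_def)
  finally show ?thesis .
qed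

section \<open>The telescoping product of quotients\<close>

definition F :: "nat \<Rightarrow> complex \<Rightarrow> complex" where
  "F k z = exp (- (h k z - h k (of_real (rho k) * z)))"

lemma rho_disc: "z \<in> unit_disc \<Longrightarrow> of_real (rho k) * z \<in> unit_disc \<and> cmod (of_real (rho k) * z) \<le> rho k"
  using rho[of k] by (auto simp: norm_mult mult_left_le intro: le_less_trans[OF mult_left_le])

lemma hrho_holomorphic: "(\<lambda>z. h k (of_real (rho k) * z)) holomorphic_on unit_disc"
proof -
  have "(\<lambda>z. of_real (rho k) * z) holomorphic_on unit_disc" by (intro holomorphic_intros)
  moreover have "(\<lambda>z. of_real (rho k) * z) ` unit_disc \<subseteq> unit_disc" using rho_disc by blast
  ultimately have "h k \<circ> (\<lambda>z. of_real (rho k) * z) holomorphic_on unit_disc"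
    using hp.herglotz_holomorphic holomorphic_on_compose_gen by blast
  then show ?thesis by (simp only: comp_def)
qed

lemma F_holomorphic: "F k holomorphic_on unit_disc"
  unfolding F_def[abs_def] by (intro holomorphic_intros hp.herglotz_holomorphic hrho_holomorphic)

text \<open>The numerator is a contraction, and the denominator is evaluated only in the disc of
  radius \<open>rho k\<close>, where \<open>poisson_piece\<close> bounds it from below.\<close>

lemma F_bound: assumes z: "z \<in> unit_disc" shows "cmod (F k z) \<le> x k powr (- gam)"
proof -
  have "0 \<le> Re (h k z)" using z by (intro hp.Re_herglotz_nonneg hp.integrable_kernel) auto
  moreover have "Re (h k (of_real (rho k) * z)) \<le> gam * ln (1 / x k)"
    using rho_disc[OF z] by (intro poisson_piece) auto
  ultimately have "cmod (F k z) \<le> exp (gam * ln (1 / x k))"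
    by (simp add: F_def)
  also have "\<dots> = x k powr (- gam)"
    using x_pos[of k] by (simp add: powr_def ln_div)
  finally show ?thesis .
qed

lemma ln_x_le: "gam * ln (1 / x k) \<le> x k powr (- gam)"
proof -
  have "gam * ln (1 / x k) = ln (x k powr (- gam))" using x_pos[of k] by (simp add: ln_powr ln_div)
  also have "\<dots> \<le> x k powr (- gam)" using x_pos[of k] by (intro ln_bound) simp
  finally show ?thesis .
qed

text \<open>The width of the boundary layer outside which \<open>F k\<close> is near 1. It exceeds 1
  / n by the factor x k^(-3 gam): one gam absorbs the Poisson integral, one the bound of the earlier
  factors, and one remains as gain.\<close>

definition kap :: "nat \<Rightarrow> real" where "kap k = x k powr (- 3 * gam) / real (n k)"

lemma x_powr_ge_1: "0 \<le> s \<Longrightarrow> 1 \<le> x k powr (- s)"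
proof -
  assume "0 \<le> s"
  then have "x k powr 0 \<le> x k powr (- s)" using x_pos[of k] x_le_1[of k] by (intro powr_mono') auto
  then show ?thesis using x_pos[of k] by simp
qed

lemma kap: "0 < kap k" "kap k \<le> 1" "1 / real (n k) \<le> kap k"
proof -
  show "0 < kap k" using x_pos[of k] n_pos[of k] by (simp add: kap_def)
  show "1 / real (n k) \<le> kap k"
    unfolding kap_def using x_powr_ge_1[of "3 * gam" k] gam by (intro divide_right_mono) auto
  \<comment> \<open>\<open>W_scale\<close> from 1 / n up to 1 shows that n is at least w 1 / (2 x
    k), which dominates x k^(-3 gam) because 3 gam < 1/2 and x 0 is small.\<close>
  have "W 1 \<le> (1 + 1 / (1 / real (n k))) * x k" using n_pos[of k] by (intro W_scale) auto
  also have "\<dots> \<le> (2 * real (n k)) * x k" using n_pos[of k] x_pos[of k] by (intro mult_right_mono) auto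
  finally have 1: "w 1 \<le> 2 * real (n k) * x k" by (simp add: W_eq)
  have "x k powr (- 3 * gam) * sqrt (x k) \<le> 1"
  proof -
    have "x k powr (- 3 * gam) * sqrt (x k) = x k powr (- 3 * gam + 1 / 2)"
      unfolding powr_add using x_pos[of k] by (simp only: powr_half_sqrt less_imp_le)
    also have "\<dots> \<le> 1" using x_pos[of k] x_le_1[of k] gam by (intro powr_le1) auto
    finally show ?thesis .
  qed
  moreover have "2 * sqrt (x k) \<le> w 1"
    using small(1) x_antimono[of k] real_sqrt_le_mono[of "x k" "x 0"] by linarith
  ultimately have "x k powr (- 3 * gam) * sqrt (x k) * (2 * sqrt (x k)) \<le> 1 * w 1"
    using x_pos[of k] by (intro mult_mono) auto
  also have "\<dots> \<le> 2 * real (n k) * x k" using 1 by simp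
  also have "x k powr (- 3 * gam) * sqrt (x k) * (2 * sqrt (x k)) = 2 * x k powr (- 3 * gam) * x k"
    using x_pos[of k] by simp
  finally have "x k powr (- 3 * gam) \<le> real (n k)" using x_pos[of k] by simp
  then show "kap k \<le> 1" using n_pos[of k] by (simp add: kap_def)
qed

text \<open>The difference of the kernels at \<open>z\<close> and at its dilate is at most 4 / (n
  kap) times the Poisson kernel at \<open>z\<close>, since 1 - |z|^2 \<ge> kap. So the exponent is
  bounded by the Poisson integral of the piece, that is by 4 x k^(2 gam), and 12 = 3 * 4 with e
  \<le> 3.\<close>

lemma F_near_1:
  assumes z: "cmod z \<le> 1 - kap k"
  shows "cmod (1 - F k z) \<le> 12 * x k powr (2 * gam)"
proof -
  have zd: "z \<in> unit_disc" using z kap(1)[of k] by simp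
  have zr: "cmod z \<le> rho k" using z kap(3)[of k] by (simp add: rho_def)
  define z' where "z' = of_real (rho k) * z"
  have z'd: "z' \<in> unit_disc" using rho_disc[OF zd] by (simp add: z'_def)
  have zz': "cmod (z - z') \<le> 1 / real (n k)" "cmod (z - z') \<le> 1 - cmod z'"
  proof -
    have "z - z' = of_real (1 / real (n k)) * z" by (simp add: z'_def rho_def algebra_simps)
    then have e: "cmod (z - z') = 1 / real (n k) * cmod z" by (simp only: norm_mult norm_of_real) simp
    then show le: "cmod (z - z') \<le> 1 / real (n k)" using zd n_pos[of k] by (simp add: divide_right_mono)
    have "cmod z' \<le> rho k" using rho_disc[OF zd] by (simp add: z'_def)
    then show "cmod (z - z') \<le> 1 - cmod z'" using le by (simp add: rho_def)
  qed
  define P where "P \<zeta> = ((cmod \<zeta>)\<^sup>2 - (cmod z)\<^sup>2) / (cmod (\<zeta> - z))\<^sup>2" for \<zeta>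
  let ?q = "4 / (real (n k) * kap k)"
  have "cmod (h k z - h k z') \<le> (\<integral> \<zeta>. ?q * (piece k \<zeta> * P \<zeta>) \<partial>\<nu>)"
  proof (rule hp.herglotz_diff_le[OF hp.integrable_kernel[OF zd] hp.integrable_kernel[OF z'd]])
    show "AE \<zeta> in \<nu>. \<zeta> \<noteq> z \<and> \<zeta> \<noteq> z'"
      by (rule AE_I2) (use zd z'd in auto)
    show "integrable \<nu> (\<lambda>\<zeta>. ?q * (piece k \<zeta> * P \<zeta>))"
      unfolding P_def by (intro integrable_mult_right hp.Re_herglotz(2) hp.integrable_kernel zd)
    show "AE \<zeta> in \<nu>. piece k \<zeta> * (2 * cmod \<zeta> * cmod (z - z') / (cmod (\<zeta> - z) * cmod (\<zeta> - z'))) \<le> ?q * (piece k \<zeta> * P \<zeta>)"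
    proof (rule AE_I2)
      fix \<zeta> assume "\<zeta> \<in> space \<nu>"
      then have c: "cmod \<zeta> = 1" by simp
      have f: "1 - cmod z \<le> cmod (\<zeta> - z)" "1 - cmod z' \<le> cmod (\<zeta> - z')"
        using norm_triangle_ineq2[of \<zeta> z] norm_triangle_ineq2[of \<zeta> z'] c by auto
      have p: "0 < cmod (\<zeta> - z)" "0 < cmod (\<zeta> - z')" using f zd z'd by auto
      have half: "cmod (\<zeta> - z) \<le> 2 * cmod (\<zeta> - z')"
        using norm_triangle_ineq[of "\<zeta> - z'" "z' - z"] zz'(2) f(2) by (simp add: norm_minus_commute)
      have "2 * cmod (z - z') / (cmod (\<zeta> - z) * cmod (\<zeta> - z')) \<le> 2 * (1 / real (n k)) / (cmod (\<zeta> - z) * (cmod (\<zeta> - z) / 2))"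
        using half p zz'(1) n_pos[of k] by (intro frac_le mult_left_mono) auto
      also have "\<dots> = 4 / real (n k) * (1 / (cmod (\<zeta> - z))\<^sup>2)" by (simp add: power2_eq_square)
      also have "\<dots> \<le> 4 / real (n k) * ((1 - (cmod z)\<^sup>2) / kap k / (cmod (\<zeta> - z))\<^sup>2)"
      proof (intro mult_left_mono divide_right_mono)
        have "kap k \<le> 1 - cmod z" using z by simp
        also have "\<dots> \<le> 1 - (cmod z)\<^sup>2" using zd by (simp add: power2_eq_square mult_left_le)
        finally show "1 \<le> (1 - (cmod z)\<^sup>2) / kap k" using kap(1)[of k] by (simp add: field_simps)
      qed auto
      also have "\<dots> = ?q * P \<zeta>" by (simp add: P_def c)
      finally have "piece k \<zeta> * (2 * cmod (z - z') / (cmod (\<zeta> - z) * cmod (\<zeta> - z'))) \<le> piece k \<zeta> * (?q * P \<zeta>)"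
        by (intro mult_left_mono piece_range)
      then show "piece k \<zeta> * (2 * cmod \<zeta> * cmod (z - z') / (cmod (\<zeta> - z) * cmod (\<zeta> - z'))) \<le> ?q * (piece k \<zeta> * P \<zeta>)"
        using c by (simp add: mult_ac)
    qed
  qed
  also have "\<dots> = ?q * Re (h k z)"
    unfolding P_def hp.Re_herglotz(1)[OF hp.integrable_kernel[OF zd]]
    by (rule Bochner_Integration.integral_mult_right_zero)
  also have "\<dots> \<le> ?q * (x k powr (- gam))"
    using poisson_piece[OF zr] ln_x_le[of k] kap(1)[of k] by (intro mult_left_mono) auto
  also have "\<dots> = 4 * x k powr (2 * gam)"
  proof -
    have "real (n k) * kap k = x k powr (- 3 * gam)" using n_pos[of k] by (simp add: kap_def)
    then have "?q * (x k powr (- gam)) = 4 * (x k powr (- gam) / x k powr (- 3 * gam))" by simp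
    also have "x k powr (- gam) / x k powr (- 3 * gam) = x k powr (2 * gam)"
      using x_pos[of k] by (simp add: powr_diff[symmetric])
    finally show ?thesis .
  qed
  finally have y: "cmod (h k z - h k z') \<le> 4 * x k powr (2 * gam)" .
  have "x k powr (2 * gam) \<le> x 0 powr (2 * gam)"
    using x_antimono[of k] x_pos[of k] gam by (intro powr_mono2) auto
  moreover have "2 * gam = (1 - \<alpha>) / 4" by (simp add: gam_def)
  ultimately have y1: "cmod (h k z - h k z') \<le> 1" using y small(2) by (simp only:)
  have "cmod (exp (- (h k z - h k z')) - exp 0) \<le> exp 1 * cmod (- (h k z - h k z') - 0)"
    using y1 abs_Re_le_cmod[of "h k z - h k z'"] by (intro exp_diff_le) auto
  also have "\<dots> \<le> 3 * cmod (- (h k z - h k z') - 0)"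
    by (intro mult_right_mono exp_le) simp
  finally have "cmod (1 - F k z) \<le> 3 * cmod (h k z - h k z')"
    by (simp add: F_def z'_def norm_minus_commute)
  then show ?thesis using y by simp
qed

text \<open>\<open>T N N\<close> is a bounded multiple of the singular inner function, and \<open>T N 0\<close> tends to 1 as \<open>N\<close> grows.\<close>

definition T :: "nat \<Rightarrow> nat \<Rightarrow> complex \<Rightarrow> complex" where
  "T N k z = exp (- hrest N z) * (\<Prod>j<k. F j z)"

lemma T_holomorphic: "T N k holomorphic_on unit_disc"
  unfolding T_def[abs_def] by (intro holomorphic_intros hr.herglotz_holomorphic F_holomorphic)

text \<open>The exponential of the remainder is a contraction, and \<open>x_prod\<close> collects
  the bounds of the factors.\<close>

lemma T_bound: assumes z: "z \<in> unit_disc" shows "cmod (T N k z) \<le> x k powr (- gam)"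
proof -
  have "cmod (T N k z) \<le> 1 * (\<Prod>j<k. x j powr (- gam))"
    unfolding T_def norm_mult prod_norm[symmetric]
    using contractiveD(2)[OF hr.exp_herglotz_contractive z] z
    by (intro mult_mono prod_mono) (auto intro: F_bound prod_nonneg)
  also have "\<dots> = (\<Prod>j<k. x j) powr (- gam)"
    using x_pos by (simp add: prod_powr_distrib less_imp_le)
  also have "\<dots> \<le> x k powr (- gam)"
    using x_prod[of k] x_pos[of k] gam by (intro powr_mono2') auto
  finally show ?thesis .
qed

text \<open>The difference is Q T (1 - F): at most 12 x k^gam outside the layer of width
  \<open>kap k\<close>, and at most 2 x k^(-2 gam) everywhere. In the layer term W(kap k) \<le> 2 x
  k^(1 - 3 gam) is raised to the power 1 - \<alpha> = 8 gam; as gam \<le> 1/8 the exponent is at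
  least 3 gam, so that x k^gam is left. Finally 16 = 12 + 4.\<close>

lemma T_step_pairing:
  assumes f: "hardy f" and C: "0 \<le> C"
    and pairing: "paired f C"
    and Q: "contractive Q"
  shows "cmod (H2_inner f (\<lambda>z. Q z * T N k z - Q z * T N (Suc k) z)) \<le> 16 * C * x k powr gam"
proof -
  have eq: "(\<lambda>z. Q z * T N k z - Q z * T N (Suc k) z) = (\<lambda>z. Q z * (T N k z * (1 - F k z)))"
    by (auto simp: T_def fun_eq_iff algebra_simps)
  have bQ: "cmod (Q z * (T N k z * (1 - F k z))) \<le> 1 * (x k powr (- gam) * b)" if "z \<in> unit_disc" "cmod (1 - F k z) \<le> b" for z b
    unfolding norm_mult using that contractiveD(2)[OF Q that(1)] T_bound[OF that(1)]
    by (intro mult_mono) auto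
  have "cmod (H2_inner f (\<lambda>z. Q z * (T N k z * (1 - F k z))))
      \<le> C * (12 * x k powr gam + 2 * x k powr (- 2 * gam) * W (kap k) powr (1 - \<alpha>))"
  proof (rule pairing[unfolded paired_def, rule_format, OF _ _ kap(1,2)])
    show "(\<lambda>z. Q z * (T N k z * (1 - F k z))) holomorphic_on unit_disc"
      by (intro holomorphic_intros T_holomorphic F_holomorphic contractiveD[OF Q])
    fix z :: complex assume z: "z \<in> unit_disc"
    have "cmod (1 - F k z) \<le> 1 + x k powr (- gam)"
      using norm_triangle_ineq4[of 1 "F k z"] F_bound[OF z, of k] by simp
    also have "\<dots> \<le> 2 * x k powr (- gam)" using x_powr_ge_1[of gam k] gam by simp
    finally have "cmod (Q z * (T N k z * (1 - F k z))) \<le> 1 * (x k powr (- gam) * (2 * x k powr (- gam)))"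
      by (rule bQ[OF z])
    also have "\<dots> = 2 * x k powr (- 2 * gam)" using x_pos[of k] by (simp add: powr_add[symmetric])
    finally show "cmod (Q z * (T N k z * (1 - F k z))) \<le> 2 * x k powr (- 2 * gam)" .
  next
    fix z assume z: "cmod z \<le> 1 - kap k"
    then have zd: "z \<in> unit_disc" using kap(1)[of k] by simp
    have "cmod (Q z * (T N k z * (1 - F k z))) \<le> 1 * (x k powr (- gam) * (12 * x k powr (2 * gam)))"
      by (rule bQ[OF zd F_near_1[OF z]])
    also have "\<dots> = 12 * x k powr gam" using x_pos[of k] by (simp add: powr_add[symmetric])
    finally show "cmod (Q z * (T N k z * (1 - F k z))) \<le> 12 * x k powr gam" .
  qed
  also have "\<dots> \<le> C * (12 * x k powr gam + 4 * x k powr gam)"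
  proof (intro mult_left_mono add_left_mono C)
    have "W (kap k) \<le> (1 + kap k / (1 / real (n k))) * x k"
      using kap(1)[of k] n_pos[of k] by (intro W_scale) auto
    also have "kap k / (1 / real (n k)) = x k powr (- 3 * gam)" using n_pos[of k] by (simp add: kap_def)
    also have "(1 + x k powr (- 3 * gam)) * x k \<le> (2 * x k powr (- 3 * gam)) * x k"
      using x_powr_ge_1[of "3 * gam" k] gam x_pos[of k] by (intro mult_right_mono) auto
    also have "\<dots> = 2 * x k powr (1 - 3 * gam)"
      using x_pos[of k] by (simp add: powr_mult_base powr_diff powr_minus divide_inverse mult_ac)
    finally have "W (kap k) powr (1 - \<alpha>) \<le> (2 * x k powr (1 - 3 * gam)) powr (1 - \<alpha>)"
      using alpha kap(1)[of k] W_nonneg[of "kap k"] by (intro powr_mono2) auto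
    also have "\<dots> = 2 powr (1 - \<alpha>) * x k powr ((1 - 3 * gam) * (1 - \<alpha>))"
      using x_pos[of k] by (simp add: powr_mult powr_powr)
    also have "\<dots> \<le> 2 powr 1 * x k powr (3 * gam)"
    proof (rule mult_mono)
      show "2 powr (1 - \<alpha>) \<le> 2 powr (1::real)" using alpha by (intro powr_mono) auto
      have "(1 - 3 * gam) * (1 - \<alpha>) = 8 * gam - 24 * (gam * gam)"
        unfolding gam(4) by (simp add: algebra_simps)
      moreover have "gam * gam \<le> gam * (1 / 8)" using gam by (intro mult_left_mono) auto
      ultimately have "3 * gam \<le> (1 - 3 * gam) * (1 - \<alpha>)" using gam by linarith
      then show "x k powr ((1 - 3 * gam) * (1 - \<alpha>)) \<le> x k powr (3 * gam)"
        using x_pos[of k] x_le_1[of k] by (intro powr_mono') auto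
    qed simp_all
    finally have "2 * x k powr (- 2 * gam) * W (kap k) powr (1 - \<alpha>) \<le> 2 * x k powr (- 2 * gam) * (2 powr 1 * x k powr (3 * gam))"
      by (intro mult_left_mono) auto
    also have "\<dots> = 4 * x k powr gam" using x_pos[of k] by (simp add: powr_add[symmetric])
    finally show "2 * x k powr (- 2 * gam) * W (kap k) powr (1 - \<alpha>) \<le> 4 * x k powr gam" .
  qed
  finally show ?thesis unfolding eq by (simp add: algebra_simps)
qed

lemma x_powr_sum: "(\<Sum>k<N. x k powr gam) \<le> 2 * x 0 powr gam"
proof -
  define q where "q = x 0 powr gam"
  have q: "0 < q" "q \<le> 1 / 2" using x_pos[of 0] small(3) by (auto simp: q_def gam_def)
  have "x k powr gam \<le> q * (1 / 2) ^ k" for k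
  proof -
    have "x k powr gam \<le> (x 0 ^ Suc k) powr gam"
      using x_geometric[of k] x_pos[of k] gam by (intro powr_mono2) auto
    also have "\<dots> = q ^ Suc k"
    proof -
      have "(x 0 ^ Suc k) powr gam = (x 0 powr real (Suc k)) powr gam"
        using x_pos[of 0] by (simp only: powr_realpow)
      also have "\<dots> = (x 0 powr gam) powr real (Suc k)" by (simp only: powr_powr mult.commute)
      also have "\<dots> = q ^ Suc k" unfolding q_def using x_pos[of 0] by (intro powr_realpow) simp
      finally show ?thesis .
    qed
    also have "\<dots> \<le> q * (1 / 2) ^ k"
      using q by (auto intro!: mult_left_mono power_mono)
    finally show ?thesis .
  qed
  then have "(\<Sum>k<N. x k powr gam) \<le> (\<Sum>k<N. q * (1 / 2) ^ k)" by (intro sum_mono)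
  also have "\<dots> = q * (2 - 2 * (1/2) ^ N)"
    by (subst sum_distrib_left[symmetric], subst geometric_sum) (auto simp: field_simps)
  also have "\<dots> \<le> q * 2" using q by (intro mult_left_mono) auto
  finally show ?thesis by (simp add: q_def)
qed

text \<open>\<open>Q\<close> is reached from Q \<open>T N N\<close>, which is orthogonal to
  \<open>f\<close>, by undoing the factors one at a time and then dropping \<open>T N 0\<close>. The
  factors cost a convergent sum; \<open>T N 0\<close> is a contraction whose value at 0 is the
  exponential of minus the remaining mass, so this last cost vanishes as N grows.\<close>

lemma pairing_bound:
  assumes f: "hardy f" and C: "0 \<le> C"
    and pairing: "paired f C"
    and Q: "contractive Q"
    and orth: "\<And>g. hardy g \<Longrightarrow> H2_inner f (\<lambda>z. Q z * singular_inner \<nu> z * g z) = 0"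
  shows "cmod (H2_inner f Q) \<le> 32 * C * x 0 powr gam"
proof -
  note hQ = contractive_hardy_mult[OF Q]
  have bnd: "cmod (H2_inner f Q) \<le> H2_norm f * sqrt (2 - 2 * exp (- (\<integral> \<zeta>. rest N \<zeta> \<partial>\<nu>))) + 32 * C * x 0 powr gam" for N
  proof -
    have hT: "hardy (T N k)" for k by (rule hardy_bounded(1)[OF T_holomorphic T_bound])
    have T0: "T N 0 = (\<lambda>z. exp (- hrest N z))" by (auto simp: T_def)
    have cT0: "contractive (T N 0)" unfolding T0 by (rule hr.exp_herglotz_contractive)
    have hQ': "hardy Q" by (rule contractive_hardy[OF Q])
    have 1: "cmod (H2_inner f (\<lambda>z. Q z - Q z * T N 0 z)) \<le> H2_norm f * sqrt (2 - 2 * exp (- (\<integral> \<zeta>. rest N \<zeta> \<partial>\<nu>)))"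
    proof -
      have h1: "hardy (\<lambda>z. 1 - T N 0 z)" by (intro hardy_diff hardy_const hT)
      have "(\<lambda>z. Q z - Q z * T N 0 z) = (\<lambda>z. Q z * (1 - T N 0 z))" by (auto simp: algebra_simps)
      then have "cmod (H2_inner f (\<lambda>z. Q z - Q z * T N 0 z)) \<le> H2_norm f * H2_norm (\<lambda>z. Q z * (1 - T N 0 z))"
        using H2_Cauchy_Schwarz[OF f hQ(1)[OF h1]] by simp
      also have "\<dots> \<le> H2_norm f * sqrt (2 - 2 * Re (T N 0 0))"
        using hQ(2)[OF h1] contractive_one_minus[OF cT0] by (intro mult_left_mono) auto
      also have "Re (T N 0 0) = exp (- (\<integral> \<zeta>. rest N \<zeta> \<partial>\<nu>))"
        unfolding T0 hr.herglotz_0 of_real_minus[symmetric] exp_of_real by simp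
      finally show ?thesis .
    qed
    have 2: "cmod (H2_inner f (\<lambda>z. Q z * T N 0 z - Q z * T N K z)) \<le> (\<Sum>k<K. 16 * C * x k powr gam)" for K
    proof (induction K)
      case 0
      then show ?case using H2_inner_cmult_right[OF hardy_const[of 0] f, of 0] by simp
    next
      case (Suc K)
      have "H2_inner f (\<lambda>z. Q z * T N 0 z - Q z * T N (Suc K) z)
         = H2_inner f (\<lambda>z. Q z * T N 0 z - Q z * T N K z) + H2_inner f (\<lambda>z. Q z * T N K z - Q z * T N (Suc K) z)"
        by (subst H2_inner_add_right[symmetric]) (auto intro!: hardy_diff hQ hT f)
      then show ?case
        unfolding sum.lessThan_Suc
        by (simp only: order_trans[OF norm_triangle_ineq add_mono[OF Suc T_step_pairing[OF f C pairing Q]]])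
    qed
    have 3: "H2_inner f (\<lambda>z. Q z * T N N z) = 0"
    proof -
      \<comment> \<open>The product of the reciprocals of the dilated inner functions. It is bounded
        for fixed \<open>N\<close>, and makes \<open>T N N\<close> a bounded multiple of the
        singular inner function.\<close>
      define X where "X z = (\<Prod>k<N. exp (h k (of_real (rho k) * z)))" for z
      have X: "X holomorphic_on unit_disc"
        unfolding X_def[abs_def] by (intro holomorphic_intros hrho_holomorphic)
      have Xb: "cmod (X z) \<le> (\<Prod>k<N. exp (gam * ln (1 / x k)))" if "z \<in> unit_disc" for z
        unfolding X_def prod_norm[symmetric] using rho_disc[OF that] poisson_piece
        by (intro prod_mono) auto
      have "H2_inner f (\<lambda>z. Q z * singular_inner \<nu> z * X z) = 0"
        by (rule orth[OF hardy_bounded(1)[OF X Xb]])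
      moreover have "T N N z = singular_inner \<nu> z * X z" if "z \<in> unit_disc" for z
      proof -
        define p where "p = (\<Prod>k<N. exp (h k z))"
        have "F k z = exp (h k (of_real (rho k) * z)) / exp (h k z)" for k
          by (simp add: F_def exp_diff[symmetric])
        then have "(\<Prod>k<N. F k z) = X z / p" by (simp only: X_def p_def prod_dividef)
        moreover have "singular_inner \<nu> z = exp (- hrest N z) / p"
          unfolding singular_inner_herglotz herglotz_split[OF that, of N] p_def
          by (simp add: exp_sum[symmetric] exp_diff[symmetric] algebra_simps)
        ultimately show ?thesis by (simp add: T_def)
      qed
      ultimately show ?thesis
        by (subst H2_inner_cong[where f' = f and g' = "\<lambda>z. Q z * singular_inner \<nu> z * X z"]) (auto simp: mult_ac)
    qed
    have "H2_inner f Q = H2_inner f (\<lambda>z. Q z - Q z * T N 0 z) + (H2_inner f (\<lambda>z. Q z * T N 0 z - Q z * T N N z) + H2_inner f (\<lambda>z. Q z * T N N z))"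
      by (simp add: H2_inner_diff_right hQ hT f hQ')
    then have "cmod (H2_inner f Q) \<le> cmod (H2_inner f (\<lambda>z. Q z - Q z * T N 0 z)) + cmod (H2_inner f (\<lambda>z. Q z * T N 0 z - Q z * T N N z))"
      using 3 norm_triangle_ineq by simp
    also have "\<dots> \<le> H2_norm f * sqrt (2 - 2 * exp (- (\<integral> \<zeta>. rest N \<zeta> \<partial>\<nu>))) + (\<Sum>k<N. 16 * C * x k powr gam)"
      by (intro add_mono 1 2)
    also have "(\<Sum>k<N. 16 * C * x k powr gam) \<le> 16 * C * (2 * x 0 powr gam)"
      unfolding sum_distrib_left[symmetric] using C by (intro mult_left_mono x_powr_sum) auto
    finally show ?thesis by simp
  qed
  have "(\<lambda>N. H2_norm f * sqrt (2 - 2 * exp (- (\<integral> \<zeta>. rest N \<zeta> \<partial>\<nu>))) + 32 * C * x 0 powr gam)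
     \<longlonglongrightarrow> H2_norm f * sqrt (2 - 2 * exp (- 0)) + 32 * C * x 0 powr gam"
    by (intro tendsto_intros rest_tendsto_0)
  then have "cmod (H2_inner f Q) \<le> H2_norm f * sqrt (2 - 2 * exp (- 0)) + 32 * C * x 0 powr gam"
    by (rule LIMSEQ_le_const) (use bnd in auto)
  then show ?thesis by simp
qed

end

context dini_modulus
begin

text \<open>The decomposition is run anew for every starting scale \<open>e\<close>. The constant in
  \<open>paired\<close> depends on \<open>f\<close> only, so letting \<open>e\<close> tend to 0
  annihilates the pairing with \<Phi> times each monomial.\<close>

theorem smooth_part_orthogonal:
  assumes nu: "finite_measure \<nu>" "sets \<nu> = sets circle_borel"
    and null: "\<And>E. finite_entropy w E \<Longrightarrow> emeasure \<nu> E = 0"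
    and \<Phi>: "contractive \<Phi>"
    and \<Theta>: "\<And>z. z \<in> unit_disc \<Longrightarrow> \<Theta> z = \<Phi> z * singular_inner \<nu> z" and c\<Theta>: "contractive \<Theta>"
    and f: "f \<in> A_space w" "f \<in> model_space \<Theta>"
  shows "f \<in> model_space \<Phi>"
proof -
  obtain C where C: "0 \<le> C" and hf: "hardy f" and pairing: "paired f C"
    using A_space_pairing[OF f(1)] by blast
  have "H2_inner f (\<lambda>z. \<Phi> z * z ^ j) = 0" for j
  proof -
    define Q where "Q z = \<Phi> z * z ^ j" for z
    have Q: "contractive Q"
      unfolding Q_def by (intro contractive_mult \<Phi>) (auto simp: contractive_def norm_power power_le_one intro!: holomorphic_intros)
    have orth: "H2_inner f (\<lambda>z. Q z * singular_inner \<nu> z * g z) = 0" if "hardy g" for g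
    proof -
      have zg: "hardy (\<lambda>z. z ^ j * g z)"
        by (rule hardy_bounded_mult(1)[of "\<lambda>z. z ^ j" 1]) (use that in \<open>auto simp: norm_power power_le_one intro!: holomorphic_intros\<close>)
      have "H2_inner f (\<lambda>z. \<Theta> z * (z ^ j * g z)) = 0"
        by (rule model_space_orth[OF c\<Theta> f(2) zg])
      then show ?thesis
        by (subst H2_inner_cong[where f' = f and g' = "\<lambda>z. \<Theta> z * (z ^ j * g z)"]) (auto simp: Q_def \<Theta> mult_ac)
    qed
    have bound: "cmod (H2_inner f Q) \<le> 32 * C * e powr ((1 - \<alpha>) / 8)"
      if e: "0 < e" "e \<le> exp (- 1)" "e < w 1" "2 * sqrt e \<le> w 1" "4 * e powr ((1 - \<alpha>) / 4) \<le> 1" "2 * e powr ((1 - \<alpha>) / 8) \<le> 1" for e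
    proof -
      have e1: "e \<le> 1" using e(2) by (rule order_trans) simp
      obtain n :: "nat \<Rightarrow> nat" where n: "\<And>k. 0 < n k" "W (1 / real (n 0)) \<le> e"
        "\<And>k. W (1 / real (n (Suc k))) \<le> (W (1 / real (n k)))\<^sup>2"
        "\<And>k. (W (1 / real (n k)))\<^sup>2 / 2 \<le> W (1 / real (n (Suc k)))"
        using scales[OF e(1) e1 e(3)] by blast
      have pos: "0 < W (1 / real (n k))" for k using n(1)[of k] by (intro W_pos) simp
      have ge: "W (1 / real (n k)) \<le> e ^ Suc k" for k
      proof (induction k)
        case (Suc k)
        have ek: "e ^ Suc k \<le> e" using power_le_one[of e k] e(1) e1 by (simp add: mult_left_le)
        have "W (1 / real (n (Suc k))) \<le> W (1 / real (n k)) * W (1 / real (n k))"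
          using n(3)[of k] by (simp add: power2_eq_square)
        also have "\<dots> \<le> e ^ Suc k * e"
          by (intro mult_mono Suc order_trans[OF Suc ek]) (use e(1) pos[of k] in \<open>auto intro: less_imp_le\<close>)
        finally show ?case by (simp add: mult_ac)
      qed (use n(2) in simp)
      have le: "W (1 / real (n k)) \<le> e" for k
      proof -
        have "e ^ Suc k \<le> e" using power_le_one[of e k] e(1) e1 by (simp add: mult_left_le)
        then show ?thesis using ge[of k] by linarith
      qed
      have lim: "(\<lambda>k. W (1 / real (n k))) \<longlonglongrightarrow> 0"
      proof (rule tendsto_sandwich[OF _ _ tendsto_const])
        have "e < 1" using e(2) by (rule order_le_less_trans) simp
        then have "(\<lambda>k. e ^ k) \<longlonglongrightarrow> 0" using e(1) by (intro LIMSEQ_power_zero) simp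
        then show "(\<lambda>k. e ^ Suc k) \<longlonglongrightarrow> 0" by (rule LIMSEQ_Suc)
      qed (use ge pos in \<open>auto intro!: always_eventually less_imp_le\<close>)
      interpret fm: finite_measure \<nu> by (rule nu(1))
      interpret rd: roberts_dini w \<nu> n "(1 - \<alpha>) / 648" \<alpha>
      proof
        show "2 * sqrt (W (1 / real (n 0))) \<le> w 1"
          using real_sqrt_le_mono[OF n(2)] e(4) by linarith
        have "W (1 / real (n 0)) powr ((1 - \<alpha>) / 4) \<le> e powr ((1 - \<alpha>) / 4)"
          using n(2) pos[of 0] alpha by (intro powr_mono2) auto
        then show "4 * W (1 / real (n 0)) powr ((1 - \<alpha>) / 4) \<le> 1" using e(5) by linarith
        have "W (1 / real (n 0)) powr ((1 - \<alpha>) / 8) \<le> e powr ((1 - \<alpha>) / 8)"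
          using n(2) pos[of 0] alpha by (intro powr_mono2) auto
        then show "2 * W (1 / real (n 0)) powr ((1 - \<alpha>) / 8) \<le> 1" using e(6) by linarith
        show "sets \<nu> = sets circle_borel" by (rule nu(2))
        show "emeasure \<nu> E = 0" if "finite_entropy w E" for E by (rule null[OF that])
        show "0 < n k" for k by (rule n(1))
        show "0 < (1 - \<alpha>) / 648" using alpha by simp
        show "W (1 / real (n k)) \<le> exp (- 1)" for k by (rule order_trans[OF le e(2)])
        show "(W (1 / real (n k)))\<^sup>2 / 2 \<le> W (1 / real (n (Suc k)))" for k by (rule n(4))
        show "W (1 / real (n (Suc k))) \<le> (W (1 / real (n k)))\<^sup>2" for k by (rule n(3))
      qed (rule lim refl)+
      have "cmod (H2_inner f Q) \<le> 32 * C * W (1 / real (n 0)) powr rd.gam"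
        by (rule rd.pairing_bound[OF hf C pairing Q orth])
      also have "\<dots> \<le> 32 * C * e powr ((1 - \<alpha>) / 8)"
        unfolding rd.gam_def using C n(2) pos[of 0] alpha by (intro mult_left_mono powr_mono2) auto
      finally show ?thesis .
    qed
    have lim0: "((\<lambda>e. e powr s) \<longlongrightarrow> 0) (at_right 0)" if "0 < s" for s :: real
    proof -
      have "((\<lambda>e. e powr s) \<longlongrightarrow> 0 powr s) (at_right 0)"
        using that by (intro tendsto_powr' tendsto_intros) (auto simp: eventually_at_filter)
      then show ?thesis by simp
    qed
    have a8: "0 < (1 - \<alpha>) / 8" "0 < (1 - \<alpha>) / 4" using alpha by auto
    have ev: "\<forall>\<^sub>F e in at_right 0. cmod (H2_inner f Q) \<le> 32 * C * e powr ((1 - \<alpha>) / 8)"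
    proof -
      have s: "((\<lambda>e. 2 * sqrt e) \<longlongrightarrow> 2 * sqrt 0) (at_right (0::real))" by (intro tendsto_intros)
      have "\<forall>\<^sub>F e in at_right (0::real). 2 * sqrt e < w 1"
        using order_tendstoD(2)[OF s] w_1_pos by simp
      moreover have "\<forall>\<^sub>F e in at_right (0::real). e powr ((1 - \<alpha>) / 4) < 1 / 4"
        using order_tendstoD(2)[OF lim0[OF a8(2)], of "1 / 4"] by simp
      moreover have "\<forall>\<^sub>F e in at_right (0::real). e powr ((1 - \<alpha>) / 8) < 1 / 2"
        using order_tendstoD(2)[OF lim0[OF a8(1)], of "1 / 2"] by simp
      moreover have "\<forall>\<^sub>F e in at_right (0::real). e \<in> {0<..<min (exp (-1)) (w 1)}"
        using w_1_pos by (intro eventually_at_right_real) simp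
      ultimately show ?thesis
        by eventually_elim (rule bound, auto)
    qed
    have "((\<lambda>e. 32 * C * e powr ((1 - \<alpha>) / 8)) \<longlongrightarrow> 32 * C * 0) (at_right 0)"
      by (intro tendsto_intros lim0 a8)
    then have "cmod (H2_inner f Q) \<le> 32 * C * 0"
      by (rule tendsto_lowerbound[OF _ ev]) simp
    then show ?thesis by (simp add: Q_def[abs_def])
  qed
  then show ?thesis
    using f(2) unfolding model_space_iff[OF \<Phi>] by (simp add: model_space_def)
qed

end

section \<open>Outer functions adapted to a set of finite entropy\<close>

context herglotz_data
begin

lemma boundary_integrable:
  assumes z: "cmod z \<le> 1" and b: "0 < b" "AE x in M. b \<le> cmod (\<xi> x - z) \<and> cmod (\<xi> x) \<le> 2"
  shows "integrable M (kern z)"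
proof (rule Bochner_Integration.integrable_bound[OF integrable_mult_left[OF d_int, of "3 / b"]])
  show "AE x in M. norm (kern z x) \<le> norm (d x * (3 / b))"
    using b(2) AE_space
  proof eventually_elim
    case (elim x)
    have "cmod ((\<xi> x + z) / (\<xi> x - z)) \<le> 3 / b"
      unfolding norm_divide using elim norm_triangle_ineq[of "\<xi> x" z] z b by (intro frac_le) auto
    then have "d x * cmod ((\<xi> x + z) / (\<xi> x - z)) \<le> d x * (3 / b)"
      using d_nonneg[OF elim(2)] by (rule mult_left_mono)
    moreover have "0 \<le> d x * (3 / b)" using d_nonneg[OF elim(2)] b by simp
    ultimately show ?case
      using d_nonneg[OF elim(2)] by (simp only: norm_mult norm_of_real real_norm_def abs_of_nonneg)
  qed
qed measurable

text \<open>The poles lie outside the disc, so their distance to r z is at least 1 - r and hence at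
  least half of that to \<open>z\<close>. Thus the difference of the two values is of order 1 -
  r.\<close>

lemma herglotz_radial_limit:
  assumes z: "cmod z = 1" and b: "0 < b" "AE x in M. b \<le> cmod (\<xi> x - z) \<and> cmod (\<xi> x) \<le> 2"
  shows "((\<lambda>r. herglotz M \<xi> d (of_real r * z)) \<longlongrightarrow> herglotz M \<xi> d z) (at_left 1)"
proof -
  let ?C = "8 / b\<^sup>2 * (\<integral> x. d x \<partial>M)"
  have bound: "cmod (herglotz M \<xi> d (of_real r * z) - herglotz M \<xi> d z) \<le> (1 - r) * ?C" if r: "0 < r" "r < 1" for r
  proof -
    let ?z = "of_real r * z"
    have zd: "?z \<in> unit_disc" using z r by (simp add: norm_mult)
    have dist: "cmod (?z - z) = 1 - r"
    proof -
      have "?z - z = of_real (r - 1) * z" by (simp add: algebra_simps)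
      then show ?thesis using z r by (simp only: norm_mult norm_of_real) simp
    qed
    have "cmod (herglotz M \<xi> d ?z - herglotz M \<xi> d z) \<le> (\<integral> x. (1 - r) * (8 / b\<^sup>2) * d x \<partial>M)"
    proof (rule herglotz_diff_le[OF integrable_kernel[OF zd] boundary_integrable[OF _ b]])
      show "AE x in M. \<xi> x \<noteq> ?z \<and> \<xi> x \<noteq> z"
        using b(2) AE_space
      proof eventually_elim
        case (elim x)
        then show ?case using xi_ge[OF elim(2)] zd b(1) by auto
      qed
      show "integrable M (\<lambda>x. (1 - r) * (8 / b\<^sup>2) * d x)" by (intro integrable_mult_right d_int)
      show "AE x in M. d x * (2 * cmod (\<xi> x) * cmod (?z - z) / (cmod (\<xi> x - ?z) * cmod (\<xi> x - z))) \<le> (1 - r) * (8 / b\<^sup>2) * d x"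
        using b(2) AE_space
      proof eventually_elim
        case (elim x)
        have far: "1 - r \<le> cmod (\<xi> x - ?z)"
          using norm_triangle_ineq2[of "\<xi> x" ?z] xi_ge[OF elim(2)] z r by (simp add: norm_mult)
        have "cmod (\<xi> x - z) \<le> 2 * cmod (\<xi> x - ?z)"
          using norm_triangle_ineq[of "\<xi> x - ?z" "?z - z"] dist far by simp
        then have half: "b / 2 \<le> cmod (\<xi> x - ?z)" using elim by simp
        have "2 * cmod (\<xi> x) * cmod (?z - z) / (cmod (\<xi> x - ?z) * cmod (\<xi> x - z)) \<le> 4 * (1 - r) / (b / 2 * b)"
          unfolding dist using elim half b r by (intro frac_le mult_mono) auto
        also have "\<dots> = (1 - r) * (8 / b\<^sup>2)" by (simp add: power2_eq_square)
        finally show ?case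
          using mult_left_mono[OF _ d_nonneg[OF elim(2)]] by (metis mult.commute)
      qed
    qed (use z in simp)
    also have "\<dots> = (1 - r) * ?C" by (simp only: mult.assoc Bochner_Integration.integral_mult_right_zero)
    finally show ?thesis .
  qed
  have "((\<lambda>r::real. (1 - r) * ?C) \<longlongrightarrow> (1 - 1) * ?C) (at_left 1)"
    by (intro tendsto_intros)
  then have lim: "((\<lambda>r::real. (1 - r) * ?C) \<longlongrightarrow> 0) (at_left 1)" by simp
  have "((\<lambda>r. herglotz M \<xi> d (of_real r * z) - herglotz M \<xi> d z) \<longlongrightarrow> 0) (at_left 1)"
    by (rule Lim_null_comparison[OF eventually_mono[OF eventually_at_left_real[OF zero_less_one]] lim])
       (rule bound, auto)
  then show ?thesis by (simp add: LIM_zero_iff)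
qed

end

context modulus
begin

lemma w_arc_le:
  assumes "0 \<le> s" "s \<le> t" "t \<le> 1"
  shows "w s \<le> W t"
  using W_mono[OF assms(1,2)] assms by (simp add: W_eq)

end

text \<open>\<open>g\<close> is the density of the part of \<mu> carried by \<open>E\<close>, in the
  application the indicator of \<open>E\<close>. A density keeps the measure fixed while
  \<open>E\<close> exhausts the support.\<close>

locale entropy_set = dini_modulus w \<alpha> for w :: "real \<Rightarrow> real" and \<alpha> +
  fixes E :: "complex set" and \<mu> :: "complex measure" and g :: "complex \<Rightarrow> real"
  assumes v_modulus: "modulus_of_continuity (\<lambda>t. w t powr (1 + \<alpha>))"
    and ent: "finite_entropy w E"
    and mu: "finite_measure \<mu>" "sets \<mu> = sets circle_borel"
    and g_meas [measurable]: "g \<in> borel_measurable circle_borel"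
    and g_range: "\<And>\<zeta>. 0 \<le> g \<zeta> \<and> g \<zeta> \<le> 1"
    and g_supp: "\<And>\<zeta>. \<zeta> \<in> unit_circle - E \<Longrightarrow> g \<zeta> = 0"
begin

lemma E: "closed E" "E \<subseteq> unit_circle" "emeasure circle_measure E = 0"
  "integrable circle_measure (\<lambda>\<zeta>. ln (w (arc_infdist \<zeta> E)))"
  using ent by (auto simp: finite_entropy_def)

sublocale mu: finite_measure \<mu> by (rule mu)

lemma measurable_mu: "measurable \<mu> N = measurable circle_borel N"
  by (rule circle_sets_measurable[OF mu(2)])

lemma space_mu [simp]: "space \<mu> = unit_circle"
  by (rule circle_sets_space[OF mu(2)])

text \<open>Note that \<open>infdist \<zeta> {} = 0\<close>.\<close>

definition \<delta> :: "complex \<Rightarrow> real" where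
  "\<delta> \<zeta> = (if E = {} then 1 else min 1 (infdist \<zeta> E))"

lemma delta_range: "0 \<le> \<delta> \<zeta>" "\<delta> \<zeta> \<le> 1"
  by (auto simp: \<delta>_def infdist_nonneg)

lemma delta_lipschitz: "\<delta> \<zeta> \<le> \<delta> \<eta> + cmod (\<zeta> - \<eta>)"
proof -
  have "infdist \<zeta> E \<le> infdist \<eta> E + cmod (\<zeta> - \<eta>)"
    using infdist_triangle[of \<zeta> E \<eta>] by (simp add: dist_norm)
  then show ?thesis using norm_ge_zero[of "\<zeta> - \<eta>"] by (auto simp: \<delta>_def min_def simp del: norm_ge_zero)
qed

lemma delta_continuous: "continuous_on A \<delta>"
  unfolding \<delta>_def[abs_def] by (cases "E = {}") (auto intro!: continuous_intros)

lemma delta_measurable [measurable]: "\<delta> \<in> borel_measurable borel"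
  by (rule borel_measurable_continuous_onI[OF delta_continuous])

lemma delta_0_iff: "\<delta> \<zeta> = 0 \<longleftrightarrow> \<zeta> \<in> E"
  using infdist_0_iff[OF E(1), of \<zeta>] infdist_nonneg[of \<zeta> E] by (auto simp: \<delta>_def min_def)

lemma delta_pos: "\<zeta> \<notin> E \<Longrightarrow> 0 < \<delta> \<zeta>"
  using delta_0_iff[of \<zeta>] delta_range(1)[of \<zeta>] by linarith

lemma W_delta_continuous: "continuous_on A (\<lambda>\<zeta>. W (\<delta> \<zeta>))"
  by (intro W_continuous_comp delta_continuous delta_range)

lemma W_delta_measurable [measurable]: "(\<lambda>\<zeta>. W (\<delta> \<zeta>)) \<in> borel_measurable borel"
  by (rule borel_measurable_continuous_onI[OF W_delta_continuous])

definition f0 :: "complex \<Rightarrow> real" where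
  "f0 \<zeta> = (if \<zeta> \<in> E then 2 else 2 + ln (w 1 / W (\<delta> \<zeta>)))"

lemma E_sets [measurable]: "E \<in> sets borel"
  using E(1) by simp

lemma f0_measurable [measurable]: "f0 \<in> borel_measurable borel"
  unfolding f0_def[abs_def] by measurable

lemma W_delta_pos: "\<zeta> \<notin> E \<Longrightarrow> 0 < W (\<delta> \<zeta>)"
  by (intro W_pos delta_pos)

lemma f0_ge: "2 \<le> f0 \<zeta>"
  using W_delta_pos[of \<zeta>] W_le[OF delta_range(1), of \<zeta>] by (auto simp: f0_def)

lemma AE_not_E: "AE \<zeta> in circle_measure. \<zeta> \<notin> E"
proof (rule AE_not_in)
  have "E \<in> sets circle_borel"
    using E(1,2) by (rule closed_circle_borel)
  then show "E \<in> null_sets circle_measure" using E(3) by (simp add: null_sets_def sets_circle_measure)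
qed

text \<open>Finite entropy in the form used below. The capped chordal distance \<delta> is at least
  the arc distance, so monotonicity of \<open>w\<close> works in the required direction; for empty
  \<open>E\<close> both are 1.\<close>

lemma f0_integrable: "integrable circle_measure f0"
proof (rule Bochner_Integration.integrable_bound)
  show "integrable circle_measure (\<lambda>\<zeta>. 2 + \<bar>ln (w 1)\<bar> + \<bar>ln (w (arc_infdist \<zeta> E))\<bar>)"
    using E(4) by (intro Bochner_Integration.integrable_add integrable_abs) auto
  show "f0 \<in> borel_measurable circle_measure"
    unfolding circle_measurable_cong by (rule circle_borel_measurable_borel) measurable
  show "AE \<zeta> in circle_measure. norm (f0 \<zeta>) \<le> norm (2 + \<bar>ln (w 1)\<bar> + \<bar>ln (w (arc_infdist \<zeta> E))\<bar>)"
    using AE_not_E AE_space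
  proof eventually_elim
    case (elim \<zeta>)
    then have z: "\<zeta> \<in> unit_circle" by simp
    have p: "0 < W (\<delta> \<zeta>)" by (rule W_delta_pos[OF elim(1)])
    have "- ln (W (\<delta> \<zeta>)) \<le> \<bar>ln (w (arc_infdist \<zeta> E))\<bar>"
    proof (cases "E = {}")
      case True
      have "\<delta> \<zeta> = 1" "arc_infdist \<zeta> E = 1" unfolding \<delta>_def arc_infdist_def using True by simp_all
      then show ?thesis by (simp add: W_eq)
    next
      case False
      note arc = arc_infdist_bounds[OF E(1) False E(2) z]
      have d: "arc_infdist \<zeta> E \<le> \<delta> \<zeta>" using arc False by (simp add: \<delta>_def)
      have "0 < arc_infdist \<zeta> E"
        using arc(2,3) elim(1) infdist_0_iff[OF E(1) False, of \<zeta>] infdist_nonneg[of \<zeta> E] by linarith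
      then have "0 < w (arc_infdist \<zeta> E)" using W_pos[of "arc_infdist \<zeta> E"] arc(4) by (simp add: W_eq)
      moreover have "w (arc_infdist \<zeta> E) \<le> W (\<delta> \<zeta>)"
        by (rule w_arc_le) (use arc d delta_range[of \<zeta>] in auto)
      ultimately have "ln (w (arc_infdist \<zeta> E)) \<le> ln (W (\<delta> \<zeta>))" by (intro ln_mono)
      then show ?thesis by linarith
    qed
    then have "f0 \<zeta> \<le> 2 + \<bar>ln (w 1)\<bar> + \<bar>ln (w (arc_infdist \<zeta> E))\<bar>"
      using elim(1) p w_1_pos by (simp add: f0_def ln_div)
    then show ?case using f0_ge[of \<zeta>] by simp
  qed
qed

text \<open>The factor is \<open>3 * 768\<close>, where \<open>768\<close> is the constant lost in the lower bound for the Herglotz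
  integral below, so that the outer function decays like \<open>(W \<circ> \<delta>)\<^sup>3\<close>.\<close>

definition f :: "complex \<Rightarrow> real" where "f \<zeta> = 2304 * f0 \<zeta>"

lemma f_measurable [measurable]: "f \<in> borel_measurable borel"
  unfolding f_def[abs_def] by measurable

lemma f_ge: "1 \<le> f \<zeta>" using f0_ge[of \<zeta>] by (simp add: f_def)

lemma f_integrable: "integrable circle_measure f"
  unfolding f_def[abs_def] by (intro integrable_mult_right f0_integrable)

text \<open>Off \<open>E\<close> the poles of the Herglotz kernel are moved away from the circle, which makes the Herglotz
  integrals smooth on the circle off \<open>E\<close>.\<close>

definition xi :: "complex \<Rightarrow> complex" where "xi \<eta> = of_real (1 + \<delta> \<eta>) * \<eta>"

lemma xi_measurable [measurable]: "xi \<in> borel_measurable borel"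
  unfolding xi_def[abs_def] by measurable

lemma xi_E: "\<eta> \<in> E \<Longrightarrow> xi \<eta> = \<eta>"
  by (simp add: xi_def delta_0_iff[THEN iffD2])

definition D :: "complex \<Rightarrow> complex \<Rightarrow> real" where "D \<zeta> \<eta> = cmod (xi \<eta> - \<zeta>)"

lemma D_measurable [measurable]: "(\<lambda>\<zeta>. D \<zeta> \<eta>) \<in> borel_measurable borel"
  "(\<lambda>(\<zeta>, \<eta>). D \<zeta> \<eta>) \<in> borel_measurable (borel \<Otimes>\<^sub>M borel)"
  unfolding D_def[abs_def] by measurable

lemma cmod_xi: "\<eta> \<in> unit_circle \<Longrightarrow> cmod (xi \<eta>) = 1 + \<delta> \<eta>"
  unfolding xi_def norm_mult norm_of_real using delta_range[of \<eta>] by simp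

lemma xi_minus: "\<eta> \<in> unit_circle \<Longrightarrow> cmod (xi \<eta> - \<eta>) = \<delta> \<eta>"
proof -
  assume "\<eta> \<in> unit_circle"
  moreover have "xi \<eta> - \<eta> = of_real (\<delta> \<eta>) * \<eta>" by (simp add: xi_def algebra_simps)
  ultimately show ?thesis using delta_range[of \<eta>] by (simp add: norm_mult)
qed

text \<open>The pole \<open>xi \<eta>\<close> lies outside the disc at distance \<delta> \<eta> from
  \<eta>. Its distance from \<zeta> therefore dominates \<delta> \<eta>, then the chord, and then
  \<delta> \<zeta> by the Lipschitz property.\<close>

lemma D_bounds:
  assumes "\<zeta> \<in> unit_circle" "\<eta> \<in> unit_circle"
  shows "0 \<le> D \<zeta> \<eta>" "\<delta> \<eta> \<le> D \<zeta> \<eta>" "cmod (\<zeta> - \<eta>) \<le> 2 * D \<zeta> \<eta>" "\<delta> \<zeta> \<le> 3 * D \<zeta> \<eta>" "D \<zeta> \<eta> \<le> 3"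
proof -
  show "0 \<le> D \<zeta> \<eta>" by (simp add: D_def)
  show 1: "\<delta> \<eta> \<le> D \<zeta> \<eta>"
    using norm_triangle_ineq2[of "xi \<eta>" \<zeta>] assms by (simp add: D_def cmod_xi)
  show 2: "cmod (\<zeta> - \<eta>) \<le> 2 * D \<zeta> \<eta>"
    using norm_triangle_ineq[of "xi \<eta> - \<eta>" "\<zeta> - xi \<eta>"] norm_triangle_ineq4[of "xi \<eta> - \<eta>" "xi \<eta> - \<zeta>"] xi_minus[OF assms(2)] 1
    by (simp add: D_def)
  show "\<delta> \<zeta> \<le> 3 * D \<zeta> \<eta>" using delta_lipschitz[of \<zeta> \<eta>] 1 2 by linarith
  show "D \<zeta> \<eta> \<le> 3"
    using norm_triangle_ineq4[of "xi \<eta>" \<zeta>] assms delta_range[of \<eta>] by (simp add: D_def cmod_xi)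
qed

lemma D_pos: "\<zeta> \<in> unit_circle - E \<Longrightarrow> \<eta> \<in> unit_circle \<Longrightarrow> 0 < D \<zeta> \<eta>"
  using D_bounds(4)[of \<zeta> \<eta>] delta_pos[of \<zeta>] by auto

lemma D_triangle:
  assumes "\<zeta> \<in> unit_circle" "\<tau> \<in> unit_circle" "\<eta> \<in> unit_circle"
  shows "D \<zeta> \<eta> \<le> D \<tau> \<eta> + 2 * D \<zeta> \<tau>"
proof -
  have "D \<zeta> \<eta> \<le> D \<tau> \<eta> + cmod (\<tau> - \<zeta>)"
    using norm_triangle_ineq[of "xi \<eta> - \<tau>" "\<tau> - \<zeta>"] by (simp add: D_def)
  then show ?thesis using D_bounds(3)[OF assms(1,2)] by (simp add: norm_minus_commute)
qed

lemma D_near: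
  assumes "\<zeta> \<in> unit_circle" "\<zeta>' \<in> unit_circle" "\<eta> \<in> unit_circle" "cmod (\<zeta> - \<zeta>') \<le> \<delta> \<zeta> / 4"
  shows "D \<zeta> \<eta> \<le> 4 * D \<zeta>' \<eta>" "D \<zeta>' \<eta> \<le> 2 * D \<zeta> \<eta>"
proof -
  have 1: "D \<zeta> \<eta> \<le> D \<zeta>' \<eta> + cmod (\<zeta> - \<zeta>')" "D \<zeta>' \<eta> \<le> D \<zeta> \<eta> + cmod (\<zeta> - \<zeta>')"
    using norm_triangle_ineq[of "xi \<eta> - \<zeta>'" "\<zeta>' - \<zeta>"] norm_triangle_ineq[of "xi \<eta> - \<zeta>" "\<zeta> - \<zeta>'"]
    by (simp_all add: D_def norm_minus_commute)
  then show "D \<zeta> \<eta> \<le> 4 * D \<zeta>' \<eta>" "D \<zeta>' \<eta> \<le> 2 * D \<zeta> \<eta>"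
    using D_bounds(4)[OF assms(1,3)] assms(4) D_bounds(1)[OF assms(1,3)] by linarith+
qed

lemma delta_near:
  assumes "cmod (\<zeta> - \<zeta>') \<le> \<delta> \<zeta> / 4"
  shows "3 / 4 * \<delta> \<zeta> \<le> \<delta> \<zeta>'" "\<delta> \<zeta>' \<le> 5 / 4 * \<delta> \<zeta>"
  using delta_lipschitz[of \<zeta> \<zeta>'] delta_lipschitz[of \<zeta>' \<zeta>] assms by (simp_all add: norm_minus_commute)

text \<open>The weight of the correction in the exponent \<open>\<psi>\<close>. It is small enough
  for its potential to be controlled by the Dini kernel, and large enough that its reciprocal
  W^(-\<alpha>) / \<delta> can be paid for by the decay W^3.\<close>

definition \<rho> :: "complex \<Rightarrow> real" where "\<rho> \<zeta> = W (\<delta> \<zeta>) powr \<alpha> * \<delta> \<zeta>"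

lemma rho_measurable [measurable]: "\<rho> \<in> borel_measurable borel"
  unfolding \<rho>_def[abs_def] by measurable

lemma rho_nonneg: "0 \<le> \<rho> \<zeta>"
  using delta_range[of \<zeta>] by (simp add: \<rho>_def)

text \<open>If \<delta> \<tau> is at most the chord t, monotonicity of \<open>W\<close> and x \<ge>
  t / 2 give the constant 4. Otherwise W(\<delta>) is traded for W(t) at the price 2 \<delta> / t,
  and x \<ge> \<delta> / 3 gives 18 = 2 * 9.\<close>

lemma rho_kernel:
  assumes "\<tau> \<in> unit_circle" "p \<in> unit_circle" "\<tau> \<noteq> p" "\<delta> \<tau> \<le> 3 * x" "cmod (\<tau> - p) \<le> 2 * x"
  shows "\<rho> \<tau> / x\<^sup>2 \<le> 18 * kernel p \<tau>"
proof -
  define t where "t = cmod (\<tau> - p)"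
  have t: "0 < t" "t \<le> 2 * x" using assms by (auto simp: t_def)
  have x: "0 < x" using t by simp
  have k: "kernel p \<tau> = W t powr \<alpha> / t" by (simp add: kernel_def t_def)
  note d0 = delta_range(1)[of \<tau>]
  show ?thesis
  proof (cases "\<delta> \<tau> \<le> t")
    case True
    have "W (\<delta> \<tau>) powr \<alpha> \<le> W t powr \<alpha>"
      using True d0 alpha W_nonneg[OF d0] by (intro powr_mono2 W_mono) auto
    moreover have "\<delta> \<tau> / x\<^sup>2 \<le> t / (t / 2)\<^sup>2"
      using True t x d0 by (intro frac_le power_mono) auto
    ultimately have "W (\<delta> \<tau>) powr \<alpha> * (\<delta> \<tau> / x\<^sup>2) \<le> W t powr \<alpha> * (t / (t / 2)\<^sup>2)"
      using d0 by (intro mult_mono) auto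
    also have "\<dots> = 4 * (W t powr \<alpha> / t)" using t by (simp add: power2_eq_square)
    also have "\<dots> \<le> 18 * (W t powr \<alpha> / t)" using t by (intro mult_right_mono) auto
    finally show ?thesis by (simp add: \<rho>_def k)
  next
    case False
    then have dt: "t < \<delta> \<tau>" by simp
    have "W (\<delta> \<tau>) powr \<alpha> * (t / (t + \<delta> \<tau>)) \<le> W t powr \<alpha>"
      by (rule W_powr_shift) (use t d0 alpha in auto)
    then have "W (\<delta> \<tau>) powr \<alpha> \<le> W t powr \<alpha> * ((t + \<delta> \<tau>) / t)"
      using t d0 by (simp add: field_simps)
    also have "\<dots> \<le> W t powr \<alpha> * (2 * \<delta> \<tau> / t)"
      using t dt by (intro mult_left_mono divide_right_mono) auto
    finally have "W (\<delta> \<tau>) powr \<alpha> * (\<delta> \<tau> / x\<^sup>2) \<le> (W t powr \<alpha> * (2 * \<delta> \<tau> / t)) * (\<delta> \<tau> / (\<delta> \<tau> / 3)\<^sup>2)"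
      using t d0 dt x assms(4) by (intro mult_mono frac_le power_mono) auto
    also have "\<dots> = 18 * (W t powr \<alpha> / t)" using t dt by (simp add: power2_eq_square)
    finally show ?thesis by (simp add: \<rho>_def k)
  qed
qed

lemma AE_neq: "p \<in> unit_circle \<Longrightarrow> AE \<tau> in circle_measure. \<tau> \<noteq> p"
proof -
  assume p: "p \<in> unit_circle"
  have "emeasure circle_measure {\<zeta> \<in> unit_circle. cmod (\<zeta> - p) \<le> 0} \<le> ennreal (3 * 0)"
    by (rule circle_measure_ball_le[OF p]) simp
  moreover have "{\<zeta> \<in> unit_circle. cmod (\<zeta> - p) \<le> 0} = {p}" using p by auto
  moreover have "{p} \<in> sets circle_borel"
    using p by (intro closed_circle_borel) auto
  ultimately have "{p} \<in> null_sets circle_measure" by (simp add: null_sets_def sets_circle_measure)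
  from AE_not_in[OF this] show ?thesis by simp
qed

definition K0 :: real where "K0 = 18 * kernel_mass"

lemma K0_nonneg: "0 \<le> K0"
  using kernel_mass_nonneg by (simp add: K0_def)

text \<open>The distance \<open>x\<close> is left open because \<tau> occurs in both roles: as the
  parameter of the pole seen from \<zeta>, and as the point from which a pole is seen.\<close>

lemma rho_integral:
  assumes p: "p \<in> unit_circle" and x: "\<And>\<tau>. \<tau> \<in> unit_circle \<Longrightarrow> \<delta> \<tau> \<le> 3 * x \<tau> \<and> cmod (\<tau> - p) \<le> 2 * x \<tau>"
  shows "(\<integral>\<^sup>+ \<tau>. ennreal (\<rho> \<tau> / (x \<tau>)\<^sup>2) \<partial>circle_measure) \<le> ennreal K0"
proof -
  have "(\<integral>\<^sup>+ \<tau>. ennreal (\<rho> \<tau> / (x \<tau>)\<^sup>2) \<partial>circle_measure) \<le> (\<integral>\<^sup>+ \<tau>. ennreal 18 * ennreal (kernel p \<tau>) \<partial>circle_measure)"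
  proof (rule nn_integral_mono_AE)
    show "AE \<tau> in circle_measure. ennreal (\<rho> \<tau> / (x \<tau>)\<^sup>2) \<le> ennreal 18 * ennreal (kernel p \<tau>)"
      using AE_neq[OF p] AE_space
    proof eventually_elim
      case (elim \<tau>)
      then have "\<rho> \<tau> / (x \<tau>)\<^sup>2 \<le> 18 * kernel p \<tau>"
        using x[of \<tau>] p by (intro rho_kernel) auto
      then show ?case by (subst ennreal_mult[symmetric]) (auto simp: kernel_nonneg intro: ennreal_leI)
    qed
  qed
  also have "\<dots> = ennreal 18 * (\<integral>\<^sup>+ \<tau>. ennreal (kernel p \<tau>) \<partial>circle_measure)"
    by (rule nn_integral_cmult) (auto simp: circle_measurable_cong intro!: circle_borel_measurable_borel)
  also have "\<dots> \<le> ennreal 18 * ennreal kernel_mass"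
    by (intro mult_left_mono kernel_integral p) simp
  also have "\<dots> = ennreal K0" unfolding K0_def by (subst ennreal_mult[symmetric]) (auto simp: kernel_mass_nonneg)
  finally show ?thesis .
qed

text \<open>Up to a constant, a bound for the derivative at \<zeta> of the Herglotz integral with
  poles \<open>xi\<close> and density \<open>h\<close>: the kernel has derivative 2 \<xi> / (\<xi> -
  z)^2.\<close>

definition pot :: "complex measure \<Rightarrow> (complex \<Rightarrow> real) \<Rightarrow> complex \<Rightarrow> ennreal" where
  "pot M h \<zeta> = (\<integral>\<^sup>+ \<eta>. ennreal (h \<eta> / (D \<zeta> \<eta>)\<^sup>2) \<partial>M)"

lemma ennreal_mult_div: "0 \<le> a \<Longrightarrow> 0 \<le> b \<Longrightarrow> ennreal a * ennreal (b / c\<^sup>2) = ennreal (a * b / c\<^sup>2)"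
  by (subst ennreal_mult[symmetric]) auto

lemma ennreal_comb:
  "0 \<le> c \<Longrightarrow> 0 \<le> a \<Longrightarrow> 0 \<le> b \<Longrightarrow>
    ennreal c * (ennreal 2 * ennreal a + ennreal 8 * ennreal b) = ennreal (c * (2 * a + 8 * b))"
  by (simp only: ennreal_mult[symmetric] ennreal_plus[symmetric] mult_nonneg_nonneg add_nonneg_nonneg zero_le_numeral)

lemma pot_Fubini:
  assumes M: "finite_measure M" "sets M = sets circle_borel"
    and h: "h \<in> borel_measurable circle_borel" and k [measurable]: "k \<in> borel_measurable borel"
  shows "(\<integral>\<^sup>+ \<tau>. ennreal (k \<tau>) * pot M h \<tau> \<partial>circle_measure)
     = (\<integral>\<^sup>+ \<eta>. (\<integral>\<^sup>+ \<tau>. ennreal (k \<tau>) * ennreal (h \<eta> / (D \<tau> \<eta>)\<^sup>2) \<partial>circle_measure) \<partial>M)"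
proof -
  interpret M: finite_measure M by (rule M)
  interpret pair_sigma_finite M circle_measure ..
  have [measurable]: "h \<in> borel_measurable M" using h by (simp add: circle_sets_measurable[OF M(2)])
  note [measurable] = circle_sets_id[OF M(2)] circle_sets_id[OF sets_circle_measure]
  have mf: "(\<lambda>(\<eta>, \<tau>). ennreal (k \<tau>) * ennreal (h \<eta> / (D \<tau> \<eta>)\<^sup>2)) \<in> borel_measurable (M \<Otimes>\<^sub>M circle_measure)"
    unfolding D_def xi_def by measurable
  have "(\<integral>\<^sup>+ \<tau>. ennreal (k \<tau>) * pot M h \<tau> \<partial>circle_measure)
     = (\<integral>\<^sup>+ \<tau>. (\<integral>\<^sup>+ \<eta>. ennreal (k \<tau>) * ennreal (h \<eta> / (D \<tau> \<eta>)\<^sup>2) \<partial>M) \<partial>circle_measure)"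
    unfolding pot_def D_def xi_def by (intro nn_integral_cong nn_integral_cmult[symmetric]) measurable
  then show ?thesis unfolding Fubini'[OF mf] .
qed

text \<open>With x = D \<zeta> \<tau>, y = D \<tau> \<eta> and z = D \<zeta> \<eta>, the triangle
  inequality gives z^2 \<le> 2 y^2 + 8 x^2, so 1 / (x y)^2 \<le> (2 / x^2 + 8 / y^2) / z^2. After
  Fubini both terms are integrals as in \<open>rho_integral\<close>; 10 = 2 + 8.\<close>

lemma pot_iterate:
  assumes M: "finite_measure M" "sets M = sets circle_borel"
    and h: "h \<in> borel_measurable circle_borel" "\<And>\<eta>. 0 \<le> h \<eta>"
    and z: "\<zeta> \<in> unit_circle - E"
  shows "(\<integral>\<^sup>+ \<tau>. ennreal (\<rho> \<tau> / (D \<zeta> \<tau>)\<^sup>2) * pot M h \<tau> \<partial>circle_measure) \<le> ennreal (10 * K0) * pot M h \<zeta>"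
proof -
  note mM = circle_sets_measurable[OF M(2)]
  note spM = circle_sets_space[OF M(2)]
  have zc: "\<zeta> \<in> unit_circle" using z by simp
  have hM [measurable]: "h \<in> borel_measurable M" using h by (simp add: mM)
  note [measurable] = circle_sets_id[OF M(2)] circle_sets_id[OF sets_circle_measure]
  have "(\<integral>\<^sup>+ \<tau>. ennreal (\<rho> \<tau> / (D \<zeta> \<tau>)\<^sup>2) * pot M h \<tau> \<partial>circle_measure)
     = (\<integral>\<^sup>+ \<eta>. (\<integral>\<^sup>+ \<tau>. ennreal (\<rho> \<tau> / (D \<zeta> \<tau>)\<^sup>2) * ennreal (h \<eta> / (D \<tau> \<eta>)\<^sup>2) \<partial>circle_measure) \<partial>M)"
    by (rule pot_Fubini[OF M h(1)]) (unfold D_def, measurable)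
  also have "\<dots> \<le> (\<integral>\<^sup>+ \<eta>. ennreal (10 * K0) * ennreal (h \<eta> / (D \<zeta> \<eta>)\<^sup>2) \<partial>M)"
  proof (rule nn_integral_mono)
    fix \<eta> assume "\<eta> \<in> space M"
    then have e: "\<eta> \<in> unit_circle" by (simp add: spM)
    define zz where "zz = D \<zeta> \<eta>"
    have zz: "0 < zz" unfolding zz_def by (rule D_pos[OF z e])
    have "(\<integral>\<^sup>+ \<tau>. ennreal (\<rho> \<tau> / (D \<zeta> \<tau>)\<^sup>2) * ennreal (h \<eta> / (D \<tau> \<eta>)\<^sup>2) \<partial>circle_measure)
       \<le> (\<integral>\<^sup>+ \<tau>. ennreal (h \<eta> / zz\<^sup>2) * (ennreal 2 * ennreal (\<rho> \<tau> / (D \<zeta> \<tau>)\<^sup>2) + ennreal 8 * ennreal (\<rho> \<tau> / (D \<tau> \<eta>)\<^sup>2)) \<partial>circle_measure)"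
    proof (rule nn_integral_mono)
      fix \<tau> assume "\<tau> \<in> space circle_measure"
      then have t: "\<tau> \<in> unit_circle" by simp
      define x y where "x = D \<zeta> \<tau>" "y = D \<tau> \<eta>"
      have x: "0 < x" unfolding x_y_def by (rule D_pos[OF z t])
      have tri: "zz \<le> y + 2 * x" unfolding zz_def x_y_def by (rule D_triangle[OF zc t e])
      have "zz\<^sup>2 \<le> (y + 2 * x)\<^sup>2" using tri zz by (intro power_mono) auto
      also have "\<dots> \<le> 2 * y\<^sup>2 + 8 * x\<^sup>2"
        using zero_le_power2[of "y - 2 * x"] by (simp add: power2_eq_square algebra_simps)
      finally have z2: "zz\<^sup>2 \<le> 2 * y\<^sup>2 + 8 * x\<^sup>2" .
      have "\<rho> \<tau> / x\<^sup>2 * (h \<eta> / y\<^sup>2) \<le> h \<eta> / zz\<^sup>2 * (2 * (\<rho> \<tau> / x\<^sup>2) + 8 * (\<rho> \<tau> / y\<^sup>2))"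
      proof (cases "y = 0")
        \<comment> \<open>This happens when \<tau> = \<eta> lies in \<open>E\<close>; the quotient
          with \<open>y\<close> is then 0 by division by zero.\<close>
        case True
        then show ?thesis using h(2)[of \<eta>] rho_nonneg[of \<tau>] by simp
      next
        case False
        have "h \<eta> * \<rho> \<tau> * zz\<^sup>2 \<le> h \<eta> * \<rho> \<tau> * (2 * y\<^sup>2 + 8 * x\<^sup>2)"
          using h(2)[of \<eta>] rho_nonneg[of \<tau>] z2 by (intro mult_left_mono) auto
        then have "h \<eta> * \<rho> \<tau> * zz\<^sup>2 / (x\<^sup>2 * y\<^sup>2 * zz\<^sup>2) \<le> h \<eta> * \<rho> \<tau> * (2 * y\<^sup>2 + 8 * x\<^sup>2) / (x\<^sup>2 * y\<^sup>2 * zz\<^sup>2)"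
          by (intro divide_right_mono) auto
        also have "\<dots> = h \<eta> / zz\<^sup>2 * (2 * (\<rho> \<tau> / x\<^sup>2) + 8 * (\<rho> \<tau> / y\<^sup>2))"
          using False x zz by (simp add: field_simps)
        also have "h \<eta> * \<rho> \<tau> * zz\<^sup>2 / (x\<^sup>2 * y\<^sup>2 * zz\<^sup>2) = \<rho> \<tau> / x\<^sup>2 * (h \<eta> / y\<^sup>2)"
          using False x zz by (simp add: field_simps)
        finally show ?thesis .
      qed
      then have "ennreal (\<rho> \<tau> / x\<^sup>2 * (h \<eta> / y\<^sup>2)) \<le> ennreal (h \<eta> / zz\<^sup>2 * (2 * (\<rho> \<tau> / x\<^sup>2) + 8 * (\<rho> \<tau> / y\<^sup>2)))"
        by (rule ennreal_leI)
      then show "ennreal (\<rho> \<tau> / (D \<zeta> \<tau>)\<^sup>2) * ennreal (h \<eta> / (D \<tau> \<eta>)\<^sup>2)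
        \<le> ennreal (h \<eta> / zz\<^sup>2) * (ennreal 2 * ennreal (\<rho> \<tau> / (D \<zeta> \<tau>)\<^sup>2) + ennreal 8 * ennreal (\<rho> \<tau> / (D \<tau> \<eta>)\<^sup>2))"
        unfolding x_y_def[symmetric]
        by (subst ennreal_comb, (use h(2)[of \<eta>] rho_nonneg[of \<tau>] in simp_all)[3])
           (subst ennreal_mult[symmetric], (use h(2)[of \<eta>] rho_nonneg[of \<tau>] in simp_all)[2])
    qed
    also have "\<dots> = ennreal (h \<eta> / zz\<^sup>2) * (ennreal 2 * (\<integral>\<^sup>+ \<tau>. ennreal (\<rho> \<tau> / (D \<zeta> \<tau>)\<^sup>2) \<partial>circle_measure)
        + ennreal 8 * (\<integral>\<^sup>+ \<tau>. ennreal (\<rho> \<tau> / (D \<tau> \<eta>)\<^sup>2) \<partial>circle_measure))"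
      unfolding D_def xi_def by (subst nn_integral_cmult, measurable) (subst nn_integral_add, measurable, simp add: nn_integral_cmult)
    also have "\<dots> \<le> ennreal (h \<eta> / zz\<^sup>2) * (ennreal 2 * ennreal K0 + ennreal 8 * ennreal K0)"
    proof (intro mult_left_mono add_mono)
      show "(\<integral>\<^sup>+ \<tau>. ennreal (\<rho> \<tau> / (D \<zeta> \<tau>)\<^sup>2) \<partial>circle_measure) \<le> ennreal K0"
      proof (rule rho_integral[OF zc])
        fix \<tau> assume t: "\<tau> \<in> unit_circle"
        show "\<delta> \<tau> \<le> 3 * D \<zeta> \<tau> \<and> cmod (\<tau> - \<zeta>) \<le> 2 * D \<zeta> \<tau>"
          using D_bounds[OF zc t] by (auto simp: norm_minus_commute)
      qed
      show "(\<integral>\<^sup>+ \<tau>. ennreal (\<rho> \<tau> / (D \<tau> \<eta>)\<^sup>2) \<partial>circle_measure) \<le> ennreal K0"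
      proof (rule rho_integral[OF e])
        fix \<tau> assume t: "\<tau> \<in> unit_circle"
        show "\<delta> \<tau> \<le> 3 * D \<tau> \<eta> \<and> cmod (\<tau> - \<eta>) \<le> 2 * D \<tau> \<eta>"
          using D_bounds[OF t e] by auto
      qed
    qed auto
    also have "\<dots> = ennreal (10 * K0) * ennreal (h \<eta> / (D \<zeta> \<eta>)\<^sup>2)"
    proof -
      have "ennreal 2 * ennreal K0 + ennreal 8 * ennreal K0 = ennreal (10 * K0)"
        using K0_nonneg by (simp only: ennreal_mult[symmetric] ennreal_plus[symmetric] zero_le_numeral mult_nonneg_nonneg) simp
      then show ?thesis by (simp add: zz_def mult.commute)
    qed
    finally show "(\<integral>\<^sup>+ \<tau>. ennreal (\<rho> \<tau> / (D \<zeta> \<tau>)\<^sup>2) * ennreal (h \<eta> / (D \<tau> \<eta>)\<^sup>2) \<partial>circle_measure)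
       \<le> ennreal (10 * K0) * ennreal (h \<eta> / (D \<zeta> \<eta>)\<^sup>2)" .
  qed
  also have "\<dots> = ennreal (10 * K0) * pot M h \<zeta>"
    unfolding pot_def D_def xi_def by (rule nn_integral_cmult) measurable
  finally show ?thesis .
qed

text \<open>The same use of Fubini without the kernel at \<zeta>. It yields the integrability of
  \<open>\<psi>\<close>.\<close>

lemma pot_mass:
  assumes M: "finite_measure M" "sets M = sets circle_borel"
    and h: "h \<in> borel_measurable circle_borel" "\<And>\<eta>. 0 \<le> h \<eta>"
  shows "(\<integral>\<^sup>+ \<tau>. ennreal (\<rho> \<tau>) * pot M h \<tau> \<partial>circle_measure) \<le> ennreal K0 * (\<integral>\<^sup>+ \<eta>. ennreal (h \<eta>) \<partial>M)"
proof -
  note mM = circle_sets_measurable[OF M(2)]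
  note spM = circle_sets_space[OF M(2)]
  have hM [measurable]: "h \<in> borel_measurable M" using h by (simp add: mM)
  note [measurable] = circle_sets_id[OF M(2)] circle_sets_id[OF sets_circle_measure]
  have "(\<integral>\<^sup>+ \<tau>. ennreal (\<rho> \<tau>) * pot M h \<tau> \<partial>circle_measure)
     = (\<integral>\<^sup>+ \<eta>. (\<integral>\<^sup>+ \<tau>. ennreal (\<rho> \<tau>) * ennreal (h \<eta> / (D \<tau> \<eta>)\<^sup>2) \<partial>circle_measure) \<partial>M)"
    by (rule pot_Fubini[OF M h(1) rho_measurable])
  also have "\<dots> \<le> (\<integral>\<^sup>+ \<eta>. ennreal K0 * ennreal (h \<eta>) \<partial>M)"
  proof (rule nn_integral_mono)
    fix \<eta> assume "\<eta> \<in> space M"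
    then have e: "\<eta> \<in> unit_circle" by (simp add: spM)
    have "(\<integral>\<^sup>+ \<tau>. ennreal (\<rho> \<tau>) * ennreal (h \<eta> / (D \<tau> \<eta>)\<^sup>2) \<partial>circle_measure)
        = (\<integral>\<^sup>+ \<tau>. ennreal (h \<eta>) * ennreal (\<rho> \<tau> / (D \<tau> \<eta>)\<^sup>2) \<partial>circle_measure)"
      using h(2)[of \<eta>] rho_nonneg by (intro nn_integral_cong) (simp add: ennreal_mult_div mult.commute)
    also have "\<dots> = ennreal (h \<eta>) * (\<integral>\<^sup>+ \<tau>. ennreal (\<rho> \<tau> / (D \<tau> \<eta>)\<^sup>2) \<partial>circle_measure)"
      unfolding D_def xi_def by (rule nn_integral_cmult) measurable
    also have "\<dots> \<le> ennreal (h \<eta>) * ennreal K0"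
    proof (intro mult_left_mono rho_integral[OF e])
      fix \<tau> assume t: "\<tau> \<in> unit_circle"
      show "\<delta> \<tau> \<le> 3 * D \<tau> \<eta> \<and> cmod (\<tau> - \<eta>) \<le> 2 * D \<tau> \<eta>"
        using D_bounds[OF t e] by auto
    qed simp
    finally show "(\<integral>\<^sup>+ \<tau>. ennreal (\<rho> \<tau>) * ennreal (h \<eta> / (D \<tau> \<eta>)\<^sup>2) \<partial>circle_measure) \<le> ennreal K0 * ennreal (h \<eta>)"
      by (simp add: mult.commute)
  qed
  also have "\<dots> = ennreal K0 * (\<integral>\<^sup>+ \<eta>. ennreal (h \<eta>) \<partial>M)"
    by (rule nn_integral_cmult) measurable
  finally show ?thesis .
qed

lemma pot_finite:
  assumes h: "h \<in> borel_measurable M" "\<And>\<eta>. 0 \<le> h \<eta>" and M: "sets M = sets circle_borel" and z: "\<zeta> \<in> unit_circle - E"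
  shows "pot M h \<zeta> \<le> ennreal (9 / (\<delta> \<zeta>)\<^sup>2) * (\<integral>\<^sup>+ \<eta>. ennreal (h \<eta>) \<partial>M)"
proof -
  have d: "0 < \<delta> \<zeta>" using z by (intro delta_pos) simp
  note spM = circle_sets_space[OF M]
  have "pot M h \<zeta> \<le> (\<integral>\<^sup>+ \<eta>. ennreal (9 / (\<delta> \<zeta>)\<^sup>2) * ennreal (h \<eta>) \<partial>M)"
    unfolding pot_def
  proof (rule nn_integral_mono)
    fix \<eta> assume "\<eta> \<in> space M"
    then have e: "\<eta> \<in> unit_circle" by (simp add: spM)
    have "h \<eta> / (D \<zeta> \<eta>)\<^sup>2 \<le> h \<eta> / (\<delta> \<zeta> / 3)\<^sup>2"
      using D_bounds(4)[of \<zeta> \<eta>] z e d h(2)[of \<eta>] by (intro divide_left_mono power_mono mult_pos_pos) auto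
    then have "h \<eta> / (D \<zeta> \<eta>)\<^sup>2 \<le> 9 / (\<delta> \<zeta>)\<^sup>2 * h \<eta>" by (simp add: power2_eq_square mult.commute)
    then have "ennreal (h \<eta> / (D \<zeta> \<eta>)\<^sup>2) \<le> ennreal (9 / (\<delta> \<zeta>)\<^sup>2 * h \<eta>)" by (rule ennreal_leI)
    then show "ennreal (h \<eta> / (D \<zeta> \<eta>)\<^sup>2) \<le> ennreal (9 / (\<delta> \<zeta>)\<^sup>2) * ennreal (h \<eta>)"
      by (subst ennreal_mult[symmetric]) (use h(2)[of \<eta>] in auto)
  qed
  also have "\<dots> = ennreal (9 / (\<delta> \<zeta>)\<^sup>2) * (\<integral>\<^sup>+ \<eta>. ennreal (h \<eta>) \<partial>M)"
    by (rule nn_integral_cmult) (use h in measurable)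
  finally show ?thesis .
qed

end

lemma lipschitz_on_cball:
  assumes "open S" "cball 0 1 \<subseteq> S" "p holomorphic_on S"
  obtains L where "0 \<le> L" "\<And>z z'. z \<in> cball 0 1 \<Longrightarrow> z' \<in> cball 0 1 \<Longrightarrow> cmod (p z - p z') \<le> L * cmod (z - z')"
proof -
  obtain L where L: "\<And>z. z \<in> cball 0 1 \<Longrightarrow> cmod (deriv p z) \<le> L"
    using compact_norm_bound[OF compact_cball
        continuous_on_subset[OF holomorphic_on_imp_continuous_on[OF holomorphic_deriv[OF assms(3,1)]] assms(2)]] by blast
  have L0: "0 \<le> L" using L[of 0] norm_ge_zero[of "deriv p 0"] by (simp del: norm_ge_zero)
  show ?thesis
  proof (rule that[OF L0])
    fix z z' :: complex assume z: "z \<in> cball 0 1" "z' \<in> cball 0 1"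
    show "cmod (p z - p z') \<le> L * cmod (z - z')"
    proof (rule field_differentiable_bound[OF convex_cball _ L z(1) z(2)])
      fix x :: complex assume "x \<in> cball 0 1"
      then have "x \<in> S" using assms(2) by blast
      then have "(p has_field_derivative deriv p x) (at x)"
        using assms(1,3) holomorphic_derivI by blast
      then show "(p has_field_derivative deriv p x) (at x within cball 0 1)"
        by (rule has_field_derivative_at_within)
    qed
  qed
qed

section \<open>The local Lipschitz constant and the exponent of the outer function\<close>

context entropy_set
begin

interpretation v: modulus "\<lambda>t. w t powr (1 + \<alpha>)"
  by standard (rule v_modulus)

text \<open>That this power of \<open>w\<close> is itself a modulus gives \<open>V\<close> the
  doubling property and an almost decreasing ratio V t / t, which turn bounds in terms of \<delta>
  into bounds in terms of the distance of two points.\<close>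

definition V :: "real \<Rightarrow> real" where "V t = W t powr (1 + \<alpha>)"

lemma v_W: "v.W t = V t"
  by (simp add: V_def modulus_ext_def)

lemmas V_mono = v.W_mono[unfolded v_W]
  and V_twice = v.W_le_twice[unfolded v_W]
  and V_double = v.W_double[unfolded v_W]
  and V_ratio = v.W_ratio[unfolded v_W]
  and V_nonneg = v.W_nonneg[unfolded v_W]
  and V_pos = v.W_pos[unfolded v_W]

lemma g_meas_mu [measurable]: "g \<in> borel_measurable \<mu>"
  by (simp add: measurable_mu g_meas)

lemma g_integrable: "integrable \<mu> g"
  by (rule mu.integrable_const_bound[where B = 1]) (use g_range in auto)

lemma f_circle_meas [measurable]: "f \<in> borel_measurable circle_borel"
  by (rule circle_borel_measurable_borel) measurable

lemma f_nonneg: "0 \<le> f \<zeta>" using f_ge[of \<zeta>] by simp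

lemma pot_measurable:
  assumes M: "finite_measure M" "sets M = sets circle_borel" and h: "h \<in> borel_measurable circle_borel"
  shows "pot M h \<in> borel_measurable borel"
proof -
  interpret M: finite_measure M by (rule M)
  note mM = circle_sets_measurable[OF M(2)]
  have hM [measurable]: "h \<in> borel_measurable M" using h by (simp add: mM)
  note [measurable] = circle_sets_id[OF M(2)]
  show ?thesis unfolding pot_def[abs_def] D_def xi_def by measurable
qed

definition A :: "complex \<Rightarrow> ennreal" where
  "A \<zeta> = pot \<mu> g \<zeta> + pot circle_measure f \<zeta>"

definition a :: "complex \<Rightarrow> real" where "a \<zeta> = enn2real (A \<zeta>)"

lemma circle_finite: "finite_measure circle_measure" by unfold_locales

lemma A_measurable [measurable]: "A \<in> borel_measurable borel"
  unfolding A_def[abs_def]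
  by (intro borel_measurable_add pot_measurable mu g_meas circle_finite sets_circle_measure f_circle_meas)

lemma a_measurable [measurable]: "a \<in> borel_measurable borel"
  unfolding a_def[abs_def] by measurable

lemma a_nonneg: "0 \<le> a \<zeta>" by (simp add: a_def)

definition tot :: real where "tot = (\<integral> \<eta>. g \<eta> \<partial>\<mu>) + (\<integral> \<eta>. f \<eta> \<partial>circle_measure)"

lemma tot_parts: "0 \<le> (\<integral> \<eta>. g \<eta> \<partial>\<mu>)" "0 \<le> (\<integral> \<eta>. f \<eta> \<partial>circle_measure)"
  using g_range f_nonneg by (auto intro!: Bochner_Integration.integral_nonneg)

lemma nn_parts: "(\<integral>\<^sup>+ \<eta>. ennreal (g \<eta>) \<partial>\<mu>) = ennreal (\<integral> \<eta>. g \<eta> \<partial>\<mu>)"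
   "(\<integral>\<^sup>+ \<eta>. ennreal (f \<eta>) \<partial>circle_measure) = ennreal (\<integral> \<eta>. f \<eta> \<partial>circle_measure)"
  using g_range f_nonneg by (auto intro!: nn_integral_eq_integral g_integrable f_integrable)

lemma tot_nonneg: "0 \<le> tot" using tot_parts by (simp add: tot_def)

lemma A_le:
  assumes z: "\<zeta> \<in> unit_circle - E"
  shows "A \<zeta> \<le> ennreal (9 / (\<delta> \<zeta>)\<^sup>2 * tot)"
proof -
  have "A \<zeta> \<le> ennreal (9 / (\<delta> \<zeta>)\<^sup>2) * ennreal (\<integral> \<eta>. g \<eta> \<partial>\<mu>) + ennreal (9 / (\<delta> \<zeta>)\<^sup>2) * ennreal (\<integral> \<eta>. f \<eta> \<partial>circle_measure)"
    unfolding A_def nn_parts[symmetric] using g_range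
    by (intro add_mono pot_finite z mu sets_circle_measure f_nonneg)
       (auto simp: circle_measurable_cong)
  also have "\<dots> = ennreal (9 / (\<delta> \<zeta>)\<^sup>2) * ennreal tot"
    unfolding tot_def ennreal_plus[OF tot_parts] distrib_left ..
  also have "\<dots> = ennreal (9 / (\<delta> \<zeta>)\<^sup>2 * tot)"
    by (rule ennreal_mult[symmetric]) (use tot_nonneg in auto)
  finally show ?thesis .
qed

lemma A_eq: "\<zeta> \<in> unit_circle - E \<Longrightarrow> A \<zeta> = ennreal (a \<zeta>)"
  unfolding a_def using A_le[of \<zeta>] by (intro ennreal_enn2real[symmetric]) (auto intro: order.strict_trans1 ennreal_less_top)

lemma a_le: "\<zeta> \<in> unit_circle - E \<Longrightarrow> a \<zeta> \<le> 9 / (\<delta> \<zeta>)\<^sup>2 * tot"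
  using A_le[of \<zeta>] A_eq[of \<zeta>] tot_nonneg by (simp add: ennreal_le_iff)

lemma pot_near:
  assumes "\<zeta> \<in> unit_circle" "\<zeta>' \<in> unit_circle" "cmod (\<zeta> - \<zeta>') \<le> \<delta> \<zeta> / 4" "\<zeta> \<notin> E"
    and M: "sets M = sets circle_borel" and h: "h \<in> borel_measurable circle_borel" "\<And>\<eta>. 0 \<le> h \<eta>"
  shows "pot M h \<zeta> \<le> ennreal 4 * pot M h \<zeta>'"
proof -
  note mM = circle_sets_measurable[OF M]
  have hM [measurable]: "h \<in> borel_measurable M" using h by (simp add: mM)
  note [measurable] = circle_sets_id[OF M]
  note spM = circle_sets_space[OF M]
  have "pot M h \<zeta> \<le> (\<integral>\<^sup>+ \<eta>. ennreal 4 * ennreal (h \<eta> / (D \<zeta>' \<eta>)\<^sup>2) \<partial>M)"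
    unfolding pot_def
  proof (rule nn_integral_mono)
    fix \<eta> assume "\<eta> \<in> space M"
    then have e: "\<eta> \<in> unit_circle" by (simp add: spM)
    have p: "0 < D \<zeta> \<eta>" using assms e by (intro D_pos) auto
    have n: "D \<zeta> \<eta> \<le> 4 * D \<zeta>' \<eta>" "D \<zeta>' \<eta> \<le> 2 * D \<zeta> \<eta>" by (rule D_near[OF assms(1,2) e assms(3)])+
    have p': "0 < D \<zeta>' \<eta>" using p n by linarith
    have "(D \<zeta>' \<eta>)\<^sup>2 \<le> (2 * D \<zeta> \<eta>)\<^sup>2" using n p' by (intro power_mono) auto
    then have "(D \<zeta>' \<eta>)\<^sup>2 \<le> 4 * (D \<zeta> \<eta>)\<^sup>2" by (simp add: power_mult_distrib)
    then have "h \<eta> / (D \<zeta> \<eta>)\<^sup>2 \<le> 4 * (h \<eta> / (D \<zeta>' \<eta>)\<^sup>2)"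
      using p p' h(2)[of \<eta>] by (intro harnack_frac) auto
    then have "ennreal (h \<eta> / (D \<zeta> \<eta>)\<^sup>2) \<le> ennreal (4 * (h \<eta> / (D \<zeta>' \<eta>)\<^sup>2))" by (rule ennreal_leI)
    then show "ennreal (h \<eta> / (D \<zeta> \<eta>)\<^sup>2) \<le> ennreal 4 * ennreal (h \<eta> / (D \<zeta>' \<eta>)\<^sup>2)"
      by (subst ennreal_mult[symmetric]) (use h(2)[of \<eta>] in auto)
  qed
  also have "\<dots> = ennreal 4 * pot M h \<zeta>'"
    unfolding pot_def D_def xi_def by (rule nn_integral_cmult) measurable
  finally show ?thesis .
qed

lemma near_not_E: "cmod (\<zeta> - \<zeta>') \<le> \<delta> \<zeta> / 4 \<Longrightarrow> \<zeta> \<notin> E \<Longrightarrow> \<zeta>' \<notin> E"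
  using delta_near(1)[of \<zeta> \<zeta>'] delta_pos[of \<zeta>] delta_0_iff[of \<zeta>'] by auto

lemma a_near:
  assumes "\<zeta> \<in> unit_circle" "\<zeta>' \<in> unit_circle" "cmod (\<zeta> - \<zeta>') \<le> \<delta> \<zeta> / 4" "\<zeta> \<notin> E"
  shows "a \<zeta> \<le> 4 * a \<zeta>'"
proof -
  have z': "\<zeta>' \<notin> E" by (rule near_not_E[OF assms(3,4)])
  have "A \<zeta> \<le> ennreal 4 * pot \<mu> g \<zeta>' + ennreal 4 * pot circle_measure f \<zeta>'"
    unfolding A_def using g_range
    by (intro add_mono pot_near assms mu sets_circle_measure f_nonneg g_meas f_circle_meas) auto
  also have "\<dots> = ennreal 4 * A \<zeta>'" by (simp only: A_def distrib_left)
  finally have "ennreal (a \<zeta>) \<le> ennreal (4 * a \<zeta>')"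
    using A_eq[of \<zeta>] A_eq[of \<zeta>'] assms(1,2,4) z' a_nonneg[of \<zeta>']
    by (simp only: DiffI not_False_eq_True ennreal_mult zero_le_numeral)
  then show ?thesis using a_nonneg[of \<zeta>'] by (simp add: ennreal_le_iff)
qed

lemma pot_f_le: "pot circle_measure f \<zeta> \<le> A \<zeta>" "pot \<mu> g \<zeta> \<le> A \<zeta>"
  by (simp_all add: A_def)

text \<open>The distances \<open>D\<close> are at most 3 and the density \<open>f\<close> is at
  least 9. So ordinary Lipschitz constants can be absorbed into multiples of
  \<open>a\<close>.\<close>

lemma a_ge: assumes z: "\<zeta> \<in> unit_circle - E" shows "1 \<le> a \<zeta>"
proof -
  have "ennreal 1 = (\<integral>\<^sup>+ \<eta>. ennreal 1 \<partial>circle_measure)" by simp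
  also have "\<dots> \<le> pot circle_measure f \<zeta>"
    unfolding pot_def
  proof (rule nn_integral_mono)
    fix \<eta> assume "\<eta> \<in> space circle_measure"
    then have e: "\<eta> \<in> unit_circle" by simp
    have p: "0 < D \<zeta> \<eta>" by (rule D_pos[OF z e])
    have "(D \<zeta> \<eta>)\<^sup>2 \<le> 3\<^sup>2" using D_bounds(5)[of \<zeta> \<eta>] z e p by (intro power_mono) auto
    moreover have "9 \<le> f \<eta>" using f0_ge[of \<eta>] by (simp add: f_def)
    ultimately have "1 \<le> f \<eta> / (D \<zeta> \<eta>)\<^sup>2" using p by (simp add: le_divide_eq)
    then show "ennreal 1 \<le> ennreal (f \<eta> / (D \<zeta> \<eta>)\<^sup>2)" by (rule ennreal_leI)
  qed
  also have "\<dots> \<le> ennreal (a \<zeta>)" using pot_f_le(1)[of \<zeta>] A_eq[OF z] by simp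
  finally show ?thesis using a_nonneg[of \<zeta>] by (simp only: ennreal_le_iff)
qed

text \<open>The second summand compensates the growth of the local Lipschitz constant \<open>a\<close>; by the Dini
  condition it increases the potential only by a constant factor.\<close>

definition \<psi> :: "complex \<Rightarrow> real" where "\<psi> \<tau> = f \<tau> + \<rho> \<tau> * a \<tau>"

lemma psi_measurable [measurable]: "\<psi> \<in> borel_measurable borel"
  unfolding \<psi>_def[abs_def] by measurable

lemma psi_nonneg: "0 \<le> \<psi> \<tau>"
  using f_nonneg[of \<tau>] rho_nonneg[of \<tau>] a_nonneg[of \<tau>] by (simp add: \<psi>_def)

lemma ennreal_a_le: "ennreal (a \<tau>) \<le> A \<tau>"
  unfolding a_def by (simp add: ennreal_enn2real_if)

lemma A_iterate:
  assumes z: "\<zeta> \<in> unit_circle - E"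
  shows "(\<integral>\<^sup>+ \<tau>. ennreal (\<rho> \<tau> / (D \<zeta> \<tau>)\<^sup>2) * A \<tau> \<partial>circle_measure) \<le> ennreal (10 * K0) * A \<zeta>"
proof -
  have [measurable]: "pot \<mu> g \<in> borel_measurable circle_measure" "pot circle_measure f \<in> borel_measurable circle_measure"
    unfolding circle_measurable_cong
    by (intro circle_borel_measurable_borel pot_measurable mu g_meas circle_finite sets_circle_measure f_circle_meas)+
  note [measurable] = circle_sets_id[OF sets_circle_measure]
  have "(\<integral>\<^sup>+ \<tau>. ennreal (\<rho> \<tau> / (D \<zeta> \<tau>)\<^sup>2) * A \<tau> \<partial>circle_measure)
     = (\<integral>\<^sup>+ \<tau>. ennreal (\<rho> \<tau> / (D \<zeta> \<tau>)\<^sup>2) * pot \<mu> g \<tau> \<partial>circle_measure)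
       + (\<integral>\<^sup>+ \<tau>. ennreal (\<rho> \<tau> / (D \<zeta> \<tau>)\<^sup>2) * pot circle_measure f \<tau> \<partial>circle_measure)"
    unfolding A_def distrib_left D_def xi_def by (rule nn_integral_add) measurable
  also have "\<dots> \<le> ennreal (10 * K0) * pot \<mu> g \<zeta> + ennreal (10 * K0) * pot circle_measure f \<zeta>"
    using g_range by (intro add_mono pot_iterate mu g_meas circle_finite sets_circle_measure f_circle_meas f_nonneg z) auto
  finally show ?thesis by (simp add: A_def distrib_left)
qed

lemma pot_psi_le:
  assumes z: "\<zeta> \<in> unit_circle - E"
  shows "pot circle_measure \<psi> \<zeta> \<le> ennreal ((1 + 10 * K0) * a \<zeta>)"
proof -
  note [measurable] = circle_sets_id[OF sets_circle_measure]
  have "pot circle_measure \<psi> \<zeta> \<le> (\<integral>\<^sup>+ \<tau>. ennreal (f \<tau> / (D \<zeta> \<tau>)\<^sup>2) + ennreal (\<rho> \<tau> / (D \<zeta> \<tau>)\<^sup>2) * A \<tau> \<partial>circle_measure)"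
    unfolding pot_def
  proof (rule nn_integral_mono)
    fix \<tau>
    have "\<psi> \<tau> / (D \<zeta> \<tau>)\<^sup>2 = f \<tau> / (D \<zeta> \<tau>)\<^sup>2 + (\<rho> \<tau> / (D \<zeta> \<tau>)\<^sup>2) * a \<tau>"
      by (simp add: \<psi>_def add_divide_distrib)
    then have "ennreal (\<psi> \<tau> / (D \<zeta> \<tau>)\<^sup>2) = ennreal (f \<tau> / (D \<zeta> \<tau>)\<^sup>2) + ennreal (\<rho> \<tau> / (D \<zeta> \<tau>)\<^sup>2) * ennreal (a \<tau>)"
      using f_nonneg[of \<tau>] rho_nonneg[of \<tau>] a_nonneg[of \<tau>]
      by (simp only: ennreal_plus ennreal_mult divide_nonneg_nonneg zero_le_power2 mult_nonneg_nonneg)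
    also have "\<dots> \<le> ennreal (f \<tau> / (D \<zeta> \<tau>)\<^sup>2) + ennreal (\<rho> \<tau> / (D \<zeta> \<tau>)\<^sup>2) * A \<tau>"
      by (intro add_left_mono mult_left_mono ennreal_a_le) simp
    finally show "ennreal (\<psi> \<tau> / (D \<zeta> \<tau>)\<^sup>2) \<le> ennreal (f \<tau> / (D \<zeta> \<tau>)\<^sup>2) + ennreal (\<rho> \<tau> / (D \<zeta> \<tau>)\<^sup>2) * A \<tau>" .
  qed
  also have "\<dots> = pot circle_measure f \<zeta> + (\<integral>\<^sup>+ \<tau>. ennreal (\<rho> \<tau> / (D \<zeta> \<tau>)\<^sup>2) * A \<tau> \<partial>circle_measure)"
    unfolding pot_def D_def xi_def by (rule nn_integral_add) measurable
  also have "\<dots> \<le> ennreal 1 * A \<zeta> + ennreal (10 * K0) * A \<zeta>"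
    using pot_f_le(1)[of \<zeta>] by (intro add_mono A_iterate[OF z]) simp
  also have "\<dots> = ennreal ((1 + 10 * K0) * a \<zeta>)"
    unfolding A_eq[OF z] using K0_nonneg a_nonneg[of \<zeta>]
    by (subst ennreal_mult[symmetric], simp, simp)+ (subst ennreal_plus[symmetric], simp_all add: distrib_right)
  finally show ?thesis .
qed

lemma psi_integrable: "integrable circle_measure \<psi>"
proof -
  note [measurable] = circle_sets_id[OF sets_circle_measure]
  have [measurable]: "pot \<mu> g \<in> borel_measurable circle_measure" "pot circle_measure f \<in> borel_measurable circle_measure"
    unfolding circle_measurable_cong
    by (intro circle_borel_measurable_borel pot_measurable mu g_meas circle_finite sets_circle_measure f_circle_meas)+
  have "(\<integral>\<^sup>+ \<tau>. ennreal (\<psi> \<tau>) \<partial>circle_measure)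
     \<le> (\<integral>\<^sup>+ \<tau>. ennreal (f \<tau>) + (ennreal (\<rho> \<tau>) * pot \<mu> g \<tau> + ennreal (\<rho> \<tau>) * pot circle_measure f \<tau>) \<partial>circle_measure)"
  proof (rule nn_integral_mono)
    fix \<tau>
    have "ennreal (\<psi> \<tau>) = ennreal (f \<tau>) + ennreal (\<rho> \<tau>) * ennreal (a \<tau>)"
      unfolding \<psi>_def using f_nonneg[of \<tau>] rho_nonneg[of \<tau>] a_nonneg[of \<tau>]
      by (simp only: ennreal_plus ennreal_mult mult_nonneg_nonneg)
    also have "\<dots> \<le> ennreal (f \<tau>) + ennreal (\<rho> \<tau>) * A \<tau>"
      by (intro add_left_mono mult_left_mono ennreal_a_le) simp
    finally show "ennreal (\<psi> \<tau>) \<le> ennreal (f \<tau>) + (ennreal (\<rho> \<tau>) * pot \<mu> g \<tau> + ennreal (\<rho> \<tau>) * pot circle_measure f \<tau>)"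
      by (simp only: A_def distrib_left)
  qed
  also have "\<dots> = (\<integral>\<^sup>+ \<tau>. ennreal (f \<tau>) \<partial>circle_measure) + ((\<integral>\<^sup>+ \<tau>. ennreal (\<rho> \<tau>) * pot \<mu> g \<tau> \<partial>circle_measure)
      + (\<integral>\<^sup>+ \<tau>. ennreal (\<rho> \<tau>) * pot circle_measure f \<tau> \<partial>circle_measure))"
    by (simp add: nn_integral_add)
  also have "\<dots> \<le> ennreal (\<integral> \<eta>. f \<eta> \<partial>circle_measure) + (ennreal K0 * ennreal (\<integral> \<eta>. g \<eta> \<partial>\<mu>) + ennreal K0 * ennreal (\<integral> \<eta>. f \<eta> \<partial>circle_measure))"
    unfolding nn_parts[symmetric] using g_range
    by (intro add_mono order_refl pot_mass mu g_meas circle_finite sets_circle_measure f_circle_meas f_nonneg) auto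
  also have "\<dots> < \<infinity>"
    by (simp add: ennreal_mult_less_top ennreal_add_less_top)
  finally have "(\<integral>\<^sup>+ \<tau>. ennreal (norm (\<psi> \<tau>)) \<partial>circle_measure) < \<infinity>"
    using psi_nonneg by simp
  then show ?thesis by (intro integrableI_bounded) measurable
qed

text \<open>Restricting the exponent to a neighbourhood of \<open>E\<close> keeps the decay at
  \<open>E\<close> and makes the outer function tend to 1 in norm as \<open>s\<close> tends to
  0.\<close>

definition psi_cut :: "real \<Rightarrow> complex \<Rightarrow> real" where
  "psi_cut s \<tau> = (if \<delta> \<tau> < s then \<psi> \<tau> else 0)"

lemma psi_cut_measurable [measurable]: "psi_cut s \<in> borel_measurable borel"
  unfolding psi_cut_def[abs_def] by measurable

lemma psi_cut_range: "0 \<le> psi_cut s \<tau>" "psi_cut s \<tau> \<le> \<psi> \<tau>"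
  using psi_nonneg[of \<tau>] by (auto simp: psi_cut_def)

lemma psi_cut_integrable: "integrable circle_measure (psi_cut s)"
proof (rule Bochner_Integration.integrable_bound[OF psi_integrable])
  show "psi_cut s \<in> borel_measurable circle_measure"
    unfolding circle_measurable_cong by (rule circle_borel_measurable_borel) measurable
  show "AE \<tau> in circle_measure. norm (psi_cut s \<tau>) \<le> norm (\<psi> \<tau>)"
    using psi_cut_range psi_nonneg by (intro AE_I2) simp
qed

lemma xi_circle: "xi \<in> borel_measurable circle_measure" "xi \<in> borel_measurable \<mu>"
  unfolding circle_measurable_cong measurable_mu by (auto intro: circle_borel_measurable_borel)

sublocale hd: herglotz_data circle_measure xi "psi_cut s" for s
  by standard (use psi_cut_integrable psi_cut_range xi_circle cmod_xi delta_range in auto)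

sublocale hg: herglotz_data \<mu> xi g
  by standard (use g_integrable g_range xi_circle cmod_xi delta_range in auto)

lemma xi_far:
  assumes "sets M = sets circle_borel" "\<zeta> \<in> unit_circle - E"
  shows "AE x in M. \<delta> \<zeta> / 3 \<le> cmod (xi x - \<zeta>) \<and> cmod (xi x) \<le> 2" "0 < \<delta> \<zeta> / 3"
proof -
  note spM = circle_sets_space[OF assms(1)]
  show "AE x in M. \<delta> \<zeta> / 3 \<le> cmod (xi x - \<zeta>) \<and> cmod (xi x) \<le> 2"
  proof (rule AE_I2)
    fix x assume "x \<in> space M"
    then have "x \<in> unit_circle" by (simp add: spM)
    then show "\<delta> \<zeta> / 3 \<le> cmod (xi x - \<zeta>) \<and> cmod (xi x) \<le> 2"
      using D_bounds(4)[of \<zeta> x] cmod_xi[of x] delta_range[of x] assms by (auto simp: D_def)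
  qed
  show "0 < \<delta> \<zeta> / 3" using delta_pos[of \<zeta>] assms by auto
qed

text \<open>At \<zeta> and \<zeta>' the distances to every pole agree up to the factor 4, so the
  difference of the kernels is at most 16 |\<zeta> - \<zeta>'| / D^2; here 16 = 4 * 4 with 2 |xi|
  \<le> 4.\<close>

lemma herglotz_near:
  assumes hd: "herglotz_data M xi h" and M: "finite_measure M" "sets M = sets circle_borel"
    and h: "h \<in> borel_measurable circle_borel" "\<And>\<eta>. 0 \<le> h \<eta>"
    and z: "\<zeta> \<in> unit_circle - E" "\<zeta>' \<in> unit_circle" "cmod (\<zeta> - \<zeta>') \<le> \<delta> \<zeta> / 4"
    and b: "pot M h \<zeta> \<le> ennreal b" "0 \<le> b"
  shows "cmod (herglotz M xi h \<zeta> - herglotz M xi h \<zeta>') \<le> 16 * cmod (\<zeta> - \<zeta>') * b"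
proof -
  interpret herglotz_data M xi h by (rule hd)
  note spM = circle_sets_space[OF M(2)]
  have z': "\<zeta>' \<in> unit_circle - E" using near_not_E[OF z(3)] z by auto
  let ?q = "\<lambda>\<eta>. h \<eta> / (D \<zeta> \<eta>)\<^sup>2"
  have qm: "?q \<in> borel_measurable M"
    unfolding D_def by measurable
  have nn: "(\<integral>\<^sup>+ \<eta>. ennreal (?q \<eta>) \<partial>M) \<le> ennreal b" using b(1) by (simp add: pot_def)
  have qi: "integrable M ?q"
    using nn qm h(2) by (intro integrableI_nonneg) (auto intro: order.strict_trans1 ennreal_less_top)
  have "cmod (herglotz M xi h \<zeta> - herglotz M xi h \<zeta>') \<le> (\<integral> \<eta>. 16 * cmod (\<zeta> - \<zeta>') * ?q \<eta> \<partial>M)"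
  proof (rule herglotz_diff_le)
    show "integrable M (\<lambda>x. of_real (h x) * ((xi x + \<zeta>) / (xi x - \<zeta>)))"
      by (rule boundary_integrable[OF _ xi_far(2)[OF M(2) z(1)] xi_far(1)[OF M(2) z(1)]]) (use z in simp)
    show "integrable M (\<lambda>x. of_real (h x) * ((xi x + \<zeta>') / (xi x - \<zeta>')))"
      by (rule boundary_integrable[OF _ xi_far(2)[OF M(2) z'] xi_far(1)[OF M(2) z']]) (use z in simp)
    show "integrable M (\<lambda>\<eta>. 16 * cmod (\<zeta> - \<zeta>') * ?q \<eta>)" by (intro integrable_mult_right qi)
    show "AE x in M. xi x \<noteq> \<zeta> \<and> xi x \<noteq> \<zeta>'"
      using D_pos[OF z(1)] D_pos[OF z'] by (intro AE_I2) (auto simp: D_def spM)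
    show "AE x in M. h x * (2 * cmod (xi x) * cmod (\<zeta> - \<zeta>') / (cmod (xi x - \<zeta>) * cmod (xi x - \<zeta>'))) \<le> 16 * cmod (\<zeta> - \<zeta>') * ?q x"
    proof (rule AE_I2)
      fix x assume "x \<in> space M"
      then have x: "x \<in> unit_circle" by (simp add: spM)
      have p: "0 < D \<zeta> x" by (rule D_pos[OF z(1) x])
      have n: "D \<zeta> x \<le> 4 * D \<zeta>' x" using D_near(1)[of \<zeta> \<zeta>' x] z x by auto
      have "2 * cmod (xi x) * cmod (\<zeta> - \<zeta>') / (D \<zeta> x * D \<zeta>' x) \<le> 4 * cmod (\<zeta> - \<zeta>') / (D \<zeta> x * (D \<zeta> x / 4))"
        using p n cmod_xi[OF x] delta_range[of x] by (intro frac_le mult_right_mono mult_left_mono) auto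
      also have "\<dots> = 16 * cmod (\<zeta> - \<zeta>') / (D \<zeta> x)\<^sup>2" by (simp add: power2_eq_square)
      finally have "h x * (2 * cmod (xi x) * cmod (\<zeta> - \<zeta>') / (D \<zeta> x * D \<zeta>' x)) \<le> h x * (16 * cmod (\<zeta> - \<zeta>') / (D \<zeta> x)\<^sup>2)"
        using h(2) by (rule mult_left_mono)
      then show "h x * (2 * cmod (xi x) * cmod (\<zeta> - \<zeta>') / (cmod (xi x - \<zeta>) * cmod (xi x - \<zeta>'))) \<le> 16 * cmod (\<zeta> - \<zeta>') * ?q x"
        by (simp add: D_def mult_ac)
    qed
  qed
  also have "\<dots> = 16 * cmod (\<zeta> - \<zeta>') * (\<integral> \<eta>. ?q \<eta> \<partial>M)" by (rule Bochner_Integration.integral_mult_right_zero)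
  also have "\<dots> \<le> 16 * cmod (\<zeta> - \<zeta>') * b"
  proof (rule mult_left_mono)
    have "ennreal (\<integral> \<eta>. ?q \<eta> \<partial>M) \<le> ennreal b"
      using nn nn_integral_eq_integral[OF qi] h(2) by simp
    then show "(\<integral> \<eta>. ?q \<eta> \<partial>M) \<le> b" using b(2) by (simp add: ennreal_le_iff)
  qed simp
  finally show ?thesis .
qed

abbreviation "G s \<equiv> herglotz circle_measure xi (psi_cut s)"
abbreviation "H \<equiv> herglotz \<mu> xi g"

lemma psi_cut_circle [measurable]: "psi_cut s \<in> borel_measurable circle_borel"
  by (rule circle_borel_measurable_borel) measurable

lemma G_near:
  assumes "\<zeta> \<in> unit_circle - E" "\<zeta>' \<in> unit_circle" "cmod (\<zeta> - \<zeta>') \<le> \<delta> \<zeta> / 4"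
  shows "cmod (G s \<zeta> - G s \<zeta>') \<le> 16 * cmod (\<zeta> - \<zeta>') * ((1 + 10 * K0) * a \<zeta>)"
proof (rule herglotz_near[OF hd.herglotz_data_axioms circle_finite sets_circle_measure psi_cut_circle psi_cut_range(1) assms])
  have "pot circle_measure (psi_cut s) \<zeta> \<le> pot circle_measure \<psi> \<zeta>"
    unfolding pot_def by (intro nn_integral_mono ennreal_leI divide_right_mono psi_cut_range) simp
  then show "pot circle_measure (psi_cut s) \<zeta> \<le> ennreal ((1 + 10 * K0) * a \<zeta>)"
    using pot_psi_le[OF assms(1)] by (rule order_trans)
qed (use K0_nonneg a_nonneg in auto)

lemma H_near:
  assumes "\<zeta> \<in> unit_circle - E" "\<zeta>' \<in> unit_circle" "cmod (\<zeta> - \<zeta>') \<le> \<delta> \<zeta> / 4"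
  shows "cmod (H \<zeta> - H \<zeta>') \<le> 16 * cmod (\<zeta> - \<zeta>') * a \<zeta>"
  by (rule herglotz_near[OF hg.herglotz_data_axioms mu g_meas _ assms])
     (use g_range a_nonneg pot_f_le(2)[of \<zeta>] A_eq[OF assms(1)] in auto)

lemma Re_boundary_nonneg:
  assumes "\<zeta> \<in> unit_circle - E"
  shows "0 \<le> Re (G s \<zeta>)" "0 \<le> Re (H \<zeta>)"
  using assms
  by (auto intro!: hd.Re_herglotz_nonneg hg.Re_herglotz_nonneg
      hd.boundary_integrable[OF _ xi_far(2) xi_far(1)] hg.boundary_integrable[OF _ xi_far(2) xi_far(1)] sets_circle_measure mu)

text \<open>\<rho> and \<open>a\<close> change by a factor of at most 4 each. The logarithm in
  \<open>f0\<close> changes by at most ln 2 < 1, since \<open>W\<close> changes at most by the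
  factor 2.\<close>

lemma psi_near:
  assumes "\<zeta> \<in> unit_circle - E" "\<eta> \<in> unit_circle" "cmod (\<zeta> - \<eta>) \<le> \<delta> \<zeta> / 4"
  shows "\<psi> \<zeta> \<le> 16 * \<psi> \<eta>"
proof -
  have e: "\<eta> \<notin> E" and zE: "\<zeta> \<notin> E" using near_not_E[OF assms(3)] assms by auto
  note dn = delta_near[OF assms(3)]
  have dz: "0 < \<delta> \<zeta>" "0 < \<delta> \<eta>" using delta_pos zE e by auto
  have W1: "W (\<delta> \<eta>) \<le> 2 * W (\<delta> \<zeta>)" and W2: "W (\<delta> \<zeta>) \<le> 2 * W (\<delta> \<eta>)"
    using dn dz by (auto intro!: W_double)
  have Wp: "0 < W (\<delta> \<zeta>)" "0 < W (\<delta> \<eta>)" using W_pos dz by auto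
  have "f0 \<zeta> \<le> 2 * f0 \<eta>"
  proof -
    have "ln (W (\<delta> \<eta>)) \<le> ln (2 * W (\<delta> \<zeta>))" using W1 Wp by (intro ln_mono) auto
    also have "\<dots> = ln 2 + ln (W (\<delta> \<zeta>))" using Wp by (simp add: ln_mult)
    finally have "f0 \<zeta> - 1 \<le> f0 \<eta>"
      using ln_2_less_1 zE e Wp w_1_pos by (simp add: f0_def ln_div)
    then show ?thesis using f0_ge[of \<eta>] by linarith
  qed
  then have 1: "f \<zeta> \<le> 16 * f \<eta>" using f0_ge[of \<eta>] by (simp add: f_def)
  have "W (\<delta> \<zeta>) powr \<alpha> \<le> (2 * W (\<delta> \<eta>)) powr \<alpha>" using W2 Wp alpha by (intro powr_mono2) auto
  also have "\<dots> = 2 powr \<alpha> * W (\<delta> \<eta>) powr \<alpha>" using Wp by (simp add: powr_mult)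
  also have "\<dots> \<le> 2 powr 1 * W (\<delta> \<eta>) powr \<alpha>" using alpha by (intro mult_right_mono powr_mono) auto
  finally have "\<rho> \<zeta> \<le> (2 powr 1 * W (\<delta> \<eta>) powr \<alpha>) * (2 * \<delta> \<eta>)"
    unfolding \<rho>_def using dn dz by (intro mult_mono) auto
  then have "\<rho> \<zeta> \<le> 4 * \<rho> \<eta>" by (simp add: \<rho>_def)
  moreover have "a \<zeta> \<le> 4 * a \<eta>" using assms zE by (intro a_near) auto
  ultimately have "\<rho> \<zeta> * a \<zeta> \<le> (4 * \<rho> \<eta>) * (4 * a \<eta>)"
    using rho_nonneg a_nonneg by (intro mult_mono) auto
  then show ?thesis using 1 by (simp add: \<psi>_def)
qed

text \<open>Only the arc of radius \<delta> / 4 about \<zeta> is kept. It has measure at least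
  \<delta> / 32, \<open>\<psi>\<close> is at least \<open>\<psi> \<zeta> / 16\<close> on it, and the
  Poisson kernel, positive on the circle because the poles are moved outwards, is at least 2 / (3
  \<delta>). This gives 768 = 16 * 32 * 3 / 2.\<close>

lemma Re_G_lower:
  assumes z: "\<zeta> \<in> unit_circle - E" and s: "\<delta> \<zeta> < s / 2"
  shows "\<psi> \<zeta> / 768 \<le> Re (G s \<zeta>)"
proof -
  have zc: "\<zeta> \<in> unit_circle" and d: "0 < \<delta> \<zeta>" "\<delta> \<zeta> \<le> 1" using z delta_pos delta_range by auto
  note bi = hd.boundary_integrable[OF _ xi_far(2)[OF sets_circle_measure z] xi_far(1)[OF sets_circle_measure z], of s]
  have bi': "integrable circle_measure (\<lambda>x. of_real (psi_cut s x) * ((xi x + \<zeta>) / (xi x - \<zeta>)))"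
    using bi zc by simp
  let ?B = "{\<eta> \<in> unit_circle. cmod (\<eta> - \<zeta>) < \<delta> \<zeta> / 4}"
  let ?c = "\<psi> \<zeta> / 16 * (2 / (3 * \<delta> \<zeta>))"
  have B: "?B \<in> sets circle_measure"
    unfolding sets_circle_measure by (rule circle_borel_Collect) measurable
  have mB: "\<delta> \<zeta> / 32 \<le> measure circle_measure ?B"
  proof -
    have "ennreal (\<delta> \<zeta> / 4 / 8) \<le> emeasure circle_measure ?B"
      by (rule circle_measure_ball_ge[OF zc]) (use d in auto)
    then show ?thesis by (simp add: circle.emeasure_eq_measure measure_nonneg)
  qed
  have "\<psi> \<zeta> / 768 = \<delta> \<zeta> / 32 * ?c" using d by simp
  also have "\<dots> \<le> measure circle_measure ?B * ?c"
    using d psi_nonneg[of \<zeta>] by (intro mult_right_mono mB) auto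
  also have "\<dots> = (\<integral> \<eta>. ?c * indicator ?B \<eta> \<partial>circle_measure)"
    using sets.Int_space_eq2[OF B] by simp
  also have "\<dots> \<le> (\<integral> \<eta>. psi_cut s \<eta> * (((cmod (xi \<eta>))\<^sup>2 - (cmod \<zeta>)\<^sup>2) / (cmod (xi \<eta> - \<zeta>))\<^sup>2) \<partial>circle_measure)"
  proof (rule integral_mono[OF _ hd.Re_herglotz(2)[OF bi']])
    show "integrable circle_measure (\<lambda>\<eta>. ?c * indicator ?B \<eta>)"
      using B by (intro integrable_mult_right integrable_real_indicator) (auto simp: circle.emeasure_eq_measure)
    fix \<eta> assume "\<eta> \<in> space circle_measure"
    then have e: "\<eta> \<in> unit_circle" by simp
    have num: "(cmod (xi \<eta>))\<^sup>2 - (cmod \<zeta>)\<^sup>2 = 2 * \<delta> \<eta> + (\<delta> \<eta>)\<^sup>2"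
      using zc cmod_xi[OF e] by (simp add: power2_eq_square algebra_simps)
    show "?c * indicator ?B \<eta> \<le> psi_cut s \<eta> * (((cmod (xi \<eta>))\<^sup>2 - (cmod \<zeta>)\<^sup>2) / (cmod (xi \<eta> - \<zeta>))\<^sup>2)"
    proof (cases "\<eta> \<in> ?B")
      case True
      then have near: "cmod (\<zeta> - \<eta>) \<le> \<delta> \<zeta> / 4" by (simp add: norm_minus_commute)
      note dn = delta_near[OF near]
      have "psi_cut s \<eta> = \<psi> \<eta>" using dn s d by (simp add: psi_cut_def)
      then have 1: "\<psi> \<zeta> / 16 \<le> psi_cut s \<eta>" using psi_near[OF z e near] by simp
      have D: "cmod (xi \<eta> - \<zeta>) \<le> 3 / 2 * \<delta> \<zeta>"
        using norm_triangle_ineq[of "xi \<eta> - \<eta>" "\<eta> - \<zeta>"] xi_minus[OF e] dn near by (simp add: norm_minus_commute)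
      have Dp: "0 < cmod (xi \<eta> - \<zeta>)" using D_pos[OF z e] by (simp add: D_def)
      have "2 / (3 * \<delta> \<zeta>) = (3 / 2 * \<delta> \<zeta>) / (3 / 2 * \<delta> \<zeta>)\<^sup>2" using d by (simp add: power2_eq_square field_simps)
      also have "\<dots> \<le> (2 * \<delta> \<eta> + (\<delta> \<eta>)\<^sup>2) / (cmod (xi \<eta> - \<zeta>))\<^sup>2"
      proof (intro frac_le power_mono)
        show "3 / 2 * \<delta> \<zeta> \<le> 2 * \<delta> \<eta> + (\<delta> \<eta>)\<^sup>2" using dn(1) zero_le_power2[of "\<delta> \<eta>"] by linarith
      qed (use D Dp d dn in auto)
      finally show ?thesis
        unfolding num using True 1 psi_nonneg[of \<zeta>] d psi_cut_range(1)[of s \<eta>] by (simp del: times_divide_eq_left times_divide_eq_right) (intro mult_mono, auto)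
    next
      case False
      have "0 \<le> psi_cut s \<eta> * ((2 * \<delta> \<eta> + (\<delta> \<eta>)\<^sup>2) / (cmod (xi \<eta> - \<zeta>))\<^sup>2)"
        using psi_cut_range(1)[of s \<eta>] delta_range(1)[of \<eta>] by simp
      then show ?thesis using False unfolding num by simp
    qed
  qed
  also have "\<dots> = Re (G s \<zeta>)" by (rule hd.Re_herglotz(1)[OF bi', symmetric])
  finally show ?thesis .
qed

text \<open>Near \<open>E\<close> the exponential is at most q^3 exp (- y), where q = W / w 1 and y
  = \<rho> a / 768. The first bound uses q^3 \<le> q^(1 + \<alpha>). For the second, y exp (- y)
  \<le> 1 replaces \<open>a\<close> by 768 / \<rho>, and q^3 \<le> q^(1 + 2 \<alpha>) pays for the
  W^\<alpha> in \<rho>. At distance at least s / 2 all quantities are bounded, and the constants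
  depend on \<open>s\<close>.\<close>

lemma decay:
  assumes s: "0 < s" "s \<le> 1"
  obtains C where "0 \<le> C"
    "\<And>\<zeta>. \<zeta> \<in> unit_circle - E \<Longrightarrow> exp (- Re (G s \<zeta>)) \<le> C * V (\<delta> \<zeta>)"
    "\<And>\<zeta>. \<zeta> \<in> unit_circle - E \<Longrightarrow> exp (- Re (G s \<zeta>)) * a \<zeta> \<le> C * (V (\<delta> \<zeta>) / \<delta> \<zeta>)"
proof -
  define C1 C2 C3 C4 where "C1 = 1 / w 1 powr (1 + \<alpha>)" and "C2 = 768 / (w 1 powr (1 + \<alpha>) * w 1 powr \<alpha>)"
    and "C3 = 1 / V (s / 2)" and "C4 = 9 * tot / (s / 2 * V (s / 2))"
  have Vs: "0 < V (s / 2)" using s by (intro V_pos) simp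
  have Cnn: "0 \<le> C1" "0 \<le> C2" "0 \<le> C3" "0 \<le> C4"
    using Vs s tot_nonneg by (auto simp: C1_def C2_def C3_def C4_def)
  let ?C = "C1 + C2 + C3 + C4"
  have main: "exp (- Re (G s \<zeta>)) \<le> ?C * V (\<delta> \<zeta>) \<and> exp (- Re (G s \<zeta>)) * a \<zeta> \<le> ?C * (V (\<delta> \<zeta>) / \<delta> \<zeta>)"
    if z: "\<zeta> \<in> unit_circle - E" for \<zeta>
  proof -
    have d: "0 < \<delta> \<zeta>" using z delta_pos by auto
    have Vd: "0 < V (\<delta> \<zeta>)" by (rule V_pos[OF d])
    have Wd: "0 < W (\<delta> \<zeta>)" by (rule W_pos[OF d])
    have weak: "c \<le> ?C \<Longrightarrow> c * V (\<delta> \<zeta>) \<le> ?C * V (\<delta> \<zeta>)" "c \<le> ?C \<Longrightarrow> c * (V (\<delta> \<zeta>) / \<delta> \<zeta>) \<le> ?C * (V (\<delta> \<zeta>) / \<delta> \<zeta>)" for c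
      using Vd d by (intro mult_right_mono; simp)+
    show ?thesis
    proof (cases "\<delta> \<zeta> < s / 2")
      case True
      define q where "q = W (\<delta> \<zeta>) / w 1"
      have q: "0 < q" "q \<le> 1" using Wd w_1_pos W_le[of "\<delta> \<zeta>"] d by (auto simp: q_def)
      define y where "y = \<rho> \<zeta> * a \<zeta> / 768"
      have rp: "0 < \<rho> \<zeta>" using Wd d by (simp add: \<rho>_def)
      have y: "0 \<le> y" using rp a_nonneg[of \<zeta>] by (simp add: y_def)
      have "3 * f0 \<zeta> + y \<le> Re (G s \<zeta>)"
        using Re_G_lower[OF z True] by (simp add: \<psi>_def f_def y_def)
      moreover have "- ln q \<le> f0 \<zeta>"
        using z Wd w_1_pos by (simp add: f0_def q_def ln_div)
      ultimately have "exp (- Re (G s \<zeta>)) \<le> exp (3 * ln q + - y)" by simp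
      also have "\<dots> = q powr 3 * exp (- y)"
        unfolding exp_add using q by (simp add: powr_def)
      finally have e: "exp (- Re (G s \<zeta>)) \<le> q powr 3 * exp (- y)" .
      have V: "V (\<delta> \<zeta>) = q powr (1 + \<alpha>) * w 1 powr (1 + \<alpha>)"
        unfolding V_def q_def using Wd w_1_pos by (simp add: powr_divide)
      have "q powr 3 * exp (- y) \<le> q powr (1 + \<alpha>) * 1"
        using q y alpha by (intro mult_mono powr_mono') auto
      also have "\<dots> = C1 * V (\<delta> \<zeta>)" using w_1_pos by (simp add: V C1_def)
      finally have 1: "exp (- Re (G s \<zeta>)) \<le> C1 * V (\<delta> \<zeta>)" using e by simp
      have "exp (- Re (G s \<zeta>)) * a \<zeta> \<le> (q powr 3 * exp (- y)) * a \<zeta>"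
        using e a_nonneg by (rule mult_right_mono)
      also have "\<dots> = q powr 3 * (y * exp (- y)) * (768 / \<rho> \<zeta>)" using rp by (simp add: y_def)
      also have "\<dots> \<le> q powr (1 + 2 * \<alpha>) * 1 * (768 / \<rho> \<zeta>)"
      proof (intro mult_right_mono mult_mono)
        show "q powr 3 \<le> q powr (1 + 2 * \<alpha>)" using q alpha by (intro powr_mono') auto
        have "y \<le> exp y" using exp_ge_add_one_self[of y] by linarith
        then show "y * exp (- y) \<le> 1" by (simp add: exp_minus divide_inverse[symmetric])
      qed (use y rp in auto)
      also have "\<dots> = C2 * (V (\<delta> \<zeta>) / \<delta> \<zeta>)"
      proof -
        have "q powr (1 + 2 * \<alpha>) = q powr (1 + \<alpha>) * q powr \<alpha>"
          unfolding powr_add[symmetric] by (simp add: algebra_simps)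
        moreover have "q powr \<alpha> = W (\<delta> \<zeta>) powr \<alpha> / w 1 powr \<alpha>"
          unfolding q_def using Wd w_1_pos by (simp add: powr_divide)
        ultimately show ?thesis
          using Wd w_1_pos d by (simp add: V C2_def \<rho>_def)
      qed
      finally have 2: "exp (- Re (G s \<zeta>)) * a \<zeta> \<le> C2 * (V (\<delta> \<zeta>) / \<delta> \<zeta>)" .
      show ?thesis using order_trans[OF 1 weak(1)] order_trans[OF 2 weak(2)] Cnn by auto
    next
      case False
      then have ds: "s / 2 \<le> \<delta> \<zeta>" by simp
      have VV: "V (s / 2) \<le> V (\<delta> \<zeta>)" using ds s by (intro V_mono) auto
      have e: "exp (- Re (G s \<zeta>)) \<le> 1" using Re_boundary_nonneg(1)[OF z] by simp
      also have "1 \<le> C3 * V (\<delta> \<zeta>)" using VV Vs by (simp add: C3_def)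
      finally have 1: "exp (- Re (G s \<zeta>)) \<le> C3 * V (\<delta> \<zeta>)" .
      have "exp (- Re (G s \<zeta>)) * a \<zeta> \<le> 1 * (9 / (\<delta> \<zeta>)\<^sup>2 * tot)"
        using e a_le[OF z] a_nonneg by (intro mult_mono) auto
      also have "\<dots> = 9 * tot / (\<delta> \<zeta> * V (\<delta> \<zeta>)) * (V (\<delta> \<zeta>) / \<delta> \<zeta>)" using Vd d by (simp add: power2_eq_square)
      also have "\<dots> \<le> C4 * (V (\<delta> \<zeta>) / \<delta> \<zeta>)"
        unfolding C4_def using ds VV Vs Vd d s tot_nonneg
        by (intro mult_right_mono divide_left_mono mult_mono mult_pos_pos) auto
      finally have 2: "exp (- Re (G s \<zeta>)) * a \<zeta> \<le> C4 * (V (\<delta> \<zeta>) / \<delta> \<zeta>)" .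
      show ?thesis using order_trans[OF 1 weak(1)] order_trans[OF 2 weak(2)] Cnn by auto
    qed
  qed
  show ?thesis by (rule that[of ?C]) (use Cnn main in auto)
qed

text \<open>The boundary function of exp (- h). The value 0 on the null set \<open>E\<close>, where
  poles lie on the circle, agrees with the decay of the outer function towards
  \<open>E\<close>.\<close>

definition cut :: "(complex \<Rightarrow> complex) \<Rightarrow> complex \<Rightarrow> complex" where
  "cut h \<zeta> = (if \<zeta> \<in> E then 0 else exp (- h \<zeta>))"

text \<open>For points closer than \<delta> / 4 the product rule leaves the exponential times
  \<open>a\<close> times their distance t, which \<open>decay\<close> and the ratio property of
  \<open>V\<close> bound by a multiple of V t. For other points \<delta> is at most 5 t at both, and
  each term is bounded by \<open>V\<close> of \<delta>.\<close>

lemma smooth_symbol: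
  assumes s: "0 < s" "s \<le> 1" and CY: "0 \<le> CY" "\<And>\<zeta>. \<zeta> \<in> unit_circle \<Longrightarrow> cmod (Y \<zeta>) \<le> CY"
    and Y: "\<And>\<zeta> \<zeta>'. \<zeta> \<in> unit_circle - E \<Longrightarrow> \<zeta>' \<in> unit_circle \<Longrightarrow> cmod (\<zeta> - \<zeta>') \<le> \<delta> \<zeta> / 4 \<Longrightarrow>
        cmod (Y \<zeta> - Y \<zeta>') \<le> CY * (a \<zeta> * cmod (\<zeta> - \<zeta>'))"
  obtains L where "0 \<le> L" "\<And>\<zeta> \<zeta>'. \<zeta> \<in> unit_circle \<Longrightarrow> \<zeta>' \<in> unit_circle \<Longrightarrow>
     cmod (cnj (cut (G s) \<zeta>) * Y \<zeta> - cnj (cut (G s) \<zeta>') * Y \<zeta>') \<le> L * V (cmod (\<zeta> - \<zeta>'))"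
proof -
  obtain C where C: "0 \<le> C"
    "\<And>\<zeta>. \<zeta> \<in> unit_circle - E \<Longrightarrow> exp (- Re (G s \<zeta>)) \<le> C * V (\<delta> \<zeta>)"
    "\<And>\<zeta>. \<zeta> \<in> unit_circle - E \<Longrightarrow> exp (- Re (G s \<zeta>)) * a \<zeta> \<le> C * (V (\<delta> \<zeta>) / \<delta> \<zeta>)"
    using decay[OF s] by blast
  define K where "K = 16 * (1 + 10 * K0)"
  have K: "0 \<le> K" using K0_nonneg by (simp add: K_def)
  define L where "L = 2 * (CY * (C * (K + 11 * (K + 1)))) + 10 * (C * CY)"
  have L0: "0 \<le> L" using C K CY by (simp add: L_def)
  let ?U = "\<lambda>\<zeta>. cnj (cut (G s) \<zeta>) * Y \<zeta>"
  have size: "cmod (?U \<zeta>) \<le> C * V (\<delta> \<zeta>) * CY" if "\<zeta> \<in> unit_circle" for \<zeta>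
  proof (cases "\<zeta> \<in> E")
    case True
    then show ?thesis using C CY V_nonneg[of "\<delta> \<zeta>"] delta_range[of \<zeta>] by (simp add: cut_def)
  next
    case False
    then show ?thesis unfolding norm_mult complex_mod_cnj using C(2)[of \<zeta>] CY(2)[of \<zeta>] that C(1) V_nonneg[of "\<delta> \<zeta>"] delta_range[of \<zeta>]
      by (intro mult_mono) (auto simp: cut_def)
  qed
  have main: "cmod (?U \<zeta> - ?U \<zeta>') \<le> L * V (cmod (\<zeta> - \<zeta>'))" if z: "\<zeta> \<in> unit_circle" "\<zeta>' \<in> unit_circle" for \<zeta> \<zeta>'
  proof (cases "\<zeta> \<notin> E \<and> cmod (\<zeta> - \<zeta>') \<le> \<delta> \<zeta> / 4")
    case True
    define t where "t = cmod (\<zeta> - \<zeta>')"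
    have zE: "\<zeta> \<in> unit_circle - E" "\<zeta> \<notin> E" and near: "cmod (\<zeta> - \<zeta>') \<le> \<delta> \<zeta> / 4" using True z by auto
    have z'E: "\<zeta>' \<in> unit_circle - E" "\<zeta>' \<notin> E" using near_not_E[OF near] True z by auto
    note dn = delta_near[OF near]
    have d: "0 < \<delta> \<zeta>" "0 < \<delta> \<zeta>'" using delta_pos zE z'E by auto
    show ?thesis
    proof (cases "t = 0")
      case True
      then show ?thesis using L0 V_nonneg[of 0] by (simp add: t_def)
    next
      case False
      then have t: "0 < t" "t \<le> \<delta> \<zeta>" using near d by (auto simp: t_def)
      define e e' where "e = exp (- Re (G s \<zeta>))" and "e' = exp (- Re (G s \<zeta>'))"
      have ee: "0 \<le> e" "0 \<le> e'" by (simp_all add: e_def e'_def)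
      define q where "q = V (\<delta> \<zeta>) / \<delta> \<zeta>"
      have q0: "0 \<le> q" using V_nonneg[of "\<delta> \<zeta>"] d by (simp add: q_def)
      have ea: "e * a \<zeta> \<le> C * q" using C(3)[OF zE(1)] by (simp add: e_def q_def)
      \<comment> \<open>The factor 4 is from \<open>a_near\<close>, 2 from doubling of
        \<open>V\<close>, and 3/4 from \<open>delta_near\<close>; 11 is an upper bound for
        32/3.\<close>
      have e'a: "e' * a \<zeta> \<le> 11 * (C * q)"
      proof -
        have "e' * a \<zeta> \<le> e' * (4 * a \<zeta>')" using a_near[OF z near zE(2)] ee by (intro mult_left_mono) auto
        also have "\<dots> \<le> 4 * (C * (V (\<delta> \<zeta>') / \<delta> \<zeta>'))" using C(3)[OF z'E(1)] by (simp add: e'_def)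
        also have "\<dots> \<le> 4 * (C * (2 * V (\<delta> \<zeta>) / (3 / 4 * \<delta> \<zeta>)))"
        proof (intro mult_left_mono frac_le)
          show "V (\<delta> \<zeta>') \<le> 2 * V (\<delta> \<zeta>)"
            using dn d by (intro V_double) auto
        qed (use C dn d V_nonneg[of "\<delta> \<zeta>"] in auto)
        also have "\<dots> = 32 / 3 * (C * q)" by (simp add: q_def)
        also have "\<dots> \<le> 11 * (C * q)" using C(1) q0 by (intro mult_right_mono) auto
        finally show ?thesis .
      qed
      have Gd: "cmod (G s \<zeta> - G s \<zeta>') \<le> K * a \<zeta> * t"
        using G_near[OF zE(1) z(2) near, of s] by (simp add: K_def t_def mult_ac)
      have Fd: "cmod (cut (G s) \<zeta> - cut (G s) \<zeta>') \<le> (e + e') * (K * a \<zeta> * t)"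
      proof -
        have "cmod (exp (- G s \<zeta>) - exp (- G s \<zeta>')) \<le> exp (max (- Re (G s \<zeta>)) (- Re (G s \<zeta>'))) * cmod (- G s \<zeta> - (- G s \<zeta>'))"
          by (rule exp_diff_le) auto
        also have "cmod (- G s \<zeta> - (- G s \<zeta>')) = cmod (G s \<zeta> - G s \<zeta>')" by (simp add: norm_minus_commute)
        also have "exp (max (- Re (G s \<zeta>)) (- Re (G s \<zeta>'))) * cmod (G s \<zeta> - G s \<zeta>') \<le> (e + e') * (K * a \<zeta> * t)"
          using Gd ee by (intro mult_mono) (auto simp: e_def e'_def max_def)
        finally show ?thesis using zE z'E by (simp add: cut_def)
      qed
      have Yd: "cmod (Y \<zeta> - Y \<zeta>') \<le> CY * (a \<zeta> * t)" using Y[OF zE(1) z(2) near] by (simp add: t_def)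
      have "?U \<zeta> - ?U \<zeta>' = cnj (cut (G s) \<zeta> - cut (G s) \<zeta>') * Y \<zeta> + cnj (cut (G s) \<zeta>') * (Y \<zeta> - Y \<zeta>')"
        by (simp add: algebra_simps)
      then have "cmod (?U \<zeta> - ?U \<zeta>') \<le> cmod (cut (G s) \<zeta> - cut (G s) \<zeta>') * cmod (Y \<zeta>) + cmod (cut (G s) \<zeta>') * cmod (Y \<zeta> - Y \<zeta>')"
        using norm_triangle_ineq[of "cnj (cut (G s) \<zeta> - cut (G s) \<zeta>') * Y \<zeta>" "cnj (cut (G s) \<zeta>') * (Y \<zeta> - Y \<zeta>')"]
        by (simp only: norm_mult complex_mod_cnj)
      also have "\<dots> \<le> ((e + e') * (K * a \<zeta> * t)) * CY + e' * (CY * (a \<zeta> * t))"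
        using Fd CY(2)[OF z(1)] CY(1) Yd ee K a_nonneg[of \<zeta>] t z'E
        by (intro add_mono mult_mono) (auto simp: cut_def e'_def)
      also have "\<dots> = CY * t * (K * (e * a \<zeta>) + (K + 1) * (e' * a \<zeta>))" by (simp add: algebra_simps)
      also have "\<dots> \<le> CY * t * (K * (C * q) + (K + 1) * (11 * (C * q)))"
        using CY(1) t K ea e'a by (intro mult_left_mono add_mono) auto
      also have "\<dots> = (CY * (C * (K + 11 * (K + 1)))) * (t * q)" by (simp add: algebra_simps)
      \<comment> \<open>\<open>q\<close> is the ratio of \<open>V\<close> at the larger argument
        \<delta> \<zeta>, hence at most twice the ratio at t.\<close>
      also have "t * q \<le> t * (2 * (V t / t))"
        unfolding q_def using V_ratio[OF t] t by (intro mult_left_mono) auto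
      also have "t * (2 * (V t / t)) = 2 * V t" using t by simp
      finally have "cmod (?U \<zeta> - ?U \<zeta>') \<le> (CY * (C * (K + 11 * (K + 1)))) * (2 * V t)"
        using CY(1) C(1) K by (simp add: mult_left_mono)
      also have "\<dots> \<le> L * V t"
        using CY(1) C(1) V_nonneg[of t] t by (simp add: L_def algebra_simps)
      finally show ?thesis by (simp add: t_def)
    qed
  next
    case False
    define t where "t = cmod (\<zeta> - \<zeta>')"
    have t0: "0 \<le> t" by (simp add: t_def)
    have d4: "\<delta> \<zeta> \<le> 4 * t" using False delta_0_iff[of \<zeta>] t0 by (auto simp: t_def)
    have d5: "\<delta> \<zeta>' \<le> 5 * t" using delta_lipschitz[of \<zeta>' \<zeta>] d4 by (simp add: t_def norm_minus_commute)
    have V5: "V (\<delta> x) \<le> 5 * V t" if "\<delta> x \<le> 5 * t" for x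
    proof -
      have "V (\<delta> x) \<le> V (5 * t)" using that delta_range[of x] by (intro V_mono) auto
      also have "\<dots> \<le> real 5 * V t" using t0 by (intro V_twice) auto
      finally show ?thesis by simp
    qed
    have "cmod (?U \<zeta> - ?U \<zeta>') \<le> cmod (?U \<zeta>) + cmod (?U \<zeta>')" by (rule norm_triangle_ineq4)
    also have "\<dots> \<le> C * (5 * V t) * CY + C * (5 * V t) * CY"
    proof (intro add_mono order_trans[OF size] mult_right_mono mult_left_mono V5)
      show "\<delta> \<zeta> \<le> 5 * t" using d4 t0 by simp
    qed (use z C CY d5 in auto)
    also have "\<dots> = 10 * (C * CY) * V t" by simp
    also have "\<dots> \<le> L * V t"
      using CY(1) C(1) K V_nonneg[OF t0] by (intro mult_right_mono) (auto simp: L_def)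
    finally show ?thesis by (simp add: t_def)
  qed
  show ?thesis by (rule that[OF L0 main])
qed

end

section \<open>Approximation of the generators on one set of finite entropy\<close>

context entropy_set
begin

text \<open>Off \<open>E\<close> the poles keep a positive distance from the point, so the radial
  limit exists there. Setting the functions to 0 on \<open>E\<close> makes the convergence along
  \<open>rseq\<close> hold everywhere and gives measurability.\<close>

lemma radial_boundary_herglotz:
  assumes hd: "herglotz_data M xi h" and M: "sets M = sets circle_borel"
  shows "radial_boundary (\<lambda>z. exp (- herglotz M xi h z)) (cut (herglotz M xi h)) 1"
proof -
  interpret herglotz_data M xi h by (rule hd)
  note c = contractiveD[OF exp_herglotz_contractive]
  have lim: "((\<lambda>r. exp (- herglotz M xi h (of_real r * \<zeta>))) \<longlongrightarrow> cut (herglotz M xi h) \<zeta>) (at_left 1)"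
    if "\<zeta> \<in> unit_circle - E" for \<zeta>
    using that herglotz_radial_limit[OF _ xi_far(2)[OF M that] xi_far(1)[OF M that]]
    by (auto simp: cut_def intro!: tendsto_intros)
  have "bounded_borel (cut (herglotz M xi h)) 1"
    unfolding bounded_borel_def
  proof (intro conjI ballI)
    have [measurable]: "Measurable.pred circle_borel (\<lambda>\<zeta>. \<zeta> \<in> E)"
      by (rule circle_borel_measurable_borel) measurable
    show "cut (herglotz M xi h) \<in> borel_measurable circle_borel"
    proof (rule borel_measurable_LIMSEQ_metric)
      fix n
      have [measurable]: "(\<lambda>\<zeta>. exp (- herglotz M xi h (of_real (rseq n) * \<zeta>))) \<in> borel_measurable circle_borel"
        using measurable_on_circle[OF c(1) rseq(1,2)] by (simp add: circle_measurable_cong)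
      show "(\<lambda>\<zeta>. if \<zeta> \<in> E then 0 else exp (- herglotz M xi h (of_real (rseq n) * \<zeta>))) \<in> borel_measurable circle_borel"
        by measurable
    next
      fix \<zeta> assume "\<zeta> \<in> space circle_borel"
      then show "(\<lambda>n. if \<zeta> \<in> E then 0 else exp (- herglotz M xi h (of_real (rseq n) * \<zeta>))) \<longlonglongrightarrow> cut (herglotz M xi h) \<zeta>"
        using filterlim_compose[OF lim rseq_at_left, of \<zeta>] by (cases "\<zeta> \<in> E") (auto simp: cut_def)
    qed
    fix \<zeta> assume z: "\<zeta> \<in> unit_circle"
    show "cmod (cut (herglotz M xi h) \<zeta>) \<le> 1"
    proof (cases "\<zeta> \<in> E")
      case False
      then have zE: "\<zeta> \<in> unit_circle - E" using z by simp
      have "0 \<le> Re (herglotz M xi h \<zeta>)"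
        by (rule Re_herglotz_nonneg[OF boundary_integrable[OF _ xi_far(2)[OF M zE] xi_far(1)[OF M zE]]]) (use z in auto)
      then show ?thesis using False by (simp add: cut_def)
    qed (simp add: cut_def)
  qed
  moreover have "AE \<zeta> in circle_measure. ((\<lambda>r. exp (- herglotz M xi h (of_real r * \<zeta>))) \<longlongrightarrow> cut (herglotz M xi h) \<zeta>) (at_left 1)"
    using AE_not_E AE_space by eventually_elim (auto intro!: lim)
  ultimately show ?thesis unfolding radial_boundary_def using c by blast
qed

text \<open>The poles stay in place on \<open>E\<close>, and \<open>g\<close> vanishes elsewhere; so
  moving them does not alter the singular inner function.\<close>

lemma herglotz_xi: "herglotz \<mu> xi g z = herglotz \<mu> (\<lambda>\<zeta>. \<zeta>) g z"
  unfolding herglotz_def using g_supp xi_E by (intro Bochner_Integration.integral_cong) force+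

lemma psi_cut_small: "(\<lambda>k. \<integral> \<tau>. psi_cut (1 / real (Suc k)) \<tau> \<partial>circle_measure) \<longlonglongrightarrow> 0"
proof -
  have "(\<lambda>k. \<integral> \<tau>. psi_cut (1 / real (Suc k)) \<tau> \<partial>circle_measure) \<longlonglongrightarrow> (\<integral> \<tau>. 0 \<partial>circle_measure)"
  proof (rule integral_dominated_convergence[OF _ _ psi_integrable])
    show "AE \<tau> in circle_measure. (\<lambda>k. psi_cut (1 / real (Suc k)) \<tau>) \<longlonglongrightarrow> 0"
      using AE_not_E
    proof eventually_elim
      case (elim \<tau>)
      have "\<forall>\<^sub>F k in sequentially. 1 / real (Suc k) < \<delta> \<tau>"
        using order_tendstoD(2)[OF LIMSEQ_Suc[OF lim_1_over_n] delta_pos[OF elim]] by simp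
      then have "\<forall>\<^sub>F k in sequentially. psi_cut (1 / real (Suc k)) \<tau> = 0"
        by (rule eventually_mono) (simp add: psi_cut_def)
      then show ?case by (rule tendsto_eventually)
    qed
    show "AE \<tau> in circle_measure. norm (psi_cut (1 / real (Suc k)) \<tau>) \<le> \<psi> \<tau>" for k
      using psi_cut_range by (intro AE_I2) simp
  qed (use psi_cut_integrable in auto)
  then show ?thesis by simp
qed

text \<open>The approximant is the Toeplitz operator with symbol the conjugate of exp (- G s),
  applied to the generator. It stays in the model space, lies in \<open>A_space w\<close> by
  \<open>smooth_symbol\<close> and the Cauchy transform estimate, and is close since exp (- G s) has
  a value near 1 at the origin for small \<open>s\<close>. The factor \<open>B\<close> is
  holomorphic across the circle, so it only adds a Lipschitz term.\<close>

theorem model_gen_approximable: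
  assumes S: "open S" "cball 0 1 \<subseteq> S" "B holomorphic_on S" and B: "\<And>z. z \<in> cball 0 1 \<Longrightarrow> cmod (B z) \<le> 1"
    and \<Theta>: "\<And>z. z \<in> unit_disc \<Longrightarrow> \<Theta> z = B z * exp (- herglotz \<mu> (\<lambda>\<zeta>. \<zeta>) g z)"
    and iso: "isometric \<Theta>" and e: "0 < e"
  obtains h where "h \<in> A_space w" "h \<in> model_space \<Theta>" "H2_norm (\<lambda>z. model_gen \<Theta> n z - h z) < e"
proof -
  define p where "p = proj_poly \<Theta> n"
  have hp: "p holomorphic_on X" for X
    unfolding p_def proj_poly_def[abs_def] by (intro holomorphic_intros)
  have hn: "(\<lambda>z. z ^ n) holomorphic_on X" for X :: "complex set" by (intro holomorphic_intros)
  have cont: "q holomorphic_on S \<Longrightarrow> continuous_on (cball 0 1) q" for q :: "complex \<Rightarrow> complex"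
    using holomorphic_on_imp_continuous_on S(2) continuous_on_subset by blast
  have disc: "q holomorphic_on S \<Longrightarrow> q holomorphic_on unit_disc" for q :: "complex \<Rightarrow> complex"
    using holomorphic_on_subset S(2) ball_subset_cball by blast
  obtain LB where LB: "0 \<le> LB" "\<And>z z'. z \<in> cball 0 1 \<Longrightarrow> z' \<in> cball 0 1 \<Longrightarrow> cmod (B z - B z') \<le> LB * cmod (z - z')"
    using lipschitz_on_cball[OF S] by blast
  obtain Lp where Lp: "0 \<le> Lp" "\<And>z z'. z \<in> cball 0 1 \<Longrightarrow> z' \<in> cball 0 1 \<Longrightarrow> cmod (p z - p z') \<le> Lp * cmod (z - z')"
    using lipschitz_on_cball[OF S(1,2) hp] by blast
  obtain Ln where Ln: "0 \<le> Ln" "\<And>z z'. z \<in> cball 0 1 \<Longrightarrow> z' \<in> cball 0 1 \<Longrightarrow> cmod (z ^ n - z' ^ n) \<le> Ln * cmod (z - z')"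
    using lipschitz_on_cball[OF S(1,2) hn] by blast
  define Cp where "Cp = cmod (p 0) + Lp"
  have Cp0: "0 \<le> Cp" using Lp by (simp add: Cp_def)
  have Cp: "cmod (p z) \<le> Cp" if "z \<in> cball 0 1" for z
  proof -
    have "cmod (p z - p 0) \<le> Lp * cmod (z - 0)" using that by (intro Lp) auto
    also have "\<dots> \<le> Lp * 1" using that Lp by (intro mult_left_mono) auto
    finally show ?thesis using norm_triangle_sub[of "p z" "p 0"] by (simp add: Cp_def)
  qed
  have rH: "radial_boundary (\<lambda>z. exp (- H z)) (cut H) 1"
    by (rule radial_boundary_herglotz[OF hg.herglotz_data_axioms mu(2)])
  define T where "T = (\<lambda>z. B z * cut H z)"
  have rT: "radial_boundary \<Theta> T 1"
  proof (rule radial_boundary_cong)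
    show "radial_boundary (\<lambda>z. B z * exp (- H z)) T 1"
      using radial_boundary_mult[OF radial_boundary_cball[OF disc[OF S(3)] cont[OF S(3)] B] rH] by (simp add: T_def)
  qed (simp add: \<Theta> herglotz_xi)
  define Y where "Y = (\<lambda>z. z ^ n - T z * p z)"
  have rp: "radial_boundary p p Cp" by (rule radial_boundary_cball[OF disc[OF hp] cont[OF hp] Cp])
  have rn: "radial_boundary (\<lambda>z. z ^ n) (\<lambda>z. z ^ n) 1"
    by (rule radial_boundary_cball[OF disc[OF hn] cont[OF hn]]) (simp add: norm_power power_le_one)
  have re: "radial_boundary (model_gen \<Theta> n) Y (1 + Cp)"
    using radial_boundary_diff[OF rn radial_boundary_mult[OF rT rp]]
    by (simp add: Y_def model_gen_def[abs_def] p_def)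
  \<comment> \<open>Collects the sup bound of the generator and the Lipschitz constants of its
    parts, the latter relative to \<open>a\<close>; 16 is the constant of
    \<open>H_near\<close>.\<close>
  define CY where "CY = 1 + Cp + Ln + (LB + 16) * Cp + Lp"
  have prod0: "0 \<le> (LB + 16) * Cp" using LB Cp0 by simp
  have CY: "0 \<le> CY" using LB Lp Ln Cp0 prod0 by (simp add: CY_def)
  have Y_bound: "cmod (Y \<zeta>) \<le> CY" if "\<zeta> \<in> unit_circle" for \<zeta>
    using bounded_borelD(2)[OF radial_boundaryD(3)[OF re] that] LB Lp Ln prod0 by (simp add: CY_def)
  have Y_near: "cmod (Y \<zeta> - Y \<zeta>') \<le> CY * (a \<zeta> * cmod (\<zeta> - \<zeta>'))"
    if z: "\<zeta> \<in> unit_circle - E" and z': "\<zeta>' \<in> unit_circle" and near: "cmod (\<zeta> - \<zeta>') \<le> \<delta> \<zeta> / 4" for \<zeta> \<zeta>'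
  proof -
    have zE: "\<zeta> \<notin> E" "\<zeta>' \<notin> E" "\<zeta> \<in> cball 0 1" "\<zeta>' \<in> cball 0 1" "\<zeta> \<in> unit_circle" "\<zeta>' \<in> unit_circle - E"
      using near_not_E[OF near] z z' by auto
    define t where "t = a \<zeta> * cmod (\<zeta> - \<zeta>')"
    have "1 * cmod (\<zeta> - \<zeta>') \<le> a \<zeta> * cmod (\<zeta> - \<zeta>')" using a_ge[OF z] by (rule mult_right_mono) simp
    then have t: "cmod (\<zeta> - \<zeta>') \<le> t" "0 \<le> t" using a_nonneg[of \<zeta>] by (auto simp: t_def)
    have lip: "x \<le> L * cmod (\<zeta> - \<zeta>') \<Longrightarrow> 0 \<le> L \<Longrightarrow> x \<le> L * t" for x L
      using mult_left_mono[OF t(1), of L] by linarith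
    have cut1: "cmod (cut H x) \<le> 1" if "x \<in> unit_circle" for x
      using bounded_borelD(2)[OF radial_boundaryD(3)[OF rH] that] .
    have "cmod (exp (- H \<zeta>) - exp (- H \<zeta>')) \<le> exp 0 * cmod (- H \<zeta> - (- H \<zeta>'))"
      using Re_boundary_nonneg(2)[OF z] Re_boundary_nonneg(2)[OF zE(6)] by (intro exp_diff_le) auto
    also have "\<dots> = cmod (H \<zeta> - H \<zeta>')" by (simp add: norm_minus_commute)
    also have "\<dots> \<le> 16 * t" using H_near[OF z z' near] by (simp add: t_def mult_ac)
    finally have cH: "cmod (cut H \<zeta> - cut H \<zeta>') \<le> 16 * t" using zE by (simp add: cut_def)
    have "T \<zeta> - T \<zeta>' = (B \<zeta> - B \<zeta>') * cut H \<zeta> + B \<zeta>' * (cut H \<zeta> - cut H \<zeta>')"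
      by (simp add: T_def algebra_simps)
    then have "cmod (T \<zeta> - T \<zeta>') \<le> cmod (B \<zeta> - B \<zeta>') * cmod (cut H \<zeta>) + cmod (B \<zeta>') * cmod (cut H \<zeta> - cut H \<zeta>')"
      by (metis norm_mult norm_triangle_ineq)
    also have "\<dots> \<le> (LB * t) * 1 + 1 * (16 * t)"
      using zE cut1[of \<zeta>] B[of \<zeta>'] cH LB(1) t lip[OF LB(2)[of \<zeta> \<zeta>'] LB(1)]
      by (intro add_mono mult_mono) auto
    finally have cT: "cmod (T \<zeta> - T \<zeta>') \<le> (LB + 16) * t" by (simp add: algebra_simps)
    have T1: "cmod (T \<zeta>') \<le> 1" using bounded_borelD(2)[OF radial_boundaryD(3)[OF rT] z'] .
    have "Y \<zeta> - Y \<zeta>' = (\<zeta> ^ n - \<zeta>' ^ n) - ((T \<zeta> - T \<zeta>') * p \<zeta> + T \<zeta>' * (p \<zeta> - p \<zeta>'))"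
      by (simp add: Y_def algebra_simps)
    then have "cmod (Y \<zeta> - Y \<zeta>') \<le> cmod (\<zeta> ^ n - \<zeta>' ^ n) + cmod ((T \<zeta> - T \<zeta>') * p \<zeta> + T \<zeta>' * (p \<zeta> - p \<zeta>'))"
      by (metis norm_triangle_ineq4)
    also have "cmod ((T \<zeta> - T \<zeta>') * p \<zeta> + T \<zeta>' * (p \<zeta> - p \<zeta>')) \<le> cmod (T \<zeta> - T \<zeta>') * cmod (p \<zeta>) + cmod (T \<zeta>') * cmod (p \<zeta> - p \<zeta>')"
      by (metis norm_mult norm_triangle_ineq)
    also have "cmod (\<zeta> ^ n - \<zeta>' ^ n) + (cmod (T \<zeta> - T \<zeta>') * cmod (p \<zeta>) + cmod (T \<zeta>') * cmod (p \<zeta> - p \<zeta>'))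
       \<le> Ln * t + (((LB + 16) * t) * Cp + 1 * (Lp * t))"
      using zE cT Cp[of \<zeta>] T1 LB(1) t lip[OF Ln(2)[of \<zeta> \<zeta>'] Ln(1)] lip[OF Lp(2)[of \<zeta> \<zeta>'] Lp(1)] Lp(1)
      by (intro add_mono mult_mono) auto
    also have "\<dots> = (Ln + (LB + 16) * Cp + Lp) * t" by (simp add: algebra_simps)
    also have "\<dots> \<le> CY * t" using t Cp0 by (intro mult_right_mono) (auto simp: CY_def)
    finally show ?thesis by (simp add: t_def)
  qed
  have "(\<lambda>k. (1 + Cp) * sqrt (2 - 2 * exp (- (\<integral> \<tau>. psi_cut (1 / real (Suc k)) \<tau> \<partial>circle_measure)))) \<longlonglongrightarrow> (1 + Cp) * sqrt (2 - 2 * exp (- 0))"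
    by (intro tendsto_intros psi_cut_small)
  then have "\<forall>\<^sub>F k in sequentially. (1 + Cp) * sqrt (2 - 2 * exp (- (\<integral> \<tau>. psi_cut (1 / real (Suc k)) \<tau> \<partial>circle_measure))) < e"
    using e by (intro order_tendstoD(2)) auto
  then obtain k where k: "(1 + Cp) * sqrt (2 - 2 * exp (- (\<integral> \<tau>. psi_cut (1 / real (Suc k)) \<tau> \<partial>circle_measure))) < e"
    by (auto simp: eventually_sequentially)
  define s where "s = 1 / real (Suc k)"
  have s: "0 < s" "s \<le> 1" by (auto simp: s_def)
  define U where "U = (\<lambda>\<zeta>. cnj (cut (G s) \<zeta>) * Y \<zeta>)"
  have rG: "radial_boundary (\<lambda>z. exp (- G s z)) (cut (G s)) 1"
    by (rule radial_boundary_herglotz[OF hd.herglotz_data_axioms sets_circle_measure])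
  have bU: "bounded_borel U (1 * (1 + Cp))"
    unfolding U_def by (intro bounded_borel_mult bounded_borel_cnj radial_boundaryD(3)[OF rG] radial_boundaryD(3)[OF re])
  obtain L where L: "0 \<le> L" "\<And>\<zeta> \<zeta>'. \<zeta> \<in> unit_circle \<Longrightarrow> \<zeta>' \<in> unit_circle \<Longrightarrow> cmod (U \<zeta> - U \<zeta>') \<le> L * V (cmod (\<zeta> - \<zeta>'))"
    unfolding U_def using smooth_symbol[OF s CY Y_bound Y_near] by blast
  define h where "h = disc_cut (cauchy_transform U)"
  have hm: "h \<in> model_space \<Theta>"
    unfolding h_def U_def by (rule toeplitz_model_space[OF rT rG re model_gen_orth[OF iso]])
  have hA: "h \<in> A_space w"
  proof (rule A_space_smoothI)
    show "h \<in> disc_holomorphic" using hm by (simp add: model_space_def H2_space_def)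
    show "0 \<le> 24 * L * kernel_mass" using L(1) kernel_mass_nonneg by simp
    show "cmod (h z - h z') \<le> 24 * L * kernel_mass * W (cmod (z - z'))" if z: "z \<in> unit_disc" "z' \<in> unit_disc" for z z'
      unfolding h_def disc_cut_eq[OF z(1)] disc_cut_eq[OF z(2)]
      by (rule cauchy_transform_smooth[OF bU L(1) L(2)[unfolded V_def] z])
  qed
  have "H2_norm (\<lambda>z. model_gen \<Theta> n z - h z) = H2_norm (\<lambda>z. model_gen \<Theta> n z - cauchy_transform (\<lambda>\<zeta>. cnj (cut (G s) \<zeta>) * Y \<zeta>) z)"
    by (rule H2_norm_cong) (simp add: h_def U_def)
  also have "\<dots> \<le> (1 + Cp) * sqrt (2 - 2 * Re (exp (- G s 0)))"
    by (rule toeplitz_close[OF rG re])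
  also have "Re (exp (- G s 0)) = exp (- (\<integral> \<tau>. psi_cut s \<tau> \<partial>circle_measure))"
    unfolding hd.herglotz_0 of_real_minus[symmetric] exp_of_real by simp
  also have "(1 + Cp) * sqrt (2 - 2 * exp (- (\<integral> \<tau>. psi_cut s \<tau> \<partial>circle_measure))) < e"
    using k by (simp only: s_def)
  finally show ?thesis using that[OF hA hm] by blast
qed

end

section \<open>Exhaustion\<close>

lemma norm_one_minus_mult:
  fixes a b :: complex
  assumes "cmod a \<le> 1"
  shows "cmod (1 - a * b) \<le> cmod (1 - a) + cmod (1 - b)"
proof -
  have "1 - a * b = (1 - a) + a * (1 - b)" by (simp add: algebra_simps)
  then have "cmod (1 - a * b) \<le> cmod (1 - a) + cmod a * cmod (1 - b)"
    by (metis norm_mult norm_triangle_ineq)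
  also have "\<dots> \<le> cmod (1 - a) + 1 * cmod (1 - b)"
    using assms by (intro add_left_mono mult_right_mono) auto
  finally show ?thesis by simp
qed

section \<open>Blaschke products\<close>

lemma blaschke_factor_denominator:
  assumes "cmod a * cmod z < 1"
  shows "1 - cnj a * z \<noteq> 0"
  using assms by (metis complex_mod_cnj eq_iff_diff_eq_0 less_irrefl norm_mult norm_one)

lemma blaschke_factor_holomorphic:
  assumes "\<And>z. z \<in> S \<Longrightarrow> cmod a * cmod z < 1"
  shows "blaschke_factor a holomorphic_on S"
proof (cases "a = 0")
  case True
  then show ?thesis by (simp add: blaschke_factor_def[abs_def])
next
  case False
  then show ?thesis
    unfolding blaschke_factor_def[abs_def] using blaschke_factor_denominator[OF assms]
    by (simp only: if_False) (intro holomorphic_intros, auto)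
qed

lemma norm_blaschke_factor:
  assumes "a \<in> unit_disc" "z \<in> cball 0 1"
  shows "cmod (blaschke_factor a z) \<le> 1"
proof (cases "a = 0")
  case True
  then show ?thesis using assms by (simp add: blaschke_factor_def)
next
  case False
  have "cmod a * cmod z \<le> cmod a * 1" using assms by (intro mult_left_mono) auto
  then have az: "cmod a * cmod z < 1" using assms by simp
  have "(cmod (1 - cnj a * z))\<^sup>2 - (cmod (a - z))\<^sup>2 = (1 - (cmod a)\<^sup>2) * (1 - (cmod z)\<^sup>2)"
    unfolding cmod_power2 by (simp add: power2_eq_square algebra_simps)
  moreover have "0 \<le> (1 - (cmod a)\<^sup>2) * (1 - (cmod z)\<^sup>2)"
    using assms by (intro mult_nonneg_nonneg) (auto simp: power_le_one)
  ultimately have "(cmod (a - z))\<^sup>2 \<le> (cmod (1 - cnj a * z))\<^sup>2" by linarith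
  then have "cmod (a - z) \<le> cmod (1 - cnj a * z)" by (rule power2_le_imp_le) simp
  then have "cmod ((a - z) / (1 - cnj a * z)) \<le> 1"
    using blaschke_factor_denominator[OF az] by (simp add: norm_divide)
  then show ?thesis using False by (simp add: blaschke_factor_def norm_mult norm_divide)
qed

text \<open>The normalization by |a| / a puts a factor 1 - |a| into the difference from 1; what
  remains has numerator at most 2 |a| and denominator at least |a| (1 - r).\<close>

lemma blaschke_factor_near_1:
  assumes "a \<in> unit_disc" "cmod z \<le> r" "r < 1"
  shows "cmod (blaschke_factor a z - 1) \<le> 2 / (1 - r) * (1 - cmod a)"
proof (cases "a = 0")
  case True
  have "cmod (z - 1) \<le> 2" using norm_triangle_ineq4[of z 1] assms by simp
  also have "2 \<le> 2 / (1 - r)"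
    using assms norm_ge_zero[of z] by (simp add: le_divide_eq del: norm_ge_zero)
  finally show ?thesis using True by (simp add: blaschke_factor_def)
next
  case False
  have az: "cmod a * cmod z \<le> r"
    using mult_mono[of "cmod a" 1 "cmod z" r] assms by simp
  then have nz: "1 - cnj a * z \<noteq> 0" using assms by (intro blaschke_factor_denominator) simp
  have n: "1 - r \<le> cmod (1 - cnj a * z)"
    using norm_triangle_ineq2[of 1 "cnj a * z"] az by (simp add: norm_mult)
  have "blaschke_factor a z - 1 = - (of_real (1 - cmod a) * ((a + of_real (cmod a) * z) / (a * (1 - cnj a * z))))"
  proof -
    have aa: "a * cnj a = of_real (cmod a) * of_real (cmod a)"
      by (metis complex_norm_square of_real_mult power2_eq_square)
    have "of_real (cmod a) * (a - z) - a * (1 - cnj a * z) = - (of_real (1 - cmod a) * (a + of_real (cmod a) * z))"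
      using aa by (simp add: algebra_simps)
    moreover have "blaschke_factor a z - 1 = (of_real (cmod a) * (a - z) - a * (1 - cnj a * z)) / (a * (1 - cnj a * z))"
      using False nz by (simp add: blaschke_factor_def field_simps)
    ultimately show ?thesis by simp
  qed
  then have "cmod (blaschke_factor a z - 1) = (1 - cmod a) * (cmod (a + of_real (cmod a) * z) / (cmod a * cmod (1 - cnj a * z)))"
    using assms by (simp only: norm_minus_cancel norm_mult norm_divide norm_of_real) simp
  also have "\<dots> \<le> (1 - cmod a) * ((2 * cmod a) / (cmod a * (1 - r)))"
  proof (intro mult_left_mono frac_le)
    have "cmod a * cmod z \<le> cmod a * 1" using assms by (intro mult_left_mono) auto
    then show "cmod (a + of_real (cmod a) * z) \<le> 2 * cmod a"
      using norm_triangle_ineq[of a "of_real (cmod a) * z"] by (simp add: norm_mult)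
  qed (use n assms False in auto)
  also have "\<dots> = 2 / (1 - r) * (1 - cmod a)" using False by simp
  finally show ?thesis .
qed

text \<open>\<open>B0\<close> consists of the constant and finitely many factors, which are
  holomorphic across the circle; \<open>R\<close> is the tail. The value of the tail at 0 is the
  product of the |a n|, at least 1 minus the tail of the convergent sum of 1 - |a n|.\<close>

lemma blaschke_product_split:
  assumes B: "blaschke_product B" and e: "0 < e"
  obtains S B0 R where "open S" "cball 0 1 \<subseteq> S" "B0 holomorphic_on S"
    "\<And>z. z \<in> cball 0 1 \<Longrightarrow> cmod (B0 z) \<le> 1" "contractive R"
    "\<And>z. z \<in> unit_disc \<Longrightarrow> B z = B0 z * R z" "cmod (1 - R 0) < e"
proof -
  obtain c N a where c: "cmod c = 1" and a: "\<And>n. n \<in> N \<Longrightarrow> a n \<in> unit_disc"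
    and sum: "(\<lambda>n. 1 - cmod (a n)) summable_on N"
    and BN: "\<And>z. z \<in> unit_disc \<Longrightarrow> B z = c * (\<Prod>n. if n \<in> N then blaschke_factor (a n) z else 1)"
    using B unfolding blaschke_product_def by blast
  define f where "f n z = (if n \<in> N then blaschke_factor (a n) z else 1)" for n z
  define d where "d n = (if n \<in> N then 1 - cmod (a n) else 0)" for n
  have d: "0 \<le> d n" "d n \<le> 1" for n using a[of n] by (auto simp: d_def)
  have sd: "summable d"
  proof -
    have "d summable_on UNIV"
      using sum by (subst (asm) summable_on_cong_neutral[where T = UNIV and g = d]) (auto simp: d_def)
    then show ?thesis using summable_on_UNIV_nonneg_real_iff[of d] d by simp
  qed
  have f_near: "cmod (f n z - 1) \<le> 2 / (1 - r) * d n" if "cmod z \<le> r" "r < 1" for n z r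
    using blaschke_factor_near_1[OF a that, of n] by (simp add: f_def d_def)
  have f_hol: "f n holomorphic_on unit_disc" for n
  proof (cases "n \<in> N")
    case True
    have "blaschke_factor (a n) holomorphic_on unit_disc"
    proof (rule blaschke_factor_holomorphic)
      fix z :: complex assume "z \<in> unit_disc"
      then show "cmod (a n) * cmod z < 1" using mult_strict_mono'[of "cmod (a n)" 1 "cmod z" 1] a[OF True] by simp
    qed
    then show ?thesis using True by (simp add: f_def[abs_def])
  qed (simp add: f_def[abs_def])
  have f_le: "cmod (f n z) \<le> 1" if "z \<in> cball 0 1" for n z
    using norm_blaschke_factor[OF a that, of n] by (simp add: f_def)
  have conv: "convergent_prod (\<lambda>n. f (n + k) z)" if "z \<in> unit_disc" for k z
  proof -
    have "summable (\<lambda>n. norm (f (n + k) z - 1))"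
    proof (rule summable_comparison_test)
      show "summable (\<lambda>n. 2 / (1 - cmod z) * d (n + k))" by (intro summable_mult summable_ignore_initial_segment sd)
      show "\<exists>M. \<forall>n\<ge>M. norm (norm (f (n + k) z - 1)) \<le> 2 / (1 - cmod z) * d (n + k)"
        using f_near[of z "cmod z"] that by simp
    qed
    then show ?thesis by (intro abs_convergent_prod_imp_convergent_prod summable_imp_abs_convergent_prod)
  qed
  obtain k where "norm (\<Sum>n. d (n + k)) < e" using suminf_exist_split[OF e sd] by blast
  then have k: "(\<Sum>n. d (n + k)) < e" by (simp add: abs_less_iff)
  define R where "R z = (\<Prod>n. f (n + k) z)" for z
  have lim: "(\<lambda>M. \<Prod>n<M. f (n + k) z) \<longlonglongrightarrow> R z" if "z \<in> unit_disc" for z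
    using convergent_prod_LIMSEQ[OF conv[OF that]] unfolding R_def by (simp add: LIMSEQ_lessThan_iff_atMost)
  have R_le: "cmod (R z) \<le> 1" if "z \<in> unit_disc" for z
  proof (rule Lim_bounded[OF tendsto_norm[OF lim[OF that]]])
    show "\<forall>n\<ge>0. cmod (\<Prod>n<n. f (n + k) z) \<le> 1"
      using f_le that unfolding prod_norm[symmetric] by (auto intro!: prod_le_1)
  qed
  have R_hol: "R holomorphic_on unit_disc"
  proof (rule holomorphic_uniform_sequence[OF open_ball])
    show "(\<lambda>z. \<Prod>n<M. f (n + k) z) holomorphic_on unit_disc" for M
      by (intro holomorphic_on_prod f_hol)
    fix x :: complex assume x: "x \<in> unit_disc"
    define t where "t = (1 - cmod x) / 2"
    have t: "0 < t" "cmod x + t < 1" using x by (auto simp: t_def field_simps)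
    have sub: "cmod z \<le> cmod x + t" if "z \<in> cball x t" for z
      using norm_triangle_sub[of z x] that by (simp add: dist_norm norm_minus_commute)
    have sub': "cball x t \<subseteq> unit_disc" using sub t by force
    have "uniformly_convergent_on (cball x t) (\<lambda>M z. \<Prod>n<M. f (n + k) z)"
    proof (rule uniformly_convergent_on_prod')
      show "continuous_on (cball x t) (f (n + k))" for n
        using f_hol holomorphic_on_imp_continuous_on holomorphic_on_subset sub' by blast
      show "uniformly_convergent_on (cball x t) (\<lambda>M z. \<Sum>n<M. norm (f (n + k) z - 1))"
      proof (rule Weierstrass_m_test')
        show "summable (\<lambda>n. 2 / (1 - (cmod x + t)) * d (n + k))" by (intro summable_mult summable_ignore_initial_segment sd)
        show "norm (norm (f (n + k) z - 1)) \<le> 2 / (1 - (cmod x + t)) * d (n + k)" if "z \<in> cball x t" for n z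
          using f_near[OF sub[OF that] t(2)] by simp
      qed
    qed simp
    then obtain l where l: "uniform_limit (cball x t) (\<lambda>M z. \<Prod>n<M. f (n + k) z) l sequentially"
      unfolding uniformly_convergent_on_def by blast
    have "l z = R z" if "z \<in> cball x t" for z
      using tendsto_uniform_limitI[OF l that] lim sub' that LIMSEQ_unique by blast
    then have "uniform_limit (cball x t) (\<lambda>M z. \<Prod>n<M. f (n + k) z) R sequentially"
      by (intro iffD1[OF uniform_limit_cong' l]) auto
    then show "\<exists>d>0. cball x d \<subseteq> unit_disc \<and> uniform_limit (cball x d) (\<lambda>M z. \<Prod>n<M. f (n + k) z) R sequentially"
      using t(1) sub' by blast
  qed
  define S where "S = {z::complex. \<forall>n\<in>N \<inter> {..<k}. cmod (a n) * cmod z < 1}"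
  define B0 where "B0 z = c * (\<Prod>n<k. f n z)" for z
  show ?thesis
  proof (rule that[of S B0 R])
    have "S = (\<Inter>n\<in>N \<inter> {..<k}. {z. cmod (a n) * cmod z < 1})" by (auto simp: S_def)
    then show "open S" by (auto intro!: open_INT open_Collect_less continuous_intros)
    show "cball 0 1 \<subseteq> S"
    proof
      fix z :: complex assume z: "z \<in> cball 0 1"
      have "cmod (a n) * cmod z < 1" if "n \<in> N" for n
        using mult_left_mono[of "cmod z" 1 "cmod (a n)"] a[OF that] z by simp
      then show "z \<in> S" by (auto simp: S_def)
    qed
    show "B0 holomorphic_on S"
      unfolding B0_def[abs_def]
    proof (intro holomorphic_intros)
      fix n assume "n \<in> {..<k}"
      then show "f n holomorphic_on S"
        by (cases "n \<in> N") (auto simp: f_def[abs_def] S_def intro!: blaschke_factor_holomorphic)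
    qed
    show "cmod (B0 z) \<le> 1" if "z \<in> cball 0 1" for z
      unfolding B0_def norm_mult c prod_norm[symmetric] using f_le[OF that] by (auto intro!: prod_le_1)
    show "contractive R" by (rule contractiveI[OF R_hol R_le])
    show "B z = B0 z * R z" if z: "z \<in> unit_disc" for z
    proof -
      have "(\<lambda>M. \<Prod>n<M. f (n + 0) z) \<longlonglongrightarrow> (\<Prod>n. f (n + 0) z)"
        using convergent_prod_LIMSEQ[OF conv[OF z, of 0]] by (simp add: LIMSEQ_lessThan_iff_atMost)
      then have 1: "(\<lambda>M. \<Prod>n<M + k. f n z) \<longlonglongrightarrow> (\<Prod>n. f n z)"
        using LIMSEQ_ignore_initial_segment[of "\<lambda>M. \<Prod>n<M. f n z" _ k] by simp
      have "(\<Prod>n<M + k. f n z) = (\<Prod>n<k. f n z) * (\<Prod>n<M. f (n + k) z)" for M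
        using prod.nat_group by (induction M) auto
      then have "(\<lambda>M. \<Prod>n<M + k. f n z) \<longlonglongrightarrow> (\<Prod>n<k. f n z) * R z"
        using tendsto_mult[OF tendsto_const lim[OF z]] by simp
      then have "(\<Prod>n. f n z) = (\<Prod>n<k. f n z) * R z" using 1 LIMSEQ_unique by blast
      then show ?thesis using BN[OF z] by (simp add: B0_def f_def)
    qed
    \<comment> \<open>Each factor is real and nonnegative at the origin; indices outside
      \<open>N\<close> have \<open>d n = 0\<close> and contribute 1.\<close>
    have f0: "f n 0 = of_real (1 - d n)" for n
      using a[of n] by (auto simp: f_def d_def blaschke_factor_def)
    have "cmod (1 - (\<Prod>n<M. f (n + k) 0)) \<le> (\<Sum>n. d (n + k))" for M
    proof -
      have "(\<Prod>n<M. f (n + k) 0) = of_real (\<Prod>n<M. 1 - d (n + k))" by (simp add: f0)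
      then have "cmod (1 - (\<Prod>n<M. f (n + k) 0)) = \<bar>1 - (\<Prod>n<M. 1 - d (n + k))\<bar>"
        by (metis norm_of_real of_real_1 of_real_diff)
      also have "\<dots> = 1 - (\<Prod>n<M. 1 - d (n + k))"
        using d by (intro abs_of_nonneg) (auto intro!: prod_le_1 simp: diff_le_eq)
      also have "\<dots> \<le> (\<Sum>n<M. d (n + k))"
        using Weierstrass_prod_ineq[of "{..<M}" "\<lambda>n. d (n + k)"] d by simp
      also have "\<dots> \<le> (\<Sum>n. d (n + k))"
        using d by (intro sum_le_suminf summable_ignore_initial_segment sd) auto
      finally show ?thesis .
    qed
    then have "cmod (1 - R 0) \<le> (\<Sum>n. d (n + k))"
      by (intro Lim_bounded[OF tendsto_norm[OF tendsto_diff[OF tendsto_const lim]]]) auto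
    then show "cmod (1 - R 0) < e" using k by simp
  qed
qed

section \<open>Unions of sets of finite entropy\<close>

context modulus
begin

lemma arc_infdist_in: "closed E \<Longrightarrow> E \<subseteq> unit_circle \<Longrightarrow> \<zeta> \<in> E \<Longrightarrow> arc_infdist \<zeta> E = 0"
  using arc_infdist_bounds[of E \<zeta>] infdist_0_iff[of E \<zeta>] by force

lemma arc_infdist_range:
  assumes "closed E" "E \<subseteq> unit_circle" "\<zeta> \<in> unit_circle"
  shows "0 \<le> arc_infdist \<zeta> E" "arc_infdist \<zeta> E \<le> 1" "\<zeta> \<notin> E \<Longrightarrow> 0 < arc_infdist \<zeta> E"
proof -
  have "0 \<le> arc_infdist \<zeta> E \<and> arc_infdist \<zeta> E \<le> 1 \<and> (\<zeta> \<notin> E \<longrightarrow> 0 < arc_infdist \<zeta> E)"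
  proof (cases "E = {}")
    case True
    then show ?thesis by (simp add: arc_infdist_def)
  next
    case False
    show ?thesis
      using arc_infdist_bounds[OF assms(1) False assms(2,3)] infdist_0_iff[OF assms(1) False, of \<zeta>] infdist_nonneg[of \<zeta> E]
      by auto
  qed
  then show "0 \<le> arc_infdist \<zeta> E" "arc_infdist \<zeta> E \<le> 1" "\<zeta> \<notin> E \<Longrightarrow> 0 < arc_infdist \<zeta> E" by auto
qed

text \<open>The convention 1 for the empty set is neutral for the minimum, because distances never
  exceed 1.\<close>

lemma arc_infdist_Un:
  assumes "closed E" "E \<subseteq> unit_circle" "closed E'" "E' \<subseteq> unit_circle" "\<zeta> \<in> unit_circle"
  shows "arc_infdist \<zeta> (E \<union> E') = min (arc_infdist \<zeta> E) (arc_infdist \<zeta> E')"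
proof (cases "E = {} \<or> E' = {}")
  case True
  then show ?thesis
    using arc_infdist_range(2)[OF assms(1,2,5)] arc_infdist_range(2)[OF assms(3,4,5)]
    by (cases "E = {}"; cases "E' = {}") (simp_all add: arc_infdist_def min_absorb1 min_absorb2)
next
  case False
  have "bdd_below (arc_dist \<zeta> ` X)" for X by (rule bdd_belowI[of _ 0]) (auto simp: arc_dist_def)
  then have "(INF \<xi>\<in>E \<union> E'. arc_dist \<zeta> \<xi>) = inf (INF \<xi>\<in>E. arc_dist \<zeta> \<xi>) (INF \<xi>\<in>E'. arc_dist \<zeta> \<xi>)"
    using False by (intro cINF_union) auto
  then show ?thesis using False by (simp add: arc_infdist_def inf_min)
qed

lemma finite_entropy_empty: "finite_entropy w {}"
  by (simp add: finite_entropy_def arc_infdist_def)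

text \<open>Off the union the integrand is the minimum of the two given ones, by monotonicity of ln
  and \<open>w\<close>. The indicator accounts for the points of the union, where ln (w 0) = 0 in
  HOL.\<close>

lemma finite_entropy_Un:
  assumes "finite_entropy w E" "finite_entropy w E'"
  shows "finite_entropy w (E \<union> E')"
proof -
  have E: "closed E" "E \<subseteq> unit_circle" "emeasure circle_measure E = 0" "integrable circle_measure (\<lambda>\<zeta>. ln (w (arc_infdist \<zeta> E)))"
    and E': "closed E'" "E' \<subseteq> unit_circle" "emeasure circle_measure E' = 0" "integrable circle_measure (\<lambda>\<zeta>. ln (w (arc_infdist \<zeta> E')))"
    using assms by (auto simp: finite_entropy_def)
  have sets: "X \<in> sets circle_measure" if "closed X" "X \<subseteq> unit_circle" for X
    unfolding sets_circle_measure using that by (rule closed_circle_borel)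
  have "emeasure circle_measure (E \<union> E') \<le> emeasure circle_measure E + emeasure circle_measure E'"
    by (intro emeasure_subadditive sets E E')
  then have null: "emeasure circle_measure (E \<union> E') = 0" using E E' by simp
  have "integrable circle_measure (\<lambda>\<zeta>. indicator (unit_circle - (E \<union> E')) \<zeta> * min (ln (w (arc_infdist \<zeta> E))) (ln (w (arc_infdist \<zeta> E'))))"
    unfolding real_scaleR_def[symmetric]
  proof (rule integrable_mult_indicator)
    show "unit_circle - (E \<union> E') \<in> sets circle_measure"
      using sets[of "E \<union> E'"] sets.top[of circle_measure] E E' by (intro sets.Diff) auto
    show "integrable circle_measure (\<lambda>\<zeta>. min (ln (w (arc_infdist \<zeta> E))) (ln (w (arc_infdist \<zeta> E'))))"
      by (intro integrable_min E E')
  qed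
  also have "?this \<longleftrightarrow> integrable circle_measure (\<lambda>\<zeta>. ln (w (arc_infdist \<zeta> (E \<union> E'))))"
  proof (rule Bochner_Integration.integrable_cong)
    fix \<zeta> assume "\<zeta> \<in> space circle_measure"
    then have z: "\<zeta> \<in> unit_circle" by simp
    show "indicator (unit_circle - (E \<union> E')) \<zeta> * min (ln (w (arc_infdist \<zeta> E))) (ln (w (arc_infdist \<zeta> E'))) = ln (w (arc_infdist \<zeta> (E \<union> E')))"
    proof (cases "\<zeta> \<in> E \<union> E'")
      case True
      then have "arc_infdist \<zeta> (E \<union> E') = 0" using E E' by (intro arc_infdist_in) auto
      moreover have "w 0 = 0" by (metis W_0 W_eq zero_le_one)
      ultimately show ?thesis using True by simp
    next
      case False
      have mono: "ln (w s) \<le> ln (w t)" if "0 < s" "s \<le> t" "t \<le> 1" for s t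
        using W_mono[of s t] W_pos[of s] that by (intro ln_mono) (auto simp: W_eq)
      show ?thesis
        unfolding arc_infdist_Un[OF E(1,2) E'(1,2) z]
        using False z arc_infdist_range[OF E(1,2) z] arc_infdist_range[OF E'(1,2) z]
          mono[of "arc_infdist \<zeta> E" "arc_infdist \<zeta> E'"] mono[of "arc_infdist \<zeta> E'" "arc_infdist \<zeta> E"]
        by (auto simp: min_def)
    qed
  qed simp
  finally show ?thesis unfolding finite_entropy_def using E E' null by auto
qed

lemma finite_entropy_UN:
  fixes k :: nat
  assumes "\<And>i. finite_entropy w (E i)"
  shows "finite_entropy w (\<Union>i<k. E i)"
  by (induction k) (simp_all add: finite_entropy_empty lessThan_Suc finite_entropy_Un assms)

end

section \<open>Stability of generators and model spaces\<close>

lemma hcoeff_bound_contractive: "contractive \<Theta> \<Longrightarrow> cmod (hcoeff \<Theta> j) \<le> 1"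
  using hcoeff_le_H2_norm[of \<Theta> j] contractive_hardy[of \<Theta>] hardy_bounded(2)[OF contractiveD] by force

lemma H2_norm_sum_le:
  "finite I \<Longrightarrow> (\<And>i. i \<in> I \<Longrightarrow> hardy (f i)) \<Longrightarrow> H2_norm (\<lambda>z. \<Sum>i\<in>I. f i z) \<le> (\<Sum>i\<in>I. H2_norm (f i))"
proof (induction I rule: finite_induct)
  case empty
  then show ?case using H2_norm_const[of 0] by simp
next
  case (insert x I)
  have "H2_norm (\<lambda>z. f x z + (\<Sum>i\<in>I. f i z)) \<le> H2_norm (f x) + H2_norm (\<lambda>z. \<Sum>i\<in>I. f i z)"
    using insert by (intro H2_norm_triangle hardy_sum) auto
  then show ?case using insert by simp
qed

text \<open>Allows \<Theta> to be replaced by a divisor that is close to it in norm. In each of the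
  n + 1 terms of the polynomial both the coefficient and the factor \<Theta> change, each by at most
  the distance of the two functions.\<close>

lemma model_gen_lipschitz:
  assumes "contractive \<Theta>" "contractive \<Phi>"
  shows "H2_norm (\<lambda>z. model_gen \<Theta> n z - model_gen \<Phi> n z) \<le> 2 * real (Suc n) * H2_norm (\<lambda>z. \<Theta> z - \<Phi> z)"
proof -
  let ?d = "H2_norm (\<lambda>z. \<Theta> z - \<Phi> z)"
  have hd: "hardy (\<lambda>z. \<Theta> z - \<Phi> z)" by (intro hardy_diff contractive_hardy assms)
  have hol: "\<Theta> holomorphic_on unit_disc" "\<Phi> holomorphic_on unit_disc" using assms contractiveD by auto
  define t where "t j z = cnj (hcoeff \<Theta> (n - j)) * z ^ j * (\<Phi> z - \<Theta> z) + \<Phi> z * (cnj (hcoeff \<Phi> (n - j) - hcoeff \<Theta> (n - j)) * z ^ j)" for j z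
  have t: "hardy (t j)" "H2_norm (t j) \<le> 2 * ?d" for j
  proof -
    have dneg: "hardy (\<lambda>z. \<Phi> z - \<Theta> z)" "H2_norm (\<lambda>z. \<Phi> z - \<Theta> z) = ?d"
      using hardy_cmult[OF hd, of "- 1"] H2_norm_cmult[OF hd, of "- 1"] by simp_all
    have c1: "contractive (\<lambda>z. cnj (hcoeff \<Theta> (n - j)) * z ^ j)"
    proof (rule contractiveI)
      show "cmod (cnj (hcoeff \<Theta> (n - j)) * z ^ j) \<le> 1" if "z \<in> unit_disc" for z
        using that hcoeff_bound_contractive[OF assms(1), of "n - j"]
        by (simp add: norm_mult norm_power mult_le_one power_le_one)
    qed (intro holomorphic_intros)
    have cd: "cmod (cnj (hcoeff \<Phi> (n - j) - hcoeff \<Theta> (n - j))) \<le> ?d"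
      unfolding complex_mod_cnj
      using hcoeff_le_H2_norm[OF dneg(1), of "n - j"] dneg(2) hcoeff_diff[OF hol(2,1)] by simp
    have h2: "hardy (\<lambda>z. cnj (hcoeff \<Phi> (n - j) - hcoeff \<Theta> (n - j)) * z ^ j)" by (intro hardy_cmult hardy_power)
    have n2: "H2_norm (\<lambda>z. cnj (hcoeff \<Phi> (n - j) - hcoeff \<Theta> (n - j)) * z ^ j) \<le> ?d"
    proof (rule hardy_bounded(2))
      show "cmod (cnj (hcoeff \<Phi> (n - j) - hcoeff \<Theta> (n - j)) * z ^ j) \<le> ?d" if "z \<in> unit_disc" for z
      proof -
        have "cmod (cnj (hcoeff \<Phi> (n - j) - hcoeff \<Theta> (n - j)) * z ^ j) \<le> ?d * 1"
          unfolding norm_mult using that cd by (intro mult_mono) (auto simp: norm_power power_le_one)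
        then show ?thesis by simp
      qed
    qed (intro holomorphic_intros)
    note p1 = contractive_hardy_mult[OF c1 dneg(1)] and p2 = contractive_hardy_mult[OF assms(2) h2]
    show "hardy (t j)" unfolding t_def[abs_def] by (intro hardy_add p1(1) p2(1))
    show "H2_norm (t j) \<le> 2 * ?d"
      unfolding t_def[abs_def] using H2_norm_triangle[OF p1(1) p2(1)] p1(2) p2(2) n2 dneg(2) by simp
  qed
  have "model_gen \<Theta> n z - model_gen \<Phi> n z = (\<Sum>j\<le>n. t j z)" for z
    unfolding model_gen_def proj_poly_def t_def
    by (simp add: sum_distrib_left sum_subtractf[symmetric] algebra_simps)
  then have "H2_norm (\<lambda>z. model_gen \<Theta> n z - model_gen \<Phi> n z) = H2_norm (\<lambda>z. \<Sum>j\<le>n. t j z)" by simp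
  also have "\<dots> \<le> (\<Sum>j\<le>n. H2_norm (t j))" using t(1) by (intro H2_norm_sum_le) auto
  also have "\<dots> \<le> (\<Sum>j\<le>n. 2 * ?d)" by (intro sum_mono t(2))
  also have "\<dots> = 2 * real (Suc n) * ?d" by simp
  finally show ?thesis .
qed

lemma herglotz_data_circle:
  assumes "finite_measure \<nu>" "sets \<nu> = sets circle_borel"
    and "g \<in> borel_measurable circle_borel" "\<And>\<zeta>. 0 \<le> g \<zeta> \<and> g \<zeta> \<le> 1"
  shows "herglotz_data \<nu> (\<lambda>\<zeta>. \<zeta>) g"
proof -
  interpret finite_measure \<nu> by (rule assms)
  note m = circle_sets_measurable[OF assms(2)]
  note sp = circle_sets_space[OF assms(2)]
  show ?thesis
  proof
    show "(\<lambda>\<zeta>. \<zeta>) \<in> borel_measurable \<nu>" unfolding m by (rule circle_borel_measurable_borel) simp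
    show "integrable \<nu> g"
      by (rule integrable_const_bound[where B = 1]) (use assms in \<open>auto simp: m\<close>)
  qed (use assms in \<open>auto simp: sp\<close>)
qed

lemma herglotz_add:
  assumes "herglotz_data M \<xi> d" "herglotz_data M \<xi> d'" "z \<in> unit_disc"
  shows "herglotz M \<xi> (\<lambda>x. d x + d' x) z = herglotz M \<xi> d z + herglotz M \<xi> d' z"
  unfolding herglotz_def of_real_add distrib_right
  by (rule Bochner_Integration.integral_add) (intro herglotz_data.integrable_kernel assms)+

lemma contractive_singular_inner:
  assumes "finite_measure \<nu>" "sets \<nu> = sets circle_borel"
  shows "contractive (singular_inner \<nu>)"
  using herglotz_data.exp_herglotz_contractive[OF herglotz_data_circle[OF assms, of "\<lambda>_. 1"]]
  by (simp add: singular_inner_herglotz[abs_def])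

lemma contractive_blaschke_product:
  assumes "blaschke_product B"
  shows "contractive B"
proof -
  obtain S B0 R where "open S" and B: "cball 0 1 \<subseteq> S" "B0 holomorphic_on S" "\<And>z. z \<in> cball 0 1 \<Longrightarrow> cmod (B0 z) \<le> 1"
    "contractive R" "\<And>z. z \<in> unit_disc \<Longrightarrow> B z = B0 z * R z" and "cmod (1 - R 0) < 1"
    by (rule blaschke_product_split[OF assms zero_less_one]) (rule that)
  have "B0 holomorphic_on unit_disc"
    using B(1) ball_subset_cball by (intro holomorphic_on_subset[OF B(2)]) blast
  then have "contractive B0" using B(3) by (intro contractiveI) auto
  then show ?thesis using contractive_cong[OF contractive_mult[OF _ B(4)]] B(5) by force
qed

lemma H2_norm_minus_commute:
  assumes "hardy f" "hardy g"
  shows "H2_norm (\<lambda>z. f z - g z) = H2_norm (\<lambda>z. g z - f z)"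
  using H2_norm_cmult[OF hardy_diff[OF assms], of "- 1"] by simp

lemma model_space_lincomb:
  assumes f: "f \<in> model_space \<Theta>" and g: "g \<in> model_space \<Theta>" and c: "contractive \<Theta>"
  shows "(\<lambda>z. f z + c * g z) \<in> model_space \<Theta>"
proof -
  have h: "hardy f" "hardy g" using f g by (auto dest: model_space_hardy)
  have cg: "hardy (\<lambda>z. c * g z)" by (intro hardy_cmult h)
  have H2: "f \<in> H2_space" "g \<in> H2_space" using f g by (auto simp: model_space_def)
  have "H2_inner (\<lambda>z. f z + c * g z) (\<lambda>z. \<Theta> z * z ^ k) = 0" for k
  proof -
    have t: "hardy (\<lambda>z. \<Theta> z * z ^ k)" by (intro contractive_hardy_mult c hardy_power)
    have "H2_inner (\<lambda>z. f z + c * g z) (\<lambda>z. \<Theta> z * z ^ k) = H2_inner f (\<lambda>z. \<Theta> z * z ^ k) + c * H2_inner g (\<lambda>z. \<Theta> z * z ^ k)"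
      unfolding H2_inner_add_left[OF h(1) cg t] H2_inner_cmult_left[OF h(2) t] ..
    also have "\<dots> = 0" using f g by (simp add: model_space_iff[OF c])
    finally show ?thesis .
  qed
  then show ?thesis
    unfolding model_space_iff[OF c] using H2 hardy_add[OF h(1) cg] by (simp add: H2_space_iff)
qed

lemma zero_in_model_space: "(\<lambda>_. 0) \<in> model_space \<Theta>"
proof -
  have "H2_inner (\<lambda>_. 0) g = 0" for g
    by (auto simp: H2_inner_def intro!: tendsto_Lim)
  then show ?thesis using hardy_const[of 0] by (simp add: model_space_def H2_space_iff)
qed

lemma model_space_closed:
  assumes c: "contractive \<Theta>" and f: "f \<in> H2_space"
    and approx: "\<And>e. 0 < e \<Longrightarrow> \<exists>h \<in> model_space \<Theta>. H2_norm (\<lambda>z. f z - h z) < e"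
  shows "f \<in> model_space \<Theta>"
  unfolding model_space_iff[OF c]
proof (intro conjI allI f)
  fix k
  have hf: "hardy f" using f by (simp add: H2_space_iff)
  have t: "hardy (\<lambda>z. \<Theta> z * z ^ k)" by (intro contractive_hardy_mult c hardy_power)
  have "cmod (H2_inner f (\<lambda>z. \<Theta> z * z ^ k)) \<le> 0"
  proof (rule field_le_epsilon)
    fix e :: real assume e: "0 < e"
    let ?t = "H2_norm (\<lambda>z. \<Theta> z * z ^ k)"
    have pos: "0 < e / (?t + 1)" using e by (simp add: add_nonneg_pos)
    then obtain h where h: "h \<in> model_space \<Theta>" "H2_norm (\<lambda>z. f z - h z) < e / (?t + 1)"
      using approx by blast
    have hh: "hardy h" using h(1) by (rule model_space_hardy)
    have "H2_inner f (\<lambda>z. \<Theta> z * z ^ k) = H2_inner (\<lambda>z. f z - h z) (\<lambda>z. \<Theta> z * z ^ k)"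
      unfolding H2_inner_diff_left[OF hf hh t] using h(1) by (simp add: model_space_iff[OF c])
    then have "cmod (H2_inner f (\<lambda>z. \<Theta> z * z ^ k)) \<le> H2_norm (\<lambda>z. f z - h z) * ?t"
      using H2_Cauchy_Schwarz[OF hardy_diff[OF hf hh] t] by simp
    also have "\<dots> \<le> e / (?t + 1) * (?t + 1)" using h(2) pos by (intro mult_mono) auto
    also have "\<dots> = e" using H2_norm_nonneg[of "\<lambda>z. \<Theta> z * z ^ k"] by (simp del: H2_norm_nonneg)
    finally show "cmod (H2_inner f (\<lambda>z. \<Theta> z * z ^ k)) \<le> 0 + e" by simp
  qed
  then show "H2_inner f (\<lambda>z. \<Theta> z * z ^ k) = 0" by simp
qed

text \<open>Both parts lie below the measure \<open>M\<close>, so they inherit integrability, and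
  additivity extends from indicators by induction over integrable functions.\<close>

lemma integral_measure_add:
  fixes f :: "'a \<Rightarrow> 'b::{banach, second_countable_topology}"
  assumes sets: "sets P = sets M" "sets C = sets M"
    and add: "\<And>A. A \<in> sets M \<Longrightarrow> emeasure M A = emeasure P A + emeasure C A"
    and f: "integrable M f"
  shows "(\<integral> x. f x \<partial>M) = (\<integral> x. f x \<partial>P) + (\<integral> x. f x \<partial>C)"
proof -
  have le: "P \<le> M" "C \<le> M" using add by (auto simp: le_measure sets)
  have int: "integrable N g" if "integrable M g" "N \<le> M" "sets N = sets M" for g :: "'a \<Rightarrow> 'b" and N
  proof (rule integrableI_bounded)
    have "measurable N (borel :: 'b measure) = measurable M borel" using that(3) by (rule measurable_cong_sets) simp
    then show "g \<in> borel_measurable N" using that(1) by auto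
    have "(\<integral>\<^sup>+ x. ennreal (norm (g x)) \<partial>N) \<le> (\<integral>\<^sup>+ x. ennreal (norm (g x)) \<partial>M)"
      by (rule nn_integral_mono_measure) (use that in auto)
    also have "\<dots> < \<infinity>" using that(1) by (simp add: integrable_iff_bounded)
    finally show "(\<integral>\<^sup>+ x. ennreal (norm (g x)) \<partial>N) < \<infinity>" .
  qed
  note intP = int[OF _ le(1) sets(1)] and intC = int[OF _ le(2) sets(2)]
  show ?thesis using f
  proof (induction rule: integrable_induct)
    case (base A c)
    have fin: "emeasure P A < \<infinity>" "emeasure C A < \<infinity>"
      using base add[OF base(1)] by (auto simp: less_top[symmetric])
    then have "measure M A = measure P A + measure C A"
      unfolding measure_def add[OF base(1)] by (intro enn2real_plus) auto
    then show ?case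
      using has_bochner_integral_integral_eq[OF has_bochner_integral_indicator, of A _ c] base fin
      by (simp add: sets scaleR_add_left)
  next
    case (add f g)
    then show ?case by (simp add: intP intC)
  next
    case (lim f s)
    have conv: "(\<lambda>i. \<integral> x. s i x \<partial>N) \<longlonglongrightarrow> (\<integral> x. f x \<partial>N)" if "sets N = sets M" "integrable N f" "\<And>i. integrable N (s i)" for N
    proof (rule integral_dominated_convergence[where w = "\<lambda>x. 2 * norm (f x)"])
      have "space N = space M" using that(1) by (rule sets_eq_imp_space_eq)
      then show "AE x in N. (\<lambda>i. s i x) \<longlonglongrightarrow> f x" "AE x in N. norm (s i x) \<le> 2 * norm (f x)" for i
        using lim by auto
    qed (use that in auto)
    have "(\<lambda>i. \<integral> x. s i x \<partial>M) \<longlonglongrightarrow> (\<integral> x. f x \<partial>P) + (\<integral> x. f x \<partial>C)"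
      using tendsto_add[OF conv[OF sets(1) intP intP] conv[OF sets(2) intC intC]] lim by simp
    then show ?case using conv[of M] lim LIMSEQ_unique by blast
  qed
qed

section \<open>Exhaustion by finitely many zeros and finitely many sets\<close>

context dini_modulus
begin

text \<open>\<Phi> keeps finitely many zeros and the part of \<nu> on a finite union of the sets;
  the omitted factor \<open>R\<close> has a value near 1 at the origin, so \<Phi> is near \<Theta>
  and its generators are near those of \<Theta>. As a divisor, \<Phi> is isometric and its model
  space lies in that of \<Theta>, so the approximants for \<Phi> serve for \<Theta>.\<close>

theorem polar_part_approximable:
  assumes v: "modulus_of_continuity (\<lambda>t. w t powr (1 + \<alpha>))" and B: "blaschke_product B"
    and nu: "finite_measure \<nu>" "sets \<nu> = sets circle_borel"
    and F: "countable F" "\<And>E. E \<in> F \<Longrightarrow> finite_entropy w E" "emeasure \<nu> (unit_circle - \<Union>F) = 0"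
    and \<Theta>: "\<And>z. z \<in> unit_disc \<Longrightarrow> \<Theta> z = B z * singular_inner \<nu> z" and iso: "isometric \<Theta>"
    and e: "0 < e"
  obtains h where "h \<in> A_space w" "h \<in> model_space \<Theta>" "H2_norm (\<lambda>z. model_gen \<Theta> n z - h z) < e"
proof -
  interpret nu: finite_measure \<nu> by (rule nu)
  note m = circle_sets_measurable[OF nu(2)]
  note sp = circle_sets_space[OF nu(2)]
  \<comment> \<open>Chosen so that the Lipschitz constant 2 (n + 1) times the distance bound sqrt (4
    \<kappa>) is e / 4; each of the two omitted factors may deviate by \<kappa> at the
    origin.\<close>
  define \<kappa> where "\<kappa> = (e / (16 * real (Suc n)))\<^sup>2"
  have \<kappa>: "0 < \<kappa>" using e by (simp add: \<kappa>_def)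
  obtain S B0 R1 where B0: "open S" "cball 0 1 \<subseteq> S" "B0 holomorphic_on S" "\<And>z. z \<in> cball 0 1 \<Longrightarrow> cmod (B0 z) \<le> 1"
    and R1: "contractive R1" "\<And>z. z \<in> unit_disc \<Longrightarrow> B z = B0 z * R1 z" "cmod (1 - R1 0) < \<kappa>"
    by (rule blaschke_product_split[OF B \<kappa>]) (rule that)
  \<comment> \<open>For empty \<open>F\<close> the enumeration has no prescribed values, and the
    empty set, which has finite entropy, is used instead.\<close>
  define E where "E i = (if F = {} then {} else from_nat_into F i)" for i :: nat
  define EE where "EE k = (\<Union>i<k. E i)" for k
  have EF: "finite_entropy w (E i)" for i
    using F(2) from_nat_into[of F i] finite_entropy_empty by (auto simp: E_def)
  have EEF: "finite_entropy w (EE k)" for k unfolding EE_def by (rule finite_entropy_UN[OF EF])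
  have UF: "\<Union>F = (\<Union>i. E i)"
    using range_from_nat_into[OF _ F(1)] by (auto simp: E_def)
  define g g' where "g k \<zeta> = (if \<zeta> \<in> EE k then 1 else 0 :: real)" and "g' k \<zeta> = (if \<zeta> \<in> EE k then 0 else 1 :: real)" for k \<zeta>
  have gm [measurable]: "g k \<in> borel_measurable circle_borel" "g' k \<in> borel_measurable circle_borel" for k
  proof -
    have "closed (EE k)" using EEF by (simp add: finite_entropy_def)
    then have [measurable]: "EE k \<in> sets borel" by simp
    show "g k \<in> borel_measurable circle_borel" "g' k \<in> borel_measurable circle_borel"
      unfolding g_def[abs_def] g'_def[abs_def] by (rule circle_borel_measurable_borel, measurable)+
  qed
  have hg: "herglotz_data \<nu> (\<lambda>\<zeta>. \<zeta>) (g k)" and hg': "herglotz_data \<nu> (\<lambda>\<zeta>. \<zeta>) (g' k)" for k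
    by (auto intro!: herglotz_data_circle[OF nu gm(1)] herglotz_data_circle[OF nu gm(2)]) (auto simp: g_def g'_def)
  have "(\<lambda>k. \<integral> \<zeta>. g' k \<zeta> \<partial>\<nu>) \<longlonglongrightarrow> (\<integral> \<zeta>. 0 \<partial>\<nu>)"
  proof (rule integral_dominated_convergence[where w = "\<lambda>_. 1"])
    have "unit_circle - \<Union>F \<in> sets \<nu>"
    proof -
      have "E' \<in> sets circle_borel" if "E' \<in> F" for E'
        using F(2)[OF that] by (intro closed_circle_borel) (auto simp: finite_entropy_def)
      then have "\<Union>F \<in> sets \<nu>" unfolding nu(2) using F(1) by (intro sets.countable_Union) auto
      then show ?thesis using sets.top[of \<nu>] sp by (auto intro: sets.Diff)
    qed
    then have "unit_circle - \<Union>F \<in> null_sets \<nu>" using F(3) by (simp add: null_sets_def)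
    from AE_not_in[OF this] AE_space show "AE \<zeta> in \<nu>. (\<lambda>k. g' k \<zeta>) \<longlonglongrightarrow> 0"
    proof eventually_elim
      case (elim \<zeta>)
      then obtain i where "\<zeta> \<in> E i" using UF by (auto simp: sp)
      then have "g' k \<zeta> = 0" if "i < k" for k using that by (auto simp: g'_def EE_def)
      then show ?case by (intro tendsto_eventually eventually_sequentiallyI[of "Suc i"]) auto
    qed
    show "AE \<zeta> in \<nu>. norm (g' k \<zeta>) \<le> 1" for k by (simp add: g'_def)
  qed (simp_all add: m)
  then have "(\<lambda>k. \<integral> \<zeta>. g' k \<zeta> \<partial>\<nu>) \<longlonglongrightarrow> 0" by simp
  then have "(\<lambda>k. cmod (1 - exp (- of_real (\<integral> \<zeta>. g' k \<zeta> \<partial>\<nu>)))) \<longlonglongrightarrow> cmod (1 - exp (- of_real 0))"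
    by (intro tendsto_intros)
  then have "\<forall>\<^sub>F k in sequentially. cmod (1 - exp (- of_real (\<integral> \<zeta>. g' k \<zeta> \<partial>\<nu>))) < \<kappa>"
    using \<kappa> by (intro order_tendstoD(2)) auto
  then obtain k where k: "cmod (1 - exp (- of_real (\<integral> \<zeta>. g' k \<zeta> \<partial>\<nu>))) < \<kappa>"
    by (auto simp: eventually_sequentially)
  define R2 where "R2 z = exp (- herglotz \<nu> (\<lambda>\<zeta>. \<zeta>) (g' k) z)" for z
  have R2: "contractive R2" "cmod (1 - R2 0) < \<kappa>"
    using herglotz_data.exp_herglotz_contractive[OF hg'] k by (simp_all add: R2_def[abs_def] herglotz_data.herglotz_0[OF hg'])
  define R where "R z = R1 z * R2 z" for z
  have R: "contractive R" unfolding R_def[abs_def] by (rule contractive_mult[OF R1(1) R2(1)])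
  have R0: "cmod (1 - R 0) < 2 * \<kappa>"
    using norm_one_minus_mult[of "R1 0" "R2 0"] contractiveD(2)[OF R1(1), of 0] R1(3) R2(2) by (simp add: R_def)
  define \<Phi> where "\<Phi> z = B0 z * exp (- herglotz \<nu> (\<lambda>\<zeta>. \<zeta>) (g k) z)" for z
  have "B0 holomorphic_on unit_disc" using B0(2) ball_subset_cball by (intro holomorphic_on_subset[OF B0(3)]) blast
  then have "contractive B0" using B0(4) by (intro contractiveI) auto
  then have \<Phi>: "contractive \<Phi>"
    unfolding \<Phi>_def[abs_def] by (intro contractive_mult herglotz_data.exp_herglotz_contractive[OF hg])
  have split: "\<Theta> z = \<Phi> z * R z" if z: "z \<in> unit_disc" for z
  proof -
    have "(\<lambda>\<zeta>. g k \<zeta> + g' k \<zeta>) = (\<lambda>_. 1)" by (auto simp: g_def g'_def)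
    then have "herglotz \<nu> (\<lambda>\<zeta>. \<zeta>) (\<lambda>_. 1) z = herglotz \<nu> (\<lambda>\<zeta>. \<zeta>) (g k) z + herglotz \<nu> (\<lambda>\<zeta>. \<zeta>) (g' k) z"
      using herglotz_add[OF hg hg' z, of k k] by simp
    then have "singular_inner \<nu> z = exp (- herglotz \<nu> (\<lambda>\<zeta>. \<zeta>) (g k) z) * R2 z"
      by (simp add: singular_inner_herglotz R2_def exp_add[symmetric])
    then show ?thesis using \<Theta>[OF z] R1(2)[OF z] by (simp add: \<Phi>_def R_def)
  qed
  have iso\<Phi>: "isometric \<Phi>" by (rule isometric_divisor[OF iso \<Phi> R split])
  have "entropy_set w \<alpha> (EE k) \<nu> (g k)"
    by unfold_locales (use v EEF nu gm in \<open>auto simp: g_def\<close>)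
  then obtain h where h: "h \<in> A_space w" "h \<in> model_space \<Phi>" "H2_norm (\<lambda>z. model_gen \<Phi> n z - h z) < e / 2"
    using entropy_set.model_gen_approximable[OF _ B0 _ iso\<Phi>, of w \<alpha> "EE k" \<nu> "g k" "e / 2" n] e
    by (auto simp: \<Phi>_def)
  have c\<Theta>: "contractive \<Theta>" using iso by (rule isometric_contractive)
  have hh: "hardy h" using h(2) by (rule model_space_hardy)
  have h\<Phi>: "hardy \<Phi>" "hardy \<Theta>" "hardy (\<lambda>z. 1 - R z)"
    using contractive_hardy \<Phi> c\<Theta> R by (auto intro: hardy_diff hardy_const)
  have "H2_norm (\<lambda>z. \<Theta> z - \<Phi> z) = H2_norm (\<lambda>z. \<Phi> z * (1 - R z))"
    unfolding H2_norm_minus_commute[OF h\<Phi>(2,1)] by (rule H2_norm_cong) (simp add: split algebra_simps)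
  also have "\<dots> \<le> H2_norm (\<lambda>z. 1 - R z)" by (rule contractive_hardy_mult(2)[OF \<Phi> h\<Phi>(3)])
  also have "\<dots> \<le> sqrt (2 - 2 * Re (R 0))" by (rule contractive_one_minus[OF R])
  also have "\<dots> \<le> sqrt (4 * \<kappa>)"
    using complex_Re_le_cmod[of "1 - R 0"] R0 by (intro real_sqrt_le_mono) simp
  also have "\<dots> = 2 * (e / (16 * real (Suc n)))"
    unfolding \<kappa>_def real_sqrt_mult using e by (simp del: of_nat_Suc)
  finally have "2 * real (Suc n) * H2_norm (\<lambda>z. \<Theta> z - \<Phi> z) \<le> 2 * real (Suc n) * (2 * (e / (16 * real (Suc n))))"
    by (rule mult_left_mono) simp
  also have "\<dots> = e / 4" by (simp del: of_nat_Suc)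
  finally have "H2_norm (\<lambda>z. model_gen \<Theta> n z - model_gen \<Phi> n z) \<le> e / 4"
    using model_gen_lipschitz[OF c\<Theta> \<Phi>, of n] by simp
  moreover have "H2_norm (\<lambda>z. (model_gen \<Theta> n z - model_gen \<Phi> n z) + (model_gen \<Phi> n z - h z))
     \<le> H2_norm (\<lambda>z. model_gen \<Theta> n z - model_gen \<Phi> n z) + H2_norm (\<lambda>z. model_gen \<Phi> n z - h z)"
    by (intro H2_norm_triangle hardy_diff hardy_model_gen c\<Theta> \<Phi> hh)
  ultimately have "H2_norm (\<lambda>z. model_gen \<Theta> n z - h z) < e" using h(3) e by simp
  moreover have "h \<in> model_space \<Theta>" using model_space_divisor[OF \<Phi> R split] h(2) by blast
  ultimately show ?thesis using that h(1) by blast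
qed

lemma zero_in_A_space: "(\<lambda>_. 0) \<in> A_space w"
  by (rule A_space_smoothI[where C = 0]) (auto simp: disc_holomorphic_def)

text \<open>Finite combinations of generators are dense by \<open>model_gen_approx\<close>. Each
  generator is approximated with an error scaled down by its coefficient, where adding 1 guards
  against a zero coefficient.\<close>

lemma model_space_approximable:
  assumes iso: "isometric \<Theta>" and f: "f \<in> model_space \<Theta>" and e: "0 < e"
    and gen: "\<And>n e. 0 < e \<Longrightarrow> \<exists>h \<in> A_space w \<inter> model_space \<Theta>. H2_norm (\<lambda>z. model_gen \<Theta> n z - h z) < e"
  shows "\<exists>h \<in> A_space w \<inter> model_space \<Theta>. H2_norm (\<lambda>z. f z - h z) < e"
proof -
  have c: "contractive \<Theta>" using iso by (rule isometric_contractive)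
  have hf: "hardy f" using f by (rule model_space_hardy)
  define s where "s N z = (\<Sum>k<N. hcoeff f k * model_gen \<Theta> k z)" for N z
  have hs: "hardy (s N)" for N
    unfolding s_def[abs_def] by (intro hardy_sum hardy_cmult hardy_model_gen c)
  have sum: "\<exists>h \<in> A_space w \<inter> model_space \<Theta>. H2_norm (\<lambda>z. s N z - h z) < e" if "0 < e" for N e
    using that
  proof (induction N arbitrary: e)
    case 0
    then show ?case
      using zero_in_A_space zero_in_model_space H2_norm_const[of 0] by (intro bexI[of _ "\<lambda>_. 0"]) (auto simp: s_def)
  next
    case (Suc N)
    let ?c = "hcoeff f N"
    obtain h1 where h1: "h1 \<in> A_space w" "h1 \<in> model_space \<Theta>" "H2_norm (\<lambda>z. s N z - h1 z) < e / 2"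
      using Suc.IH[of "e / 2"] Suc.prems by auto
    have c1: "0 < e / (2 * (cmod ?c + 1))" using Suc.prems by (simp add: add_nonneg_pos)
    obtain h2 where h2: "h2 \<in> A_space w" "h2 \<in> model_space \<Theta>" "H2_norm (\<lambda>z. model_gen \<Theta> N z - h2 z) < e / (2 * (cmod ?c + 1))"
      using gen[OF c1, of N] by auto
    have hh: "hardy h1" "hardy h2" using h1 h2 by (auto dest: model_space_hardy)
    have d: "hardy (\<lambda>z. s N z - h1 z)" "hardy (\<lambda>z. model_gen \<Theta> N z - h2 z)"
      by (intro hardy_diff hs hh hardy_model_gen c)+
    have "H2_norm (\<lambda>z. s (Suc N) z - (h1 z + ?c * h2 z)) = H2_norm (\<lambda>z. (s N z - h1 z) + ?c * (model_gen \<Theta> N z - h2 z))"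
      by (simp add: s_def algebra_simps)
    also have "\<dots> \<le> H2_norm (\<lambda>z. s N z - h1 z) + H2_norm (\<lambda>z. ?c * (model_gen \<Theta> N z - h2 z))"
      by (intro H2_norm_triangle hardy_cmult d)
    also have "H2_norm (\<lambda>z. ?c * (model_gen \<Theta> N z - h2 z)) = cmod ?c * H2_norm (\<lambda>z. model_gen \<Theta> N z - h2 z)"
      by (rule H2_norm_cmult[OF d(2)])
    also have "\<dots> \<le> (cmod ?c + 1) * (e / (2 * (cmod ?c + 1)))"
      using h2(3) by (intro mult_mono) auto
    also have "\<dots> = e / 2"
    proof -
      have "b * (e / (2 * b)) = e / 2" if "b \<noteq> 0" for b using that by simp
      moreover have "cmod ?c + 1 \<noteq> 0" using norm_ge_zero[of ?c] by linarith
      ultimately show ?thesis by blast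
    qed
    finally have "H2_norm (\<lambda>z. s (Suc N) z - (h1 z + ?c * h2 z)) < e" using h1(3) by simp
    then show ?case
      using A_space_lincomb[OF h1(1) h2(1)] model_space_lincomb[OF h1(2) h2(2) c]
      by (intro bexI[of _ "\<lambda>z. h1 z + ?c * h2 z"]) auto
  qed
  obtain N where N: "H2_norm (\<lambda>z. f z - taylor_poly f N z) < e / 2"
    using order_tendstoD(2)[OF taylor_poly_tendsto[OF hf], of "e / 2"] e by (auto simp: eventually_sequentially)
  obtain h where h: "h \<in> A_space w" "h \<in> model_space \<Theta>" "H2_norm (\<lambda>z. s N z - h z) < e / 2"
    using sum[of "e / 2" N] e by auto
  have "H2_norm (\<lambda>z. (f z - s N z) + (s N z - h z)) \<le> H2_norm (\<lambda>z. f z - s N z) + H2_norm (\<lambda>z. s N z - h z)"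
    by (intro H2_norm_triangle hardy_diff hf hs model_space_hardy[OF h(2)])
  moreover have "H2_norm (\<lambda>z. f z - s N z) \<le> H2_norm (\<lambda>z. f z - taylor_poly f N z)"
    unfolding s_def by (rule model_gen_approx[OF iso f])
  ultimately have "H2_norm (\<lambda>z. f z - h z) < e" using N h(3) by simp
  then show ?thesis using h by blast
qed

end

section \<open>Trivial model spaces and equality of model spaces\<close>

lemma disc_cut_model_gen:
  assumes "isometric \<Theta>"
  shows "disc_cut (model_gen \<Theta> n) \<in> model_space \<Theta>"
proof -
  have c: "contractive \<Theta>" using assms by (rule isometric_contractive)
  have "H2_inner (disc_cut (model_gen \<Theta> n)) (\<lambda>z. \<Theta> z * z ^ k) = 0" for k
    using H2_inner_cong[of "disc_cut (model_gen \<Theta> n)" "model_gen \<Theta> n"] model_gen_orth[OF assms hardy_power] by simp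
  then show ?thesis
    unfolding model_space_iff[OF c] using disc_cut_H2_space[OF hardy_model_gen[OF c]] by blast
qed

lemma model_space_constant:
  assumes "cmod c = 1" "\<And>z. z \<in> unit_disc \<Longrightarrow> \<Theta> z = c"
  shows "model_space \<Theta> = {\<lambda>_. 0}"
proof (intro equalityI subsetI)
  fix f assume f: "f \<in> model_space \<Theta>"
  have hf: "hardy f" using f by (rule model_space_hardy)
  have con: "contractive \<Theta>"
    by (rule contractive_cong[of "\<lambda>_. c"]) (use assms in \<open>auto intro: contractiveI\<close>)
  have "cnj c * H2_inner f f = H2_inner f (\<lambda>z. c * f z)" by (rule H2_inner_cmult_right[OF hf hf, symmetric])
  also have "\<dots> = H2_inner f (\<lambda>z. \<Theta> z * f z)" by (rule H2_inner_cong) (simp_all add: assms)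
  also have "\<dots> = 0" by (rule model_space_orth[OF con f hf])
  finally have "H2_norm f = 0" using assms(1) by (auto simp: H2_inner_self[OF hf])
  then have "f z = 0" for z
    using H2_norm_0_imp[OF hf, of z] f by (cases "z \<in> unit_disc") (auto simp: model_space_def H2_space_def disc_holomorphic_def)
  then show "f \<in> {\<lambda>_. 0}" by auto
qed (use zero_in_model_space in auto)

text \<open>\<open>k\<close> is the reproducing kernel at 0 of the model space of \<psi>. The
  product \<phi> k lies in the model space of \<Theta>; if it also lies in that of \<phi>, it is
  orthogonal to itself, and \<open>k\<close> vanishes because \<phi> is isometric.\<close>

lemma model_space_divisor_eq:
  assumes iso: "isometric \<Theta>" and \<phi>: "contractive \<phi>" and \<psi>: "contractive \<psi>"
    and split: "\<And>z. z \<in> unit_disc \<Longrightarrow> \<Theta> z = \<phi> z * \<psi> z"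
    and sub: "model_space \<Theta> \<subseteq> model_space \<phi>" and z: "z \<in> unit_disc"
  shows "cnj (\<psi> 0) * \<psi> z = 1"
proof -
  have iso\<phi>: "isometric \<phi>" by (rule isometric_divisor[OF iso \<phi> \<psi> split])
  have iso\<psi>: "isometric \<psi>" by (rule isometric_divisor[OF iso \<psi> \<phi>]) (simp add: split)
  define k where "k = model_gen \<psi> 0"
  have k: "hardy k" unfolding k_def by (rule hardy_model_gen[OF \<psi>])
  have k_eq: "k z = 1 - \<psi> z * cnj (\<psi> 0)" for z by (simp add: k_def model_gen_def proj_poly_def)
  define x where "x = disc_cut (\<lambda>z. \<phi> z * k z)"
  have pk: "hardy (\<lambda>z. \<phi> z * k z)" by (rule contractive_hardy_mult(1)[OF \<phi> k])
  have "H2_inner x (\<lambda>z. \<Theta> z * z ^ j) = 0" for j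
  proof -
    have "H2_inner x (\<lambda>z. \<Theta> z * z ^ j) = H2_inner (\<lambda>z. \<phi> z * k z) (\<lambda>z. \<phi> z * (\<psi> z * z ^ j))"
      by (rule H2_inner_cong) (simp_all add: x_def split)
    also have "\<dots> = H2_inner k (\<lambda>z. \<psi> z * z ^ j)"
      by (rule isometric_inner[OF iso\<phi> k contractive_hardy_mult(1)[OF \<psi> hardy_power]])
    also have "\<dots> = 0" unfolding k_def by (rule model_gen_orth[OF iso\<psi> hardy_power])
    finally show ?thesis .
  qed
  then have "x \<in> model_space \<Theta>"
    unfolding model_space_iff[OF isometric_contractive[OF iso]] x_def using disc_cut_H2_space[OF pk] by blast
  then have x: "x \<in> model_space \<phi>" using sub by blast
  have "H2_inner k k = H2_inner (\<lambda>z. \<phi> z * k z) (\<lambda>z. \<phi> z * k z)" by (rule isometric_inner[OF iso\<phi> k k, symmetric])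
  also have "\<dots> = H2_inner x (\<lambda>z. \<phi> z * k z)" by (rule H2_inner_cong) (simp_all add: x_def)
  also have "\<dots> = 0" by (rule model_space_orth[OF \<phi> x k])
  finally have "H2_norm k = 0" by (simp add: H2_inner_self[OF k])
  then have "k z = 0" by (rule H2_norm_0_imp[OF k _ z])
  then show ?thesis by (simp add: k_eq mult.commute)
qed

theorem theorem1p3:
  fixes w :: "real \<Rightarrow> real" and \<alpha> :: real
    and \<Theta> B :: "complex \<Rightarrow> complex" and \<mu> \<mu>P \<mu>C :: "complex measure"
  assumes "modulus_of_continuity w"
    and "0 < \<alpha>" and "\<alpha> < 1"
    and "modulus_of_continuity (\<lambda>t. w t powr (1 + \<alpha>))"
    and "(\<integral>\<^sup>+ t\<in>{0<..1}. ennreal (w t powr \<alpha> / t) \<partial>lborel) < \<infinity>"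
    and "inner_function \<Theta>"
    and "blaschke_product B"
    and "sets \<mu> = sets circle_borel" and "finite_measure \<mu>" and "singular_on_circle \<mu>"
    and "\<forall>z\<in>unit_disc. \<Theta> z = B z * singular_inner \<mu> z"
    and "entropy_decomposition w \<mu> \<mu>P \<mu>C"
  shows "(A_space w \<inter> model_space \<Theta> = {\<lambda>_. 0} \<longleftrightarrow>
            (\<exists>c. cmod c = 1 \<and> (\<forall>z\<in>unit_disc. \<Theta> z = c * singular_inner \<mu>C z))) \<and>
         (model_topology \<Theta> closure_of (A_space w \<inter> model_space \<Theta>) = model_space \<Theta> \<longleftrightarrow>
            (\<forall>z\<in>unit_disc. \<Theta> z = B z * singular_inner \<mu>P z)) \<and>
         model_topology \<Theta> closure_of (A_space w \<inter> model_space \<Theta>) =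
           model_space (\<lambda>z. B z * singular_inner \<mu>P z)"
proof -
  interpret dini_modulus w \<alpha> by unfold_locales (use assms in auto)
  note mu = \<open>sets \<mu> = sets circle_borel\<close> \<open>finite_measure \<mu>\<close>
  interpret mu: finite_measure \<mu> by (rule mu)
  have P: "sets \<mu>P = sets circle_borel" and C: "sets \<mu>C = sets circle_borel"
    and add: "\<And>A. A \<in> sets circle_borel \<Longrightarrow> emeasure \<mu> A = emeasure \<mu>P A + emeasure \<mu>C A"
    and C_null: "\<And>E. finite_entropy w E \<Longrightarrow> emeasure \<mu>C E = 0"
    using \<open>entropy_decomposition w \<mu> \<mu>P \<mu>C\<close> by (auto simp: entropy_decomposition_def)
  obtain F where F: "countable F" "\<And>E. E \<in> F \<Longrightarrow> finite_entropy w E" "emeasure \<mu>P (unit_circle - \<Union>F) = 0"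
    using \<open>entropy_decomposition w \<mu> \<mu>P \<mu>C\<close> unfolding entropy_decomposition_def by blast
  have sp: "space \<mu> = unit_circle" "space \<mu>P = unit_circle" "space \<mu>C = unit_circle"
    using mu P C by (auto dest: sets_eq_imp_space_eq)
  have "emeasure \<mu> unit_circle \<noteq> \<infinity>" using mu.emeasure_finite[of unit_circle] by simp
  moreover have "emeasure \<mu> unit_circle = emeasure \<mu>P unit_circle + emeasure \<mu>C unit_circle"
    using sets.top[of circle_borel] by (intro add) simp
  ultimately have fP: "finite_measure \<mu>P" and fC: "finite_measure \<mu>C"
    by (auto simp: sp intro!: finite_measureI)
  have mul: "singular_inner \<mu> z = singular_inner \<mu>P z * singular_inner \<mu>C z" if z: "z \<in> unit_disc" for z
  proof -
    have int: "integrable \<mu> (\<lambda>\<zeta>. (\<zeta> + z) / (\<zeta> - z))"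
      using herglotz_data.integrable_kernel[OF herglotz_data_circle[OF mu(2,1), of "\<lambda>_. 1"] z] by simp
    show ?thesis
      unfolding singular_inner_def
      by (subst integral_measure_add[OF _ _ _ int, of \<mu>P \<mu>C]) (use P C mu add in \<open>auto simp: exp_add[symmetric]\<close>)
  qed
  define \<Phi> where "\<Phi> z = B z * singular_inner \<mu>P z" for z
  let ?S = "singular_inner \<mu>C"
  have cB: "contractive B" by (rule contractive_blaschke_product) fact
  have c\<Phi>: "contractive \<Phi>"
    unfolding \<Phi>_def[abs_def] by (rule contractive_mult[OF cB contractive_singular_inner[OF fP P]])
  have cS: "contractive ?S" by (rule contractive_singular_inner[OF fC C])
  have split: "\<Theta> z = \<Phi> z * ?S z" if "z \<in> unit_disc" for z
    using assms(11) mul[OF that] that by (simp add: \<Phi>_def)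
  have c\<Theta>: "contractive \<Theta>" by (rule contractive_cong[OF contractive_mult[OF c\<Phi> cS]]) (simp add: split)
  have iso: "isometric \<Theta>" by (rule inner_function_isometric[OF \<open>inner_function \<Theta>\<close> c\<Theta>])
  have iso\<Phi>: "isometric \<Phi>" by (rule isometric_divisor[OF iso c\<Phi> cS split])
  have sub: "model_space \<Phi> \<subseteq> model_space \<Theta>" by (rule model_space_divisor[OF c\<Phi> cS split])
  have smooth: "A_space w \<inter> model_space \<Theta> \<subseteq> model_space \<Phi>"
    using smooth_part_orthogonal[OF fC C C_null c\<Phi> split c\<Theta>] by blast
  have gen: "\<exists>h \<in> A_space w \<inter> model_space \<Phi>. H2_norm (\<lambda>z. model_gen \<Phi> n z - h z) < e" if "0 < e" for n e
    using polar_part_approximable[OF assms(4,7) fP P F _ iso\<Phi> that, of n] by (auto simp: \<Phi>_def)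
  interpret K: Metric_space "model_space \<Theta>" H2_dist by (rule Metric_space_model_space)
  \<comment> \<open>One inclusion holds because model spaces are closed and \<open>smooth\<close>
    confines the intersection to the smaller one; the other because \<open>gen\<close> provides
    approximants within the smaller space.\<close>
  have closure: "model_topology \<Theta> closure_of (A_space w \<inter> model_space \<Theta>) = model_space \<Phi>"
    unfolding model_topology_def K.metric_closure_of
  proof (intro equalityI subsetI)
    fix f assume "f \<in> {f \<in> model_space \<Theta>. \<forall>r>0. \<exists>h\<in>A_space w \<inter> model_space \<Theta>. h \<in> K.mball f r}"
    then have "f \<in> model_space \<Theta>" "\<And>e. 0 < e \<Longrightarrow> \<exists>h \<in> A_space w \<inter> model_space \<Theta>. H2_norm (\<lambda>z. f z - h z) < e"
      by (simp, force simp: H2_dist_def)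
    then have f: "f \<in> H2_space" "\<And>e. 0 < e \<Longrightarrow> \<exists>h \<in> A_space w \<inter> model_space \<Theta>. H2_norm (\<lambda>z. f z - h z) < e"
      by (simp add: model_space_def, blast)
    show "f \<in> model_space \<Phi>" using f smooth by (intro model_space_closed[OF c\<Phi>]) blast+
  next
    fix f assume f: "f \<in> model_space \<Phi>"
    have "\<exists>h\<in>A_space w \<inter> model_space \<Theta>. h \<in> K.mball f r" if "0 < r" for r
      using model_space_approximable[OF iso\<Phi> f that gen] f sub by (auto simp: H2_dist_def)
    then show "f \<in> {f \<in> model_space \<Theta>. \<forall>r>0. \<exists>h\<in>A_space w \<inter> model_space \<Theta>. h \<in> K.mball f r}"
      using f sub by blast
  qed
  have "A_space w \<inter> model_space \<Theta> = {\<lambda>_. 0} \<longleftrightarrow> (\<exists>c. cmod c = 1 \<and> (\<forall>z\<in>unit_disc. \<Theta> z = c * ?S z))"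
  proof
    assume triv: "A_space w \<inter> model_space \<Theta> = {\<lambda>_. 0}"
    \<comment> \<open>The kernel of the model space of \<Phi> at 0 is a limit of elements of the
      trivial intersection, hence zero. This says that \<Phi> times the conjugate of its value at 0
      is 1, so \<Phi> is a unimodular constant.\<close>
    have "H2_norm (disc_cut (model_gen \<Phi> 0)) < e" if "0 < e" for e
    proof -
      obtain h where h: "h \<in> A_space w \<inter> model_space \<Phi>" "H2_norm (\<lambda>z. disc_cut (model_gen \<Phi> 0) z - h z) < e"
        using model_space_approximable[OF iso\<Phi> disc_cut_model_gen[OF iso\<Phi>] \<open>0 < e\<close> gen] by blast
      then have "h = (\<lambda>_. 0)" using triv sub by blast
      then show ?thesis using h(2) by simp
    qed
    then have "H2_norm (disc_cut (model_gen \<Phi> 0)) = 0"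
      using H2_norm_nonneg[of "disc_cut (model_gen \<Phi> 0)"] by (metis less_irrefl less_eq_real_def)
    then have 1: "\<Phi> z * cnj (\<Phi> 0) = 1" if "z \<in> unit_disc" for z
      using H2_norm_0_imp[OF model_space_hardy[OF disc_cut_model_gen[OF iso\<Phi>]], of 0 z] that
      by (simp add: model_gen_def proj_poly_def)
    have n: "cmod (\<Phi> 0) = 1"
      using arg_cong[OF 1[of 0], of cmod] by (simp add: norm_mult power2_eq_square[symmetric] power2_eq_1_iff) (smt (verit) norm_ge_zero)
    have const: "\<Phi> z = \<Phi> 0" if "z \<in> unit_disc" for z
      using 1[OF that] 1[of 0] by (metis centre_in_ball mult_right_cancel mult_zero_right zero_less_one zero_neq_one)
    have "\<Theta> z = \<Phi> 0 * ?S z" if z: "z \<in> unit_disc" for z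
      by (simp only: split[OF z] const[OF z])
    then show "\<exists>c. cmod c = 1 \<and> (\<forall>z\<in>unit_disc. \<Theta> z = c * ?S z)" using n by blast
  next
    assume "\<exists>c. cmod c = 1 \<and> (\<forall>z\<in>unit_disc. \<Theta> z = c * ?S z)"
    then obtain c where c: "cmod c = 1" "\<And>z. z \<in> unit_disc \<Longrightarrow> \<Theta> z = c * ?S z" by blast
    \<comment> \<open>The singular inner function is an exponential, so it can be cancelled.\<close>
    have "\<Phi> z = c" if "z \<in> unit_disc" for z
      using split[OF that] c(2)[OF that] by (simp add: singular_inner_def)
    then have "model_space \<Phi> = {\<lambda>_. 0}" by (rule model_space_constant[OF c(1)])
    then show "A_space w \<inter> model_space \<Theta> = {\<lambda>_. 0}"
      using smooth zero_in_A_space zero_in_model_space by blast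
  qed
  moreover have "model_space \<Phi> = model_space \<Theta> \<longleftrightarrow> (\<forall>z\<in>unit_disc. \<Theta> z = \<Phi> z)"
  proof
    assume eq: "model_space \<Phi> = model_space \<Theta>"
    have S: "cnj (?S 0) * ?S z = 1" if "z \<in> unit_disc" for z
      by (rule model_space_divisor_eq[OF iso c\<Phi> cS split _ that]) (use eq in auto)
    \<comment> \<open>The value at the origin is the exponential of minus the mass of
      \<open>\<mu>C\<close>, hence positive. Its square is 1, so it equals 1, and then
      \<open>S\<close> makes the whole function equal to 1.\<close>
    have "herglotz \<mu>C (\<lambda>\<zeta>. \<zeta>) (\<lambda>_. 1) 0 = of_real (\<integral> x. 1 \<partial>\<mu>C)"
      by (rule herglotz_data.herglotz_0[OF herglotz_data_circle[OF fC C]]) auto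
    then have "?S 0 = of_real (exp (- (\<integral> x. 1 \<partial>\<mu>C)))"
      by (simp only: singular_inner_herglotz exp_of_real of_real_minus[symmetric])
    then obtain r where r: "?S 0 = of_real r" "0 < r" by force
    then have "of_real (r * r) = (1::complex)" using S[of 0] by simp
    then have "r * r = 1" using of_real_eq_1_iff by blast
    then have "?S 0 = 1" using r by (simp add: square_eq_1_iff)
    then show "\<forall>z\<in>unit_disc. \<Theta> z = \<Phi> z" using S split by simp
  next
    assume "\<forall>z\<in>unit_disc. \<Theta> z = \<Phi> z"
    then show "model_space \<Phi> = model_space \<Theta>" by (intro model_space_cong) simp
  qed
  ultimately show ?thesis unfolding closure by (simp add: \<Phi>_def[abs_def])
qed

end
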